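(* Assume that the coefficients satisfy (A1), (A2) and (A3) below: (A1) $\rho,a,b:\mathbb{R}\to\mathbb{R}$ are measurable and there exist constants $0<\lambda\le\Lambda$ such that $\lambda\le\rho(x)\le\Lambda$, $\lambda\le a(x)\le\Lambda$ and $|b(x)|\le\Lambda$ for all $x\in\mathbb{R}$. (A2) $\kappa,\sigma:\Omega\times[0,T]\times\mathbb{R}\times\mathbb{R}\to\mathbb{R}$ are measurable and there is a constant $L>0$ such that for all $(\omega,t,x)\in\Omega\times[0,T]\times\mathbb{R}$ and all $y,y'\in\mathbb{R}$, $|\kappa(t,x,y)-\kappa(t,x,y')|\vee|\sigma(t,x,y)-\sigma(t,x,y')|\le L|y-y'|$ and $|\kappa(t,x,y)|\vee|\sigma(t,x,y)|\le L(1+|y|)$. (A3) $\xi:\mathbb{R}\to\mathbb{R}$ is nonrandom, measurable and bounded: there is $M>0$ with $|\xi(x)|\le M$ for all $x\in\mathbb{R}$. Let $(P_t)_{t\ge0}$ be the $C_0$-semigroup on $\mathbb{H}$ associated with $\mathcal{A}_{\rho,a,b}$. Then the forward SPDE $$dY(t,x)=\mathcal{A}_{\rho,a,b}Y(t,x)\,dt+\kappa(t,x,Y(t,x))\,dt+\sigma(t,x,Y(t,x))\,dB(t),\quad (t,x)\in[0,T]\times\mathbb{R},\qquad Y(0,x)=\xi(x),$$ admits a unique mild solution $Y\in L^2(\Omega;C([0,T];\mathbb{H}))$, which satisfies, for all $t\in[0,T]$, $$Y(t)=P_t\xi+\int_0^tP_{t-s}\,\kappa(s,\cdot,Y(s,\cdot))\,ds+\int_0^tP_{t-s}\,\sigma(s,\cdot,Y(s,\cdot))\,dB(s),$$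 where the first integral is understood in the classical sense in $\mathbb{H}$ and the second one in the Itô sense in $\mathbb{H}$. Moreover, the solution is pathwise unique.
   Context: $T>0$; $(\Omega,\mathcal{F},\mathbb{P})$ is a probability space with a filtration $\mathbb{F}=(\mathcal{F}_t)_{t\in[0,T]}$ satisfying the usual conditions, and $B=(B(t))_{t\in[0,T]}$ is a one-dimensional $\mathbb{F}$-Brownian motion. $\mathbb{H}:=L^2(\mathbb{R},\rho(x)^{-1}dx)$ with inner product $\langle\varphi,\psi\rangle_{\mathbb{H}}=\int_{\mathbb{R}}\varphi\psi\,\rho^{-1}dx$. The operator is $$\mathcal{A}_{\rho,a,b}=\frac{\rho(x)}{2}\frac{d}{dx}\Big(a(x)\frac{d}{dx}\Big)+b(x)\frac{d}{dx},$$ a linear second-order operator with possibly discontinuous coefficients. The semigroup has the kernel representation $(P_t\varphi)(x)=\int_{\mathbb{R}}p(t,x,y)\varphi(y)\,\frac{dy}{\rho(y)}$, where $p(t,x,y)$ is the transition kernel associated with $\mathcal{A}_{\rho,a,b}$. A mild solution is an $\mathbb{H}$-valued predictable process satisfying the displayed integral equation.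
   Formalization: Added, since the claim fails otherwise (e.g. ξ=1, or κ=1): ξ belongs to the space H; κ(·,·,·,0) and σ(·,·,·,0) are H-valued and square integrable over Ω×[0,T]; κ and σ are adapted to the filtration. *)

theory Defs
  imports "HOL-Probability.Probability"
begin

definition sq_int :: "(real \<Rightarrow> real) \<Rightarrow> (real \<Rightarrow> real) set" where
  "sq_int \<rho> = {\<phi> \<in> borel_measurable borel. integrable lborel (\<lambda>x. (\<phi> x)\<^sup>2 / \<rho> x)}"

text \<open>The weight is a term, so the weighted space cannot be a type of its own. A Hilbert type
  \<open>'h\<close> is identified with the weighted space through the map \<open>cls\<close>, which sends a square integrable
  function to its class. By the inner product clause \<open>cls \<phi> = cls \<psi>\<close> holds iff \<open>\<phi> = \<psi>\<close> almost
  everywhere, so \<open>'h\<close> is the quotient of \<open>sq_int \<rho>\<close> by almost everywhere equality.\<close>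

definition is_L2_space :: "(real \<Rightarrow> real) \<Rightarrow> ((real \<Rightarrow> real) \<Rightarrow> 'h::real_inner) \<Rightarrow> bool" where
  "is_L2_space \<rho> cls \<longleftrightarrow>
     cls ` sq_int \<rho> = UNIV \<and>
     (\<forall>\<phi>\<in>sq_int \<rho>. \<forall>\<psi>\<in>sq_int \<rho>. \<forall>c d.
        cls (\<lambda>x. c * \<phi> x + d * \<psi> x) = c *\<^sub>R cls \<phi> + d *\<^sub>R cls \<psi>) \<and>
     (\<forall>\<phi>\<in>sq_int \<rho>. \<forall>\<psi>\<in>sq_int \<rho>.
        inner (cls \<phi>) (cls \<psi>) = (LINT x|lborel. \<phi> x * \<psi> x / \<rho> x))"

definition repr :: "(real \<Rightarrow> real) \<Rightarrow> ((real \<Rightarrow> real) \<Rightarrow> 'h::real_inner) \<Rightarrow> 'h \<Rightarrow> real \<Rightarrow> real" where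
  "repr \<rho> cls h = (SOME \<phi>. \<phi> \<in> sq_int \<rho> \<and> cls \<phi> = h)"

definition test_function :: "(real \<Rightarrow> real) \<Rightarrow> bool" where
  "test_function \<psi> \<longleftrightarrow>
     (\<forall>n. (deriv ^^ n) \<psi> differentiable_on UNIV) \<and> (\<exists>R. \<forall>x. \<bar>x\<bar> > R \<longrightarrow> \<psi> x = 0)"

definition weak_derivative :: "(real \<Rightarrow> real) \<Rightarrow> (real \<Rightarrow> real) \<Rightarrow> bool" where
  "weak_derivative f g \<longleftrightarrow>
     (\<forall>\<psi>. test_function \<psi> \<longrightarrow>
        (LINT x|lborel. f x * deriv \<psi> x) = - (LINT x|lborel. g x * \<psi> x))"

text \<open>The graph of \<open>(\<rho>/2) (a \<phi>')' + b \<phi>'\<close>. Its domain consists of those \<open>\<phi>\<close> for which \<open>\<phi>\<close> and the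
  flux \<open>a \<phi>'\<close> both lie in $H^1(\mathbb{R})$; as \<open>\<rho>\<close> is bounded above and below, membership in
  \<open>sq_int \<rho>\<close> is unweighted square integrability.\<close>

definition div_form_graph ::
    "(real \<Rightarrow> real) \<Rightarrow> (real \<Rightarrow> real) \<Rightarrow> (real \<Rightarrow> real) \<Rightarrow> ((real \<Rightarrow> real) \<Rightarrow> 'h::real_inner) \<Rightarrow> ('h \<times> 'h) set"
  where
  "div_form_graph \<rho> a b cls =
     {(cls \<phi>, cls (\<lambda>x. \<rho> x / 2 * q x + b x * d x)) | \<phi> d q.
        \<phi> \<in> sq_int \<rho> \<and> d \<in> sq_int \<rho> \<and> q \<in> sq_int \<rho> \<and>
        weak_derivative \<phi> d \<and> weak_derivative (\<lambda>x. a x * d x) q}"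

definition C0_semigroup :: "(real \<Rightarrow> 'h \<Rightarrow> 'h::real_normed_vector) \<Rightarrow> bool" where
  "C0_semigroup P \<longleftrightarrow>
     (\<forall>t\<ge>0. bounded_linear (P t)) \<and> (\<forall>u. P 0 u = u) \<and>
     (\<forall>s\<ge>0. \<forall>t\<ge>0. \<forall>u. P (s + t) u = P s (P t u)) \<and>
     (\<forall>u. ((\<lambda>t. P t u) \<longlongrightarrow> u) (at_right 0))"

definition generator_graph :: "(real \<Rightarrow> 'h \<Rightarrow> 'h::real_normed_vector) \<Rightarrow> ('h \<times> 'h) set" where
  "generator_graph P = {(u, v). ((\<lambda>t. (1 / t) *\<^sub>R (P t u - u)) \<longlongrightarrow> v) (at_right 0)}"

definition usual_filtration :: "'w measure \<Rightarrow> (real \<Rightarrow> 'w measure) \<Rightarrow> real \<Rightarrow> bool" where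
  "usual_filtration M F T \<longleftrightarrow>
     (\<forall>t\<in>{0..T}. subalgebra M (F t)) \<and>
     (\<forall>s t. 0 \<le> s \<and> s \<le> t \<and> t \<le> T \<longrightarrow> sets (F s) \<subseteq> sets (F t)) \<and>
     (\<forall>t. 0 \<le> t \<and> t < T \<longrightarrow> sets (F t) = (\<Inter>s\<in>{t<..T}. sets (F s))) \<and>
     (\<forall>N\<in>null_sets M. \<forall>A. A \<subseteq> N \<longrightarrow> A \<in> sets (F 0))"

definition brownian_motion ::
    "'w measure \<Rightarrow> (real \<Rightarrow> 'w measure) \<Rightarrow> real \<Rightarrow> (real \<Rightarrow> 'w \<Rightarrow> real) \<Rightarrow> bool" where
  "brownian_motion M F T B \<longleftrightarrow>
     (\<forall>t\<in>{0..T}. B t \<in> borel_measurable (F t)) \<and>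
     (AE \<omega> in M. B 0 \<omega> = 0) \<and>
     (AE \<omega> in M. continuous_on {0..T} (\<lambda>t. B t \<omega>)) \<and>
     (\<forall>s t. 0 \<le> s \<and> s < t \<and> t \<le> T \<longrightarrow>
        distributed M lborel (\<lambda>\<omega>. B t \<omega> - B s \<omega>) (normal_density 0 (sqrt (t - s))) \<and>
        prob_space.indep_set M (sets (F s))
          (sets (vimage_algebra (space M) (\<lambda>\<omega>. B t \<omega> - B s \<omega>) borel)))"

definition predictable_algebra ::
    "'w measure \<Rightarrow> (real \<Rightarrow> 'w measure) \<Rightarrow> real \<Rightarrow> ('w \<times> real) measure" where
  "predictable_algebra M F T = sigma (space M \<times> {0..T})
     ({A \<times> {0} | A. A \<in> sets (F 0)} \<union>
      {A \<times> {s<..t} | A s t. 0 \<le> s \<and> s \<le> t \<and> t \<le> T \<and> A \<in> sets (F s)})"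

definition elementary ::
    "(real \<Rightarrow> 'w measure) \<Rightarrow> real \<Rightarrow> nat \<Rightarrow> (nat \<Rightarrow> real) \<Rightarrow> (nat \<Rightarrow> 'w \<Rightarrow> 'h::real_normed_vector) \<Rightarrow> bool"
  where
  "elementary F t n \<tau> X \<longleftrightarrow>
     (\<forall>i<n. 0 \<le> \<tau> i \<and> \<tau> i \<le> \<tau> (Suc i) \<and> \<tau> (Suc i) \<le> t \<and>
        X i \<in> borel_measurable (F (\<tau> i)) \<and> bounded (X i ` space (F (\<tau> i))))"

definition elem_process ::
    "nat \<Rightarrow> (nat \<Rightarrow> real) \<Rightarrow> (nat \<Rightarrow> 'w \<Rightarrow> 'h::real_normed_vector) \<Rightarrow> 'w \<Rightarrow> real \<Rightarrow> 'h" where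
  "elem_process n \<tau> X \<omega> s = (\<Sum>i<n. indicat_real {\<tau> i<..\<tau> (Suc i)} s *\<^sub>R X i \<omega>)"

definition elem_integral ::
    "(real \<Rightarrow> 'w \<Rightarrow> real) \<Rightarrow> nat \<Rightarrow> (nat \<Rightarrow> real) \<Rightarrow> (nat \<Rightarrow> 'w \<Rightarrow> 'h::real_normed_vector) \<Rightarrow> 'w \<Rightarrow> 'h"
  where
  "elem_integral B n \<tau> X \<omega> = (\<Sum>i<n. (B (\<tau> (Suc i)) \<omega> - B (\<tau> i) \<omega>) *\<^sub>R X i \<omega>)"

text \<open>\<open>J\<close> is (a version of) $\int_0^t \Phi(s)\,dB(s)$: elementary processes approximate \<open>\<Phi>\<close> in
  $L^2([0,t])$, in probability, and their integrals converge to \<open>J\<close> in probability. This covers every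
  integrand whose squared norm is almost surely integrable over \<open>[0, t]\<close>, and it is the
  $L^2(\Omega)$-limit when \<open>\<Phi>\<close> is square integrable over $\Omega \times [0,t]$.\<close>

definition has_ito_integral ::
    "'w measure \<Rightarrow> (real \<Rightarrow> 'w measure) \<Rightarrow> (real \<Rightarrow> 'w \<Rightarrow> real) \<Rightarrow> real \<Rightarrow>
     ('w \<Rightarrow> real \<Rightarrow> 'h::{real_normed_vector, second_countable_topology}) \<Rightarrow> ('w \<Rightarrow> 'h) \<Rightarrow> bool" where
  "has_ito_integral M F B t \<Phi> J \<longleftrightarrow>
     (\<lambda>(\<omega>, s). \<Phi> \<omega> s) \<in> borel_measurable (M \<Otimes>\<^sub>M restrict_space borel {0..t}) \<and>
     J \<in> borel_measurable M \<and>
     (\<exists>n \<tau> X. (\<forall>k. elementary F t (n k) (\<tau> k) (X k)) \<and>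
        (\<forall>\<epsilon>>0. (\<lambda>k. measure M {\<omega> \<in> space M.
            (\<integral>\<^sup>+s\<in>{0..t}. ennreal ((norm (\<Phi> \<omega> s - elem_process (n k) (\<tau> k) (X k) \<omega> s))\<^sup>2) \<partial>lborel)
              > ennreal \<epsilon>}) \<longlonglongrightarrow> 0) \<and>
        (\<forall>\<epsilon>>0. (\<lambda>k. measure M {\<omega> \<in> space M.
            norm (J \<omega> - elem_integral B (n k) (\<tau> k) (X k) \<omega>) > \<epsilon>}) \<longlonglongrightarrow> 0))"

definition measurable_field :: "'w measure \<Rightarrow> real \<Rightarrow> ('w \<Rightarrow> real \<Rightarrow> real \<Rightarrow> real \<Rightarrow> real) \<Rightarrow> bool" where
  "measurable_field M T g \<longleftrightarrow>
     (\<lambda>(\<omega>, t, x, y). g \<omega> t x y)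
       \<in> borel_measurable (M \<Otimes>\<^sub>M restrict_space borel {0..T} \<Otimes>\<^sub>M borel \<Otimes>\<^sub>M borel)"

definition adapted_field ::
    "(real \<Rightarrow> 'w measure) \<Rightarrow> real \<Rightarrow> ('w \<Rightarrow> real \<Rightarrow> real \<Rightarrow> real \<Rightarrow> real) \<Rightarrow> bool" where
  "adapted_field F T g \<longleftrightarrow>
     (\<forall>t\<in>{0..T}. (\<lambda>(\<omega>, x, y). g \<omega> t x y) \<in> borel_measurable (F t \<Otimes>\<^sub>M borel \<Otimes>\<^sub>M borel))"

text \<open>\<open>g(\<cdot>, \<cdot>, \<cdot>, 0)\<close> takes values in the weighted space and belongs to
  $L^2(\Omega \times [0,T]; L^2(\mathbb{R}, \rho(x)^{-1}dx))$.\<close>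

definition H_valued_at_zero ::
    "'w measure \<Rightarrow> real \<Rightarrow> (real \<Rightarrow> real) \<Rightarrow> ('w \<Rightarrow> real \<Rightarrow> real \<Rightarrow> real \<Rightarrow> real) \<Rightarrow> bool" where
  "H_valued_at_zero M T \<rho> g \<longleftrightarrow>
     (\<forall>\<omega>\<in>space M. \<forall>t\<in>{0..T}. (\<lambda>x. g \<omega> t x 0) \<in> sq_int \<rho>) \<and>
     (\<integral>\<^sup>+\<omega>. (\<integral>\<^sup>+t\<in>{0..T}. (\<integral>\<^sup>+x. ennreal ((g \<omega> t x 0)\<^sup>2 / \<rho> x) \<partial>lborel) \<partial>lborel) \<partial>M) < \<infinity>"

text \<open>The substitution operator \<open>h \<mapsto> g(\<omega>, t, \<cdot>, h(\<cdot>))\<close> on classes; the choice of the representative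
  made by \<open>repr\<close> does not affect the resulting class.\<close>

definition nemytskii ::
    "(real \<Rightarrow> real) \<Rightarrow> ((real \<Rightarrow> real) \<Rightarrow> 'h::real_inner) \<Rightarrow>
     ('w \<Rightarrow> real \<Rightarrow> real \<Rightarrow> real \<Rightarrow> real) \<Rightarrow> 'w \<Rightarrow> real \<Rightarrow> 'h \<Rightarrow> 'h" where
  "nemytskii \<rho> cls g \<omega> t h = cls (\<lambda>x. g \<omega> t x (repr \<rho> cls h x))"

definition mild_solution ::
    "'w measure \<Rightarrow> (real \<Rightarrow> 'w measure) \<Rightarrow> real \<Rightarrow> (real \<Rightarrow> 'w \<Rightarrow> real) \<Rightarrow>
     (real \<Rightarrow> real) \<Rightarrow> ((real \<Rightarrow> real) \<Rightarrow> 'h) \<Rightarrow>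
     (real \<Rightarrow> 'h \<Rightarrow> 'h::{real_inner, banach, second_countable_topology}) \<Rightarrow>
     (real \<Rightarrow> real) \<Rightarrow> ('w \<Rightarrow> real \<Rightarrow> real \<Rightarrow> real \<Rightarrow> real) \<Rightarrow> ('w \<Rightarrow> real \<Rightarrow> real \<Rightarrow> real \<Rightarrow> real) \<Rightarrow>
     (real \<Rightarrow> 'w \<Rightarrow> 'h) \<Rightarrow> bool" where
  "mild_solution M F T B \<rho> cls P \<xi> \<kappa> \<sigma> Y \<longleftrightarrow>
     (\<lambda>(\<omega>, t). Y t \<omega>) \<in> borel_measurable (predictable_algebra M F T) \<and>
     (\<forall>t\<in>{0..T}.
        (AE \<omega> in M. set_integrable lborel {0..t} (\<lambda>s. P (t - s) (nemytskii \<rho> cls \<kappa> \<omega> s (Y s \<omega>)))) \<and>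
        (\<exists>J. has_ito_integral M F B t (\<lambda>\<omega> s. P (t - s) (nemytskii \<rho> cls \<sigma> \<omega> s (Y s \<omega>))) J \<and>
          (AE \<omega> in M. Y t \<omega> = P t (cls \<xi>)
             + (LINT s:{0..t}|lborel. P (t - s) (nemytskii \<rho> cls \<kappa> \<omega> s (Y s \<omega>)))
             + J \<omega>)))"

definition continuous_paths ::
    "'w measure \<Rightarrow> real \<Rightarrow> (real \<Rightarrow> 'w \<Rightarrow> 'h::real_normed_vector) \<Rightarrow> bool" where
  "continuous_paths M T Y \<longleftrightarrow> (AE \<omega> in M. continuous_on {0..T} (\<lambda>t. Y t \<omega>))"

text \<open>Membership in $L^2(\Omega; C([0,T]; H))$. Measurability of the coordinates suffices: as \<open>H\<close> is
  separable, the evaluation maps generate the Borel sets of $C([0,T]; H)$.\<close>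

definition L2_continuous ::
    "'w measure \<Rightarrow> real \<Rightarrow> (real \<Rightarrow> 'w \<Rightarrow> 'h::real_normed_vector) \<Rightarrow> bool" where
  "L2_continuous M T Y \<longleftrightarrow>
     (\<forall>t\<in>{0..T}. Y t \<in> borel_measurable M) \<and> continuous_paths M T Y \<and>
     (\<integral>\<^sup>+\<omega>. (SUP t\<in>{0..T}. ennreal ((norm (Y t \<omega>))\<^sup>2)) \<partial>M) < \<infinity>"

definition indistinguishable ::
    "'w measure \<Rightarrow> real \<Rightarrow> (real \<Rightarrow> 'w \<Rightarrow> 'h) \<Rightarrow> (real \<Rightarrow> 'w \<Rightarrow> 'h) \<Rightarrow> bool" where
  "indistinguishable M T Y Z \<longleftrightarrow> (AE \<omega> in M. \<forall>t\<in>{0..T}. Y t \<omega> = Z t \<omega>)"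

text \<open>The remaining part shows that \<open>is_L2_space\<close> is satisfiable in the type classes needed for the
  library's Bochner integral: \<open>l2\<close> is the quotient of the unweighted square integrable functions, and
  \<open>\<phi> \<mapsto> \<phi> / \<surd>\<rho>\<close> is the isometry onto it.\<close>

definition S2 :: "(real \<Rightarrow> real) set" where
  "S2 = {f \<in> borel_measurable borel. integrable lborel (\<lambda>x. (f x)\<^sup>2)}"

lemma S2_meas[measurable_dest]: "f \<in> S2 \<Longrightarrow> f \<in> borel_measurable borel"
  and S2_int: "f \<in> S2 \<Longrightarrow> integrable lborel (\<lambda>x. (f x)\<^sup>2)"
  by (auto simp: S2_def)

lemma S2_mult: assumes "f \<in> S2" "g \<in> S2" shows "integrable lborel (\<lambda>x. f x * g x)"
proof -
  have [measurable]: "f \<in> borel_measurable borel" "g \<in> borel_measurable borel"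
    using assms by (auto simp: S2_def)
  show ?thesis
  proof (rule Bochner_Integration.integrable_bound)
    show "integrable lborel (\<lambda>x. (f x)\<^sup>2 + (g x)\<^sup>2)"
      using assms by (auto simp: S2_def)
    show "AE x in lborel. norm (f x * g x) \<le> norm ((f x)\<^sup>2 + (g x)\<^sup>2)"
    proof (rule AE_I2)
      fix x
      have "2 * (\<bar>f x\<bar> * \<bar>g x\<bar>) \<le> (f x)\<^sup>2 + (g x)\<^sup>2"
        using sum_squares_bound[of "\<bar>f x\<bar>" "\<bar>g x\<bar>"] by simp
      moreover have "0 \<le> \<bar>f x\<bar> * \<bar>g x\<bar>" by simp
      ultimately have "\<bar>f x\<bar> * \<bar>g x\<bar> \<le> (f x)\<^sup>2 + (g x)\<^sup>2" by linarith
      then show "norm (f x * g x) \<le> norm ((f x)\<^sup>2 + (g x)\<^sup>2)" by (simp add: abs_mult)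
    qed
  qed measurable
qed

lemma S2_lin: assumes "f \<in> S2" "g \<in> S2" shows "(\<lambda>x. c * f x + d * g x) \<in> S2"
proof -
  have [measurable]: "f \<in> borel_measurable borel" "g \<in> borel_measurable borel"
    using assms by (auto simp: S2_def)
  have "integrable lborel (\<lambda>x. c\<^sup>2 * (f x)\<^sup>2 + d\<^sup>2 * (g x)\<^sup>2 + 2 * c * d * (f x * g x))"
    using assms S2_mult[OF assms]
    by (intro Bochner_Integration.integrable_add integrable_mult_right) (auto simp: S2_def)
  also have "(\<lambda>x. c\<^sup>2 * (f x)\<^sup>2 + d\<^sup>2 * (g x)\<^sup>2 + 2 * c * d * (f x * g x)) = (\<lambda>x. (c * f x + d * g x)\<^sup>2)"
    by (auto simp: power2_eq_square algebra_simps)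
  finally show ?thesis by (auto simp: S2_def)
qed

lemma S2_zero: "(\<lambda>x. 0) \<in> S2" by (auto simp: S2_def)
lemma S2_add: "f \<in> S2 \<Longrightarrow> g \<in> S2 \<Longrightarrow> (\<lambda>x. f x + g x) \<in> S2" using S2_lin[of f g 1 1] by simp
lemma S2_scale: "f \<in> S2 \<Longrightarrow> (\<lambda>x. c * f x) \<in> S2" using S2_lin[of f f c 0] by simp
lemma S2_minus: "f \<in> S2 \<Longrightarrow> (\<lambda>x. - f x) \<in> S2" using S2_lin[of f f "-1" 0] by simp
lemma S2_diff: "f \<in> S2 \<Longrightarrow> g \<in> S2 \<Longrightarrow> (\<lambda>x. f x - g x) \<in> S2" using S2_lin[of f g 1 "-1"] by simp

quotient_type l2 = "real \<Rightarrow> real" / partial: "\<lambda>f g. f \<in> S2 \<and> g \<in> S2 \<and> (AE x in lborel. f x = g x)"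
proof (intro part_equivpI sympI transpI)
  show "\<exists>x. x \<in> S2 \<and> x \<in> S2 \<and> (AE y in lborel. x y = x y)" using S2_zero by auto
qed (auto elim: eventually_mono eventually_elim2)

instantiation l2 :: real_inner
begin
lift_definition zero_l2 :: l2 is "\<lambda>x. 0" by (simp add: S2_zero)
lift_definition plus_l2 :: "l2 \<Rightarrow> l2 \<Rightarrow> l2" is "\<lambda>f g x. f x + g x"
  by (auto simp: S2_add elim: eventually_elim2)
lift_definition minus_l2 :: "l2 \<Rightarrow> l2 \<Rightarrow> l2" is "\<lambda>f g x. f x - g x"
  by (auto simp: S2_diff elim: eventually_elim2)
lift_definition uminus_l2 :: "l2 \<Rightarrow> l2" is "\<lambda>f x. - f x"
  by (auto simp: S2_minus elim: eventually_mono)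
lift_definition scaleR_l2 :: "real \<Rightarrow> l2 \<Rightarrow> l2" is "\<lambda>c f x. c * f x"
  by (auto simp: S2_scale elim: eventually_mono)
lift_definition inner_l2 :: "l2 \<Rightarrow> l2 \<Rightarrow> real" is "\<lambda>f g. (LINT x|lborel. f x * g x)"
  by (rule integral_cong_AE) (auto dest: S2_meas elim!: eventually_elim2)

definition norm_l2 :: "l2 \<Rightarrow> real" where "norm_l2 u = sqrt (inner u u)"
definition dist_l2 :: "l2 \<Rightarrow> l2 \<Rightarrow> real" where "dist_l2 u v = norm (u - v)"
definition sgn_l2 :: "l2 \<Rightarrow> l2" where "sgn_l2 u = scaleR (inverse (norm u)) u"
definition uniformity_l2 :: "(l2 \<times> l2) filter"
  where "uniformity_l2 = (INF e\<in>{0 <..}. principal {(x, y). dist x y < e})"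
definition open_l2 :: "l2 set \<Rightarrow> bool"
  where "open_l2 U = (\<forall>x\<in>U. eventually (\<lambda>(x', y). x' = x \<longrightarrow> y \<in> U) uniformity)"

instance
proof
  fix x y z :: l2 and r s :: real
  show "x + y + z = x + (y + z)" by transfer (auto intro!: S2_add simp: add.assoc)
  show "x + y = y + x" by transfer (auto intro!: S2_add simp: add.commute)
  show "0 + x = x" by transfer auto
  show "- x + x = 0" by transfer (auto simp: S2_zero)
  show "x - y = x + - y" by transfer (auto intro!: S2_diff)
  show "r *\<^sub>R (x + y) = r *\<^sub>R x + r *\<^sub>R y"
    by transfer (auto intro!: S2_add S2_scale simp: algebra_simps S2_lin)
  show "(r + s) *\<^sub>R x = r *\<^sub>R x + s *\<^sub>R x"
    by transfer (auto intro!: S2_add S2_scale simp: algebra_simps S2_lin)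
  show "r *\<^sub>R s *\<^sub>R x = (r * s) *\<^sub>R x"
    by transfer (auto intro!: S2_scale simp: mult.assoc)
  show "1 *\<^sub>R x = x" by transfer auto
  show "dist x y = norm (x - y)" by (simp add: dist_l2_def)
  show "sgn x = scaleR (inverse (norm x)) x" by (simp add: sgn_l2_def)
  show "inner x y = inner y x" by transfer (simp add: mult.commute)
  show "inner (x + y) z = inner x z + inner y z"
    by transfer (simp add: distrib_right S2_mult)
  show "inner (r *\<^sub>R x) y = r * inner x y"
    by transfer (simp add: mult.assoc)
  show "0 \<le> inner x x" by transfer simp
  show "inner x x = 0 \<longleftrightarrow> x = 0"
  proof transfer
    fix f assume "f \<in> S2 \<and> f \<in> S2 \<and> (AE x in lborel. f x = f x)"
    then have f: "f \<in> S2" by simp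
    have "(LINT x|lborel. f x * f x) = 0 \<longleftrightarrow> (AE x in lborel. f x * f x = 0)"
      by (rule integral_nonneg_eq_0_iff_AE) (use f S2_mult in auto)
    then show "((LINT x|lborel. f x * f x) = 0) =
        (f \<in> S2 \<and> (\<lambda>x. 0) \<in> S2 \<and> (AE x in lborel. f x = 0))"
      using f S2_zero by simp
  qed
  show "norm x = sqrt (inner x x)" by (simp add: norm_l2_def)
qed (rule uniformity_l2_def open_l2_def)+
end

definition L2 :: "(real \<Rightarrow> real) \<Rightarrow> l2" where "L2 = abs_l2"

lemma L2_surj: "\<exists>f\<in>S2. u = L2 f"
  unfolding L2_def using Quotient_rep_reflp[OF Quotient_l2, of u] Quotient_abs_rep[OF Quotient_l2, of u]
  by metis

lemma L2_eq: "f \<in> S2 \<Longrightarrow> g \<in> S2 \<Longrightarrow> L2 f = L2 g \<longleftrightarrow> (AE x in lborel. f x = g x)"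
  unfolding L2_def using Quotient_rel[OF Quotient_l2, of f g] by auto

lemma L2_add: "f \<in> S2 \<Longrightarrow> g \<in> S2 \<Longrightarrow> L2 f + L2 g = L2 (\<lambda>x. f x + g x)"
  unfolding L2_def by (rule plus_l2.abs_eq) (auto simp: eq_onp_def)
lemma L2_diff: "f \<in> S2 \<Longrightarrow> g \<in> S2 \<Longrightarrow> L2 f - L2 g = L2 (\<lambda>x. f x - g x)"
  unfolding L2_def by (rule minus_l2.abs_eq) (auto simp: eq_onp_def)
lemma L2_scale: "f \<in> S2 \<Longrightarrow> c *\<^sub>R L2 f = L2 (\<lambda>x. c * f x)"
  unfolding L2_def by (rule scaleR_l2.abs_eq) (auto simp: eq_onp_def)
lemma L2_inner: "f \<in> S2 \<Longrightarrow> g \<in> S2 \<Longrightarrow> inner (L2 f) (L2 g) = (LINT x|lborel. f x * g x)"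
  unfolding L2_def by (rule inner_l2.abs_eq) (auto simp: eq_onp_def)

lemma L2_norm: "f \<in> S2 \<Longrightarrow> (norm (L2 f))\<^sup>2 = (LINT x|lborel. (f x)\<^sup>2)"
  by (simp only: power2_norm_eq_inner L2_inner) (simp add: power2_eq_square)

lemma L2_norm_nn: "f \<in> S2 \<Longrightarrow> ennreal ((norm (L2 f))\<^sup>2) = (\<integral>\<^sup>+x. ennreal ((f x)\<^sup>2) \<partial>lborel)"
  by (simp add: L2_norm S2_int nn_integral_eq_integral)

lemma S2I_nn:
  assumes [measurable]: "f \<in> borel_measurable borel" and "(\<integral>\<^sup>+x. ennreal ((f x)\<^sup>2) \<partial>lborel) < \<infinity>"
  shows "f \<in> S2"
  unfolding S2_def using assms by (auto intro!: integrableI_nonneg)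

lemma L2_DCT:
  assumes f: "\<And>k::nat. f k \<in> borel_measurable borel" and g: "g \<in> borel_measurable borel"
    and w: "w \<in> S2" and b: "\<And>k x. \<bar>f k x\<bar> \<le> w x" and lim: "\<And>x. (\<lambda>k. f k x) \<longlonglongrightarrow> g x"
  shows "g \<in> S2" "\<And>k. f k \<in> S2" "(\<lambda>k. L2 (f k)) \<longlonglongrightarrow> L2 g"
proof -
  note [measurable] = f g S2_meas[OF w]
  have *: "h \<in> S2" if [measurable]: "h \<in> borel_measurable borel" and "\<And>x. \<bar>h x\<bar> \<le> w x" for h
  proof -
    have "integrable lborel (\<lambda>x. (h x)\<^sup>2)"
    proof (rule Bochner_Integration.integrable_bound[OF S2_int[OF w]])
      show "AE x in lborel. norm ((h x)\<^sup>2) \<le> norm ((w x)\<^sup>2)"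
      proof (rule AE_I2)
        fix x have "\<bar>h x\<bar> \<le> \<bar>w x\<bar>" using that(2)[of x] by linarith
        then show "norm ((h x)\<^sup>2) \<le> norm ((w x)\<^sup>2)" by (simp add: abs_le_square_iff)
      qed
    qed measurable
    then show ?thesis by (simp add: S2_def)
  qed
  have gb: "\<bar>g x\<bar> \<le> w x" for x
    by (rule LIMSEQ_le_const2[OF tendsto_rabs[OF lim]]) (intro exI allI impI b)
  show g2: "g \<in> S2" by (rule *[OF g gb])
  show f2: "\<And>k. f k \<in> S2" by (rule *[OF f b])
  have "(\<lambda>k. LINT x|lborel. (f k x - g x)\<^sup>2) \<longlonglongrightarrow> (LINT x::real|lborel. 0)"
  proof (rule integral_dominated_convergence[where w = "\<lambda>x. (2 * w x)\<^sup>2"])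
    show "integrable lborel (\<lambda>x. (2 * w x)\<^sup>2)" using S2_int[OF S2_scale[OF w]] .
    show "AE x in lborel. (\<lambda>k. (f k x - g x)\<^sup>2) \<longlonglongrightarrow> 0"
    proof (rule AE_I2)
      fix x show "(\<lambda>k. (f k x - g x)\<^sup>2) \<longlonglongrightarrow> 0"
        using tendsto_power[OF tendsto_diff[OF lim[of x] tendsto_const[of "g x"]], of 2] by simp
    qed
    show "AE x in lborel. norm ((f k x - g x)\<^sup>2) \<le> (2 * w x)\<^sup>2" for k
    proof (rule AE_I2)
      fix x have "\<bar>f k x - g x\<bar> \<le> \<bar>2 * w x\<bar>" using b[of k x] gb[of x] by linarith
      then show "norm ((f k x - g x)\<^sup>2) \<le> (2 * w x)\<^sup>2" by (simp add: abs_le_square_iff)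
    qed
  qed measurable
  then have "(\<lambda>k. (norm (L2 (f k) - L2 g))\<^sup>2) \<longlonglongrightarrow> 0"
    by (simp add: L2_diff f2 g2 L2_norm S2_diff)
  then have "(\<lambda>k. norm (L2 (f k) - L2 g)) \<longlonglongrightarrow> 0"
    using tendsto_real_sqrt[of "\<lambda>k. (norm (L2 (f k) - L2 g))\<^sup>2" 0] by simp
  then show "(\<lambda>k. L2 (f k)) \<longlonglongrightarrow> L2 g" using LIM_zero_iff tendsto_norm_zero_iff by blast
qed


instance l2 :: banach
proof
  fix X :: "nat \<Rightarrow> l2" assume X: "Cauchy X"
  have "\<exists>N. \<forall>m\<ge>N. \<forall>n\<ge>N. norm (X m - X n) < (1/2) ^ k" for k
    using X unfolding Cauchy_iff by simp
  then obtain N where N: "\<And>k m n. N k \<le> m \<Longrightarrow> N k \<le> n \<Longrightarrow> norm (X m - X n) < (1/2) ^ k"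
    by metis
  define r where "r k = (\<Sum>i\<le>k. N i) + k" for k
  have rN: "N k \<le> r l" if "k \<le> l" for k l
    using member_le_sum[of k "{..l}" N] that by (simp add: r_def)
  obtain f where f: "\<And>k. f k \<in> S2" and fX: "\<And>k. X (r k) = L2 (f k)"
    using L2_surj[of "X (r k)" for k] by metis
  note [measurable] = S2_meas[OF f]
  have d: "(\<integral>\<^sup>+x. ennreal ((f l x - f k x)\<^sup>2) \<partial>lborel) \<le> ennreal ((1/4) ^ k)" if "k \<le> l" for k l
  proof -
    have "norm (L2 (f l) - L2 (f k)) \<le> (1/2) ^ k"
      using N[of k "r l" "r k"] rN[of k l] rN[of k k] that by (simp add: fX)
    then have "(norm (L2 (f l) - L2 (f k)))\<^sup>2 \<le> ((1/2) ^ k)\<^sup>2" by (rule power_mono) simp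
    also have "((1/2::real) ^ k)\<^sup>2 = (1/4) ^ k"
      by (simp add: power2_eq_square flip: power_mult_distrib)
    finally show ?thesis
      using f by (simp add: L2_diff S2_diff flip: L2_norm_nn)
  qed
  have "(\<integral>\<^sup>+x. (\<Sum>k. ennreal (2 ^ k * (f (Suc k) x - f k x)\<^sup>2)) \<partial>lborel)
      = (\<Sum>k. \<integral>\<^sup>+x. ennreal (2 ^ k * (f (Suc k) x - f k x)\<^sup>2) \<partial>lborel)"
    by (rule nn_integral_suminf) measurable
  also have "\<dots> \<le> (\<Sum>k. ennreal ((1/2) ^ k))"
  proof (intro suminf_le summableI)
    fix k
    have "(\<integral>\<^sup>+x. ennreal (2 ^ k * (f (Suc k) x - f k x)\<^sup>2) \<partial>lborel)
        = ennreal (2 ^ k) * (\<integral>\<^sup>+x. ennreal ((f (Suc k) x - f k x)\<^sup>2) \<partial>lborel)"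
      by (subst nn_integral_cmult[symmetric]) (auto simp: ennreal_mult)
    also have "\<dots> \<le> ennreal (2 ^ k) * ennreal ((1/4) ^ k)"
      by (intro mult_left_mono d) auto
    also have "\<dots> = ennreal ((1/2) ^ k)"
      by (simp add: ennreal_mult[symmetric] flip: power_mult_distrib)
    finally show "(\<integral>\<^sup>+x. ennreal (2 ^ k * (f (Suc k) x - f k x)\<^sup>2) \<partial>lborel) \<le> ennreal ((1/2) ^ k)" .
  qed
  also have "\<dots> < \<infinity>"
  proof -
    have "(\<Sum>k. ennreal ((1/2) ^ k)) = ennreal (\<Sum>k. (1/2) ^ k)"
      by (rule suminf_ennreal2) (auto intro: summable_geometric)
    then show ?thesis by simp
  qed
  finally have "AE x in lborel. (\<Sum>k. ennreal (2 ^ k * (f (Suc k) x - f k x)\<^sup>2)) \<noteq> \<infinity>"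
    by (intro nn_integral_PInf_AE) auto
  then have conv: "AE x in lborel. convergent (\<lambda>k. f k x)"
  proof eventually_elim
    fix x assume "(\<Sum>k. ennreal (2 ^ k * (f (Suc k) x - f k x)\<^sup>2)) \<noteq> \<infinity>"
    then have sm: "summable (\<lambda>k. 2 ^ k * (f (Suc k) x - f k x)\<^sup>2)"
      by (intro summable_suminf_not_top) auto
    have "summable (\<lambda>k. f (Suc k) x - f k x)"
    proof (rule summable_comparison_test)
      have "summable (\<lambda>k. (1/2::real) ^ k)" by (auto intro: summable_geometric)
      then show "summable (\<lambda>k. 2 ^ k * (f (Suc k) x - f k x)\<^sup>2 + (1/2) ^ k)"
        by (rule summable_add[OF sm])
      show "\<exists>N. \<forall>n\<ge>N. norm (f (Suc n) x - f n x) \<le> 2 ^ n * (f (Suc n) x - f n x)\<^sup>2 + (1/2) ^ n"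
      proof (intro exI allI impI)
        fix n
        define u where "u = \<bar>f (Suc n) x - f n x\<bar>"
        have "0 \<le> 2 ^ n * (u - (1/2) ^ n)\<^sup>2" by simp
        also have "\<dots> = 2 ^ n * u\<^sup>2 - 2 * (2 ^ n * (1/2) ^ n) * u + (2 ^ n * (1/2) ^ n) * (1/2) ^ n"
          by (simp add: power2_eq_square algebra_simps)
        also have "2 ^ n * (1/2::real) ^ n = 1" by (simp flip: power_mult_distrib)
        finally have "2 * u \<le> 2 ^ n * u\<^sup>2 + (1/2) ^ n" by simp
        moreover have "0 \<le> u" by (simp add: u_def)
        ultimately have "u \<le> 2 ^ n * u\<^sup>2 + (1/2) ^ n" by linarith
        then show "norm (f (Suc n) x - f n x) \<le> 2 ^ n * (f (Suc n) x - f n x)\<^sup>2 + (1/2) ^ n"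
          by (simp add: u_def)
      qed
    qed
    from summable_LIMSEQ[OF this] have "convergent (\<lambda>n. f n x - f 0 x)"
      by (auto simp: sum_lessThan_telescope[of "\<lambda>i. f i x" for x] convergent_def)
    then show "convergent (\<lambda>k. f k x)"
      using convergent_diff_const_right_iff by blast
  qed
  define g where "g x = lim (\<lambda>k. f k x)" for x
  have [measurable]: "g \<in> borel_measurable borel"
    unfolding g_def by measurable
  have lim: "AE x in lborel. (\<lambda>k. f k x) \<longlonglongrightarrow> g x"
    using conv by eventually_elim (simp add: g_def convergent_LIMSEQ_iff)
  have gd: "(\<integral>\<^sup>+x. ennreal ((g x - f k x)\<^sup>2) \<partial>lborel) \<le> ennreal ((1/4) ^ k)" for k
  proof -
    have "(\<integral>\<^sup>+x. ennreal ((g x - f k x)\<^sup>2) \<partial>lborel)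
        = (\<integral>\<^sup>+x. liminf (\<lambda>l. ennreal ((f l x - f k x)\<^sup>2)) \<partial>lborel)"
    proof (rule nn_integral_cong_AE)
      show "AE x in lborel. ennreal ((g x - f k x)\<^sup>2) = liminf (\<lambda>l. ennreal ((f l x - f k x)\<^sup>2))"
        using lim
      proof eventually_elim
        fix x assume "(\<lambda>k. f k x) \<longlonglongrightarrow> g x"
        then have "(\<lambda>l. ennreal ((f l x - f k x)\<^sup>2)) \<longlonglongrightarrow> ennreal ((g x - f k x)\<^sup>2)"
          by (intro tendsto_ennrealI tendsto_intros)
        from lim_imp_Liminf[OF _ this]
        show "ennreal ((g x - f k x)\<^sup>2) = liminf (\<lambda>l. ennreal ((f l x - f k x)\<^sup>2))" by simp
      qed
    qed
    also have "\<dots> \<le> liminf (\<lambda>l. \<integral>\<^sup>+x. ennreal ((f l x - f k x)\<^sup>2) \<partial>lborel)"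
      by (rule nn_integral_liminf) measurable
    also have "\<dots> \<le> ennreal ((1/4) ^ k)"
    proof -
      have "liminf (\<lambda>l. \<integral>\<^sup>+x. ennreal ((f l x - f k x)\<^sup>2) \<partial>lborel) \<le> liminf (\<lambda>l. ennreal ((1/4) ^ k))"
        by (rule Liminf_mono) (use d in \<open>auto simp: eventually_sequentially\<close>)
      then show ?thesis by (simp add: Liminf_const)
    qed
    finally show ?thesis .
  qed
  have "(\<lambda>x. g x - f 0 x) \<in> S2"
    by (rule S2I_nn) (use le_less_trans[OF gd[of 0]] in auto)
  from S2_add[OF this f[of 0]] have g: "g \<in> S2" by simp
  have nb: "norm (L2 g - L2 (f k)) \<le> (1/2) ^ k" for k
  proof -
    have "ennreal ((norm (L2 g - L2 (f k)))\<^sup>2) \<le> ennreal ((1/4) ^ k)"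
      using gd[of k] f g by (simp add: L2_diff S2_diff L2_norm_nn)
    then have "(norm (L2 g - L2 (f k)))\<^sup>2 \<le> (1/4) ^ k" by (simp add: ennreal_le_iff)
    also have "(1/4::real) ^ k = ((1/2) ^ k)\<^sup>2"
      by (simp add: power2_eq_square flip: power_mult_distrib)
    finally show ?thesis by (rule power2_le_imp_le) simp
  qed
  have "X \<longlonglongrightarrow> L2 g"
  proof (rule LIMSEQ_I)
    fix e :: real assume e: "0 < e"
    then obtain k where k: "(1/2::real) ^ k < e / 2"
      using real_arch_pow_inv[of "e/2" "1/2"] by auto
    have "norm (X n - L2 g) < e" if "n \<ge> N k" for n
    proof -
      have "norm (X n - L2 g) \<le> norm (X n - X (r k)) + norm (L2 g - L2 (f k))"
        using norm_triangle_ineq4[of "X n - X (r k)" "L2 g - L2 (f k)"] by (simp add: fX)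
      also have "\<dots> < e" using N[of k n "r k"] rN[of k k] nb[of k] k that by simp
      finally show ?thesis .
    qed
    then show "\<exists>no. \<forall>n\<ge>no. norm (X n - L2 g) < e" by blast
  qed
  then show "convergent X" by (auto simp: convergent_def)
qed

definition step_fun :: "(rat \<times> rat \<times> rat) list \<Rightarrow> real \<Rightarrow> real" where
  "step_fun ps x = (\<Sum>(c, p, q)\<leftarrow>ps. of_rat c * indicator {of_rat p..of_rat q} x)"

lemma indicator_S2: "A \<in> sets borel \<Longrightarrow> emeasure lborel A < \<infinity> \<Longrightarrow> indicat_real A \<in> S2"
  by (auto simp: S2_def power2_eq_square less_top simp flip: indicator_inter_arith)

lemma step_fun_Nil: "step_fun [] = (\<lambda>x. 0)" by (auto simp: step_fun_def)
lemma step_fun_Cons: "step_fun ((c,p,q) # ps) = (\<lambda>x. of_rat c * indicator {of_rat p..of_rat q} x + step_fun ps x)"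
  by (auto simp: step_fun_def)
lemma step_fun_append: "step_fun (ps @ qs) = (\<lambda>x. step_fun ps x + step_fun qs x)"
  by (auto simp: step_fun_def)

lemma step_fun_S2: "step_fun ps \<in> S2"
proof (induction ps)
  case Nil then show ?case by (simp add: step_fun_Nil S2_zero)
next
  case (Cons z ps)
  obtain c p q where z: "z = (c, p, q)" by (cases z) auto
  have "indicat_real {of_rat p..of_rat q} \<in> S2"
    by (rule indicator_S2) (auto simp: emeasure_lborel_Icc_eq)
  then show ?case using Cons by (simp add: z step_fun_Cons S2_add S2_scale)
qed

lemma step_fun_scale: "step_fun (map (\<lambda>(c, p, q). (d * c, p, q)) ps) = (\<lambda>x. of_rat d * step_fun ps x)"
  by (induction ps) (auto simp: step_fun_Nil step_fun_Cons of_rat_mult algebra_simps)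

definition steps :: "l2 set" where "steps = range (\<lambda>ps. L2 (step_fun ps))"

lemma steps_add: assumes "u \<in> closure steps" "v \<in> closure steps" shows "u + v \<in> closure steps"
proof -
  obtain f g where f: "\<And>n. f n \<in> steps" "f \<longlonglongrightarrow> u" and g: "\<And>n. g n \<in> steps" "g \<longlonglongrightarrow> v"
    using assms unfolding closure_sequential by metis
  have "f n + g n \<in> steps" for n
  proof -
    obtain ps qs where "f n = L2 (step_fun ps)" "g n = L2 (step_fun qs)"
      using f(1)[of n] g(1)[of n] by (auto simp: steps_def)
    then have "f n + g n = L2 (step_fun (ps @ qs))"
      by (simp add: L2_add step_fun_S2 step_fun_append)
    then show ?thesis by (auto simp: steps_def)
  qed
  then show ?thesis unfolding closure_sequential using tendsto_add[OF f(2) g(2)] by (intro exI[of _ "\<lambda>n. f n + g n"]) auto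
qed

lemma steps_scale: assumes "u \<in> closure steps" shows "c *\<^sub>R u \<in> closure steps"
proof -
  obtain f where f: "\<And>n. f n \<in> steps" "f \<longlonglongrightarrow> u"
    using assms unfolding closure_sequential by metis
  have "c \<in> closure \<rat>" by (simp add: Rats_closure_real)
  then obtain d where d: "\<And>n. d n \<in> \<rat>" "d \<longlonglongrightarrow> c" unfolding closure_sequential by metis
  have "d n *\<^sub>R f n \<in> steps" for n
  proof -
    obtain ps where "f n = L2 (step_fun ps)" using f(1)[of n] by (auto simp: steps_def)
    moreover obtain e where "d n = of_rat e" using d(1)[of n] by (auto elim: Rats_cases)
    ultimately have "d n *\<^sub>R f n = L2 (step_fun (map (\<lambda>(c, p, q). (e * c, p, q)) ps))"
      by (simp only: step_fun_scale L2_scale step_fun_S2)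
    then show ?thesis by (auto simp: steps_def)
  qed
  then show ?thesis unfolding closure_sequential using tendsto_scaleR[OF d(2) f(2)] by (intro exI[of _ "\<lambda>n. d n *\<^sub>R f n"]) auto
qed

lemma steps_zero: "0 \<in> closure steps"
proof -
  have "L2 (step_fun []) \<in> steps" by (auto simp: steps_def)
  moreover have "0 = L2 (step_fun [])" by (simp add: L2_def zero_l2_def step_fun_Nil)
  ultimately show ?thesis using closure_subset by (metis subsetD)
qed

lemma steps_lim: "(\<And>k. L2 (f k) \<in> closure steps) \<Longrightarrow> (\<lambda>k. L2 (f k)) \<longlonglongrightarrow> v \<Longrightarrow> v \<in> closure steps"
  by (rule closed_sequentially[of "closure steps"]) auto

lemma steps_sum: 
  assumes "finite I" "\<And>i. i \<in> I \<Longrightarrow> f i \<in> S2" "\<And>i. i \<in> I \<Longrightarrow> L2 (f i) \<in> closure steps"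
  shows "(\<lambda>x. \<Sum>i\<in>I. f i x) \<in> S2 \<and> L2 (\<lambda>x. \<Sum>i\<in>I. f i x) \<in> closure steps"
  using assms
proof (induction I rule: finite_induct)
  case empty
  have "0 = L2 (\<lambda>x. 0)" by (simp add: L2_def zero_l2_def)
  then show ?case using steps_zero by (simp add: S2_zero)
next
  case (insert i I)
  then have "L2 (f i) + L2 (\<lambda>x. \<Sum>i\<in>I. f i x) = L2 (\<lambda>x. f i x + (\<Sum>i\<in>I. f i x))"
    by (intro L2_add) auto
  then show ?case using insert steps_add[of "L2 (f i)" "L2 (\<lambda>x. \<Sum>i\<in>I. f i x)"]
    by (auto intro!: S2_add)
qed

lemma ind_Icc_S2: "indicat_real {p..q} \<in> S2"
  by (rule indicator_S2) (auto simp: emeasure_lborel_Icc_eq)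

lemma ind_Int_S2:
  assumes [measurable]: "A \<in> sets borel" shows "indicat_real (A \<inter> {p..q}) \<in> S2"
proof (rule indicator_S2)
  have "emeasure lborel (A \<inter> {p..q}) \<le> emeasure lborel {p..q}"
    by (rule emeasure_mono) auto
  also have "\<dots> < \<infinity>" by (simp add: emeasure_lborel_Icc_eq)
  finally show "emeasure lborel (A \<inter> {p..q}) < \<infinity>" .
qed measurable

lemma steps_Icc_rat: "L2 (indicat_real {of_rat p..of_rat q}) \<in> closure steps"
proof -
  have "indicat_real {of_rat p..of_rat q} = step_fun [(1, p, q)]" by (auto simp: step_fun_def)
  then have "L2 (indicat_real {of_rat p..of_rat q}) \<in> steps" by (auto simp: steps_def)
  then show ?thesis using closure_subset by blast
qed

lemma steps_ind:
  assumes "A \<in> sets (borel :: real measure)"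
  shows "L2 (indicat_real (A \<inter> {- real n..real n})) \<in> closure steps"
proof -
  let ?I = "{- real n..real n}"
  have G: "sets (borel :: real measure) = sigma_sets UNIV (range atMost)"
    by (simp add: borel_eq_atMost)
  have meas: "A \<in> sets borel" if "A \<in> sigma_sets UNIV (range atMost)" for A :: "real set"
    using that G by simp
  show ?thesis
  proof (rule sigma_sets_induct_disjoint[of "range atMost" UNIV A "\<lambda>A. L2 (indicat_real (A \<inter> ?I)) \<in> closure steps"])
    show "Int_stable (range atMost :: real set set)"
      by (auto simp: Int_stable_def)
    show "A \<in> sigma_sets UNIV (range atMost)" using assms G by simp
    show "L2 (indicat_real ({} \<inter> ?I)) \<in> closure steps"
    proof -
      have "indicat_real ({} \<inter> ?I) = (\<lambda>x. 0)" by auto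
      then show ?thesis using steps_zero by (simp add: L2_def zero_l2_def)
    qed
  next
    fix A :: "real set" assume "A \<in> range atMost"
    then obtain a where A: "A = {..a}" by auto
    have Sf: "indicat_real (A \<inter> ?I) = indicat_real {- real n..min a (real n)}"
      by (auto simp: A indicator_def)
    have "\<exists>q. min a (real n) < of_rat q \<and> of_rat q < min a (real n) + 1 / real (Suc k)" for k
      by (rule of_rat_dense) simp
    then obtain q where q: "\<And>k. min a (real n) < of_rat (q k)"
      "\<And>k. of_rat (q k) < min a (real n) + 1 / real (Suc k)" by metis
    show "L2 (indicat_real (A \<inter> ?I)) \<in> closure steps"
      unfolding Sf
    proof (rule steps_lim)
      show "L2 (indicat_real {- real n..of_rat (q k)}) \<in> closure steps" for k
        using steps_Icc_rat[of "- of_nat n" "q k"] by (simp add: of_rat_minus)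
      show "(\<lambda>k. L2 (indicat_real {- real n..of_rat (q k)})) \<longlonglongrightarrow> L2 (indicat_real {- real n..min a (real n)})"
      proof (rule L2_DCT(3))
        show "indicat_real {- real n..min a (real n) + 1} \<in> S2" by (rule ind_Icc_S2)
        show "\<bar>indicat_real {- real n..of_rat (q k)} x\<bar> \<le> indicat_real {- real n..min a (real n) + 1} x" for k x
        proof -
          have "1 / real (Suc k) \<le> 1" by simp
          then have "of_rat (q k) \<le> min a (real n) + 1" using q(2)[of k] by linarith
          then show ?thesis by (auto simp: indicator_def)
        qed
        show "(\<lambda>k. indicat_real {- real n..of_rat (q k)} x) \<longlonglongrightarrow> indicat_real {- real n..min a (real n)} x" for x
        proof (rule tendsto_eventually)
          show "\<forall>\<^sub>F k in sequentially. indicat_real {- real n..of_rat (q k)} x = indicat_real {- real n..min a (real n)} x"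
          proof (cases "x \<le> min a (real n)")
            case True
            have "x \<le> of_rat (q k)" for k using True q(1)[of k] by linarith
            then show ?thesis using True by (auto simp: indicator_def)
          next
            case False
            then obtain m where m: "inverse (real (Suc m)) < x - min a (real n)"
              using reals_Archimedean[of "x - min a (real n)"] by (meson diff_gt_0_iff_gt not_le)
            show ?thesis
            proof (rule eventually_sequentiallyI[of m])
              fix k assume "m \<le> k"
              then have "1 / real (Suc k) \<le> inverse (real (Suc m))" by (simp add: field_simps)
              then have "of_rat (q k) < x" using q(2)[of k] m by linarith
              then show "indicat_real {- real n..of_rat (q k)} x = indicat_real {- real n..min a (real n)} x"
                using False by (auto simp: indicator_def)
            qed
          qed
        qed
      qed measurable
    qed
  next
    fix A :: "real set" assume A: "A \<in> sigma_sets UNIV (range atMost)" and IH: "L2 (indicat_real (A \<inter> ?I)) \<in> closure steps"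
    have "L2 (indicat_real ?I) \<in> closure steps"
      using steps_Icc_rat[of "- of_nat n" "of_nat n"] by (simp add: of_rat_minus)
    moreover have "indicat_real (A \<inter> ?I) \<in> S2"
      by (rule ind_Int_S2[OF meas[OF A]])
    then have "L2 (indicat_real ?I) + (-1) *\<^sub>R L2 (indicat_real (A \<inter> ?I)) = L2 (\<lambda>x. indicat_real ?I x + (-1) * indicat_real (A \<inter> ?I) x)"
      by (simp only: L2_scale) (intro L2_add ind_Icc_S2 S2_scale)
    moreover have "(\<lambda>x. indicat_real ?I x + (-1) * indicat_real (A \<inter> ?I) x) = indicat_real ((UNIV - A) \<inter> ?I)"
      by (auto simp: indicator_def)
    ultimately show "L2 (indicat_real ((UNIV - A) \<inter> ?I)) \<in> closure steps"
      using steps_add steps_scale[OF IH] by metis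
  next
    fix A :: "nat \<Rightarrow> real set"
    assume dj: "disjoint_family A" and A: "range A \<subseteq> sigma_sets UNIV (range atMost)"
      and IH: "\<And>i. L2 (indicat_real (A i \<inter> ?I)) \<in> closure steps"
    note [measurable] = meas[OF subsetD[OF A], OF rangeI]
    have S: "indicat_real (A i \<inter> ?I) \<in> S2" for i
      by (rule ind_Int_S2) measurable
    define f where "f k x = (\<Sum>i<k. indicat_real (A i \<inter> ?I) x)" for k :: nat and x
    have fe: "f k x = indicat_real ((\<Union>i<k. A i) \<inter> ?I) x" for k x
    proof -
      have "(\<Union>i<k. A i) \<inter> ?I = (\<Union>i<k. A i \<inter> ?I)" by auto
      moreover have "disjoint_family_on (\<lambda>i. A i \<inter> ?I) {..<k}"
        using dj by (auto simp: disjoint_family_on_def)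
      ultimately show ?thesis
        unfolding f_def by (simp only: indicator_UN_disjoint finite_lessThan)
    qed
    show "L2 (indicat_real ((\<Union>i. A i) \<inter> ?I)) \<in> closure steps"
    proof (rule steps_lim)
      show "L2 (f k) \<in> closure steps" for k
        using steps_sum[of "{..<k}" "\<lambda>i. indicat_real (A i \<inter> ?I)"] S IH by (auto simp: f_def[abs_def])
      show "(\<lambda>k. L2 (f k)) \<longlonglongrightarrow> L2 (indicat_real ((\<Union>i. A i) \<inter> ?I))"
      proof (rule L2_DCT(3))
        show "indicat_real ?I \<in> S2" by (rule ind_Icc_S2)
        show "\<bar>f k x\<bar> \<le> indicat_real ?I x" for k x by (auto simp: fe indicator_def)
        show "(\<lambda>k. f k x) \<longlonglongrightarrow> indicat_real ((\<Union>i. A i) \<inter> ?I) x" for x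
        proof -
          have "(\<lambda>k. indicat_real (\<Union>i<k. A i) x * indicat_real ?I x) \<longlonglongrightarrow> indicat_real (\<Union>i. A i) x * indicat_real ?I x"
            by (intro tendsto_mult tendsto_const LIMSEQ_indicator_UN)
          then show ?thesis by (simp add: fe indicator_inter_arith)
        qed
        show "f k \<in> borel_measurable borel" for k unfolding f_def[abs_def] by measurable
      qed measurable
    qed
  qed (use assms G in auto)
qed


lemma steps_dense: "closure steps = UNIV"
proof -
  have "u \<in> closure steps" for u
  proof -
    obtain f where f: "f \<in> S2" and u: "u = L2 f" using L2_surj[of u] by auto
    note [measurable] = S2_meas[OF f]
    obtain s where s: "\<And>i. simple_function borel (s i)" "\<And>x. (\<lambda>i. s i x) \<longlonglongrightarrow> f x"
      and sb: "\<And>i x. \<bar>s i x\<bar> \<le> 2 * \<bar>f x\<bar>"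
      using borel_measurable_implies_sequence_metric[OF S2_meas[OF f], of 0]
      by (auto simp: dist_real_def)
    note [measurable] = borel_measurable_simple_function[OF s(1)]
    define h where "h i x = s i x * indicat_real {- real i..real i} x" for i x
    have h: "h i x = (\<Sum>y\<in>range (s i). y * indicat_real (s i -` {y} \<inter> {- real i..real i}) x)" for i x
    proof -
      have fin: "finite (range (s i))" using simple_functionD(1)[OF s(1), of i] by simp
      have "(\<Sum>y\<in>range (s i). y * indicat_real (s i -` {y} \<inter> {- real i..real i}) x)
          = (\<Sum>y\<in>range (s i). if y = s i x then h i x else 0)"
        by (rule sum.cong) (auto simp: h_def indicator_def)
      also have "\<dots> = h i x" using fin by simp
      finally show ?thesis by simp
    qed
    have mem: "L2 (h i) \<in> closure steps" for i
    proof -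
      have fin: "finite (range (s i))" using simple_functionD(1)[OF s(1), of i] by simp
      let ?A = "\<lambda>y. s i -` {y} \<inter> {- real i..real i}"
      have m: "s i -` {y} \<in> sets borel" for y
        using simple_functionD(2)[OF s(1), of i "{y}"] by simp
      have S: "indicat_real (?A y) \<in> S2" for y
        by (rule ind_Int_S2[OF m])
      have "L2 (\<lambda>x. y * indicat_real (?A y) x) \<in> closure steps" for y
        using steps_scale[OF steps_ind[OF m[of y], of i], of y] by (simp only: L2_scale S)
      then have "L2 (\<lambda>x. \<Sum>y\<in>range (s i). y * indicat_real (?A y) x) \<in> closure steps"
        using steps_sum[OF fin, of "\<lambda>y x. y * indicat_real (?A y) x"] S2_scale[OF S] by auto
      then show ?thesis by (simp add: h[abs_def])
    qed
    show ?thesis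
      unfolding u
    proof (rule steps_lim[OF mem])
      show "(\<lambda>i. L2 (h i)) \<longlonglongrightarrow> L2 f"
      proof (rule L2_DCT(3))
        have "(\<lambda>x. 2 * f x) \<in> S2" using f by (rule S2_scale)
        then show "(\<lambda>x. \<bar>2 * f x\<bar>) \<in> S2" by (auto simp: S2_def)
        show "\<bar>h i x\<bar> \<le> \<bar>2 * f x\<bar>" for i x
          using sb[of i x] by (auto simp: h_def indicator_def abs_mult)
        show "(\<lambda>i. h i x) \<longlonglongrightarrow> f x" for x
        proof (rule Lim_transform_eventually[OF s(2)])
          obtain m where m: "\<bar>x\<bar> \<le> real m" using real_arch_simple by blast
          show "\<forall>\<^sub>F i in sequentially. s i x = h i x"
            by (rule eventually_sequentiallyI[of m]) (use m in \<open>auto simp: h_def indicator_def\<close>)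
        qed
        show "h i \<in> borel_measurable borel" for i unfolding h_def[abs_def] by measurable
      qed measurable
    qed
  qed
  then show ?thesis by auto
qed

instance l2 :: second_countable_topology
proof
  define C where "C = (\<lambda>(u, n). ball u (1 / real (Suc n))) ` (steps \<times> UNIV)"
  have "countable C" by (auto simp: C_def steps_def)
  moreover have "topological_basis C"
  proof (rule topological_basisI)
    show "open U" if "U \<in> C" for U using that by (auto simp: C_def)
    fix U :: "l2 set" and x assume "open U" "x \<in> U"
    then obtain e where e: "0 < e" "ball x e \<subseteq> U" by (auto simp: open_contains_ball)
    obtain n where n: "inverse (real (Suc n)) < e / 2" using reals_Archimedean[of "e/2"] e by auto
    have "x \<in> closure steps" by (simp add: steps_dense)
    then obtain u where u: "u \<in> steps" "dist u x < 1 / real (Suc n)"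
      unfolding closure_approachable by (meson of_nat_0_less_iff zero_less_Suc zero_less_divide_1_iff)
    have "x \<in> ball u (1 / real (Suc n))" using u by simp
    moreover have "ball u (1 / real (Suc n)) \<subseteq> U"
    proof
      fix y assume "y \<in> ball u (1 / real (Suc n))"
      then have "dist x y < e"
        using u(2) n dist_triangle[of x y u] by (simp add: dist_commute inverse_eq_divide)
      then show "y \<in> U" using e by auto
    qed
    ultimately show "\<exists>B'\<in>C. x \<in> B' \<and> B' \<subseteq> U" using u by (auto simp: C_def)
  qed
  ultimately show "\<exists>B::l2 set set. countable B \<and> open = generate_topology B"
    using topological_basis_imp_subbasis by blast
qed

lemma is_L2_space_witness:
  assumes \<rho>[measurable]: "\<rho> \<in> borel_measurable borel" and pos: "\<And>x. 0 < \<rho> x"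
  shows "is_L2_space \<rho> (\<lambda>\<phi>. L2 (\<lambda>x. \<phi> x / sqrt (\<rho> x)))"
proof -
  have r: "sqrt (\<rho> x) \<noteq> 0" "sqrt (\<rho> x) * sqrt (\<rho> x) = \<rho> x" for x using pos[of x] by auto
  have S: "(\<lambda>x. \<phi> x / sqrt (\<rho> x)) \<in> S2" if "\<phi> \<in> sq_int \<rho>" for \<phi>
    using that pos by (auto simp: sq_int_def S2_def power_divide less_imp_le)
  have surj: "\<exists>\<phi>\<in>sq_int \<rho>. u = L2 (\<lambda>x. \<phi> x / sqrt (\<rho> x))" for u
  proof -
    obtain f where f: "f \<in> S2" "u = L2 f" using L2_surj[of u] by auto
    note [measurable] = S2_meas[OF f(1)]
    have "(\<lambda>x. f x * sqrt (\<rho> x)) \<in> sq_int \<rho>"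
      using f pos by (auto simp: sq_int_def S2_def power_mult_distrib less_imp_le less_imp_neq[symmetric])
    then show ?thesis using f r by (intro bexI[of _ "\<lambda>x. f x * sqrt (\<rho> x)"]) auto
  qed
  show ?thesis
    unfolding is_L2_space_def
  proof (intro conjI ballI allI)
    show "(\<lambda>\<phi>. L2 (\<lambda>x. \<phi> x / sqrt (\<rho> x))) ` sq_int \<rho> = UNIV" using surj by auto
  next
    fix \<phi> \<psi> c d assume "\<phi> \<in> sq_int \<rho>" "\<psi> \<in> sq_int \<rho>"
    then show "L2 (\<lambda>x. (c * \<phi> x + d * \<psi> x) / sqrt (\<rho> x))
        = c *\<^sub>R L2 (\<lambda>x. \<phi> x / sqrt (\<rho> x)) + d *\<^sub>R L2 (\<lambda>x. \<psi> x / sqrt (\<rho> x))"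
      by (simp only: L2_scale L2_add S2_scale S add_divide_distrib times_divide_eq_right[symmetric])
  next
    fix \<phi> \<psi> assume "\<phi> \<in> sq_int \<rho>" "\<psi> \<in> sq_int \<rho>"
    then show "inner (L2 (\<lambda>x. \<phi> x / sqrt (\<rho> x))) (L2 (\<lambda>x. \<psi> x / sqrt (\<rho> x)))
        = (LINT x|lborel. \<phi> x * \<psi> x / \<rho> x)"
      by (simp add: L2_inner S abs_of_pos[OF pos])
  qed
qed

end

theory Submission
  imports Defs
begin

text \<open>Integrating the divergence form by parts gives \<open>\<langle>u, Au\<rangle> \<le> \<mu> \<parallel>u\<parallel>\<^sup>2\<close>, hence the quasi-contraction
  \<open>\<parallel>P t u\<parallel> \<le> exp (\<mu> t) \<parallel>u\<parallel>\<close>, which is all that is needed of the operator. If \<open>\<Psi>\<close> is, up to the action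
  of the semigroup, piecewise constant in time, its stochastic convolution \<open>Z\<close> is an explicit continuous
  process, and a discrete maximal inequality bounds \<open>E sup \<parallel>Z\<parallel>\<^sup>2\<close> by a constant times
  \<open>E \<integral> \<parallel>\<Psi>\<parallel>\<^sup>2\<close> without any factorization argument. As every square integrable adapted integrand is
  approximated by such step processes, stochastic convolutions have continuous versions obeying the same
  bound. Existence follows by Picard iteration. For pathwise uniqueness
  among solutions without moments, the integrands of two solutions are cut off where
  \<open>sup \<parallel>Y - Z\<parallel>\<^sup>2\<close> exceeds \<open>n\<close>; locality of the Ito integral and Gronwall's lemma show that they agree.\<close>

text \<open>The generator is known only through weak derivatives, which are tested against smooth
  functions of bounded support, while the energy identity pairs functions that are merely square
  integrable; the integration by parts is therefore recovered from increments over short intervals.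
  The semigroup is a contraction only after multiplication by exp (- \<mu> t), which accounts for
  the factors exp (2 \<mu> T). Integrands are jointly measurable and adapted, not predictable:
  adaptedness controls values at single times, which is why they are approximated by processes
  frozen at grid times. Errors are measured by E sup of the squared norm and decrease like 16^-k;
  this rate beats the factors 2^k that arise when |x + y|^2 \<le> 2 (|x|^2 + |y|^2) is iterated, so
  no subsequence has to be extracted. The cut-off used for uniqueness takes the place of stopping
  times: the event that the supremum up to time s is at most n is known at time s and shrinks as s
  grows, so on the event at time r the cut-off is inactive on all of [0, r].\<close>

abbreviation nsq :: "'a::real_normed_vector \<Rightarrow> ennreal" where
  "nsq x \<equiv> ennreal ((norm x)\<^sup>2)"

abbreviation path_sq :: "real \<Rightarrow> (real \<Rightarrow> 'a::real_normed_vector) \<Rightarrow> ennreal" where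
  "path_sq t f \<equiv> (\<integral>\<^sup>+s\<in>{0..t}. nsq (f s) \<partial>lborel)"

lemma ennreal_tendsto_0I:
  fixes f :: "'a \<Rightarrow> ennreal"
  assumes "\<And>e. 0 < e \<Longrightarrow> \<forall>\<^sub>F x in F. f x \<le> ennreal e"
  shows "(f \<longlongrightarrow> 0) F"
proof (rule tendsto_0_if_Limsup_eq_0_ennreal, rule antisym[OF _ zero_le], rule ennreal_le_epsilon)
  fix e :: real assume "0 < e"
  then show "Limsup F f \<le> 0 + ennreal e"
    using Limsup_bounded[OF assms[of e]] by simp
qed

section \<open>Continuity of translations in the mean and in the square mean\<close>

lemma lborel_inner_compact_outer_open:
  fixes A :: "real set"
  assumes A[measurable]: "A \<in> sets borel" and fin: "emeasure lborel A < \<infinity>" and e: "0 < e"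
  obtains K U where "compact K" "open U" "K \<subseteq> A" "A \<subseteq> U" "emeasure lborel (U - K) < ennreal e"
proof -
  obtain U where U: "open U" "A \<subseteq> U" "emeasure lebesgue (U - A) < ennreal (e/2)"
    by (rule sets_lebesgue_outer_open[of A "e/2"]) (use A e in auto)
  have [measurable]: "U \<in> sets borel" using U by simp
  \<comment> \<open>Inner regularity concerns finite measures, so Lebesgue measure is restricted to
    \<open>A\<close>; on subsets of \<open>A\<close> the two agree.\<close>
  define N where "N = density lborel (indicator A)"
  have N: "emeasure N B = emeasure lborel (A \<inter> B)" if [measurable]: "B \<in> sets borel" for B
    unfolding N_def by (rule emeasure_restricted) auto
  have "emeasure N A = (SUP K \<in> {K. K \<subseteq> A \<and> compact K}. emeasure N K)"
    by (rule inner_regular) (use N[of UNIV] fin in \<open>auto simp: N_def\<close>)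
  then have S: "emeasure lborel A = (SUP K \<in> {K. K \<subseteq> A \<and> compact K}. emeasure N K)"
    using N by simp
  have "\<exists>K\<in>{K. K \<subseteq> A \<and> compact K}. emeasure lborel A < emeasure N K + ennreal (e/2)"
  proof (rule SUP_approx_ennreal)
    show "emeasure lborel A \<noteq> \<infinity>" using fin by simp
    show "emeasure lborel A = (SUP K \<in> {K. K \<subseteq> A \<and> compact K}. emeasure N K)" by (rule S)
    show "{K. K \<subseteq> A \<and> compact K} \<noteq> {}" by auto
  qed (use e in auto)
  then obtain K where K: "K \<subseteq> A" "compact K" "emeasure lborel A < emeasure N K + ennreal (e/2)" by auto
  have [measurable]: "K \<in> sets borel" using K by (simp add: compact_imp_closed)
  have NK: "emeasure N K = emeasure lborel K"
    using K by (simp add: N Int_absorb1)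
  have "emeasure lborel A = emeasure lborel K + emeasure lborel (A - K)"
    using K(1) by (subst plus_emeasure) (auto intro!: arg_cong[where f = "emeasure lborel"])
  moreover have "emeasure lborel K \<noteq> \<infinity>"
    using emeasure_mono[of K A lborel] K fin by (auto simp: top_unique)
  ultimately have "emeasure lborel (A - K) < ennreal (e/2)"
    using K(3) NK by simp
  moreover have "emeasure lborel (U - A) < ennreal (e/2)" using U(3) by simp
  moreover have "emeasure lborel (U - K) \<le> emeasure lborel (U - A) + emeasure lborel (A - K)"
    using K U by (subst plus_emeasure) (auto intro!: emeasure_mono)
  ultimately have "emeasure lborel (U - K) < ennreal (e/2) + ennreal (e/2)"
    by (meson add_strict_mono le_less_trans)
  also have "ennreal (e/2) + ennreal (e/2) = ennreal e"
    using e by (simp flip: ennreal_plus)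
  finally show ?thesis using that K U by blast
qed

lemma nn_integral_lborel_shift:
  fixes f :: "real \<Rightarrow> ennreal"
  assumes [measurable]: "f \<in> borel_measurable borel"
  shows "(\<integral>\<^sup>+x. f (x + u) \<partial>lborel) = (\<integral>\<^sup>+x. f x \<partial>lborel)"
  using nn_integral_real_affine[of f 1 u] by (simp add: add.commute)

text \<open>For an indicator, a translation by less than the distance from \<open>K\<close> to the
  complement of \<open>U\<close> changes the value at x only if x or x + u lies in
  \<open>U - K\<close>, a set of small measure. Sums are clear, and limits pass because the error f
  - s i has the same integral after translation.\<close>

lemma L1_translation_continuous:
  fixes f :: "real \<Rightarrow> 'a::{banach, second_countable_topology}"
  assumes "integrable lborel f"
  shows "((\<lambda>u. \<integral>\<^sup>+x. ennreal (norm (f (x + u) - f x)) \<partial>lborel) \<longlongrightarrow> 0) (at 0)"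
  using assms
proof (induction rule: integrable_induct)
  case (base A c)
  then have [measurable]: "A \<in> sets borel" and fin: "emeasure lborel A < \<infinity>" by auto
  show ?case
  proof (rule ennreal_tendsto_0I)
    fix e :: real assume e: "0 < e"
    obtain k where c1: "k \<noteq> 0" "k = norm c + 1"
      by (metis add_nonneg_pos norm_ge_zero less_numeral_extra(1) less_irrefl)
    \<comment> \<open>\<open>U - K\<close> is counted at x and at x + u, hence the division by 2;
      adding 1 to \<open>norm c\<close> covers c = 0.\<close>
    define e' where "e' = e / 2 / (norm c + 1)"
    have e': "0 < e'" using e by (simp add: e'_def add_nonneg_pos)
    obtain K U where KU: "compact K" "open U" "K \<subseteq> A" "A \<subseteq> U" "emeasure lborel (U - K) < ennreal e'"
      using lborel_inner_compact_outer_open[OF _ fin e'] by auto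
    have [measurable]: "K \<in> sets borel" "U \<in> sets borel" using KU by (auto simp: compact_imp_closed)
    obtain d where d: "0 < d" "(\<Union>x\<in>K. ball x d) \<subseteq> U"
      using compact_subset_open_imp_ball_epsilon_subset[OF KU(1,2)] KU by blast
    show "\<forall>\<^sub>F u in at 0. (\<integral>\<^sup>+x. ennreal (norm (indicat_real A (x + u) *\<^sub>R c - indicat_real A x *\<^sub>R c)) \<partial>lborel) \<le> ennreal e"
      unfolding eventually_at
    proof (intro exI[of _ d] conjI d ballI impI)
      fix u :: real assume u: "u \<noteq> 0 \<and> dist u 0 < d"
      have KU': "x + u \<in> U" "x - u \<in> U" if "x \<in> K" for x
      proof -
        have "x + u \<in> ball x d" "x - u \<in> ball x d" using u by (auto simp: dist_real_def)
        then show "x + u \<in> U" "x - u \<in> U" using d(2) that by blast+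
      qed
      have "x \<in> U" if "x + u \<in> K" for x using KU'(2)[OF that] by simp
      then have "ennreal (norm (indicat_real A (x + u) *\<^sub>R c - indicat_real A x *\<^sub>R c))
          \<le> ennreal (norm c) * (indicator (U - K) (x + u) + indicator (U - K) x)" for x
        using KU'(1)[of x] KU(3,4) by (auto simp: indicator_def mult_2_right)
      then have "(\<integral>\<^sup>+x. ennreal (norm (indicat_real A (x + u) *\<^sub>R c - indicat_real A x *\<^sub>R c)) \<partial>lborel)
          \<le> (\<integral>\<^sup>+x. ennreal (norm c) * (indicator (U - K) (x + u) + indicator (U - K) x) \<partial>lborel)"
        by (intro nn_integral_mono)
      also have "\<dots> = ennreal (norm c) * ((\<integral>\<^sup>+x. indicator (U - K) (x + u) \<partial>lborel) + (\<integral>\<^sup>+x. indicator (U - K) x \<partial>lborel))"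
        by (subst nn_integral_cmult, measurable) (subst nn_integral_add, auto)
      also have "(\<integral>\<^sup>+x. indicator (U - K) (x + u) \<partial>lborel) = (\<integral>\<^sup>+x. indicator (U - K) x \<partial>lborel)"
        by (rule nn_integral_lborel_shift) measurable
      also have "(\<integral>\<^sup>+x. indicator (U - K) x \<partial>lborel) = emeasure lborel (U - K)" by simp
      also have "ennreal (norm c) * (emeasure lborel (U - K) + emeasure lborel (U - K))
          \<le> ennreal (norm c + 1) * (ennreal e' + ennreal e')"
        using KU(5) by (intro mult_mono add_mono ennreal_leI) (auto intro: less_imp_le)
      also have "\<dots> = ennreal ((norm c + 1) * (e' + e'))"
        using e' by (simp add: ennreal_mult flip: ennreal_plus)
      also have "(norm c + 1) * (e' + e') = e"
        using c1 unfolding e'_def c1(2)[symmetric] by simp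
      finally show "(\<integral>\<^sup>+x. ennreal (norm (indicat_real A (x + u) *\<^sub>R c - indicat_real A x *\<^sub>R c)) \<partial>lborel) \<le> ennreal e" .
    qed
  qed
next
  case (add f g)
  have [measurable]: "f \<in> borel_measurable borel" "g \<in> borel_measurable borel" using add by auto
  show ?case
  proof (rule tendsto_sandwich[OF _ _ tendsto_const])
    show "((\<lambda>u. (\<integral>\<^sup>+x. ennreal (norm (f (x + u) - f x)) \<partial>lborel) + (\<integral>\<^sup>+x. ennreal (norm (g (x + u) - g x)) \<partial>lborel)) \<longlongrightarrow> 0) (at 0)"
      using tendsto_add[OF add(3,4)] by simp
    show "\<forall>\<^sub>F u in at 0. (\<integral>\<^sup>+x. ennreal (norm (f (x + u) + g (x + u) - (f x + g x))) \<partial>lborel)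
       \<le> (\<integral>\<^sup>+x. ennreal (norm (f (x + u) - f x)) \<partial>lborel) + (\<integral>\<^sup>+x. ennreal (norm (g (x + u) - g x)) \<partial>lborel)"
    proof (rule always_eventually, intro allI)
      fix u
      have "(\<integral>\<^sup>+x. ennreal (norm (f (x + u) + g (x + u) - (f x + g x))) \<partial>lborel)
        \<le> (\<integral>\<^sup>+x. ennreal (norm (f (x + u) - f x)) + ennreal (norm (g (x + u) - g x)) \<partial>lborel)"
        by (intro nn_integral_mono) (simp add: norm_diff_triangle_ineq ennreal_leI flip: ennreal_plus)
      then show "(\<integral>\<^sup>+x. ennreal (norm (f (x + u) + g (x + u) - (f x + g x))) \<partial>lborel)
       \<le> (\<integral>\<^sup>+x. ennreal (norm (f (x + u) - f x)) \<partial>lborel) + (\<integral>\<^sup>+x. ennreal (norm (g (x + u) - g x)) \<partial>lborel)"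
        by (subst (asm) nn_integral_add) auto
    qed
  qed auto
next
  case (lim f s)
  have [measurable]: "f \<in> borel_measurable borel" "\<And>i. s i \<in> borel_measurable borel"
    using lim by auto
  have L: "(\<lambda>i. \<integral>\<^sup>+x. ennreal (norm (s i x - f x)) \<partial>lborel) \<longlonglongrightarrow> 0"
  proof -
    have "(\<lambda>i. \<integral>\<^sup>+x. ennreal (norm (f x - s i x)) \<partial>lborel) \<longlonglongrightarrow> 0"
    proof (rule nn_integral_dominated_convergence_norm[where w = "\<lambda>x. 2 * norm (f x)"])
      show "(\<integral>\<^sup>+x. ennreal (2 * norm (f x)) \<partial>lborel) < \<infinity>"
        using integrable_mult_right[OF integrable_norm[OF lim.hyps(4)], of 2]
        unfolding integrable_iff_bounded by (simp add: abs_mult)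
    qed (use lim.hyps in auto)
    then show ?thesis by (simp add: norm_minus_commute)
  qed
  show ?case
  proof (rule ennreal_tendsto_0I)
    fix e :: real assume e: "0 < e"
    have "\<forall>\<^sub>F i in sequentially. (\<integral>\<^sup>+x. ennreal (norm (s i x - f x)) \<partial>lborel) < ennreal (e/3)"
      by (rule order_tendstoD[OF L]) (use e in auto)
    then obtain i where i: "(\<integral>\<^sup>+x. ennreal (norm (s i x - f x)) \<partial>lborel) < ennreal (e/3)"
      by (auto simp: eventually_sequentially)
    have "\<forall>\<^sub>F u in at 0. (\<integral>\<^sup>+x. ennreal (norm (s i (x + u) - s i x)) \<partial>lborel) < ennreal (e/3)"
      by (rule order_tendstoD[OF lim.IH]) (use e in auto)
    then show "\<forall>\<^sub>F u in at 0. (\<integral>\<^sup>+x. ennreal (norm (f (x + u) - f x)) \<partial>lborel) \<le> ennreal e"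
    proof eventually_elim
      case (elim u)
      have "norm (f (x + u) - f x) \<le> norm (s i (x + u) - s i x) + (norm (s i (x + u) - f (x + u)) + norm (s i x - f x))" for x
        by norm
      then have "(\<integral>\<^sup>+x. ennreal (norm (f (x + u) - f x)) \<partial>lborel)
        \<le> (\<integral>\<^sup>+x. ennreal (norm (s i (x + u) - s i x)) + (ennreal (norm (s i (x + u) - f (x + u))) + ennreal (norm (s i x - f x))) \<partial>lborel)"
        by (intro nn_integral_mono) (simp add: ennreal_leI flip: ennreal_plus)
      also have "\<dots> = (\<integral>\<^sup>+x. ennreal (norm (s i (x + u) - s i x)) \<partial>lborel)
         + ((\<integral>\<^sup>+x. ennreal (norm (s i (x + u) - f (x + u))) \<partial>lborel) + (\<integral>\<^sup>+x. ennreal (norm (s i x - f x)) \<partial>lborel))"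
        by (simp add: nn_integral_add)
      also have "(\<integral>\<^sup>+x. ennreal (norm (s i (x + u) - f (x + u))) \<partial>lborel) = (\<integral>\<^sup>+x. ennreal (norm (s i x - f x)) \<partial>lborel)"
        by (rule nn_integral_lborel_shift[where f = "\<lambda>x. ennreal (norm (s i x - f x))"]) measurable
      also have "(\<integral>\<^sup>+x. ennreal (norm (s i (x + u) - s i x)) \<partial>lborel)
         + ((\<integral>\<^sup>+x. ennreal (norm (s i x - f x)) \<partial>lborel) + (\<integral>\<^sup>+x. ennreal (norm (s i x - f x)) \<partial>lborel))
         \<le> ennreal (e/3) + (ennreal (e/3) + ennreal (e/3))"
        using elim i by (intro add_mono) (auto intro: less_imp_le)
      also have "\<dots> = ennreal e" using e by (simp flip: ennreal_plus)
      finally show ?case .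
    qed
  qed
qed

lemma norm_add3_sq: "(norm (a + b + c))\<^sup>2 \<le> 3 * ((norm a)\<^sup>2 + (norm b)\<^sup>2 + (norm c)\<^sup>2)"
  for a b c :: "'a::real_normed_vector"
proof -
  have "norm (a + b + c) \<le> norm a + norm b + norm c"
    by (meson add_right_mono norm_triangle_ineq order_trans)
  then have "(norm (a + b + c))\<^sup>2 \<le> (norm a + norm b + norm c)\<^sup>2"
    by (rule power_mono) simp
  also have "\<dots> \<le> 3 * ((norm a)\<^sup>2 + (norm b)\<^sup>2 + (norm c)\<^sup>2)"
  proof -
    have "0 \<le> (norm a - norm b)\<^sup>2 + (norm b - norm c)\<^sup>2 + (norm a - norm c)\<^sup>2" by simp
    then show ?thesis by (simp add: power2_eq_square algebra_simps)
  qed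
  finally show ?thesis .
qed

text \<open>The truncation \<open>g n\<close> is bounded with bounded support, so its squared
  translation error is at most 2 n + 1 times its integrable one, which
  \<open>L1_translation_continuous\<close> controls. The remainder f - g n is small in the square
  mean, uniformly in the translation.\<close>

lemma L2_translation_continuous:
  fixes f :: "real \<Rightarrow> 'a::{banach, second_countable_topology}"
  assumes [measurable]: "f \<in> borel_measurable borel"
    and fin: "(\<integral>\<^sup>+x. nsq (f x) \<partial>lborel) < \<infinity>"
  shows "((\<lambda>u. \<integral>\<^sup>+x. nsq (f (x + u) - f x) \<partial>lborel) \<longlongrightarrow> 0) (at 0)"
proof (rule ennreal_tendsto_0I)
  fix e :: real assume e: "0 < e"
  define g where "g n x = (if \<bar>x\<bar> \<le> real n \<and> norm (f x) \<le> real n then f x else 0)" for n :: nat and x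
  have [measurable]: "g n \<in> borel_measurable borel" for n unfolding g_def by measurable
  have gb: "norm (g n x) \<le> real n" for n x by (auto simp: g_def)
  have "(\<lambda>n. \<integral>\<^sup>+x. ennreal (norm (0 - (norm (f x - g n x))\<^sup>2)) \<partial>lborel) \<longlonglongrightarrow> 0"
  proof (rule nn_integral_dominated_convergence_norm[where w = "\<lambda>x. (norm (f x))\<^sup>2"])
    show "AE x in lborel. (\<lambda>n. (norm (f x - g n x))\<^sup>2) \<longlonglongrightarrow> 0"
    proof (rule AE_I2, rule tendsto_eventually)
      fix x
      obtain m where m: "max \<bar>x\<bar> (norm (f x)) \<le> real m" using real_arch_simple by blast
      show "\<forall>\<^sub>F n in sequentially. (norm (f x - g n x))\<^sup>2 = 0"
        by (rule eventually_sequentiallyI[of m]) (use m in \<open>auto simp: g_def\<close>)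
    qed
    show "AE x in lborel. norm ((norm (f x - g n x))\<^sup>2) \<le> (norm (f x))\<^sup>2" for n
      by (rule AE_I2) (auto simp: g_def)
  qed (use fin in auto)
  then have "(\<lambda>n. \<integral>\<^sup>+x. nsq (f x - g n x) \<partial>lborel) \<longlonglongrightarrow> 0" by simp
  then have "\<forall>\<^sub>F n in sequentially. (\<integral>\<^sup>+x. nsq (f x - g n x) \<partial>lborel) < ennreal (e/9)"
    by (rule order_tendstoD) (use e in auto)
  then obtain n where n: "(\<integral>\<^sup>+x. nsq (f x - g n x) \<partial>lborel) < ennreal (e/9)"
    by (auto simp: eventually_sequentially)
  have "integrable lborel (g n)"
  proof (rule Bochner_Integration.integrable_bound)
    show "integrable lborel (\<lambda>x. real n * indicat_real {- real n..real n} x)"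
      by (intro integrable_mult_right integrable_real_indicator) (auto simp: emeasure_lborel_Icc_eq)
    show "AE x in lborel. norm (g n x) \<le> norm (real n * indicat_real {- real n..real n} x)"
      by (rule AE_I2) (auto simp: g_def indicator_def)
  qed measurable
  from L1_translation_continuous[OF this]
  have "\<forall>\<^sub>F u in at 0. (\<integral>\<^sup>+x. ennreal (norm (g n (x + u) - g n x)) \<partial>lborel) < ennreal (e / (9 * (2 * real n + 1)))"
    by (rule order_tendstoD) (use e in auto)
  then show "\<forall>\<^sub>F u in at 0. (\<integral>\<^sup>+x. nsq (f (x + u) - f x) \<partial>lborel) \<le> ennreal e"
  proof eventually_elim
    case (elim u)
    have "(norm (f (x + u) - f x))\<^sup>2 \<le> 3 * ((2 * real n + 1) * norm (g n (x + u) - g n x) + (norm (f (x + u) - g n (x + u)))\<^sup>2 + (norm (f x - g n x))\<^sup>2)" for x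
    proof -
      have "norm (g n (x + u) - g n x) \<le> 2 * real n + 1"
        using norm_triangle_ineq4[of "g n (x + u)" "g n x"] gb[of n "x + u"] gb[of n x] by linarith
      then have "(norm (g n (x + u) - g n x))\<^sup>2 \<le> (2 * real n + 1) * norm (g n (x + u) - g n x)"
        by (simp add: power2_eq_square mult_right_mono)
      then show ?thesis
        using norm_add3_sq[of "g n (x + u) - g n x" "f (x + u) - g n (x + u)" "g n x - f x"]
        by (simp add: norm_minus_commute)
    qed
    then have "nsq (f (x + u) - f x) \<le> 3 * (ennreal (2 * real n + 1) * ennreal (norm (g n (x + u) - g n x))
        + nsq (f (x + u) - g n (x + u)) + nsq (f x - g n x))" for x
      by (subst ennreal_mult[symmetric], simp, simp)
        (simp flip: ennreal_plus ennreal_numeral ennreal_mult add: ennreal_leI)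
    then have "(\<integral>\<^sup>+x. nsq (f (x + u) - f x) \<partial>lborel)
      \<le> (\<integral>\<^sup>+x. 3 * (ennreal (2 * real n + 1) * ennreal (norm (g n (x + u) - g n x))
        + nsq (f (x + u) - g n (x + u)) + nsq (f x - g n x)) \<partial>lborel)"
      by (intro nn_integral_mono)
    also have "\<dots> = 3 * (ennreal (2 * real n + 1) * (\<integral>\<^sup>+x. ennreal (norm (g n (x + u) - g n x)) \<partial>lborel)
        + (\<integral>\<^sup>+x. nsq (f (x + u) - g n (x + u)) \<partial>lborel) + (\<integral>\<^sup>+x. nsq (f x - g n x) \<partial>lborel))"
      by (simp add: nn_integral_add nn_integral_cmult)
    also have "(\<integral>\<^sup>+x. nsq (f (x + u) - g n (x + u)) \<partial>lborel) = (\<integral>\<^sup>+x. nsq (f x - g n x) \<partial>lborel)"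
      by (rule nn_integral_lborel_shift[where f = "\<lambda>x. nsq (f x - g n x)"]) measurable
    also have "3 * (ennreal (2 * real n + 1) * (\<integral>\<^sup>+x. ennreal (norm (g n (x + u) - g n x)) \<partial>lborel)
        + (\<integral>\<^sup>+x. nsq (f x - g n x) \<partial>lborel) + (\<integral>\<^sup>+x. nsq (f x - g n x) \<partial>lborel))
      \<le> 3 * (ennreal (2 * real n + 1) * ennreal (e / (9 * (2 * real n + 1))) + ennreal (e/9) + ennreal (e/9))"
      using elim n by (intro mult_mono add_mono) (auto intro: less_imp_le)
    also have "ennreal (2 * real n + 1) * ennreal (e / (9 * (2 * real n + 1))) = ennreal (e/9)"
      by (subst ennreal_mult[symmetric]) (use e in \<open>auto simp: field_simps\<close>)
    also have "3 * (ennreal (e/9) + ennreal (e/9) + ennreal (e/9)) = ennreal e"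
      using e by (simp flip: ennreal_plus ennreal_numeral ennreal_mult)
    finally show ?case .
  qed
qed

subsection \<open>Test functions and weak derivatives\<close>

text \<open>Derivatives of \<open>exp (- c / ((x - a) * (b - x)))\<close> stay in this family, so a smooth bump
  is obtained by one induction over all members.\<close>

definition bump :: "real \<Rightarrow> real \<Rightarrow> real \<Rightarrow> real poly \<Rightarrow> nat \<Rightarrow> real \<Rightarrow> real" where
  "bump a b c p m x =
     (if a < x \<and> x < b then poly p x / ((x - a) * (b - x)) ^ m * exp (- c / ((x - a) * (b - x))) else 0)"

text \<open>Raising y \<le> exp y, with y = c / ((k + 1) w), to the power k + 1 shows that exp (- c
  / w) vanishes faster than any power of w. This gives the smoothness of bumps at their
  endpoints.\<close>

lemma exp_neg_inverse_le:
  fixes c w :: real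
  assumes "0 < c" "0 < w"
  shows "exp (- c / w) \<le> (real (Suc k) / c) ^ Suc k * w ^ Suc k"
proof -
  have "c / (real (Suc k) * w) \<le> exp (c / (real (Suc k) * w))"
    using exp_ge_add_one_self[of "c / (real (Suc k) * w)"] by linarith
  then have "(c / (real (Suc k) * w)) ^ Suc k \<le> exp (c / (real (Suc k) * w)) ^ Suc k"
    by (rule power_mono) (use assms in auto)
  also have "\<dots> = exp (real (Suc k) * (c / (real (Suc k) * w)))"
    by (rule exp_of_nat_mult[symmetric])
  also have "real (Suc k) * (c / (real (Suc k) * w)) = c / w" by simp
  finally have "inverse (exp (c / w)) \<le> inverse ((c / (real (Suc k) * w)) ^ Suc k)"
    by (rule le_imp_inverse_le) (use assms in auto)
  also have "\<dots> = (real (Suc k) / c) ^ Suc k * w ^ Suc k"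
    by (simp only: power_inverse[symmetric] power_mult_distrib[symmetric]) (simp add: field_simps)
  finally show ?thesis by (simp add: exp_minus)
qed

text \<open>In the interior, the new polynomial is the numerator of the usual derivative over the
  common denominator W^(m+2). At an endpoint the function is bounded by a multiple of (y - x)^2, so
  its difference quotient tends to 0.\<close>

lemma DERIV_bump:
  assumes c: "0 < c" and ab: "a < b"
  defines "W \<equiv> [:-a, 1:] * [:b, -1:]"
  shows "(bump a b c p m has_real_derivative
    bump a b c (pderiv p * W\<^sup>2 - of_nat m * p * pderiv W * W + smult c (p * pderiv W)) (m + 2) x) (at x)"
    (is "(_ has_real_derivative bump a b c ?q _ x) _")
proof -
  have W: "poly W x = (x - a) * (b - x)" for x by (simp add: W_def algebra_simps)
  consider "a < x \<and> x < b" | "x < a \<or> b < x" | "x = a \<or> x = b" by linarith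
  then show ?thesis
  proof cases
    case 1
    then have Wp: "0 < poly W x" by (simp add: W)
    have "((\<lambda>x. poly p x / poly W x ^ m * exp (- c / poly W x)) has_real_derivative
       poly ?q x / poly W x ^ (m + 2) * exp (- c / poly W x)) (at x)"
      apply (rule derivative_eq_intros refl poly_DERIV | (use Wp in \<open>simp; fail\<close>))+
      using Wp apply (cases m)
       apply (simp_all add: field_simps power2_eq_square)
      done
    then have "(bump a b c p m has_real_derivative
       poly ?q x / poly W x ^ (m + 2) * exp (- c / poly W x)) (at x)"
      by (rule has_field_derivative_transform_within_open[of _ _ _ "{a<..<b}"]) (use 1 in \<open>auto simp: bump_def W\<close>)
    also have "poly ?q x / poly W x ^ (m + 2) * exp (- c / poly W x) = bump a b c ?q (m + 2) x"
      using 1 by (simp only: bump_def W simp_thms if_True)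
    finally show ?thesis .
  next
    case 2
    have "((\<lambda>x. 0) has_real_derivative 0) (at x)" by simp
    then have "(bump a b c p m has_real_derivative 0) (at x)"
      by (rule has_field_derivative_transform_within_open[of _ _ _ "- {a..b}"]) (use 2 in \<open>auto simp: bump_def\<close>)
    moreover have "bump a b c ?q (m + 2) x = 0" using 2 by (auto simp: bump_def)
    ultimately show ?thesis by simp
  next
    case 3
    have "compact ((\<lambda>x. \<bar>poly p x\<bar>) ` {a..b})"
      by (intro compact_continuous_image continuous_intros) auto
    then obtain K where K: "\<And>y. y \<in> {a..b} \<Longrightarrow> \<bar>poly p y\<bar> \<le> K"
      by (meson bounded_imp_bdd_above compact_imp_bounded bdd_above.E imageI)
    \<comment> \<open>The exponent m + 2 provides m powers of w to cancel the denominator and two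
      more for a quadratic bound; of the two factors of w, one is the distance to the endpoint and
      the other is at most b - a.\<close>
    define C where "C = K * (real (Suc (Suc m)) / c) ^ Suc (Suc m) * (b - a)\<^sup>2"
    have K0: "0 \<le> K" using K[of a] ab by simp
    have bd: "\<bar>bump a b c p m y\<bar> \<le> C * (y - x)\<^sup>2" for y
    proof (cases "a < y \<and> y < b")
      case True
      define w where "w = (y - a) * (b - y)"
      have w: "0 < w" using True by (simp add: w_def)
      have "\<bar>bump a b c p m y\<bar> = \<bar>poly p y\<bar> / w ^ m * exp (- c / w)"
        using True w by (simp add: bump_def w_def abs_mult)
      also have "\<dots> \<le> K / w ^ m * ((real (Suc (Suc m)) / c) ^ Suc (Suc m) * w ^ Suc (Suc m))"
        by (intro mult_mono divide_right_mono K exp_neg_inverse_le c w) (use True w K0 in auto)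
      also have "\<dots> = K * (real (Suc (Suc m)) / c) ^ Suc (Suc m) * w\<^sup>2"
        using w by (simp add: power2_eq_square)
      also have "\<dots> \<le> K * (real (Suc (Suc m)) / c) ^ Suc (Suc m) * ((b - a)\<^sup>2 * (y - x)\<^sup>2)"
      proof (rule mult_left_mono)
        have "w \<le> (b - a) * \<bar>y - x\<bar>"
          using 3
        proof
          assume "x = a" then show ?thesis using True mult_mono[of "y - a" "y - a" "b - y" "b - a"] by (simp add: w_def mult.commute)
        next
          assume "x = b" then show ?thesis using True mult_mono[of "y - a" "b - a" "b - y" "b - y"] by (simp add: w_def mult.commute)
        qed
        then have "w\<^sup>2 \<le> ((b - a) * \<bar>y - x\<bar>)\<^sup>2" by (rule power_mono) (use w in simp)
        then show "w\<^sup>2 \<le> (b - a)\<^sup>2 * (y - x)\<^sup>2" by (simp add: power_mult_distrib)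
      qed (use K0 c in simp)
      finally show ?thesis by (simp add: C_def mult.assoc)
    next
      case False
      then show ?thesis using K0 c by (auto simp: bump_def C_def)
    qed
    have "((\<lambda>y. (bump a b c p m y - bump a b c p m x) / (y - x)) \<longlongrightarrow> 0) (at x)"
    proof (rule Lim_null_comparison)
      show "\<forall>\<^sub>F y in at x. norm ((bump a b c p m y - bump a b c p m x) / (y - x)) \<le> C * \<bar>y - x\<bar>"
        unfolding eventually_at_filter
      proof (intro always_eventually allI impI)
        fix y assume y: "y \<noteq> x"
        have "bump a b c p m x = 0" using 3 by (auto simp: bump_def)
        then have "norm ((bump a b c p m y - bump a b c p m x) / (y - x)) \<le> C * (y - x)\<^sup>2 / \<bar>y - x\<bar>"
          using bd[of y] by (simp add: divide_right_mono)
        also have "C * (y - x)\<^sup>2 / \<bar>y - x\<bar> = C * \<bar>y - x\<bar>"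
          using y by (simp add: power2_eq_square abs_if field_simps)
        finally show "norm ((bump a b c p m y - bump a b c p m x) / (y - x)) \<le> C * \<bar>y - x\<bar>" .
      qed
      show "((\<lambda>y. C * \<bar>y - x\<bar>) \<longlongrightarrow> 0) (at x)"
        by (auto intro!: tendsto_eq_intros)
    qed
    moreover have "bump a b c ?q (m + 2) x = 0" using 3 by (auto simp: bump_def)
    ultimately show ?thesis by (simp add: has_field_derivative_iff)
  qed
qed

lemma test_function_bump:
  assumes "0 < c" "a < b"
  shows "test_function (bump a b c p m)"
  unfolding test_function_def
proof
  have "\<exists>q k. (deriv ^^ n) (bump a b c p m) = bump a b c q k" for n
  proof (induction n)
    case (Suc n)
    then obtain q k where "(deriv ^^ n) (bump a b c p m) = bump a b c q k" by blast
    then have "(deriv ^^ Suc n) (bump a b c p m) = deriv (bump a b c q k)" by simp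
    also have "\<dots> = bump a b c (pderiv q * ([:-a, 1:] * [:b, -1:])\<^sup>2 - of_nat k * q * pderiv ([:-a, 1:] * [:b, -1:]) * ([:-a, 1:] * [:b, -1:]) + smult c (q * pderiv ([:-a, 1:] * [:b, -1:]))) (k + 2)"
      by (rule ext) (rule DERIV_imp_deriv[OF DERIV_bump[OF assms]])
    finally show ?case by blast
  qed auto
  moreover have "bump a b c q k differentiable_on UNIV" for q k
    unfolding differentiable_on_def real_differentiable_def using DERIV_bump[OF assms] by blast
  ultimately show "\<forall>n. (deriv ^^ n) (bump a b c p m) differentiable_on UNIV"
    by metis
  show "\<exists>R. \<forall>x. R < \<bar>x\<bar> \<longrightarrow> bump a b c p m x = 0"
    by (intro exI[of _ "max \<bar>a\<bar> \<bar>b\<bar>"]) (auto simp: bump_def)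
qed

lemma test_functionD:
  assumes "test_function \<psi>"
  shows "(\<psi> has_real_derivative deriv \<psi> x) (at x)" "continuous_on UNIV \<psi>"
    "\<psi> \<in> borel_measurable borel" "deriv \<psi> \<in> borel_measurable borel" "continuous_on UNIV (deriv \<psi>)"
proof -
  have d: "(deriv ^^ n) \<psi> differentiable_on UNIV" for n using assms by (simp add: test_function_def)
  have "\<psi> differentiable at x" using d[of 0] by (simp add: differentiable_on_def)
  then show "(\<psi> has_real_derivative deriv \<psi> x) (at x)"
    by (simp add: DERIV_deriv_iff_real_differentiable)
  show *: "continuous_on UNIV \<psi>" using differentiable_imp_continuous_on[OF d[of 0]] by simp
  then show "\<psi> \<in> borel_measurable borel" by (rule borel_measurable_continuous_onI)
  show "continuous_on UNIV (deriv \<psi>)" using differentiable_imp_continuous_on[OF d[of 1]] by simp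
  then show "deriv \<psi> \<in> borel_measurable borel" by (rule borel_measurable_continuous_onI)
qed

lemma tendsto_exp_neg_inverse:
  fixes w :: real
  assumes "w \<noteq> 0"
  shows "(\<lambda>n. exp (- (1 / real (Suc n)) / w)) \<longlonglongrightarrow> 1"
proof -
  have "(\<lambda>n. exp (- (inverse (real (Suc n))) / w)) \<longlonglongrightarrow> exp (- 0 / w)"
    by (intro tendsto_intros LIMSEQ_inverse_real_of_nat assms)
  then show ?thesis by (simp add: inverse_eq_divide)
qed

text \<open>Bumps with parameter 1 / (n + 1) converge to the indicator of an open interval, so g has
  integral 0 over every bounded open interval. Open intervals generate the Borel sets and are stable
  under intersection, which makes the measures with densities the positive and negative part of g
  equal.\<close>

lemma fundamental_lemma:
  fixes g :: "real \<Rightarrow> real"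
  assumes g: "\<And>n. integrable lborel (\<lambda>x. indicat_real {- real n..real n} x * g x)"
    and [measurable]: "g \<in> borel_measurable borel"
    and z: "\<And>\<psi>. test_function \<psi> \<Longrightarrow> (LINT x|lborel. g x * \<psi> x) = 0"
  shows "AE x in lborel. g x = 0"
proof -
  have int: "integrable lborel (\<lambda>x. indicat_real {a<..<b} x * g x)" for a b
  proof -
    obtain n where n: "max \<bar>a\<bar> \<bar>b\<bar> \<le> real n" using real_arch_simple by blast
    show ?thesis
      by (rule Bochner_Integration.integrable_bound[OF g[of n]])
        (use n in \<open>auto simp: indicator_def\<close>)
  qed
  have zero: "(LINT x|lborel. indicat_real {a<..<b} x * g x) = 0" if ab: "a < b" for a b
  proof -
    have "(\<lambda>n. LINT x|lborel. g x * bump a b (1 / real (Suc n)) 1 0 x) \<longlonglongrightarrow> (LINT x|lborel. indicat_real {a<..<b} x * g x)"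
    proof (rule integral_dominated_convergence[where w = "\<lambda>x. \<bar>indicat_real {a<..<b} x * g x\<bar>"])
      have "bump a b (1 / real (Suc n)) 1 0 \<in> borel_measurable borel" for n
        using test_functionD(3)[OF test_function_bump] ab by simp
      then show "(\<lambda>x. g x * bump a b (1 / real (Suc n)) 1 0 x) \<in> borel_measurable lborel" for n by simp
      show "integrable lborel (\<lambda>x. \<bar>indicat_real {a<..<b} x * g x\<bar>)" using int by (rule integrable_abs)
      show "AE x in lborel. (\<lambda>n. g x * bump a b (1 / real (Suc n)) 1 0 x) \<longlonglongrightarrow> indicat_real {a<..<b} x * g x"
      proof (rule AE_I2)
        fix x
        show "(\<lambda>n. g x * bump a b (1 / real (Suc n)) 1 0 x) \<longlonglongrightarrow> indicat_real {a<..<b} x * g x"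
          using tendsto_mult[OF tendsto_const[of "g x"] tendsto_exp_neg_inverse[of "(x - a) * (b - x)"]]
          by (cases "a < x \<and> x < b") (auto simp: bump_def indicator_def)
      qed
      show "AE x in lborel. norm (g x * bump a b (1 / real (Suc n)) 1 0 x) \<le> \<bar>indicat_real {a<..<b} x * g x\<bar>" for n
      proof (rule AE_I2)
        fix x
        have "\<bar>g x\<bar> * exp (- (1 / real (Suc n)) / ((x - a) * (b - x))) \<le> \<bar>g x\<bar> * 1" if "a < x" "x < b"
          by (rule mult_left_mono) (use that in auto)
        then show "norm (g x * bump a b (1 / real (Suc n)) 1 0 x) \<le> \<bar>indicat_real {a<..<b} x * g x\<bar>"
          by (auto simp: bump_def indicator_def abs_mult)
      qed
    qed simp
    moreover have "(LINT x|lborel. g x * bump a b (1 / real (Suc n)) 1 0 x) = 0" for n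
      by (rule z, rule test_function_bump) (use ab in auto)
    ultimately show ?thesis by (simp add: LIMSEQ_const_iff)
  qed
  \<comment> \<open>\<open>ennreal\<close> sends negative numbers to 0, so these densities are the
    positive and the negative part of g.\<close>
  define N1 where "N1 = density lborel (\<lambda>x. ennreal (g x))"
  define N2 where "N2 = density lborel (\<lambda>x. ennreal (- g x))"
  have e: "emeasure N1 {a<..<b} = (\<integral>\<^sup>+x. ennreal (indicat_real {a<..<b} x * g x) \<partial>lborel)"
    "emeasure N2 {a<..<b} = (\<integral>\<^sup>+x. ennreal (- (indicat_real {a<..<b} x * g x)) \<partial>lborel)" for a b
    unfolding N1_def N2_def by (subst emeasure_density; auto intro!: nn_integral_cong simp: indicator_def)+
  have fin: "emeasure N1 {a<..<b} < \<infinity>" "emeasure N2 {a<..<b} < \<infinity>" for a b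
    unfolding e using int[of a b] by (auto simp: real_integrable_def less_top)
  have "N1 = N2"
  proof (rule measure_eqI_generator_eq[where E = "range (\<lambda>(a, b). {a<..<b})" and \<Omega> = UNIV and A = "\<lambda>n. {- real n<..<real n}"])
    show "Int_stable (range (\<lambda>(a, b). {a<..<b::real}))"
      by (auto simp: Int_stable_def)
    fix X assume "X \<in> range (\<lambda>(a, b). {a<..<b::real})"
    then obtain a b where X: "X = {a<..<b}" by auto
    show "emeasure N1 X = emeasure N2 X"
    proof (cases "a < b")
      case True
      have "enn2real (\<integral>\<^sup>+x. ennreal (indicat_real {a<..<b} x * g x) \<partial>lborel)
         = enn2real (\<integral>\<^sup>+x. ennreal (- (indicat_real {a<..<b} x * g x)) \<partial>lborel)"
        using zero[OF True] by (subst (asm) real_lebesgue_integral_def[OF int]) simp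
      then show ?thesis using fin[of a b]
        by (metis X e ennreal_enn2real infinity_ennreal_def)
    qed (simp add: X)
  next
    show "(\<Union>n. {- real n<..<real n}) = (UNIV :: real set)"
    proof -
      have "\<exists>n. x \<in> {- real n<..<real n}" for x
        using reals_Archimedean2[of "\<bar>x\<bar>"] by (metis abs_less_iff greaterThanLessThan_iff neg_less_iff_less minus_minus)
      then show ?thesis by blast
    qed
    have G: "sets borel = sigma_sets UNIV (range (\<lambda>(a, b). {a<..<b::real}))"
      by (simp add: borel_eq_box box_real)
    then show "sets N1 = sigma_sets UNIV (range (\<lambda>(a, b). {a<..<b}))" "sets N2 = sigma_sets UNIV (range (\<lambda>(a, b). {a<..<b}))"
      by (simp_all add: N1_def N2_def)
    show "range (\<lambda>n. {- real n<..<real n}) \<subseteq> range (\<lambda>(a, b). {a<..<b})" by auto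
    show "emeasure N1 {- real n<..<real n} \<noteq> \<infinity>" for n using fin(1) by (simp add: less_top)
  qed auto
  then have "AE x in lborel. ennreal (g x) = ennreal (- g x)"
    unfolding N1_def N2_def by (subst (asm) sigma_finite_measure.density_unique_iff[OF sigma_finite_lborel]) auto
  then show ?thesis
    proof eventually_elim
    case (elim x)
    then show "g x = 0"
      by (cases "0 \<le> g x") (auto simp: ennreal_neg dest: sym)
  qed
qed

lemma S2_nn_integral: "f \<in> S2 \<Longrightarrow> (\<integral>\<^sup>+x. ennreal ((f x)\<^sup>2) \<partial>lborel) < \<infinity>"
  using integrableD(2)[OF S2_int] by (auto simp: less_top)

lemma S2_shift: "f \<in> S2 \<Longrightarrow> (\<lambda>x. f (x + h)) \<in> S2"
proof (rule S2I_nn)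
  assume f: "f \<in> S2"
  note [measurable] = S2_meas[OF f]
  show "(\<lambda>x. f (x + h)) \<in> borel_measurable borel" by measurable
  show "(\<integral>\<^sup>+x. ennreal ((f (x + h))\<^sup>2) \<partial>lborel) < \<infinity>"
    using nn_integral_lborel_shift[of "\<lambda>x. ennreal ((f x)\<^sup>2)" h] S2_nn_integral[OF f] by simp
qed

lemma integral_lborel_shift:
  fixes f :: "real \<Rightarrow> real"
  shows "(LINT x|lborel. f (x + h)) = (LINT x|lborel. f x)"
  using lborel_integral_real_affine[of 1 f h] by (simp add: add.commute)

lemma S2_continuous_compact_support:
  assumes "continuous_on UNIV f" "\<And>x. \<bar>x\<bar> > R \<Longrightarrow> f x = 0"
  shows "f \<in> S2"
proof -
  have [measurable]: "f \<in> borel_measurable borel"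
    using assms(1) by (rule borel_measurable_continuous_onI)
  have "compact ((\<lambda>x. \<bar>f x\<bar>) ` {-\<bar>R\<bar>..\<bar>R\<bar>})"
    using assms(1) by (intro compact_continuous_image continuous_intros) (auto intro: continuous_on_subset)
  then obtain K where K: "\<And>x. x \<in> {-\<bar>R\<bar>..\<bar>R\<bar>} \<Longrightarrow> \<bar>f x\<bar> \<le> K"
    by (meson bounded_imp_bdd_above compact_imp_bounded bdd_above.E imageI)
  have "integrable lborel (\<lambda>x. (f x)\<^sup>2)"
  proof (rule Bochner_Integration.integrable_bound)
    show "integrable lborel (\<lambda>x. K\<^sup>2 * indicat_real {-\<bar>R\<bar>..\<bar>R\<bar>} x)"
      by (intro integrable_mult_right integrable_real_indicator) (auto simp: emeasure_lborel_Icc_eq)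
    show "AE x in lborel. norm ((f x)\<^sup>2) \<le> norm (K\<^sup>2 * indicat_real {-\<bar>R\<bar>..\<bar>R\<bar>} x)"
    proof (rule AE_I2)
      fix x
      show "norm ((f x)\<^sup>2) \<le> norm (K\<^sup>2 * indicat_real {-\<bar>R\<bar>..\<bar>R\<bar>} x)"
      proof (cases "\<bar>x\<bar> \<le> \<bar>R\<bar>")
        case True
        then have x: "x \<in> {-\<bar>R\<bar>..\<bar>R\<bar>}" by (auto simp: abs_le_iff)
        then have "\<bar>f x\<bar> \<le> \<bar>K\<bar>" using K[of x] by linarith
        then have "(f x)\<^sup>2 \<le> K\<^sup>2" by (simp add: abs_le_square_iff)
        then show ?thesis using x by simp
      next
        case False
        then show ?thesis using assms(2)[of x] by auto
      qed
    qed
  qed measurable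
  then show ?thesis by (simp add: S2_def)
qed

lemma test_function_S2: "test_function \<psi> \<Longrightarrow> \<psi> \<in> S2"
  using test_functionD(2)[of \<psi>] S2_continuous_compact_support[of \<psi>] by (auto simp: test_function_def)

text \<open>By |p q| \<le> p^2 + q^2 and translation invariance, the integral over x is bounded
  independently of r, and r is confined to a bounded interval. The sign s is 1 for increments of a
  function and -1 when the increment has been moved to a test function.\<close>

lemma S2_correlation_integrable:
  assumes p: "p \<in> S2" and q: "q \<in> S2"
  shows "integrable (lborel \<Otimes>\<^sub>M lborel) (\<lambda>(x, r). indicat_real {0..h} r * (p (x + s * r) * q x))"
proof -
  note [measurable] = S2_meas[OF p] S2_meas[OF q]
  show ?thesis
  proof (rule integrableI_bounded)
    have "(\<integral>\<^sup>+z. ennreal (norm (case z of (x, r) \<Rightarrow> indicat_real {0..h} r * (p (x + s * r) * q x))) \<partial>(lborel \<Otimes>\<^sub>M lborel))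
       = (\<integral>\<^sup>+r. \<integral>\<^sup>+x. ennreal (norm (indicat_real {0..h} r * (p (x + s * r) * q x))) \<partial>lborel \<partial>lborel)"
      by (subst lborel_pair.nn_integral_snd[symmetric]) auto
    also have "\<dots> \<le> (\<integral>\<^sup>+r. indicator {0..h} r * ((\<integral>\<^sup>+x. ennreal ((p x)\<^sup>2) \<partial>lborel) + (\<integral>\<^sup>+x. ennreal ((q x)\<^sup>2) \<partial>lborel)) \<partial>lborel)"
    proof (rule nn_integral_mono, goal_cases)
      case (1 r)
      have "\<bar>p (x + s * r) * q x\<bar> \<le> (p (x + s * r))\<^sup>2 + (q x)\<^sup>2" for x
      proof -
        have "2 * (\<bar>p (x + s * r)\<bar> * \<bar>q x\<bar>) \<le> (p (x + s * r))\<^sup>2 + (q x)\<^sup>2"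
          using sum_squares_bound[of "\<bar>p (x + s * r)\<bar>" "\<bar>q x\<bar>"] by simp
        moreover have "0 \<le> \<bar>p (x + s * r)\<bar> * \<bar>q x\<bar>" by simp
        ultimately show ?thesis unfolding abs_mult by linarith
      qed
      then have "(\<integral>\<^sup>+x. ennreal (norm (indicat_real {0..h} r * (p (x + s * r) * q x))) \<partial>lborel)
        \<le> (\<integral>\<^sup>+x. indicator {0..h} r * (ennreal ((p (x + s * r))\<^sup>2) + ennreal ((q x)\<^sup>2)) \<partial>lborel)"
        by (intro nn_integral_mono) (auto simp: indicator_def ennreal_leI simp flip: ennreal_plus)
      also have "\<dots> = indicator {0..h} r * ((\<integral>\<^sup>+x. ennreal ((p (x + s * r))\<^sup>2) \<partial>lborel) + (\<integral>\<^sup>+x. ennreal ((q x)\<^sup>2) \<partial>lborel))"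
        by (simp add: nn_integral_cmult nn_integral_add)
      also have "(\<integral>\<^sup>+x. ennreal ((p (x + s * r))\<^sup>2) \<partial>lborel) = (\<integral>\<^sup>+x. ennreal ((p x)\<^sup>2) \<partial>lborel)"
        using nn_integral_lborel_shift[of "\<lambda>x. ennreal ((p x)\<^sup>2)" "s * r"] by simp
      finally show ?case .
    qed
    also have "\<dots> = emeasure lborel {0..h} * ((\<integral>\<^sup>+x. ennreal ((p x)\<^sup>2) \<partial>lborel) + (\<integral>\<^sup>+x. ennreal ((q x)\<^sup>2) \<partial>lborel))"
      by (subst nn_integral_multc) auto
    also have "\<dots> < \<infinity>"
      using S2_nn_integral[OF p] S2_nn_integral[OF q]
      by (simp add: ennreal_mult_less_top emeasure_lborel_Icc_eq)
    finally show "(\<integral>\<^sup>+z. ennreal (norm (case z of (x, r) \<Rightarrow> indicat_real {0..h} r * (p (x + s * r) * q x))) \<partial>(lborel \<Otimes>\<^sub>M lborel)) < \<infinity>" .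
  qed measurable
qed

lemma S2_correlation_Fubini:
  assumes p: "p \<in> S2" and q: "q \<in> S2"
  shows "integrable lborel (\<lambda>x. (LINT r|lborel. indicat_real {0..h} r * p (x + s * r)) * q x)" (is ?A)
    "integrable lborel (\<lambda>r. indicat_real {0..h} r * (LINT x|lborel. p (x + s * r) * q x))" (is ?B)
    "(LINT x|lborel. (LINT r|lborel. indicat_real {0..h} r * p (x + s * r)) * q x)
      = (LINT r|lborel. indicat_real {0..h} r * (LINT x|lborel. p (x + s * r) * q x))" (is ?C)
proof -
  note I = S2_correlation_integrable[OF assms, of h s]
  have 1: "(LINT r|lborel. indicat_real {0..h} r * (p (x + s * r) * q x))
      = (LINT r|lborel. indicat_real {0..h} r * p (x + s * r)) * q x" for x
    by (simp add: mult.assoc[symmetric])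
  have 2: "(LINT x|lborel. indicat_real {0..h} r * (p (x + s * r) * q x))
      = indicat_real {0..h} r * (LINT x|lborel. p (x + s * r) * q x)" for r
    by simp
  show ?A using lborel_pair.integrable_fst[OF I] by (simp add: 1)
  show ?B using lborel_pair.integrable_snd[OF I] by (simp add: 2)
  show ?C using lborel_pair.Fubini_integral[OF I] by (simp add: 1 2)
qed

text \<open>\<Psi> is the integral of \<psi> over [x - h, x]. An antiderivative of \<psi> alone
  would in general not have bounded support; that of the difference does, so it may be inserted into
  the definition of the weak derivative.\<close>

lemma test_function_shift_diff:
  assumes \<psi>: "test_function \<psi>" and h: "0 < h"
  obtains \<Psi> where "test_function \<Psi>" "\<And>x. deriv \<Psi> x = \<psi> x - \<psi> (x - h)"
    "\<And>x. \<Psi> x = (LINT r|lborel. indicat_real {0..h} r * \<psi> (x + (-1) * r))"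
proof -
  define Q where "Q x = (LBINT y=ereal 0..ereal x. \<psi> y)" for x
  have Q: "(Q has_real_derivative \<psi> x) (at x)" for x
  proof -
    have "((\<lambda>u. LBINT y=ereal 0..ereal u. \<psi> y) has_vector_derivative \<psi> x) (at x within {-\<bar>x\<bar>-1..\<bar>x\<bar>+1})"
      by (rule interval_integral_FTC2) (auto intro: continuous_on_subset[OF test_functionD(2)[OF \<psi>]])
    moreover have "at x within {-\<bar>x\<bar>-1..\<bar>x\<bar>+1} = at x"
      by (rule at_within_Icc_at) auto
    ultimately show ?thesis
      unfolding Q_def has_real_derivative_iff_has_vector_derivative by simp
  qed
  define \<Psi> where "\<Psi> x = Q x - Q (x - h)" for x
  have D: "(\<Psi> has_real_derivative \<psi> x - \<psi> (x - h)) (at x)" for x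
    unfolding \<Psi>_def[abs_def] by (auto intro!: derivative_eq_intros Q DERIV_chain'[OF _ Q, THEN DERIV_cong])
  then have dP: "deriv \<Psi> x = \<psi> x - \<psi> (x - h)" for x by (rule DERIV_imp_deriv)
  have d: "(deriv ^^ n) \<psi> differentiable_on UNIV" for n using \<psi> by (simp add: test_function_def)
  have dd: "((deriv ^^ n) \<psi> has_real_derivative (deriv ^^ Suc n) \<psi> x) (at x)" for n x
    using d[of n] by (simp add: differentiable_on_def DERIV_deriv_iff_real_differentiable)
  have e: "((\<lambda>x. (deriv ^^ n) \<psi> x - (deriv ^^ n) \<psi> (x - h)) has_real_derivative
      (deriv ^^ Suc n) \<psi> x - (deriv ^^ Suc n) \<psi> (x - h)) (at x)" for n x
    by (auto intro!: derivative_eq_intros dd DERIV_chain'[OF _ dd, THEN DERIV_cong])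
  have it: "(deriv ^^ Suc n) \<Psi> = (\<lambda>x. (deriv ^^ n) \<psi> x - (deriv ^^ n) \<psi> (x - h))" for n
  proof (induction n)
    case 0 show ?case by (simp add: fun_eq_iff dP)
  next
    case (Suc n)
    have "(deriv ^^ Suc (Suc n)) \<Psi> = deriv ((deriv ^^ Suc n) \<Psi>)" by simp
    also have "\<dots> = (\<lambda>x. (deriv ^^ Suc n) \<psi> x - (deriv ^^ Suc n) \<psi> (x - h))"
      unfolding Suc by (rule ext, rule DERIV_imp_deriv, rule e)
    finally show ?case .
  qed
  have diff: "(deriv ^^ n) \<Psi> differentiable_on UNIV" for n
  proof (cases n)
    case 0
    then show ?thesis using D by (auto simp: differentiable_on_def real_differentiable_def)
  next
    case (Suc k)
    then show ?thesis unfolding Suc it using e[of k] by (auto simp: differentiable_on_def real_differentiable_def)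
  qed
  obtain R where R: "\<And>x. \<bar>x\<bar> > R \<Longrightarrow> \<psi> x = 0" using \<psi> by (auto simp: test_function_def)
  have I: "\<Psi> x = (LINT r|lborel. indicat_real {0..h} r * \<psi> (x + (-1) * r))" for x
  proof -
    have "(LINT r|lborel. \<psi> (x - r) * indicator {0..h} r) = - Q (x - h) - (- Q (x - 0))"
    proof (rule integral_FTC_Icc_real)
      show "0 \<le> h" using h by simp
      show "((\<lambda>r. - Q (x - r)) has_real_derivative \<psi> (x - r)) (at r)" for r
        by (auto intro!: derivative_eq_intros DERIV_chain'[OF _ Q, THEN DERIV_cong])
      have "isCont \<psi> y" for y using DERIV_isCont[OF test_functionD(1)[OF \<psi>]] .
      then show "isCont (\<lambda>r. \<psi> (x - r)) r" for r
        by (intro isCont_o2[where g = \<psi> and f = "\<lambda>r. x - r"] continuous_intros)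
    qed
    then show ?thesis by (simp add: \<Psi>_def mult.commute)
  qed
  have "\<Psi> x = 0" if "\<bar>x\<bar> > \<bar>R\<bar> + h" for x
  proof -
    have "indicat_real {0..h} r * \<psi> (x + (-1) * r) = 0" for r
      using that R[of "x - r"] by (auto simp: indicator_def)
    then have "(\<lambda>r. indicat_real {0..h} r * \<psi> (x + (-1) * r)) = (\<lambda>r. 0)" by (rule ext)
    then show ?thesis unfolding I by simp
  qed
  then have "test_function \<Psi>" using diff unfolding test_function_def by blast
  then show ?thesis using that dP I by blast
qed

text \<open>Tested against \<psi>, the increment of f becomes f against - \<Psi>', hence g against
  \<Psi>; Fubini's theorem moves the integral over [0, h] from \<Psi> back to g, and
  \<open>fundamental_lemma\<close> removes \<psi>. The exceptional null set may depend on h, so the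
  increment is used only inside integrals over x.\<close>

lemma weak_derivative_increment:
  assumes f: "f \<in> S2" and g: "g \<in> S2" and w: "weak_derivative f g" and h: "0 < h"
  shows "AE x in lborel. f (x + h) - f x = (LINT r|lborel. indicat_real {0..h} r * g (x + r))"
proof -
  note [measurable] = S2_meas[OF f] S2_meas[OF g]
  define G where "G x = (LINT r|lborel. indicat_real {0..h} r * g (x + r))" for x
  have G1: "G x = (LINT r|lborel. indicat_real {0..h} r * g (x + 1 * r))" for x by (simp add: G_def)
  have [measurable]: "G \<in> borel_measurable borel" unfolding G_def[abs_def] by measurable
  have GS: "integrable lborel (\<lambda>x. G x * q x)"
    "(LINT x|lborel. G x * q x) = (LINT r|lborel. indicat_real {0..h} r * (LINT x|lborel. g (x + r) * q x))" if "q \<in> S2" for q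
    using S2_correlation_Fubini(1,3)[OF g that, of h 1] by (simp_all add: G_def)
  have "AE x in lborel. f (x + h) - f x - G x = 0"
  proof (rule fundamental_lemma)
    fix n :: nat
    have "integrable lborel (\<lambda>x. f (x + h) * indicat_real {- real n..real n} x)"
      "integrable lborel (\<lambda>x. f x * indicat_real {- real n..real n} x)"
      "integrable lborel (\<lambda>x. G x * indicat_real {- real n..real n} x)"
      using ind_Icc_S2 by (auto intro!: S2_mult S2_shift f GS)
    then have "integrable lborel (\<lambda>x. f (x + h) * indicat_real {- real n..real n} x - f x * indicat_real {- real n..real n} x - G x * indicat_real {- real n..real n} x)"
      by (intro Bochner_Integration.integrable_diff)
    then show "integrable lborel (\<lambda>x. indicat_real {- real n..real n} x * (f (x + h) - f x - G x))"
      by (simp add: algebra_simps)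
  next
    fix \<psi> assume \<psi>: "test_function \<psi>"
    have \<psi>2: "\<psi> \<in> S2" using \<psi> by (rule test_function_S2)
    obtain \<Psi> where \<Psi>: "test_function \<Psi>" "\<And>x. deriv \<Psi> x = \<psi> x - \<psi> (x - h)"
      "\<And>x. \<Psi> x = (LINT r|lborel. indicat_real {0..h} r * \<psi> (x + (-1) * r))"
      using test_function_shift_diff[OF \<psi> h] by metis
    have i: "integrable lborel (\<lambda>x. f (x + h) * \<psi> x)" "integrable lborel (\<lambda>x. f x * \<psi> x)"
      "integrable lborel (\<lambda>x. f x * \<psi> (x - h))"
      using S2_shift[OF \<psi>2, of "-h"] by (auto intro!: S2_mult S2_shift f \<psi>2)
    have "(LINT x|lborel. (f (x + h) - f x - G x) * \<psi> x)
        = (LINT x|lborel. f (x + h) * \<psi> x - f x * \<psi> x - G x * \<psi> x)"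
      by (simp add: algebra_simps)
    also have "\<dots> = (LINT x|lborel. f (x + h) * \<psi> x) - (LINT x|lborel. f x * \<psi> x) - (LINT x|lborel. G x * \<psi> x)"
      using i GS[OF \<psi>2] by simp
    also have "(LINT x|lborel. f (x + h) * \<psi> x) = (LINT x|lborel. f x * \<psi> (x - h))"
      using integral_lborel_shift[of "\<lambda>x. f x * \<psi> (x - h)" h] by simp
    also have "(LINT x|lborel. f x * \<psi> (x - h)) - (LINT x|lborel. f x * \<psi> x) = - (LINT x|lborel. f x * deriv \<Psi> x)"
      using i by (simp add: \<Psi>(2) right_diff_distrib)
    also have "\<dots> = (LINT x|lborel. g x * \<Psi> x)"
      using w \<Psi>(1) by (simp add: weak_derivative_def)
    also have "\<dots> = (LINT x|lborel. (LINT r|lborel. indicat_real {0..h} r * \<psi> (x + (-1) * r)) * g x)"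
      by (simp add: \<Psi>(3) mult.commute)
    also have "\<dots> = (LINT r|lborel. indicat_real {0..h} r * (LINT x|lborel. \<psi> (x + (-1) * r) * g x))"
      by (rule S2_correlation_Fubini(3)[OF \<psi>2 g])
    also have "\<dots> = (LINT r|lborel. indicat_real {0..h} r * (LINT x|lborel. g (x + r) * \<psi> x))"
    proof -
      have "(LINT x|lborel. \<psi> (x + (-1) * r) * g x) = (LINT x|lborel. g (x + r) * \<psi> x)" for r
        using integral_lborel_shift[of "\<lambda>x. \<psi> (x - r) * g x" r] by (simp add: mult.commute)
      then show ?thesis by simp
    qed
    also have "\<dots> - (LINT x|lborel. G x * \<psi> x) = 0" by (simp add: GS[OF \<psi>2])
    finally show "(LINT x|lborel. (f (x + h) - f x - G x) * \<psi> x) = 0" .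
  qed measurable
  then show ?thesis by (simp add: G_def)
qed

text \<open>The Cauchy-Schwarz inequality bounds the difference by the translation error of p in the
  square mean.\<close>

lemma S2_correlation_continuous:
  assumes p: "p \<in> S2" and q: "q \<in> S2"
  shows "((\<lambda>r. LINT x|lborel. p (x + r) * q x) \<longlongrightarrow> (LINT x|lborel. p x * q x)) (at 0)"
proof -
  note [measurable] = S2_meas[OF p]
  have "((\<lambda>r. norm (L2 (\<lambda>x. p (x + r) - p x))) \<longlongrightarrow> 0) (at 0)"
  proof -
    have "((\<lambda>r. \<integral>\<^sup>+x. nsq (p (x + r) - p x) \<partial>lborel) \<longlongrightarrow> 0) (at 0)"
      by (rule L2_translation_continuous) (use S2_nn_integral[OF p] in auto)
    then have "((\<lambda>r. nsq (L2 (\<lambda>x. p (x + r) - p x))) \<longlongrightarrow> ennreal 0) (at 0)"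
      by (subst L2_norm_nn) (auto intro!: S2_diff S2_shift p)
    then have "((\<lambda>r. (norm (L2 (\<lambda>x. p (x + r) - p x)))\<^sup>2) \<longlongrightarrow> 0) (at 0)"
      by (subst (asm) tendsto_ennreal_iff) auto
    from tendsto_real_sqrt[OF this] show ?thesis by simp
  qed
  then have lim: "((\<lambda>r. norm (L2 (\<lambda>x. p (x + r) - p x)) * norm (L2 q)) \<longlongrightarrow> 0) (at 0)"
    by (rule tendsto_mult_left_zero)
  have "((\<lambda>r. (LINT x|lborel. p (x + r) * q x) - (LINT x|lborel. p x * q x)) \<longlongrightarrow> 0) (at 0)"
  proof (rule Lim_null_comparison[OF _ lim])
    show "\<forall>\<^sub>F r in at 0. norm ((LINT x|lborel. p (x + r) * q x) - (LINT x|lborel. p x * q x))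
        \<le> norm (L2 (\<lambda>x. p (x + r) - p x)) * norm (L2 q)"
    proof (rule always_eventually, rule allI)
      fix r
      have "(LINT x|lborel. p (x + r) * q x) - (LINT x|lborel. p x * q x) = (LINT x|lborel. (p (x + r) - p x) * q x)"
        using S2_mult[OF S2_shift[OF p] q] S2_mult[OF p q] by (simp add: left_diff_distrib)
      also have "\<dots> = inner (L2 (\<lambda>x. p (x + r) - p x)) (L2 q)"
        by (simp add: L2_inner S2_diff S2_shift p q)
      finally show "norm ((LINT x|lborel. p (x + r) * q x) - (LINT x|lborel. p x * q x))
        \<le> norm (L2 (\<lambda>x. p (x + r) - p x)) * norm (L2 q)"
        using Cauchy_Schwarz_ineq2 by simp
    qed
  qed
  then show ?thesis by (rule LIM_zero_cancel)
qed

text \<open>Neither f nor u is a test function, so the definition of the weak derivative does not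
  apply directly. Increments of f paired with u equal, up to a shift, minus increments of u paired
  with f; expressed by g and k and averaged over an interval of length h, this becomes the claim as
  h tends to 0.\<close>

lemma weak_integration_by_parts:
  assumes f: "f \<in> S2" and g: "g \<in> S2" and u: "u \<in> S2" and k: "k \<in> S2"
    and fg: "weak_derivative f g" and uk: "weak_derivative u k"
  shows "(LINT x|lborel. f x * k x) = - (LINT x|lborel. g x * u x)"
proof -
  define A where "A r = (LINT x|lborel. g (x + r) * u x)" for r
  define C where "C r = (LINT x|lborel. k (x + r) * f x)" for r
  have lim: "(A \<longlongrightarrow> A 0) (at 0)" "(C \<longlongrightarrow> C 0) (at 0)"
    using S2_correlation_continuous[OF g u] S2_correlation_continuous[OF k f] by (simp_all add: A_def[abs_def] C_def[abs_def])
  \<comment> \<open>Summation by parts: a translation of the integral moves the difference from f to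
    u. What remains is f at x + h instead of x, and this shift turns \<open>C r\<close> into
    \<open>C (r - h)\<close>.\<close>
  have eq: "(LINT r|lborel. indicat_real {0..h} r * A r) = - (LINT r|lborel. indicat_real {0..h} r * C (r - h))"
    and int: "integrable lborel (\<lambda>r. indicat_real {0..h} r * A r)" "integrable lborel (\<lambda>r. indicat_real {0..h} r * C (r - h))"
    if h: "0 < h" for h
  proof -
    have fh: "(\<lambda>x. f (x + h)) \<in> S2" using f by (rule S2_shift)
    have Ch: "(LINT x|lborel. k (x + r) * f (x + h)) = C (r - h)" for r
      using integral_lborel_shift[of "\<lambda>x. k (x + r - h) * f x" h] by (simp add: C_def add_diff_eq)
    have i: "integrable lborel (\<lambda>x. f (x + h) * u (x + h))" "integrable lborel (\<lambda>x. f x * u x)" "integrable lborel (\<lambda>x. f (x + h) * u x)"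
      by (intro S2_mult S2_shift f u)+
    have "(LINT r|lborel. indicat_real {0..h} r * A r) = (LINT x|lborel. (LINT r|lborel. indicat_real {0..h} r * g (x + r)) * u x)"
      using S2_correlation_Fubini(3)[OF g u, of h 1] by (simp add: A_def)
    also have "\<dots> = (LINT x|lborel. (f (x + h) - f x) * u x)"
      by (rule integral_cong_AE) (use weak_derivative_increment[OF f g fg h] S2_meas f g u in \<open>auto simp: S2_def elim: eventually_mono\<close>)
    also have "\<dots> = (LINT x|lborel. f (x + h) * u x) - (LINT x|lborel. f x * u x)"
      using i by (simp add: left_diff_distrib)
    also have "(LINT x|lborel. f x * u x) = (LINT x|lborel. f (x + h) * u (x + h))"
      using integral_lborel_shift[of "\<lambda>x. f x * u x" h] by simp
    also have "(LINT x|lborel. f (x + h) * u x) - \<dots> = - (LINT x|lborel. (u (x + h) - u x) * f (x + h))"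
      using i by (simp add: right_diff_distrib mult.commute)
    also have "(LINT x|lborel. (u (x + h) - u x) * f (x + h)) = (LINT x|lborel. (LINT r|lborel. indicat_real {0..h} r * k (x + r)) * f (x + h))"
      by (rule integral_cong_AE) (use weak_derivative_increment[OF u k uk h] S2_meas f k u in \<open>auto simp: S2_def elim: eventually_mono\<close>)
    also have "\<dots> = (LINT r|lborel. indicat_real {0..h} r * C (r - h))"
      using S2_correlation_Fubini(3)[OF k fh, of h 1] by (simp add: Ch)
    finally show "(LINT r|lborel. indicat_real {0..h} r * A r) = - (LINT r|lborel. indicat_real {0..h} r * C (r - h))" .
    show "integrable lborel (\<lambda>r. indicat_real {0..h} r * A r)"
      using S2_correlation_Fubini(2)[OF g u, of h 1] by (simp add: A_def)
    show "integrable lborel (\<lambda>r. indicat_real {0..h} r * C (r - h))"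
      using S2_correlation_Fubini(2)[OF k fh, of h 1] by (simp add: Ch)
  qed
  have "\<bar>A 0 + C 0\<bar> \<le> 0"
  proof (rule field_le_epsilon)
    fix e :: real assume e: "0 < e"
    have "\<exists>d>0. \<forall>r. r \<noteq> 0 \<and> \<bar>r\<bar> < d \<longrightarrow> \<bar>A r - A 0\<bar> < e/2" "\<exists>d>0. \<forall>r. r \<noteq> 0 \<and> \<bar>r\<bar> < d \<longrightarrow> \<bar>C r - C 0\<bar> < e/2"
      using LIM_D[OF lim(1), of "e/2"] LIM_D[OF lim(2), of "e/2"] e by auto
    then obtain d1 d2 where d: "0 < d1" "0 < d2" "\<And>r. r \<noteq> 0 \<Longrightarrow> \<bar>r\<bar> < d1 \<Longrightarrow> \<bar>A r - A 0\<bar> < e/2"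
      "\<And>r. r \<noteq> 0 \<Longrightarrow> \<bar>r\<bar> < d2 \<Longrightarrow> \<bar>C r - C 0\<bar> < e/2" by blast
    \<comment> \<open>For r in [0, h], both r and r - h then stay within the moduli of continuity.
      The limits exclude 0 itself, so r = 0 and r = h are treated separately below.\<close>
    define h where "h = min d1 d2 / 2"
    have h: "0 < h" "h < d1" "h < d2" using d by (auto simp: h_def min_def)
    have b: "\<bar>A r - A 0\<bar> \<le> e/2" "\<bar>C (r - h) - C 0\<bar> \<le> e/2" if "r \<in> {0..h}" for r
      using that h d(3)[of r] d(4)[of "r - h"] e by (cases "r = 0"; cases "r = h"; force)+
    have ii: "integrable lborel (\<lambda>r. indicat_real {0..h} r * c)" for c
      by (intro integrable_mult_left integrable_real_indicator) (auto simp: emeasure_lborel_Icc_eq)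
    have "h * (A 0 + C 0) = (LINT r|lborel. indicat_real {0..h} r * (A 0 + C 0))"
      using h by simp
    also have "\<dots> = (LINT r|lborel. indicat_real {0..h} r * (A 0 + C 0)) - (LINT r|lborel. indicat_real {0..h} r * A r) - (LINT r|lborel. indicat_real {0..h} r * C (r - h))"
      using eq[OF h(1)] by simp
    also have "\<dots> = (LINT r|lborel. indicat_real {0..h} r * (A 0 + C 0) - indicat_real {0..h} r * A r - indicat_real {0..h} r * C (r - h))"
      using int[OF h(1)] ii by simp
    finally have "h * \<bar>A 0 + C 0\<bar> = \<bar>LINT r|lborel. indicat_real {0..h} r * (A 0 + C 0) - indicat_real {0..h} r * A r - indicat_real {0..h} r * C (r - h)\<bar>"
      using h by (metis abs_mult abs_of_pos)
    also have "\<dots> \<le> (LINT r|lborel. indicat_real {0..h} r * e)"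
    proof (rule integral_abs_bound_integral)
      show "integrable lborel (\<lambda>r. indicat_real {0..h} r * (A 0 + C 0) - indicat_real {0..h} r * A r - indicat_real {0..h} r * C (r - h))"
        using int[OF h(1)] ii by (intro Bochner_Integration.integrable_diff)
      show "\<bar>indicat_real {0..h} r * (A 0 + C 0) - indicat_real {0..h} r * A r - indicat_real {0..h} r * C (r - h)\<bar> \<le> indicat_real {0..h} r * e" for r
      proof (cases "r \<in> {0..h}")
        case True
        then have "\<bar>(A 0 + C 0) - A r - C (r - h)\<bar> \<le> e" using b[OF True] by arith
        then show ?thesis using True by simp
      qed simp
    qed (rule ii)
    also have "\<dots> = h * e" using h by simp
    finally show "\<bar>A 0 + C 0\<bar> \<le> 0 + e" using h by simp
  qed
  then show ?thesis by (simp add: A_def C_def mult.commute)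
qed

lemma S2_bounded_mult:
  assumes f: "f \<in> S2" and c[measurable]: "c \<in> borel_measurable borel" and b: "\<And>x. \<bar>c x\<bar> \<le> C"
  shows "(\<lambda>x. c x * f x) \<in> S2"
proof -
  note [measurable] = S2_meas[OF f]
  have "integrable lborel (\<lambda>x. (c x * f x)\<^sup>2)"
  proof (rule Bochner_Integration.integrable_bound)
    show "integrable lborel (\<lambda>x. C\<^sup>2 * (f x)\<^sup>2)" by (intro integrable_mult_right S2_int f)
    show "AE x in lborel. norm ((c x * f x)\<^sup>2) \<le> norm (C\<^sup>2 * (f x)\<^sup>2)"
    proof (rule AE_I2)
      fix x
      have "\<bar>c x\<bar> \<le> \<bar>C\<bar>" using b[of x] by linarith
      then have "(c x)\<^sup>2 \<le> C\<^sup>2" by (simp add: abs_le_square_iff)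
      then show "norm ((c x * f x)\<^sup>2) \<le> norm (C\<^sup>2 * (f x)\<^sup>2)"
        by (simp add: power_mult_distrib mult_right_mono)
    qed
  qed measurable
  then show ?thesis by (simp add: S2_def)
qed

lemma sq_int_eq_S2:
  assumes [measurable]: "\<rho> \<in> borel_measurable borel" and l: "0 < l" and b: "\<And>x. l \<le> \<rho> x \<and> \<rho> x \<le> u"
  shows "sq_int \<rho> = S2"
proof -
  have p: "0 < \<rho> x" for x using b[of x] l by linarith
  have "integrable lborel (\<lambda>x. (f x)\<^sup>2 / \<rho> x) = integrable lborel (\<lambda>x. (f x)\<^sup>2)"
    if [measurable]: "f \<in> borel_measurable borel" for f
  proof
    assume *: "integrable lborel (\<lambda>x. (f x)\<^sup>2 / \<rho> x)"
    show "integrable lborel (\<lambda>x. (f x)\<^sup>2)"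
    proof (rule Bochner_Integration.integrable_bound[OF integrable_mult_right[OF *, of u]])
      show "AE x in lborel. norm ((f x)\<^sup>2) \<le> norm (u * ((f x)\<^sup>2 / \<rho> x))"
      proof (rule AE_I2)
        fix x
        have "(f x)\<^sup>2 * \<rho> x \<le> (f x)\<^sup>2 * u" using b[of x] by (intro mult_left_mono) auto
        then have "(f x)\<^sup>2 \<le> u * ((f x)\<^sup>2 / \<rho> x)" using p[of x] by (simp add: field_simps)
        then show "norm ((f x)\<^sup>2) \<le> norm (u * ((f x)\<^sup>2 / \<rho> x))"
          unfolding real_norm_def using abs_ge_self order_trans abs_of_nonneg zero_le_power2 by metis
      qed
    qed measurable
  next
    assume *: "integrable lborel (\<lambda>x. (f x)\<^sup>2)"
    show "integrable lborel (\<lambda>x. (f x)\<^sup>2 / \<rho> x)"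
    proof (rule Bochner_Integration.integrable_bound[OF integrable_mult_right[OF *, of "1/l"]])
      show "AE x in lborel. norm ((f x)\<^sup>2 / \<rho> x) \<le> norm (1 / l * (f x)\<^sup>2)"
      proof (rule AE_I2)
        fix x
        have "(f x)\<^sup>2 / \<rho> x \<le> (f x)\<^sup>2 / l" using b[of x] l by (intro divide_left_mono) auto
        then show "norm ((f x)\<^sup>2 / \<rho> x) \<le> norm (1 / l * (f x)\<^sup>2)" using p[of x] l by simp
      qed
    qed measurable
  qed
  then show ?thesis by (auto simp: sq_int_def S2_def)
qed

text \<open>The weight 1 / \<rho> of the inner product cancels the factor \<rho> in front of the
  second-order part, so integration by parts leaves minus half the integral of a d^2, at most - l /
  2 times that of d^2. The drift, bounded by u / l |d| |\<phi>|, is absorbed at the cost of u^2 / (2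
  l^3) \<phi>^2; one more factor u comes from the passage to the weighted norm.\<close>

lemma div_form_quasi_dissipative:
  fixes cls :: "(real \<Rightarrow> real) \<Rightarrow> 'h::real_inner"
  assumes H: "is_L2_space \<rho> cls"
    and [measurable]: "\<rho> \<in> borel_measurable borel" "a \<in> borel_measurable borel" "b \<in> borel_measurable borel"
    and l: "0 < l"
    and bnd: "\<And>x. l \<le> \<rho> x \<and> \<rho> x \<le> u" "\<And>x. l \<le> a x \<and> a x \<le> u" "\<And>x. \<bar>b x\<bar> \<le> u"
    and hv: "(h, v) \<in> div_form_graph \<rho> a b cls"
  shows "inner v h \<le> u ^ 3 / (2 * l ^ 3) * (norm h)\<^sup>2"
proof -
  have SQ: "sq_int \<rho> = S2" by (rule sq_int_eq_S2[OF _ l bnd(1)]) simp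
  have p: "0 < \<rho> x" for x using bnd(1)[of x] l by linarith
  have lu: "l \<le> u" using bnd(1)[of 0] by linarith
  obtain \<phi> d q where h: "h = cls \<phi>" and v: "v = cls (\<lambda>x. \<rho> x / 2 * q x + b x * d x)"
    and S: "\<phi> \<in> S2" "d \<in> S2" "q \<in> S2" and w: "weak_derivative \<phi> d" "weak_derivative (\<lambda>x. a x * d x) q"
    using hv unfolding div_form_graph_def SQ by auto
  note [measurable] = S2_meas[OF S(1)] S2_meas[OF S(2)] S2_meas[OF S(3)]
  have "(\<lambda>x. \<rho> x / 2 * q x) \<in> S2"
  proof (rule S2_bounded_mult[OF S(3), where C = u])
    show "\<bar>\<rho> x / 2\<bar> \<le> u" for x using bnd(1)[of x] p[of x] by linarith
  qed measurable
  moreover have bd: "(\<lambda>x. b x * d x) \<in> S2"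
    by (rule S2_bounded_mult[OF S(2) _ bnd(3)]) simp
  ultimately have vS: "(\<lambda>x. \<rho> x / 2 * q x + b x * d x) \<in> S2" by (rule S2_add)
  have ad: "(\<lambda>x. a x * d x) \<in> S2"
  proof (rule S2_bounded_mult[OF S(2), where C = u])
    show "\<bar>a x\<bar> \<le> u" for x using bnd(2)[of x] l by linarith
  qed measurable
  have "(\<lambda>x. (1 / \<rho> x) * (b x * d x)) \<in> S2"
    by (rule S2_bounded_mult[OF bd, where C = "1/l"]) (use bnd(1) p l in \<open>auto intro!: frac_le simp: abs_of_pos\<close>)
  from S2_mult[OF this S(1)] have i2: "integrable lborel (\<lambda>x. b x * d x * \<phi> x / \<rho> x)" by simp
  note i1 = S2_mult[OF S(1,3)]
  note i3 = S2_mult[OF S(2) ad]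
  have "inner v h = (LINT x|lborel. (\<rho> x / 2 * q x + b x * d x) * \<phi> x / \<rho> x)"
    using H vS S unfolding is_L2_space_def h v SQ by blast
  also have "\<dots> = (LINT x|lborel. (\<phi> x * q x) / 2 + b x * d x * \<phi> x / \<rho> x)"
    using p by (intro Bochner_Integration.integral_cong) (auto simp: field_simps order_less_imp_not_eq2)
  also have "\<dots> = (LINT x|lborel. \<phi> x * q x) / 2 + (LINT x|lborel. b x * d x * \<phi> x / \<rho> x)"
    using i1 i2 by simp
  also have "(LINT x|lborel. \<phi> x * q x) = - (LINT x|lborel. d x * (a x * d x))"
    by (rule weak_integration_by_parts[OF S(1,2) ad S(3) w])
  also have "- (LINT x|lborel. d x * (a x * d x)) / 2 + (LINT x|lborel. b x * d x * \<phi> x / \<rho> x)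
     = (LINT x|lborel. - (d x * (a x * d x)) / 2 + b x * d x * \<phi> x / \<rho> x)"
    using i3 i2 by simp
  also have "\<dots> \<le> (LINT x|lborel. u\<^sup>2 / (2 * l ^ 3) * (\<phi> x)\<^sup>2)"
  proof (rule integral_mono)
    show "integrable lborel (\<lambda>x. - (d x * (a x * d x)) / 2 + b x * d x * \<phi> x / \<rho> x)"
      using i3 i2 by (intro Bochner_Integration.integrable_add integrable_divide integrable_minus) auto
    show "integrable lborel (\<lambda>x. u\<^sup>2 / (2 * l ^ 3) * (\<phi> x)\<^sup>2)"
      by (intro integrable_mult_right S2_int S)
    fix x
    have 1: "l * (d x)\<^sup>2 \<le> d x * (a x * d x)"
      using bnd(2)[of x] mult_right_mono[of l "a x" "(d x)\<^sup>2"] by (simp add: power2_eq_square algebra_simps)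
    have "b x * d x * \<phi> x / \<rho> x \<le> \<bar>b x\<bar> * \<bar>d x\<bar> * \<bar>\<phi> x\<bar> / \<rho> x"
      using p[of x] by (intro divide_right_mono) (auto simp flip: abs_mult)
    also have "\<dots> \<le> u * \<bar>d x\<bar> * \<bar>\<phi> x\<bar> / l"
      using bnd(1,3)[of x] l lu by (intro frac_le mult_mono) auto
    also have "\<dots> = \<bar>d x\<bar> * (u / l * \<bar>\<phi> x\<bar>)" by simp
    \<comment> \<open>Young's inequality, weighted so that the term in d is exactly what the
      second-order part can absorb.\<close>
    also have "\<dots> \<le> l / 2 * (d x)\<^sup>2 + (u / l * \<bar>\<phi> x\<bar>)\<^sup>2 / (2 * l)"
    proof -
      define r where "r = u / l * \<bar>\<phi> x\<bar>"
      have "0 \<le> (l * \<bar>d x\<bar> - r)\<^sup>2" by simp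
      then have "2 * l * (\<bar>d x\<bar> * r) \<le> l\<^sup>2 * (d x)\<^sup>2 + r\<^sup>2"
        by (simp add: power2_eq_square algebra_simps)
      then have "\<bar>d x\<bar> * r \<le> (l\<^sup>2 * (d x)\<^sup>2 + r\<^sup>2) / (2 * l)"
        using l by (simp add: field_simps)
      also have "\<dots> = l / 2 * (d x)\<^sup>2 + r\<^sup>2 / (2 * l)"
        using l by (simp add: field_simps power2_eq_square)
      finally show ?thesis by (simp add: r_def)
    qed
    also have "(u / l * \<bar>\<phi> x\<bar>)\<^sup>2 / (2 * l) = u\<^sup>2 / (2 * l ^ 3) * (\<phi> x)\<^sup>2"
    proof -
      have "(u / l * \<bar>\<phi> x\<bar>)\<^sup>2 = u\<^sup>2 * (\<phi> x)\<^sup>2 / l\<^sup>2"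
        by (simp add: power_mult_distrib power_divide)
      then show ?thesis by (simp add: power2_eq_square power3_eq_cube mult_ac)
    qed
    finally show "- (d x * (a x * d x)) / 2 + b x * d x * \<phi> x / \<rho> x \<le> u\<^sup>2 / (2 * l ^ 3) * (\<phi> x)\<^sup>2"
      using 1 by linarith
  qed
  also have "\<dots> = u\<^sup>2 / (2 * l ^ 3) * (LINT x|lborel. (\<phi> x)\<^sup>2)" by simp
  also have "\<dots> \<le> u\<^sup>2 / (2 * l ^ 3) * (u * (norm h)\<^sup>2)"
  proof (rule mult_left_mono)
    have "(norm h)\<^sup>2 = (LINT x|lborel. \<phi> x * \<phi> x / \<rho> x)"
      using H S(1) unfolding is_L2_space_def h SQ power2_norm_eq_inner by blast
    then have nh: "(norm h)\<^sup>2 = (LINT x|lborel. (\<phi> x)\<^sup>2 / \<rho> x)" by (simp add: power2_eq_square)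
    have ii: "integrable lborel (\<lambda>x. (\<phi> x)\<^sup>2 / \<rho> x)" using S(1) SQ by (auto simp: sq_int_def)
    have "(LINT x|lborel. (\<phi> x)\<^sup>2) \<le> (LINT x|lborel. u * ((\<phi> x)\<^sup>2 / \<rho> x))"
    proof (rule integral_mono[OF S2_int[OF S(1)] integrable_mult_right[OF ii]])
      fix x
      have "(\<phi> x)\<^sup>2 * \<rho> x \<le> (\<phi> x)\<^sup>2 * u" using bnd(1)[of x] by (intro mult_left_mono) auto
      then show "(\<phi> x)\<^sup>2 \<le> u * ((\<phi> x)\<^sup>2 / \<rho> x)" using p[of x] by (simp add: field_simps)
    qed
    also have "\<dots> = u * (LINT x|lborel. (\<phi> x)\<^sup>2 / \<rho> x)" by (rule integral_mult_right_zero)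
    finally have "(LINT x|lborel. (\<phi> x)\<^sup>2) \<le> u * (LINT x|lborel. (\<phi> x)\<^sup>2 / \<rho> x)" .
    then show "(LINT x|lborel. (\<phi> x)\<^sup>2) \<le> u * (norm h)\<^sup>2" by (simp only: nh)
  qed (use l in simp)
  also have "\<dots> = u ^ 3 / (2 * l ^ 3) * (norm h)\<^sup>2" by (simp add: power2_eq_square power3_eq_cube)
  finally show ?thesis .
qed

subsection \<open>Strongly continuous semigroups\<close>

text \<open>By Baire's theorem some \<open>C k\<close> contains a ball. A small vector z is the
  difference of two points of this ball, which gives the factor 2 in the bound 2 k / r.\<close>

lemma uniform_boundedness:
  fixes f :: "nat \<Rightarrow> 'a::banach \<Rightarrow> 'b::real_normed_vector"
  assumes lin: "\<And>n. bounded_linear (f n)" and pw: "\<And>x. \<exists>K. \<forall>n. norm (f n x) \<le> K"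
  shows "\<exists>K. \<forall>n x. norm (f n x) \<le> K * norm x"
proof -
  define C where "C k = {x. \<forall>n. norm (f n x) \<le> real k}" for k :: nat
  have cont: "continuous_on UNIV (\<lambda>x. norm (f n x))" for n
    by (intro continuous_on_norm linear_continuous_on lin)
  have closed: "closed (C k)" for k
  proof -
    have "C k = (\<Inter>n. {x. norm (f n x) \<le> real k})" by (auto simp: C_def)
    moreover have "closed {x. norm (f n x) \<le> real k}" for n
      by (intro closed_Collect_le cont) auto
    ultimately show ?thesis by auto
  qed
  have UN: "(\<Union>k. C k) = UNIV"
  proof -
    have "\<exists>k. x \<in> C k" for x
    proof -
      obtain K where "\<And>n. norm (f n x) \<le> K" using pw by blast
      moreover obtain k where "K \<le> real k" using real_arch_simple by blast
      ultimately show ?thesis by (auto simp: C_def intro: order_trans)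
    qed
    then show ?thesis by auto
  qed
  have "\<exists>k. interior (C k) \<noteq> {}"
  proof (rule ccontr)
    assume "\<nexists>k. interior (C k) \<noteq> {}"
    then have "euclidean interior_of \<Union>(range C) = {}"
      by (intro Baire_category_alt) (auto simp: completely_metrizable_space_euclidean closed)
    then show False using UN by simp
  qed
  then obtain k x where "x \<in> interior (C k)" by auto
  then obtain r where r: "0 < r" "cball x r \<subseteq> C k"
    by (meson mem_interior_cball)
  have "norm (f n y) \<le> 2 * real k / r * norm y" for n y
  proof (cases "y = 0")
    case True
    then show ?thesis using linear_0[OF bounded_linear.linear[OF lin]] by simp
  next
    case False
    define z where "z = (r / norm y) *\<^sub>R y"
    have "x + z \<in> C k" "x \<in> C k" using r False by (auto simp: z_def dist_norm subset_iff)
    then have "norm (f n (x + z)) \<le> real k" "norm (f n x) \<le> real k" by (auto simp: C_def)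
    moreover have "f n z = f n (x + z) - f n x"
      using bounded_linear.linear[OF lin[of n]] by (simp add: linear_add)
    ultimately have "norm (f n z) \<le> 2 * real k"
      using norm_triangle_ineq4[of "f n (x + z)" "f n x"] by simp
    moreover have "norm (f n z) = r / norm y * norm (f n y)"
      using bounded_linear.linear[OF lin[of n]] r by (simp add: z_def linear_scale)
    ultimately show ?thesis using r False by (simp add: field_simps)
  qed
  then show ?thesis by blast
qed

text \<open>The generator provides derivatives from the right only, so the mean value theorem does
  not apply. After subtraction of a small slope e, the set of times up to which g stays below its
  initial value is closed under limits from the left and can be extended to the right, hence reaches
  b.\<close>

lemma nonincreasing_if_right_derivative_nonpos:
  fixes f :: "real \<Rightarrow> real"
  assumes ab: "a \<le> b" and cont: "continuous_on {a..b} f"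
    and D: "\<And>t. a \<le> t \<Longrightarrow> t < b \<Longrightarrow> \<exists>d\<le>0. (f has_real_derivative d) (at_right t)"
  shows "f b \<le> f a"
proof (rule field_le_epsilon)
  fix e0 :: real assume "0 < e0"
  define e where "e = e0 / (b - a + 1)"
  have e: "0 < e" using \<open>0 < e0\<close> ab by (simp add: e_def)
  define g where "g t = f t - e * (t - a)" for t
  have gcont: "continuous_on {a..b} g" unfolding g_def by (intro continuous_intros cont)
  define S where "S = {t \<in> {a..b}. \<forall>s\<in>{a..t}. g s \<le> g a}"
  have aS: "a \<in> S" using ab by (auto simp: S_def)
  have bdd: "bdd_above S" by (rule bdd_aboveI[of _ b]) (auto simp: S_def)
  define c where "c = Sup S"
  have c: "a \<le> c" unfolding c_def by (rule cSup_upper[OF aS bdd])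
  have c': "c \<le> b" unfolding c_def by (rule cSup_least) (use aS in \<open>auto simp: S_def\<close>)
  note c = c c'
  have below: "g s \<le> g a" if s: "a \<le> s" "s < c" for s
  proof -
    obtain t where "t \<in> S" "s < t" using less_cSup_iff[of S s] aS bdd s(2) unfolding c_def by blast
    then show ?thesis using s by (auto simp: S_def)
  qed
  have gc: "g c \<le> g a"
  proof (cases "a = c")
    case False
    then have ac: "a < c" using c by simp
    have "continuous (at c within {a..b}) g" using gcont c by (auto simp: continuous_on_eq_continuous_within)
    then have "(g \<longlongrightarrow> g c) (at c within {a..b})" by (simp add: continuous_within)
    then have "(g \<longlongrightarrow> g c) (at c within {a..c})"
      by (rule tendsto_within_subset) (use c in auto)
    then have "(g \<longlongrightarrow> g c) (at_left c)"
      using ac by (simp add: at_within_Icc_at_left)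
    moreover have "\<forall>\<^sub>F x in at_left c. g x \<le> g a"
      using eventually_at_left_real[OF ac] by eventually_elim (use below in auto)
    ultimately show ?thesis by (rule tendsto_upperbound) simp
  qed simp
  have "c = b"
  proof (rule ccontr)
    assume "c \<noteq> b"
    then have cb: "c < b" using c by simp
    obtain d where d: "d \<le> 0" "(f has_real_derivative d) (at_right c)" using D[OF c(1) cb] by auto
    have "((\<lambda>y. (f y - f c) / (y - c)) \<longlongrightarrow> d) (at_right c)"
      using d(2) by (simp add: has_field_derivative_iff)
    then have "\<forall>\<^sub>F y in at_right c. (f y - f c) / (y - c) < e"
      by (rule order_tendstoD(2)) (use d e in linarith)
    then obtain h where h: "c < h" "\<And>y. c < y \<Longrightarrow> y < h \<Longrightarrow> (f y - f c) / (y - c) < e"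
      by (auto simp: eventually_at_right_field)
    define m where "m = min ((c + h) / 2) b"
    have m: "c < m" "m < h" "m \<le> b" using h cb by (auto simp: m_def min_def)
    have "m \<in> S"
      unfolding S_def
    proof (intro CollectI conjI ballI)
      show "m \<in> {a..b}" using m c by auto
      fix s assume s: "s \<in> {a..m}"
      show "g s \<le> g a"
      proof (cases "s \<le> c")
        case True
        then show ?thesis using below[of s] gc s by (cases "s = c") auto
      next
        case False
        then have "f s - f c < e * (s - c)" using h(2)[of s] s m by (simp add: pos_divide_less_eq)
        then have "g s \<le> g c" by (simp add: g_def algebra_simps)
        then show ?thesis using gc by simp
      qed
    qed
    then show False using cSup_upper[OF _ bdd, of m] m by (simp add: c_def)
  qed
  then have "f b \<le> f a + e * (b - a)" using gc by (simp add: g_def)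
  also have "e * (b - a) \<le> e0"
  proof -
    have "e * (b - a) \<le> e * (b - a + 1)" using e by simp
    also have "\<dots> = e0" unfolding e_def using ab by simp
    finally show ?thesis .
  qed
  finally show "f b \<le> f a + e0" by simp
qed

lemma has_vector_derivative_at_right_iff:
  fixes f :: "real \<Rightarrow> 'a::real_normed_vector"
  shows "(f has_vector_derivative D) (at_right t) \<longleftrightarrow> ((\<lambda>h. (1 / h) *\<^sub>R (f (t + h) - f t)) \<longlongrightarrow> D) (at_right 0)"
proof -
  have e: "norm (f y - f t - (y - t) *\<^sub>R D) / norm (y - t) = norm ((1 / (y - t)) *\<^sub>R (f y - f t) - D)" if "y \<noteq> t" for y
  proof -
    have "f y - f t - (y - t) *\<^sub>R D = (y - t) *\<^sub>R ((1 / (y - t)) *\<^sub>R (f y - f t) - D)"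
      using that by (simp add: algebra_simps)
    then show ?thesis using that by simp
  qed
  have "(f has_vector_derivative D) (at_right t)
    \<longleftrightarrow> ((\<lambda>y. norm (f y - f t - (y - t) *\<^sub>R D) / norm (y - t)) \<longlongrightarrow> 0) (at_right t)"
    by (simp add: has_vector_derivative_def has_derivative_iff_norm bounded_linear_scaleR_left)
  also have "\<dots> \<longleftrightarrow> ((\<lambda>y. norm ((1 / (y - t)) *\<^sub>R (f y - f t) - D)) \<longlongrightarrow> 0) (at_right t)"
    by (rule filterlim_cong[OF refl refl], unfold eventually_at_filter, rule always_eventually)
      (intro allI impI e)
  also have "\<dots> \<longleftrightarrow> ((\<lambda>y. (1 / (y - t)) *\<^sub>R (f y - f t)) \<longlongrightarrow> D) (at_right t)"
    by (simp add: tendsto_norm_zero_iff LIM_zero_iff)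
  also have "\<dots> \<longleftrightarrow> ((\<lambda>h. (1 / h) *\<^sub>R (f (t + h) - f t)) \<longlongrightarrow> D) (at_right 0)"
    by (subst at_right_to_0) (simp add: filterlim_filtermap add.commute)
  finally show ?thesis .
qed

context
  fixes P :: "real \<Rightarrow> 'h \<Rightarrow> 'h::{real_inner, banach}"
  assumes P: "C0_semigroup P"
begin

lemma C0D: "0 \<le> t \<Longrightarrow> bounded_linear (P t)" "P 0 u = u"
  "0 \<le> s \<Longrightarrow> 0 \<le> t \<Longrightarrow> P (s + t) u = P s (P t u)"
  "((\<lambda>t. P t u) \<longlongrightarrow> u) (at_right 0)"
  using P by (auto simp: C0_semigroup_def)

lemma C0_diff: "0 \<le> t \<Longrightarrow> P t (u - v) = P t u - P t v"
  using linear_diff[OF bounded_linear.linear[OF C0D(1)]] by simp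

lemma C0_right: 
  assumes "0 < e"
  obtains d where "0 < d" "\<And>h. 0 \<le> h \<Longrightarrow> h < d \<Longrightarrow> norm (P h u - u) < e"
proof -
  have "\<forall>\<^sub>F t in at_right 0. dist (P t u) u < e" using C0D(4) assms by (rule tendstoD)
  then obtain d where "0 < d" "\<And>h. 0 < h \<Longrightarrow> h < d \<Longrightarrow> norm (P h u - u) < e"
    by (auto simp: eventually_at_right_field dist_norm)
  then have "norm (P h u - u) < e" if "0 \<le> h" "h < d" for h
    using that C0D(2)[of u] assms by (cases "h = 0") auto
  with \<open>0 < d\<close> show ?thesis by (rule that)
qed

text \<open>Otherwise there are times t n tending to 0 at which the operator norms exceed n. But P
  (t n) x tends to x for every x, so these operators are pointwise and hence uniformly
  bounded.\<close>

lemma C0_local_bound: "\<exists>K \<delta>. 0 < \<delta> \<and> 0 \<le> K \<and> (\<forall>t\<in>{0..\<delta>}. \<forall>u. norm (P t u) \<le> K * norm u)"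
proof (rule ccontr)
  assume *: "\<not> ?thesis"
  have "\<exists>t u. t \<in> {0..1 / real (Suc n)} \<and> norm (P t u) > real n * norm u" for n
  proof -
    have "0 < 1 / real (Suc n)" "0 \<le> real n" by auto
    with * show ?thesis by (meson not_le)
  qed
  then obtain t u where t: "\<And>n. t n \<in> {0..1 / real (Suc n)}" "\<And>n. norm (P (t n) (u n)) > real n * norm (u n)"
    by metis
  have "\<exists>K. \<forall>n x. norm (P (t n) x) \<le> K * norm x"
  proof (rule uniform_boundedness)
    show "bounded_linear (P (t n))" for n using t(1)[of n] by (intro C0D) auto
    fix x
    have "(\<lambda>n. P (t n) x) \<longlonglongrightarrow> x"
    proof (rule LIMSEQ_I)
      fix r :: real assume "0 < r"
      then obtain d where d: "0 < d" "\<And>h. 0 \<le> h \<Longrightarrow> h < d \<Longrightarrow> norm (P h x - x) < r" by (metis C0_right)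
      obtain N where N: "inverse (real (Suc N)) < d" using reals_Archimedean[OF d(1)] by auto
      show "\<exists>no. \<forall>n\<ge>no. norm (P (t n) x - x) < r"
      proof (intro exI[of _ N] allI impI d(2))
        fix n assume "N \<le> n"
        then have "1 / real (Suc n) \<le> inverse (real (Suc N))" by (simp add: field_simps)
        then show "0 \<le> t n" "t n < d" using t(1)[of n] N by auto
      qed
    qed
    then have "Bseq (\<lambda>n. P (t n) x)" by (intro convergent_imp_Bseq convergentI)
    then show "\<exists>K. \<forall>n. norm (P (t n) x) \<le> K" by (auto simp: Bseq_def)
  qed
  then obtain K where K: "\<And>n x. norm (P (t n) x) \<le> K * norm x" by blast
  obtain n where "K \<le> real n" using real_arch_simple by blast
  then have "norm (P (t n) (u n)) \<le> real n * norm (u n)"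
    using K[of n "u n"] by (meson mult_right_mono norm_ge_zero order_trans)
  then show False using t(2)[of n] by simp
qed

lemma C0_bound: "\<exists>K\<ge>0. \<forall>t\<in>{0..N}. \<forall>u. norm (P t u) \<le> K * norm u"
proof -
  obtain K \<delta> where K: "0 < \<delta>" "0 \<le> K" "\<And>t u. 0 \<le> t \<Longrightarrow> t \<le> \<delta> \<Longrightarrow> norm (P t u) \<le> K * norm u"
    using C0_local_bound by auto
  have "\<exists>C\<ge>0. \<forall>t\<in>{0..real n * \<delta>}. \<forall>u. norm (P t u) \<le> C * norm u" for n
  proof (induction n)
    case 0
    then show ?case by (auto intro!: exI[of _ 1] simp: C0D)
  next
    case (Suc n)
    then obtain C where C: "0 \<le> C" "\<And>t u. 0 \<le> t \<Longrightarrow> t \<le> real n * \<delta> \<Longrightarrow> norm (P t u) \<le> C * norm u" by auto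
    have "norm (P t u) \<le> max C (K * C) * norm u" if t: "0 \<le> t" "t \<le> real (Suc n) * \<delta>" for t u
    proof (cases "t \<le> real n * \<delta>")
      case True
      then have "norm (P t u) \<le> C * norm u" using C t by simp
      then show ?thesis by (meson max.cobounded1 mult_right_mono norm_ge_zero order_trans)
    next
      case False
      have "P t u = P (t - real n * \<delta>) (P (real n * \<delta>) u)"
        using C0D(3)[of "t - real n * \<delta>" "real n * \<delta>" u] False K by simp
      also have "norm \<dots> \<le> K * norm (P (real n * \<delta>) u)"
        by (rule K) (use False t in \<open>auto simp: algebra_simps\<close>)
      also have "\<dots> \<le> K * (C * norm u)" by (intro mult_left_mono C K) (use K in auto)
      also have "\<dots> \<le> max C (K * C) * norm u"
        using mult_right_mono[of "K * C" "max C (K * C)" "norm u"] by (simp add: mult.assoc)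
      finally show ?thesis .
    qed
    then show ?case using C by (intro exI[of _ "max C (K * C)"]) auto
  qed
  then obtain C where C: "\<And>n. 0 \<le> C n" "\<And>n t u. t \<in> {0..real n * \<delta>} \<Longrightarrow> norm (P t u) \<le> C n * norm u"
    by metis
  obtain n where "N / \<delta> \<le> real n" using real_arch_simple by blast
  then have "N \<le> real n * \<delta>" using K(1) by (simp add: pos_divide_le_eq)
  then show ?thesis using C by (intro exI[of _ "C n"]) auto
qed

lemma C0_continuous_on: "continuous_on {0..} (\<lambda>t. P t u)"
  unfolding continuous_on_iff
proof (intro ballI allI impI)
  fix t e :: real assume t: "t \<in> {0..}" and e: "0 < e"
  obtain K where K: "0 \<le> K" "\<And>s u. 0 \<le> s \<Longrightarrow> s \<le> t + 1 \<Longrightarrow> norm (P s u) \<le> K * norm u"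
    using C0_bound[of "t + 1"] by auto
  obtain d where d: "0 < d" "\<And>h. 0 \<le> h \<Longrightarrow> h < d \<Longrightarrow> norm (P h u - u) < e / (K + 1)"
    using C0_right[of "e / (K + 1)" u] e K by auto
  \<comment> \<open>Continuity from both sides at once: the operator of the smaller time is factored
    out, and its norm is bounded uniformly on [0, t + 1].\<close>
  have key: "norm (P s' u - P s u) < e" if "0 \<le> s" "s \<le> s'" "s' \<le> t + 1" "s' - s < d" for s s'
  proof -
    have "P s' u - P s u = P s (P (s' - s) u - u)"
      using C0D(3)[of s "s' - s" u] that by (simp add: C0_diff)
    also have "norm \<dots> \<le> K * norm (P (s' - s) u - u)" by (rule K) (use that in auto)
    also have "\<dots> \<le> (K + 1) * norm (P (s' - s) u - u)" by (intro mult_right_mono) auto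
    also have "\<dots> < (K + 1) * (e / (K + 1))"
      by (intro mult_strict_left_mono d) (use that K in auto)
    also have "\<dots> = e" using K by simp
    finally show ?thesis .
  qed
  show "\<exists>d>0. \<forall>x'\<in>{0..}. dist x' t < d \<longrightarrow> dist (P x' u) (P t u) < e"
  proof (intro exI[of _ "min d 1"] conjI ballI impI)
    fix s assume s: "s \<in> {0..}" "dist s t < min d 1"
    show "dist (P s u) (P t u) < e"
    proof (cases "s \<le> t")
      case True
      then show ?thesis using key[of s t] s t by (simp add: dist_norm norm_minus_commute)
    next
      case False
      then show ?thesis using key[of t s] s t by (simp add: dist_norm)
    qed
  qed (use d in auto)
qed

text \<open>The bounded operator \<open>P t\<close> passes through the limit of the difference
  quotient. Writing P (t + h) as P t P h or as P h P t gives the right derivative and the invariance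
  of the domain.\<close>

lemma generator_semigroup:
  assumes uv: "(u, v) \<in> generator_graph P" and t: "0 \<le> t"
  shows "(P t u, P t v) \<in> generator_graph P"
    "((\<lambda>s. P s u) has_vector_derivative P t v) (at_right t)"
proof -
  have l: "((\<lambda>h. P t ((1 / h) *\<^sub>R (P h u - u))) \<longlongrightarrow> P t v) (at_right 0)"
    by (rule bounded_linear.tendsto[OF C0D(1)[OF t]]) (use uv in \<open>simp add: generator_graph_def\<close>)
  have e: "\<forall>\<^sub>F h in at_right 0. P t ((1 / h) *\<^sub>R (P h u - u)) = (1 / h) *\<^sub>R (P (t + h) u - P t u)"
    unfolding eventually_at_filter
    by (rule always_eventually) (use t in \<open>auto simp: linear_scale[OF bounded_linear.linear[OF C0D(1)]] C0_diff C0D(3)\<close>)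
  have l2: "((\<lambda>h. (1 / h) *\<^sub>R (P (t + h) u - P t u)) \<longlongrightarrow> P t v) (at_right 0)"
    using l e by (rule Lim_transform_eventually)
  have "\<forall>\<^sub>F h in at_right 0. (1 / h) *\<^sub>R (P (t + h) u - P t u) = (1 / h) *\<^sub>R (P h (P t u) - P t u)"
    unfolding eventually_at_filter
    by (rule always_eventually) (use t C0D(3)[of _ t u] in \<open>auto simp: add.commute\<close>)
  from Lim_transform_eventually[OF l2 this]
  show "(P t u, P t v) \<in> generator_graph P" by (simp add: generator_graph_def)
  show "((\<lambda>s. P s u) has_vector_derivative P t v) (at_right t)"
    unfolding has_vector_derivative_at_right_iff by (rule l2)
qed

text \<open>The averages (1 / h) \<open>I h\<close> of the orbit of u belong to the domain and tend
  to u as h tends to 0.\<close>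

lemma generator_domain_dense: "closure (Domain (generator_graph P)) = UNIV"
proof -
  have "u \<in> closure (Domain (generator_graph P))" for u
  proof -
    define I where "I t = integral {0..t} (\<lambda>s. P s u)" for t
    have cont: "continuous_on {a..b} (\<lambda>s. P s u)" if "0 \<le> a" for a b
      by (rule continuous_on_subset[OF C0_continuous_on]) (use that in auto)
    have int: "(\<lambda>s. P s u) integrable_on {a..b}" if "0 \<le> a" for a b
      by (intro integrable_continuous_real cont that)
    have D: "((\<lambda>h. (1 / h) *\<^sub>R (I (t + h) - I t)) \<longlongrightarrow> P t u) (at_right 0)" if t: "0 \<le> t" for t
    proof -
      have "(I has_vector_derivative P t u) (at t within {0..t + 1})"
        unfolding I_def by (rule integral_has_vector_derivative) (use cont t in auto)
      then have "(I has_vector_derivative P t u) (at t within {t..t + 1})"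
        by (rule has_vector_derivative_within_subset) (use t in auto)
      then have "(I has_vector_derivative P t u) (at_right t)"
        unfolding has_vector_derivative_def by (simp add: at_within_Icc_at_right)
      then show ?thesis unfolding has_vector_derivative_at_right_iff .
    qed
    have mem: "I t \<in> Domain (generator_graph P)" if t: "0 \<le> t" for t
    proof -
      \<comment> \<open>P h shifts the interval of integration by h, so the difference consists of
        two short integrals, at t and at 0, and both quotients converge by the fundamental theorem
        of calculus.\<close>
      have e: "P h (I t) - I t = (I (t + h) - I t) - (I (0 + h) - I 0)" if h: "0 \<le> h" for h
      proof -
        have "P h (I t) = integral {0..t} (P h \<circ> (\<lambda>s. P s u))"
          unfolding I_def by (rule integral_linear[symmetric]) (use int C0D h in auto)
        also have "\<dots> = integral {0..t} (\<lambda>s. P (s + h) u)"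
          by (rule integral_cong) (use C0D(3)[of h] h in \<open>auto simp: add.commute\<close>)
        also have "\<dots> = integral {h..t + h} (\<lambda>s. P s u)"
          using integral_shift_Icc_real[of 0 t "\<lambda>s. P s u" h] by (simp add: add.commute o_def)
        also have "\<dots> = I (t + h) - I h"
        proof -
          have "I h + integral {h..t + h} (\<lambda>s. P s u) = I (t + h)"
            unfolding I_def by (rule Henstock_Kurzweil_Integration.integral_combine) (use h t int[of 0 "t + h"] in auto)
          then show ?thesis by (metis add_diff_cancel_left')
        qed
        finally show ?thesis by (simp add: I_def)
      qed
      have "((\<lambda>h. (1 / h) *\<^sub>R (I (t + h) - I t) - (1 / h) *\<^sub>R (I (0 + h) - I 0)) \<longlongrightarrow> P t u - P 0 u) (at_right 0)"
        by (intro tendsto_diff D t order_refl)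
      moreover have "\<forall>\<^sub>F h in at_right 0. (1 / h) *\<^sub>R (I (t + h) - I t) - (1 / h) *\<^sub>R (I (0 + h) - I 0)
          = (1 / h) *\<^sub>R (P h (I t) - I t)"
        unfolding eventually_at_filter
        by (rule always_eventually) (auto simp: e scaleR_diff_right)
      ultimately have "((\<lambda>h. (1 / h) *\<^sub>R (P h (I t) - I t)) \<longlongrightarrow> P t u - P 0 u) (at_right 0)"
        by (rule Lim_transform_eventually)
      then show ?thesis by (auto simp: generator_graph_def)
    qed
    have sc: "c *\<^sub>R x \<in> Domain (generator_graph P)" if x: "x \<in> Domain (generator_graph P)" for c x
    proof -
      obtain v where v: "((\<lambda>t. (1 / t) *\<^sub>R (P t x - x)) \<longlongrightarrow> v) (at_right 0)"
        using x by (auto simp: generator_graph_def)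
      have "((\<lambda>t. c *\<^sub>R ((1 / t) *\<^sub>R (P t x - x))) \<longlongrightarrow> c *\<^sub>R v) (at_right 0)"
        by (intro tendsto_intros v)
      moreover have "\<forall>\<^sub>F t in at_right 0. c *\<^sub>R ((1 / t) *\<^sub>R (P t x - x)) = (1 / t) *\<^sub>R (P t (c *\<^sub>R x) - c *\<^sub>R x)"
        unfolding eventually_at_filter
        by (rule always_eventually) (auto simp: linear_scale[OF bounded_linear.linear[OF C0D(1)]] algebra_simps)
      ultimately have "((\<lambda>t. (1 / t) *\<^sub>R (P t (c *\<^sub>R x) - c *\<^sub>R x)) \<longlongrightarrow> c *\<^sub>R v) (at_right 0)"
        by (rule Lim_transform_eventually)
      then show ?thesis by (auto simp: generator_graph_def)
    qed
    have lim: "((\<lambda>h. (1 / h) *\<^sub>R I h) \<longlongrightarrow> u) (at_right 0)"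
      using D[of 0] by (simp add: C0D I_def)
    have ev: "\<forall>\<^sub>F h in at_right 0. (1 / h) *\<^sub>R I h \<in> closure (Domain (generator_graph P))"
      unfolding eventually_at_filter
    proof (rule always_eventually, intro allI impI)
      fix h :: real assume "h \<in> {0<..}"
      then show "(1 / h) *\<^sub>R I h \<in> closure (Domain (generator_graph P))"
        by (intro subsetD[OF closure_subset] sc mem) auto
    qed
    show ?thesis
      by (rule Lim_in_closed_set[OF closed_closure ev trivial_limit_at_right_real lim])
  qed
  then show ?thesis by auto
qed

text \<open>On the domain, exp (- 2 w s) times the squared norm of P s u has right derivative 2 exp
  (- 2 w s) times the quantity that dissipativity makes nonpositive. Both sides of the estimate are
  continuous in u, so density of the domain suffices.\<close>

lemma quasi_contraction:
  assumes diss: "\<And>h v. (h, v) \<in> generator_graph P \<Longrightarrow> inner v h \<le> w * (norm h)\<^sup>2" and t: "0 \<le> t"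
  shows "norm (P t u) \<le> exp (w * t) * norm u"
proof -
  have dom: "norm (P t u) \<le> exp (w * t) * norm u" if u: "u \<in> Domain (generator_graph P)" for u
  proof -
    obtain v where uv: "(u, v) \<in> generator_graph P" using u by auto
    define f where "f s = exp (- 2 * w * s) * inner (P s u) (P s u)" for s
    have "f t \<le> f 0"
    proof (rule nonincreasing_if_right_derivative_nonpos[OF t])
      have "continuous_on {0..t} (\<lambda>s. P s u)"
        by (rule continuous_on_subset[OF C0_continuous_on]) auto
      then show "continuous_on {0..t} f" unfolding f_def by (intro continuous_intros)
      fix s :: real assume s: "0 \<le> s" "s < t"
      note g = generator_semigroup[OF uv s(1)]
      have "((\<lambda>s. inner (P s u) (P s u)) has_vector_derivative inner (P s u) (P s v) + inner (P s v) (P s u)) (at_right s)"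
        by (rule bounded_bilinear.has_vector_derivative[OF bounded_bilinear_inner, where f = "\<lambda>s. P s u" and g = "\<lambda>s. P s u"])
          (rule g(2))+
      then have "(f has_real_derivative (exp (- 2 * w * s) * (2 * (inner (P s v) (P s u) - w * (norm (P s u))\<^sup>2)))) (at_right s)"
        unfolding f_def has_real_derivative_iff_has_vector_derivative[symmetric]
        by (auto intro!: derivative_eq_intros simp: algebra_simps inner_commute power2_norm_eq_inner)
      moreover have "exp (- 2 * w * s) * (2 * (inner (P s v) (P s u) - w * (norm (P s u))\<^sup>2)) \<le> 0"
        using diss[OF g(1)] by (intro mult_nonneg_nonpos) auto
      ultimately show "\<exists>d\<le>0. (f has_real_derivative d) (at_right s)" by blast
    qed
    then have "exp (- 2 * w * t) * (norm (P t u))\<^sup>2 \<le> (norm u)\<^sup>2"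
      by (simp add: f_def C0D power2_norm_eq_inner)
    then have "exp (2 * w * t) * (exp (- 2 * w * t) * (norm (P t u))\<^sup>2) \<le> exp (2 * w * t) * (norm u)\<^sup>2"
      by (intro mult_left_mono) auto
    moreover have "exp (2 * w * t) * (exp (- 2 * w * t) * (norm (P t u))\<^sup>2) = (norm (P t u))\<^sup>2"
      by (simp only: mult.assoc[symmetric] mult_exp_exp) simp
    moreover have "exp (2 * w * t) * (norm u)\<^sup>2 = (exp (w * t) * norm u)\<^sup>2"
      using exp_double[of "w * t"] by (simp add: mult.assoc power_mult_distrib)
    ultimately have "(norm (P t u))\<^sup>2 \<le> (exp (w * t) * norm u)\<^sup>2" by (simp only:)
    then show ?thesis by (rule power2_le_imp_le) simp
  qed
  have "closed {u. norm (P t u) \<le> exp (w * t) * norm u}"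
    by (intro closed_Collect_le continuous_intros linear_continuous_on C0D t)
  moreover have "Domain (generator_graph P) \<subseteq> {u. norm (P t u) \<le> exp (w * t) * norm u}" using dom by auto
  ultimately have "closure (Domain (generator_graph P)) \<subseteq> {u. norm (P t u) \<le> exp (w * t) * norm u}"
    by (rule closure_minimal[rotated])
  then show ?thesis by (auto simp: generator_domain_dense)
qed

end

subsection \<open>The discrete maximal inequality\<close>

text \<open>The functional \<open>R\<^sup>2 + \<parallel>z\<parallel>\<^sup>4 / R\<^sup>2\<close>, with \<open>R\<close> the running maximum of \<open>\<parallel>z\<parallel>\<close>, grows by a term linear
  in the increment \<open>\<xi>\<close>, which has mean zero, and by a multiple of \<open>\<parallel>\<xi>\<parallel>\<^sup>2\<close>: Doob's inequality for a
  process that is a martingale only up to contractions.\<close>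

lemma Lyapunov_step:
  fixes y \<xi> w :: "'h::real_inner"
  assumes yw: "norm y \<le> norm w" and wR: "norm w \<le> R"
  defines "R' \<equiv> max R (norm (y + \<xi>))"
  shows "R'\<^sup>2 + norm (y + \<xi>) ^ 4 / R'\<^sup>2
    \<le> R\<^sup>2 + norm w ^ 4 / R\<^sup>2 + 4 * ((norm y)\<^sup>2 / R\<^sup>2 * inner y \<xi>) + 18 * (norm \<xi>)\<^sup>2"
proof (cases "R = 0")
  case True
  \<comment> \<open>With R = 0 everything except \<xi> vanishes, division by 0 yields 0, and the
    claim compares multiples of the squared norm of \<xi>.\<close>
  then have "y = 0" "w = 0" using assms by (auto dest: order_antisym[OF _ norm_ge_zero])
  then show ?thesis using True by (simp add: R'_def power2_eq_square power4_eq_xxxx)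
next
  case False
  then have R: "0 < R" using wR norm_ge_zero[of w] by linarith
  define p c e where "p = (norm y)\<^sup>2" and "c = inner y \<xi>" and "e = (norm \<xi>)\<^sup>2"
  have z2: "(norm (y + \<xi>))\<^sup>2 = p + 2 * c + e"
    by (simp add: p_def c_def e_def power2_norm_eq_inner inner_add_left inner_add_right inner_commute)
  have z4: "norm (y + \<xi>) ^ 4 = (p + 2 * c + e)\<^sup>2"
    using z2 by (metis power_mult numeral_Bit0 mult_2 numeral_times_numeral semiring_norm(13,12) num_double)
  have p: "0 \<le> p" "p \<le> R\<^sup>2" using yw wR by (auto simp: p_def intro!: power_mono)
  have e0: "0 \<le> e" by (simp add: e_def)
  have c: "c\<^sup>2 \<le> p * e"
    using Cauchy_Schwarz_ineq[of y \<xi>] by (simp add: p_def c_def e_def power2_norm_eq_inner)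
  have "norm y ^ 4 \<le> norm w ^ 4" using yw by (intro power_mono) auto
  then have w4: "p\<^sup>2 / R\<^sup>2 \<le> norm w ^ 4 / R\<^sup>2"
    by (intro divide_right_mono) (auto simp: p_def power_mult[symmetric])
  define q where "q = p / R\<^sup>2"
  have q: "0 \<le> q" "q \<le> 1" "p = q * R\<^sup>2" using p R by (auto simp: q_def)
  have p2: "p\<^sup>2 / R\<^sup>2 = q\<^sup>2 * R\<^sup>2" using R by (simp add: q(3) power2_eq_square)
  have main: "R'\<^sup>2 + norm (y + \<xi>) ^ 4 / R'\<^sup>2 \<le> R\<^sup>2 + p\<^sup>2 / R\<^sup>2 + 4 * (q * c) + 18 * e"
  proof (cases "norm (y + \<xi>) \<le> R")
    case True
    then have R': "R' = R" by (simp add: R'_def)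
    have "norm \<xi> \<le> norm (y + \<xi>) + norm y" by norm
    also have "\<dots> \<le> 2 * R" using True yw wR by simp
    finally have "(norm \<xi>)\<^sup>2 \<le> (2 * R)\<^sup>2" by (rule power_mono) simp
    then have e: "e \<le> 4 * R\<^sup>2" by (simp add: e_def power_mult_distrib)
    have cR: "c\<^sup>2 \<le> R\<^sup>2 * e" using c mult_right_mono[OF p(2) e0] by linarith
    have "c * e \<le> 2 * R\<^sup>2 * e"
    proof -
      have "c\<^sup>2 \<le> R\<^sup>2 * (4 * R\<^sup>2)" using cR mult_left_mono[OF e, of "R\<^sup>2"] by simp
      then have "c\<^sup>2 \<le> (2 * R\<^sup>2)\<^sup>2" by (simp add: power2_eq_square)
      then have "\<bar>c\<bar> \<le> \<bar>2 * R\<^sup>2\<bar>" by (simp only: abs_le_square_iff)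
      then have "c \<le> 2 * R\<^sup>2" by simp
      then show ?thesis using e0 by (rule mult_right_mono)
    qed
    moreover have "e * e \<le> 4 * R\<^sup>2 * e" using mult_right_mono[OF e e0] by simp
    moreover have "p * e \<le> R\<^sup>2 * e" by (rule mult_right_mono[OF p(2) e0])
    \<comment> \<open>18 = 4 + 2 + 8 + 4: in the expansion of the square, the terms 4 c^2, 2 p e, 4
      c e and e^2 are bounded by these multiples of R^2 e.\<close>
    ultimately have "(p + 2 * c + e)\<^sup>2 \<le> p\<^sup>2 + 4 * (p * c) + 18 * e * R\<^sup>2"
      using cR by (simp add: power2_eq_square algebra_simps)
    then have "(p + 2 * c + e)\<^sup>2 / R\<^sup>2 \<le> (p\<^sup>2 + 4 * (p * c) + 18 * e * R\<^sup>2) / R\<^sup>2"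
      by (rule divide_right_mono) simp
    also have "\<dots> = p\<^sup>2 / R\<^sup>2 + 4 * (q * c) + 18 * e"
      using R by (simp add: q_def add_divide_distrib)
    finally show ?thesis by (simp add: R' z4)
  next
    case False
    then have R': "R' = norm (y + \<xi>)" "norm (y + \<xi>) \<noteq> 0" using R by (auto simp: R'_def)
    have "norm (y + \<xi>) ^ 4 / R'\<^sup>2 = (norm (y + \<xi>))\<^sup>2"
      using R' by (simp add: power2_eq_square power4_eq_xxxx)
    then have L: "R'\<^sup>2 + norm (y + \<xi>) ^ 4 / R'\<^sup>2 = 2 * (p + 2 * c + e)" using R' z2 by simp
    have "c\<^sup>2 \<le> R\<^sup>2 * e" using c mult_right_mono[OF p(2) e0] by linarith
    \<comment> \<open>At a new maximum the expansion produces the linear term 4 c instead of 4 q c.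
      The excess 4 c (1 - q) is paid for by R^2 (1 - q)^2, the gap between R^2 + p^2 / R^2 and 2 p,
      together with 4 e.\<close>
    have "0 \<le> (R * (1 - q) - 2 * (c / R))\<^sup>2" by simp
    also have "\<dots> = R\<^sup>2 * (1 - q)\<^sup>2 - 4 * c * (1 - q) + 4 * (c\<^sup>2 / R\<^sup>2)"
      using R by (simp add: power2_eq_square field_simps)
    also have "c\<^sup>2 / R\<^sup>2 \<le> e" using \<open>c\<^sup>2 \<le> R\<^sup>2 * e\<close> R by (simp add: field_simps)
    finally have "0 \<le> R\<^sup>2 * (1 - q)\<^sup>2 - 4 * c * (1 - q) + 4 * e" by simp
    then have "2 * (q * R\<^sup>2) + 4 * c \<le> R\<^sup>2 + q\<^sup>2 * R\<^sup>2 + 4 * (q * c) + 4 * e"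
      by (simp add: power2_eq_square algebra_simps)
    then show ?thesis unfolding L p2 q(3)[symmetric] using e0 by (simp add: q(3)[symmetric] mult.commute)
  qed
  then show ?thesis using w4 by (simp add: q_def p_def c_def e_def)
qed

text \<open>Paths are continuous at every point of the probability space, so that convolutions of
  step processes are continuous everywhere, as \<open>cprocess\<close> demands. A Brownian motion
  with almost surely continuous paths is exchanged for such a version at the end.\<close>

locale brownian_setting = prob_space M for M :: "'w measure" +
  fixes F :: "real \<Rightarrow> 'w measure" and T :: real and B :: "real \<Rightarrow> 'w \<Rightarrow> real"
  assumes T: "0 < T" and filt: "usual_filtration M F T" and BM: "brownian_motion M F T B"
    and B_cont: "\<And>w. w \<in> space M \<Longrightarrow> continuous_on {0..T} (\<lambda>t. B t w)"
begin

lemma subalg: "0 \<le> t \<Longrightarrow> t \<le> T \<Longrightarrow> subalgebra M (F t)"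
  using filt by (simp add: usual_filtration_def)

lemma space_F: "0 \<le> t \<Longrightarrow> t \<le> T \<Longrightarrow> space (F t) = space M"
  using subalg by (simp add: subalgebra_def)

lemma sets_F_M: "0 \<le> t \<Longrightarrow> t \<le> T \<Longrightarrow> sets (F t) \<subseteq> sets M"
  using subalg by (simp add: subalgebra_def)

lemma sets_F_mono: "0 \<le> s \<Longrightarrow> s \<le> t \<Longrightarrow> t \<le> T \<Longrightarrow> sets (F s) \<subseteq> sets (F t)"
  using filt by (simp add: usual_filtration_def)

lemma measurable_F_mono:
  assumes "f \<in> measurable (F s) N" "0 \<le> s" "s \<le> t" "t \<le> T"
  shows "f \<in> measurable (F t) N"
  using assms sets_F_mono[of s t] space_F[of s] space_F[of t] by (auto simp: measurable_def)

lemma measurable_F_M: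
  assumes "f \<in> measurable (F s) N" "0 \<le> s" "s \<le> T"
  shows "f \<in> measurable M N"
  using assms sets_F_M[of s] space_F[of s] by (auto simp: measurable_def)

lemma null_F: "N \<in> null_sets M \<Longrightarrow> A \<subseteq> N \<Longrightarrow> 0 \<le> t \<Longrightarrow> t \<le> T \<Longrightarrow> A \<in> sets (F t)"
  using filt sets_F_mono[of 0 t] unfolding usual_filtration_def by blast

text \<open>The usual conditions put every subset of a null set into F 0, so a change on a null set
  cannot destroy measurability with respect to F t.\<close>

lemma measurable_F_AE:
  assumes f: "f \<in> measurable (F t) N" and t: "0 \<le> t" "t \<le> T" and eq: "AE w in M. f w = g w"
    and g: "g \<in> space M \<rightarrow> space N"
  shows "g \<in> measurable (F t) N"
proof (rule measurableI)
  show "g x \<in> space N" if "x \<in> space (F t)" for x using g that space_F[OF t] by auto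
  fix A assume A: "A \<in> sets N"
  obtain Z where Z: "Z \<in> null_sets M" "{w \<in> space M. f w \<noteq> g w} \<subseteq> Z"
    using eq by (auto elim!: AE_E3 simp: null_sets_def)
  have Zn: "C \<in> sets (F t)" if "C \<subseteq> Z" for C by (rule null_F[OF Z(1) that t])
  have "g -` A \<inter> space (F t) = (f -` A \<inter> space (F t)) - {w \<in> space M. f w \<noteq> g w} \<union> (g -` A \<inter> {w \<in> space M. f w \<noteq> g w})"
    using space_F[OF t] by auto
  also have "\<dots> \<in> sets (F t)"
    by (intro sets.Un sets.Diff measurable_sets[OF f A] Zn) (use Z(2) in blast)+
  finally show "g -` A \<inter> space (F t) \<in> sets (F t)" .
qed

lemma B_meas: "0 \<le> t \<Longrightarrow> t \<le> T \<Longrightarrow> B t \<in> borel_measurable (F t)"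
  using BM by (simp add: brownian_motion_def)

lemma B_meas_M[measurable]: "0 \<le> t \<Longrightarrow> t \<le> T \<Longrightarrow> B t \<in> borel_measurable M"
  using B_meas measurable_F_M by blast

lemma increment_distributed:
  assumes "0 \<le> s" "s < t" "t \<le> T"
  shows "distributed M lborel (\<lambda>w. B t w - B s w) (normal_density 0 (sqrt (t - s)))"
  using BM assms by (auto simp: brownian_motion_def)

lemma increment_moments:
  assumes st: "0 \<le> s" "s \<le> t" "t \<le> T"
  shows "integrable M (\<lambda>w. B t w - B s w)" "expectation (\<lambda>w. B t w - B s w) = 0"
    "integrable M (\<lambda>w. (B t w - B s w)\<^sup>2)" "expectation (\<lambda>w. (B t w - B s w)\<^sup>2) = t - s"
proof -
  consider "s = t" | "s < t" using st by linarith
  then have "integrable M (\<lambda>w. B t w - B s w) \<and> expectation (\<lambda>w. B t w - B s w) = 0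
    \<and> integrable M (\<lambda>w. (B t w - B s w)\<^sup>2) \<and> expectation (\<lambda>w. (B t w - B s w)\<^sup>2) = t - s"
  proof cases
    case 2
    note D = increment_distributed[OF st(1) 2 st(3)]
    have p: "0 < sqrt (t - s)" using 2 by simp
    have m1: "has_bochner_integral lborel (\<lambda>x. normal_density 0 (sqrt (t - s)) x * x) 0"
      using normal_moment_nz_1[OF p, of 0] .
    have m2: "has_bochner_integral lborel (\<lambda>x. normal_density 0 (sqrt (t - s)) x * x\<^sup>2) (t - s)"
      using normal_moment_even[OF p, of 0 1] 2 by (simp add: fact_numeral diff_divide_distrib)
    show ?thesis
      using distributed_integral[OF D, of "\<lambda>x. x"] distributed_integrable[OF D, of "\<lambda>x. x"]
        distributed_integral[OF D, of "\<lambda>x. x\<^sup>2"] distributed_integrable[OF D, of "\<lambda>x. x\<^sup>2"]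
        m1 m2 by (auto simp: has_bochner_integral_iff normal_density_nonneg)
  qed simp
  then show "integrable M (\<lambda>w. B t w - B s w)" "expectation (\<lambda>w. B t w - B s w) = 0"
    "integrable M (\<lambda>w. (B t w - B s w)\<^sup>2)" "expectation (\<lambda>w. (B t w - B s w)\<^sup>2) = t - s" by auto
qed

lemma increment_indep:
  assumes st: "0 \<le> s" "s < t" "t \<le> T" and X: "X \<in> measurable (F s) N"
  shows "indep_var N X borel (\<lambda>w. B t w - B s w)"
proof -
  have st': "0 \<le> s" "s \<le> T" "0 \<le> t" using st by auto
  have I: "indep_set (sets (F s)) (sets (vimage_algebra (space M) (\<lambda>w. B t w - B s w) borel))"
    using BM st by (auto simp: brownian_motion_def)
  have V: "sets (vimage_algebra (space M) (\<lambda>w. B t w - B s w) borel)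
     = sigma_sets (space M) {(\<lambda>w. B t w - B s w) -` A \<inter> space M |A. A \<in> sets borel}"
    by (rule sets_vimage_algebra)
  have "sigma_sets (space M) {X -` A \<inter> space M |A. A \<in> sets N} \<subseteq> sets (F s)"
    using measurable_sets[OF X] space_F[OF st'(1,2)]
    by (intro sets.sigma_sets_subset[of _ "F s", simplified space_F[OF st'(1,2)]]) auto
  then have "indep_set (sigma_sets (space M) {X -` A \<inter> space M |A. A \<in> sets N})
     (sigma_sets (space M) {(\<lambda>w. B t w - B s w) -` A \<inter> space M |A. A \<in> sets borel})"
    using I unfolding V indep_sets2_eq by blast
  then show ?thesis
    unfolding indep_var_eq using measurable_F_M[OF X st'(1,2)] st st' by auto
qed

text \<open>X is known at time s and hence independent of the increment and of its square. The case
  s = t is separate because independence is postulated for s < t.\<close>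

lemma increment_mult:
  fixes X :: "'w \<Rightarrow> real"
  assumes st: "0 \<le> s" "s \<le> t" "t \<le> T" and X: "X \<in> borel_measurable (F s)" and i: "integrable M X"
  shows "integrable M (\<lambda>w. X w * (B t w - B s w))" "expectation (\<lambda>w. X w * (B t w - B s w)) = 0"
    "integrable M (\<lambda>w. X w * (B t w - B s w)\<^sup>2)"
    "expectation (\<lambda>w. X w * (B t w - B s w)\<^sup>2) = (t - s) * expectation X"
proof -
  note m = increment_moments[OF st]
  consider "s = t" | "s < t" using st by linarith
  then have "integrable M (\<lambda>w. X w * (B t w - B s w)) \<and> expectation (\<lambda>w. X w * (B t w - B s w)) = 0
    \<and> integrable M (\<lambda>w. X w * (B t w - B s w)\<^sup>2)
    \<and> expectation (\<lambda>w. X w * (B t w - B s w)\<^sup>2) = (t - s) * expectation X"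
  proof cases
    case 2
    have I: "indep_var borel X borel (\<lambda>w. B t w - B s w)" by (rule increment_indep[OF st(1) 2 st(3) X])
    have I2: "indep_var borel X borel (\<lambda>w. (B t w - B s w)\<^sup>2)"
      using indep_var_compose[OF I, of "\<lambda>x. x" borel "\<lambda>x. x\<^sup>2" borel] by (simp add: comp_def)
    show ?thesis
      using indep_var_integrable[OF I i m(1)] indep_var_lebesgue_integral[OF I i m(1)]
        indep_var_integrable[OF I2 i m(3)] indep_var_lebesgue_integral[OF I2 i m(3)] m(2,4) by simp
  qed simp
  then show "integrable M (\<lambda>w. X w * (B t w - B s w))" "expectation (\<lambda>w. X w * (B t w - B s w)) = 0"
    "integrable M (\<lambda>w. X w * (B t w - B s w)\<^sup>2)"
    "expectation (\<lambda>w. X w * (B t w - B s w)\<^sup>2) = (t - s) * expectation X" by auto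
qed

end

context brownian_setting
begin

text \<open>Summing \<open>Lyapunov_step\<close> along the grid bounds the squared running maximum.
  The linear terms have mean zero since \<open>\<phi> k\<close> is known at time \<open>g k\<close>,
  when the increment begins, and the quadratic terms give the energy of x. The bound K secures
  integrability; the final estimate is independent of it.\<close>

lemma discrete_maximal:
  fixes g :: "nat \<Rightarrow> real" and W x :: "nat \<Rightarrow> 'w \<Rightarrow> 'h::{real_inner, banach, second_countable_topology}"
    and C :: "nat \<Rightarrow> 'h \<Rightarrow> 'h"
  assumes g: "\<And>k. k \<le> m \<Longrightarrow> 0 \<le> g k \<and> g k \<le> T" and gmono: "\<And>k. k < m \<Longrightarrow> g k \<le> g (Suc k)"
    and W0: "\<And>w. w \<in> space M \<Longrightarrow> W 0 w = 0"
    and step: "\<And>k w. k < m \<Longrightarrow> w \<in> space M \<Longrightarrow>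
      W (Suc k) w = C k (W k w) + (B (g (Suc k)) w - B (g k) w) *\<^sub>R x k w"
    and C: "\<And>k h. k < m \<Longrightarrow> norm (C k h) \<le> norm h" "\<And>k. k < m \<Longrightarrow> C k \<in> borel_measurable borel"
    and x: "\<And>k. k < m \<Longrightarrow> x k \<in> borel_measurable (F (g k))"
      "\<And>k w. k < m \<Longrightarrow> w \<in> space M \<Longrightarrow> norm (x k w) \<le> K"
  shows "(\<integral>\<^sup>+w. (SUP k\<in>{..m}. nsq (W k w)) \<partial>M)
    \<le> 18 * (\<integral>\<^sup>+w. (\<Sum>k<m. ennreal ((g (Suc k) - g k) * (norm (x k w))\<^sup>2)) \<partial>M)"
proof -
  let ?b = "\<lambda>k w. B (g (Suc k)) w - B (g k) w"
  define \<xi> where "\<xi> k w = ?b k w *\<^sub>R x k w" for k w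
  define y where "y k w = C k (W k w)" for k w
  define R where "R k w = rec_nat 0 (\<lambda>k r. max r (norm (W (Suc k) w))) k" for k w
  define V where "V k w = (R k w)\<^sup>2 + norm (W k w) ^ 4 / (R k w)\<^sup>2" for k w
  define \<phi> where "\<phi> k w = (norm (y k w))\<^sup>2 / (R k w)\<^sup>2 * inner (y k w) (x k w)" for k w
  have R: "R 0 w = 0" "R (Suc k) w = max (R k w) (norm (W (Suc k) w))" for k w
    by (simp_all add: R_def)
  have R0: "0 \<le> R k w" for k w by (induction k) (auto simp: R)
  have WR: "norm (W k w) \<le> R k w" if "w \<in> space M" for k w
    using that by (cases k) (auto simp: R W0)
  have Rmono: "R j w \<le> R k w" if "j \<le> k" for j k w
    using that by (induction rule: dec_induct) (auto simp: R)
  have gk: "0 \<le> g k" "g k \<le> g (Suc k)" "g (Suc k) \<le> T" "g k \<le> T" "0 \<le> g (Suc k)" if "k < m" for k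
    using g[of k] g[of "Suc k"] gmono[OF that] that by auto
  have xM: "x k \<in> borel_measurable M" if "k < m" for k
    using measurable_F_M[OF x(1)[OF that]] gk[OF that] by simp
  have K0: "0 \<le> \<bar>K\<bar>" by simp
  have xK: "norm (x k w) \<le> \<bar>K\<bar>" if "k < m" "w \<in> space M" for k w
    using x(2)[OF that] by linarith
  have Wm: "k \<le> m \<Longrightarrow> W k \<in> borel_measurable (F (g k)) \<and> R k \<in> borel_measurable (F (g k))" for k
  proof (induction k)
    case 0
    have "W 0 \<in> borel_measurable (F (g 0))"
      by (subst measurable_cong[where g = "\<lambda>_. 0"]) (use W0 space_F g 0 in auto)
    then show ?case by (simp add: R(1)[abs_def])
  next
    case (Suc k)
    then have k: "k < m" and IH: "W k \<in> borel_measurable (F (g k))" "R k \<in> borel_measurable (F (g k))" by auto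
    have sp: "space (F (g (Suc k))) = space M" using gk[OF k] space_F by simp
    have [measurable]: "W k \<in> borel_measurable (F (g (Suc k)))" "R k \<in> borel_measurable (F (g (Suc k)))"
      "x k \<in> borel_measurable (F (g (Suc k)))" "B (g k) \<in> borel_measurable (F (g (Suc k)))"
      "B (g (Suc k)) \<in> borel_measurable (F (g (Suc k)))" "C k \<in> borel_measurable borel"
      using measurable_F_mono[OF IH(1)] measurable_F_mono[OF IH(2)] measurable_F_mono[OF x(1)[OF k]]
        measurable_F_mono[OF B_meas[of "g k"]] B_meas[of "g (Suc k)"] gk[OF k] C(2)[OF k] by auto
    have "(\<lambda>w. C k (W k w) + ?b k w *\<^sub>R x k w) \<in> borel_measurable (F (g (Suc k)))"
      by measurable
    then have W1[measurable]: "W (Suc k) \<in> borel_measurable (F (g (Suc k)))"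
      by (subst measurable_cong[OF step[OF k]]) (simp add: sp)
    have "(\<lambda>w. max (R k w) (norm (W (Suc k) w))) \<in> borel_measurable (F (g (Suc k)))" by measurable
    then show ?case using W1 by (simp add: R(2)[abs_def])
  qed
  have WM: "W k \<in> borel_measurable M" "R k \<in> borel_measurable M" if "k \<le> m" for k
    using measurable_F_M[of _ "g k"] Wm[OF that] g[OF that] by auto
  have Wint: "k \<le> m \<Longrightarrow> integrable M (\<lambda>w. (norm (W k w))\<^sup>2) \<and> integrable M (\<lambda>w. (R k w)\<^sup>2)" for k
  proof (induction k)
    case 0
    have "integrable M (\<lambda>w. (norm (W 0 w))\<^sup>2) = integrable M (\<lambda>w. 0::real)"
      by (rule Bochner_Integration.integrable_cong) (auto simp: W0)
    then show ?case by (simp add: R)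
  next
    case (Suc k)
    then have k: "k < m" and IH: "integrable M (\<lambda>w. (norm (W k w))\<^sup>2)" "integrable M (\<lambda>w. (R k w)\<^sup>2)" by auto
    note [measurable] = WM[OF Suc.prems]
    have iB: "integrable M (\<lambda>w. 2 * (norm (W k w))\<^sup>2 + 2 * K\<^sup>2 * (?b k w)\<^sup>2)"
      using IH(1) increment_moments(3)[of "g k" "g (Suc k)"] gk[OF k] by auto
    have i1: "integrable M (\<lambda>w. (norm (W (Suc k) w))\<^sup>2)"
    proof (rule Bochner_Integration.integrable_bound[OF iB])
      show "AE w in M. norm ((norm (W (Suc k) w))\<^sup>2) \<le> norm (2 * (norm (W k w))\<^sup>2 + 2 * K\<^sup>2 * (?b k w)\<^sup>2)"
      proof (rule AE_I2)
        fix w assume w: "w \<in> space M"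
        define d where "d = B (g (Suc k)) w - B (g k) w"
        have "norm (W (Suc k) w) \<le> norm (C k (W k w)) + norm (d *\<^sub>R x k w)"
          unfolding step[OF k w] d_def by (rule norm_triangle_ineq)
        also have "\<dots> \<le> norm (W k w) + \<bar>d\<bar> * \<bar>K\<bar>"
          using C(1)[OF k] xK[OF k w] by (intro add_mono) (auto intro: mult_left_mono)
        finally have "(norm (W (Suc k) w))\<^sup>2 \<le> (norm (W k w) + \<bar>d\<bar> * \<bar>K\<bar>)\<^sup>2" by (rule power_mono) simp
        also have "\<dots> \<le> 2 * (norm (W k w))\<^sup>2 + 2 * (\<bar>d\<bar> * \<bar>K\<bar>)\<^sup>2"
          using sum_squares_bound[of "norm (W k w)" "\<bar>d\<bar> * \<bar>K\<bar>"] by (simp add: power2_sum)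
        also have "\<dots> = 2 * (norm (W k w))\<^sup>2 + 2 * K\<^sup>2 * d\<^sup>2" by (simp add: power_mult_distrib)
        finally show "norm ((norm (W (Suc k) w))\<^sup>2) \<le> norm (2 * (norm (W k w))\<^sup>2 + 2 * K\<^sup>2 * (?b k w)\<^sup>2)"
          unfolding d_def[symmetric] by simp
      qed
    qed measurable
    have "integrable M (\<lambda>w. (R (Suc k) w)\<^sup>2)"
    proof (rule Bochner_Integration.integrable_bound[OF Bochner_Integration.integrable_add[OF IH(2) i1]])
      show "AE w in M. norm ((R (Suc k) w)\<^sup>2) \<le> norm ((R k w)\<^sup>2 + (norm (W (Suc k) w))\<^sup>2)"
        by (rule AE_I2) (auto simp: R max_def)
    qed measurable
    then show ?case using i1 by simp
  qed
  have y: "norm (y k w) \<le> norm (W k w)" if "k < m" for k w using C(1)[OF that] by (simp add: y_def)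
  \<comment> \<open>This includes \<open>R k w = 0\<close>, where the quotient is 0. It makes
    \<open>\<phi> k\<close> grow only linearly in the norm of W, so square integrability of W is
    enough.\<close>
  have q1: "(norm (y k w))\<^sup>2 / (R k w)\<^sup>2 \<le> 1" if "k < m" "w \<in> space M" for k w
    using y[OF that(1), of w] WR[OF that(2), of k]
    by (intro divide_le_eq_1[THEN iffD2]) (auto intro: power_mono order_trans simp: zero_less_power2)
  have phim: "\<phi> k \<in> borel_measurable (F (g k))" if k: "k < m" for k
  proof -
    have [measurable]: "W k \<in> borel_measurable (F (g k))" "R k \<in> borel_measurable (F (g k))" "C k \<in> borel_measurable borel"
      "x k \<in> borel_measurable (F (g k))"
      using Wm[of k] k C(2)[OF k] x(1)[OF k] by auto
    show ?thesis unfolding \<phi>_def[abs_def] y_def by measurable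
  qed
  have phii: "integrable M (\<phi> k)" if k: "k < m" for k
  proof (rule Bochner_Integration.integrable_bound)
    show "integrable M (\<lambda>w. (1 + (norm (W k w))\<^sup>2) * \<bar>K\<bar>)" using Wint[of k] k by auto
    show "\<phi> k \<in> borel_measurable M" using measurable_F_M[OF phim[OF k]] gk[OF k] by simp
    show "AE w in M. norm (\<phi> k w) \<le> norm ((1 + (norm (W k w))\<^sup>2) * \<bar>K\<bar>)"
    proof (rule AE_I2)
      fix w assume w: "w \<in> space M"
      have "norm (\<phi> k w) = (norm (y k w))\<^sup>2 / (R k w)\<^sup>2 * \<bar>inner (y k w) (x k w)\<bar>"
        by (simp add: \<phi>_def abs_mult)
      also have "\<dots> \<le> 1 * (norm (W k w) * \<bar>K\<bar>)"
      proof (rule mult_mono)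
        have "\<bar>inner (y k w) (x k w)\<bar> \<le> norm (y k w) * norm (x k w)" by (rule Cauchy_Schwarz_ineq2)
        also have "\<dots> \<le> norm (W k w) * \<bar>K\<bar>" by (intro mult_mono y[OF k] xK[OF k w]) auto
        finally show "\<bar>inner (y k w) (x k w)\<bar> \<le> norm (W k w) * \<bar>K\<bar>" .
      qed (use q1[OF k w] in auto)
      also have "\<dots> \<le> (1 + (norm (W k w))\<^sup>2) * \<bar>K\<bar>"
      proof -
        have "norm (W k w) \<le> 1 + (norm (W k w))\<^sup>2"
          using sum_squares_bound[of "norm (W k w)" 1] by simp (smt (verit) norm_ge_zero)
        then show ?thesis by (simp add: mult_right_mono)
      qed
      finally show "norm (\<phi> k w) \<le> norm ((1 + (norm (W k w))\<^sup>2) * \<bar>K\<bar>)" by simp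
    qed
  qed
  have xint: "integrable M (\<lambda>w. (norm (x k w))\<^sup>2)" if k: "k < m" for k
    by (rule integrable_const_bound[of _ "K\<^sup>2"])
      (use xK[OF k] xM[OF k] in \<open>auto intro!: AE_I2 simp: abs_le_square_iff[symmetric]\<close>)
  have xm2: "(\<lambda>w. (norm (x k w))\<^sup>2) \<in> borel_measurable (F (g k))" if k: "k < m" for k
    using x(1)[OF k] by measurable
  have stepV: "V (Suc k) w \<le> V k w + 4 * (\<phi> k w * ?b k w)
      + 18 * ((norm (x k w))\<^sup>2 * (?b k w)\<^sup>2)" if k: "k < m" and w: "w \<in> space M" for k w
  proof -
    have "W (Suc k) w = y k w + \<xi> k w" using step[OF k w] by (simp add: y_def \<xi>_def)
    then have "V (Suc k) w \<le> V k w + 4 * ((norm (y k w))\<^sup>2 / (R k w)\<^sup>2 * inner (y k w) (\<xi> k w)) + 18 * (norm (\<xi> k w))\<^sup>2"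
      using Lyapunov_step[OF y[OF k, of w] WR[OF w, of k], of "\<xi> k w"] by (simp add: V_def R)
    then show ?thesis by (simp add: \<phi>_def \<xi>_def power_mult_distrib mult_ac)
  qed
  have sumV: "n \<le> m \<Longrightarrow> V n w \<le> (\<Sum>k<n. 4 * (\<phi> k w * ?b k w)
      + 18 * ((norm (x k w))\<^sup>2 * (?b k w)\<^sup>2))" if w: "w \<in> space M" for n w
  proof (induction n)
    case 0
    then show ?case using W0[OF w] by (simp add: V_def R)
  next
    case (Suc n)
    then show ?case using stepV[OF _ w, of n] by simp
  qed
  have RV: "(R m w)\<^sup>2 \<le> V m w" for w by (simp add: V_def)
  have inc: "integrable M (\<lambda>w. \<phi> k w * ?b k w)"
    "expectation (\<lambda>w. \<phi> k w * ?b k w) = 0"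
    "integrable M (\<lambda>w. (norm (x k w))\<^sup>2 * (?b k w)\<^sup>2)"
    "expectation (\<lambda>w. (norm (x k w))\<^sup>2 * (?b k w)\<^sup>2) = (g (Suc k) - g k) * expectation (\<lambda>w. (norm (x k w))\<^sup>2)"
    if k: "k < m" for k
    using increment_mult[OF _ _ _ phim[OF k] phii[OF k]] increment_mult[OF _ _ _ xm2[OF k] xint[OF k]] gk[OF k] by auto
  have "expectation (\<lambda>w. (R m w)\<^sup>2) \<le> expectation (\<lambda>w. \<Sum>k<m. 4 * (\<phi> k w * ?b k w)
      + 18 * ((norm (x k w))\<^sup>2 * (?b k w)\<^sup>2))"
    by (rule integral_mono) (use Wint[of m] inc order_trans[OF RV sumV] in auto)
  also have "\<dots> = (\<Sum>k<m. 18 * ((g (Suc k) - g k) * expectation (\<lambda>w. (norm (x k w))\<^sup>2)))"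
    using inc by (subst Bochner_Integration.integral_sum) (auto intro!: sum.cong)
  finally have E: "expectation (\<lambda>w. (R m w)\<^sup>2) \<le> (\<Sum>k<m. 18 * ((g (Suc k) - g k) * expectation (\<lambda>w. (norm (x k w))\<^sup>2)))" .
  have "(\<integral>\<^sup>+w. (SUP k\<in>{..m}. nsq (W k w)) \<partial>M) \<le> (\<integral>\<^sup>+w. ennreal ((R m w)\<^sup>2) \<partial>M)"
    by (intro nn_integral_mono SUP_least ennreal_leI power_mono order_trans[OF WR Rmono]) auto
  also have "\<dots> = ennreal (expectation (\<lambda>w. (R m w)\<^sup>2))"
    using Wint[of m] by (intro nn_integral_eq_integral) auto
  also have "\<dots> \<le> ennreal (\<Sum>k<m. 18 * ((g (Suc k) - g k) * expectation (\<lambda>w. (norm (x k w))\<^sup>2)))"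
    using E by (rule ennreal_leI)
  also have "\<dots> = (\<Sum>k<m. ennreal (18 * ((g (Suc k) - g k) * expectation (\<lambda>w. (norm (x k w))\<^sup>2))))"
    using gk by (subst sum_ennreal) auto
  also have "\<dots> = 18 * (\<Sum>k<m. ennreal (expectation (\<lambda>w. (g (Suc k) - g k) * (norm (x k w))\<^sup>2)))"
    unfolding sum_distrib_left using gk by (intro sum.cong) (auto simp: ennreal_mult')
  also have "\<dots> = 18 * (\<Sum>k<m. \<integral>\<^sup>+w. ennreal ((g (Suc k) - g k) * (norm (x k w))\<^sup>2) \<partial>M)"
    using gk xint by (intro arg_cong2[where f = "(*)"] sum.cong nn_integral_eq_integral[symmetric]) auto
  also have "\<dots> = 18 * (\<integral>\<^sup>+w. (\<Sum>k<m. ennreal ((g (Suc k) - g k) * (norm (x k w))\<^sup>2)) \<partial>M)"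
    using xM by (subst nn_integral_sum) auto
  finally show ?thesis .
qed

end

text \<open>What the stochastic part needs of \<open>P\<close>, detached from its generator. The
  identity with \<mu> = 0 is a second instance, for which convolutions are plain stochastic
  integrals.\<close>

locale qc_semigroup =
  fixes S :: "real \<Rightarrow> 'h \<Rightarrow> 'h::{real_inner, banach, second_countable_topology}" and \<mu> :: real
  assumes \<mu>: "0 \<le> \<mu>"
    and S_linear: "\<And>t. 0 \<le> t \<Longrightarrow> bounded_linear (S t)"
    and S_0: "\<And>u. S 0 u = u"
    and S_add: "\<And>s t u. 0 \<le> s \<Longrightarrow> 0 \<le> t \<Longrightarrow> S (s + t) u = S s (S t u)"
    and S_norm: "\<And>t u. 0 \<le> t \<Longrightarrow> norm (S t u) \<le> exp (\<mu> * t) * norm u"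
    and S_cont: "\<And>u. continuous_on {0..} (\<lambda>t. S t u)"
begin

lemma S_plus: "0 \<le> t \<Longrightarrow> S t (u + v) = S t u + S t v"
  and S_minus: "0 \<le> t \<Longrightarrow> S t (u - v) = S t u - S t v"
  and S_scale: "0 \<le> t \<Longrightarrow> S t (c *\<^sub>R u) = c *\<^sub>R S t u"
  and S_zero: "0 \<le> t \<Longrightarrow> S t 0 = 0"
  using bounded_linear.linear[OF S_linear] by (auto simp: linear_add linear_diff linear_scale linear_0)

lemma S_norm_le: "0 \<le> t \<Longrightarrow> t \<le> c \<Longrightarrow> norm (S t u) \<le> exp (\<mu> * c) * norm u"
  by (rule order_trans[OF S_norm]) (auto intro!: mult_right_mono mult_left_mono \<mu>)

lemma S_norm_sq_le: "0 \<le> t \<Longrightarrow> t \<le> c \<Longrightarrow> (norm (S t u))\<^sup>2 \<le> exp (2 * \<mu> * c) * (norm u)\<^sup>2"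
  using power_mono[OF S_norm_le[of t c u] norm_ge_zero, of 2] exp_double[of "\<mu> * c"]
  by (simp add: power_mult_distrib mult.assoc)

lemma S_tendsto:
  assumes r: "(r \<longlongrightarrow> r0) A" and f: "(f \<longlongrightarrow> f0) A" and pos: "\<forall>\<^sub>F x in A. 0 \<le> r x" "0 \<le> r0"
  shows "((\<lambda>x. S (r x) (f x)) \<longlongrightarrow> S r0 f0) A"
proof -
  have 1: "((\<lambda>x. S (r x) f0) \<longlongrightarrow> S r0 f0) A"
    by (rule continuous_on_tendsto_compose[OF S_cont[of f0] r]) (use pos in auto)
  have 2: "((\<lambda>x. S (r x) (f x) - S (r x) f0) \<longlongrightarrow> 0) A"
  proof (rule Lim_null_comparison)
    have "\<forall>\<^sub>F x in A. r x < r0 + 1" by (rule order_tendstoD(2)[OF r]) simp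
    then show "\<forall>\<^sub>F x in A. norm (S (r x) (f x) - S (r x) f0) \<le> exp (\<mu> * (r0 + 1)) * norm (f x - f0)"
      using pos(1)
    proof eventually_elim
      case (elim x)
      then show ?case using S_norm_le[of "r x" "r0 + 1" "f x - f0"] by (simp add: S_minus)
    qed
    have "((\<lambda>x. exp (\<mu> * (r0 + 1)) * norm (f x - f0)) \<longlongrightarrow> exp (\<mu> * (r0 + 1)) * norm (f0 - f0)) A"
      by (intro tendsto_intros f)
    then show "((\<lambda>x. exp (\<mu> * (r0 + 1)) * norm (f x - f0)) \<longlongrightarrow> 0) A" by simp
  qed
  show ?thesis using tendsto_add[OF 2 1] by simp
qed

lemma S_continuous_on:
  assumes "continuous_on A r" "continuous_on A f" "\<And>x. x \<in> A \<Longrightarrow> 0 \<le> r x"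
  shows "continuous_on A (\<lambda>x. S (r x) (f x))"
  using assms unfolding continuous_on_def
  by (auto intro!: S_tendsto simp: eventually_at_filter)

lemma S_measurable[measurable]: "0 \<le> t \<Longrightarrow> S t \<in> borel_measurable borel"
  by (intro borel_measurable_continuous_onI linear_continuous_on S_linear)

text \<open>Strong continuity together with local boundedness makes (t, u) \<mapsto> S t u jointly
  continuous; \<open>max 0\<close> extends it to negative times, so that it is Borel on the whole
  product.\<close>

lemma S_measurable2:
  assumes [measurable]: "r \<in> borel_measurable N" "f \<in> borel_measurable N"
  shows "(\<lambda>x. S (max 0 (r x)) (f x)) \<in> borel_measurable N"
proof -
  have "continuous_on UNIV (\<lambda>z::real \<times> 'h. S (max 0 (fst z)) (snd z))"
    by (intro S_continuous_on continuous_intros) auto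
  then have "(\<lambda>z::real \<times> 'h. S (max 0 (fst z)) (snd z)) \<in> borel_measurable borel"
    by (rule borel_measurable_continuous_onI)
  then have "(\<lambda>z::real \<times> 'h. S (max 0 (fst z)) (snd z)) \<circ> (\<lambda>x. (r x, f x)) \<in> borel_measurable N"
    by (intro measurable_comp[of _ _ borel]) (simp_all add: borel_prod[symmetric])
  then show ?thesis by (simp add: comp_def)
qed

end

subsection \<open>Step processes\<close>

text \<open>Cells have positive length, so t = 0 forces m = 0. \<open>G\<close> holds the
  breakpoints of an integrand and, where needed, also a finite set of observation times.\<close>

definition is_grid :: "real set \<Rightarrow> real \<Rightarrow> nat \<Rightarrow> (nat \<Rightarrow> real) \<Rightarrow> bool" where
  "is_grid G t m g \<longleftrightarrow> g 0 = 0 \<and> g m = t \<and> (\<forall>k<m. g k < g (Suc k)) \<and> (\<forall>k\<le>m. \<forall>j\<le>k. g j \<le> g k) \<and>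
     (\<forall>k<m. G \<inter> {g k<..<g (Suc k)} = {}) \<and> G \<inter> {0..t} \<subseteq> g ` {..m}"

lemma is_gridD:
  assumes "is_grid G t m g"
  shows "g 0 = 0" "g m = t" "k < m \<Longrightarrow> g k < g (Suc k)" "j \<le> k \<Longrightarrow> k \<le> m \<Longrightarrow> g j \<le> g k"
    "k < m \<Longrightarrow> G \<inter> {g k<..<g (Suc k)} = {}" "G \<inter> {0..t} \<subseteq> g ` {..m}"
  using assms unfolding is_grid_def by blast+

lemma is_grid_exists:
  assumes "finite G" "0 \<le> t"
  shows "\<exists>m g. is_grid G t m g"
proof -
  define A where "A = (G \<inter> {0..t}) \<union> {0, t}"
  define L where "L = sorted_list_of_set A"
  have fin: "finite A" using assms by (simp add: A_def)
  have L: "set L = A" "sorted L" "distinct L" using fin by (simp_all add: L_def)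
  have ss: "sorted_wrt (<) L" using L by (simp add: strict_sorted_iff)
  have len: "0 < length L" using L(1) by (auto simp: A_def)
  define m where "m = length L - 1"
  define g where "g k = L ! k" for k
  have kl: "k < length L" if "k \<le> m" for k using that len unfolding m_def by linarith
  have inA: "g k \<in> A" if "k \<le> m" for k using nth_mem[OF kl[OF that]] L(1) by (simp add: g_def)
  have mono: "g j \<le> g k" if "j \<le> k" "k \<le> m" for j k
    using sorted_nth_mono[OF L(2) that(1) kl[OF that(2)]] by (simp add: g_def)
  have idx: "\<exists>k\<le>m. a = g k" if a: "a \<in> A" for a
  proof -
    obtain k where "k < length L" "L ! k = a" using a L(1) by (metis in_set_conv_nth)
    then show ?thesis by (intro exI[of _ k]) (auto simp: g_def m_def)
  qed
  have A0: "a \<in> A \<Longrightarrow> 0 \<le> a \<and> a \<le> t" for a using assms(2) by (auto simp: A_def)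
  have "is_grid G t m g"
    unfolding is_grid_def
  proof (intro conjI allI impI)
    obtain k where "k \<le> m" "0 = g k" using idx[of 0] by (auto simp: A_def)
    then show "g 0 = 0" using mono[of 0 k] A0[OF inA[of 0]] by simp
    obtain k where "k \<le> m" "t = g k" using idx[of t] by (auto simp: A_def)
    then show "g m = t" using mono[of k m] A0[OF inA[of m]] by simp
    show lt: "g k < g (Suc k)" if "k < m" for k
      using sorted_wrt_nth_less[OF ss, of k "Suc k"] that by (auto simp: g_def m_def)
    show "G \<inter> {g k<..<g (Suc k)} = {}" if k: "k < m" for k
    proof (rule ccontr)
      assume "G \<inter> {g k<..<g (Suc k)} \<noteq> {}"
      then obtain a where a: "a \<in> G" "g k < a" "a < g (Suc k)" by auto
      then have "a \<in> A" using A0[OF inA[of k]] A0[OF inA[of "Suc k"]] k by (auto simp: A_def)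
      then obtain j where j: "j \<le> m" "a = g j" using idx by blast
      then have "\<not> j \<le> k" "\<not> Suc k \<le> j" using a mono[of j k] mono[of "Suc k" j] k by auto
      then show False by simp
    qed
    show "G \<inter> {0..t} \<subseteq> g ` {..m}"
    proof
      fix a assume "a \<in> G \<inter> {0..t}"
      then have "a \<in> A" by (simp add: A_def)
      from idx[OF this] show "a \<in> g ` {..m}" by auto
    qed
  qed (rule mono)
  then show ?thesis by blast
qed

definition sup_sq :: "real \<Rightarrow> (real \<Rightarrow> 'w \<Rightarrow> 'h::real_normed_vector) \<Rightarrow> 'w \<Rightarrow> ennreal" where
  "sup_sq t Z w = (SUP s\<in>{0..t}. nsq (Z s w))"

text \<open>Reduces suprema over an interval to countable ones, which are measurable and accessible
  to monotone convergence.\<close>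

lemma SUP_norm_sq_dense:
  fixes f :: "'a::metric_space \<Rightarrow> 'h::real_normed_vector"
  assumes cont: "continuous_on A f" and D: "D \<subseteq> A" "A \<subseteq> closure D"
  shows "(SUP s\<in>A. nsq (f s)) = (SUP s\<in>D. nsq (f s))"
proof (rule antisym)
  show "(SUP s\<in>A. nsq (f s)) \<le> (SUP s\<in>D. nsq (f s))"
  proof (rule SUP_least)
    fix s assume s: "s \<in> A"
    then have "s \<in> closure D" using D(2) by blast
    then have "\<exists>d. (\<forall>n. d n \<in> D) \<and> d \<longlonglongrightarrow> s" by (simp add: closure_sequential)
    then obtain d where d: "\<And>n. d n \<in> D" "d \<longlonglongrightarrow> s" by blast
    have "(\<lambda>n. f (d n)) \<longlonglongrightarrow> f s"
      by (rule continuous_on_tendsto_compose[OF cont d(2) s], rule always_eventually) (use d D in auto)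
    then have "(\<lambda>n. nsq (f (d n))) \<longlonglongrightarrow> nsq (f s)"
      by (intro tendsto_ennrealI tendsto_intros)
    then show "nsq (f s) \<le> (SUP s\<in>D. nsq (f s))"
      by (rule LIMSEQ_le_const2) (auto intro!: SUP_upper d)
  qed
  show "(SUP s\<in>D. nsq (f s)) \<le> (SUP s\<in>A. nsq (f s))"
    using D by (intro SUP_subset_mono) auto
qed

context brownian_setting
begin

abbreviation MT :: "real \<Rightarrow> ('w \<times> real) measure" where
  "MT t \<equiv> M \<Otimes>\<^sub>M restrict_space borel {0..t}"

abbreviation E_sup :: "real \<Rightarrow> (real \<Rightarrow> 'w \<Rightarrow> 'h::real_normed_vector) \<Rightarrow> ennreal" where
  "E_sup t Z \<equiv> (\<integral>\<^sup>+w. sup_sq t Z w \<partial>M)"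

definition cprocess :: "(real \<Rightarrow> 'w \<Rightarrow> 'h::real_normed_vector) \<Rightarrow> bool" where
  "cprocess Z \<longleftrightarrow> (\<forall>t\<in>{0..T}. Z t \<in> borel_measurable (F t)) \<and>
     (\<forall>w\<in>space M. continuous_on {0..T} (\<lambda>t. Z t w))"

lemma cprocessD:
  assumes "cprocess Z" "0 \<le> t" "t \<le> T"
  shows "Z t \<in> borel_measurable (F t)" "Z t \<in> borel_measurable M"
proof -
  show "Z t \<in> borel_measurable (F t)" using assms by (simp add: cprocess_def)
  then show "Z t \<in> borel_measurable M" by (rule measurable_F_M[OF _ assms(2,3)])
qed

lemma sup_sq_measurable:
  fixes Z :: "real \<Rightarrow> 'w \<Rightarrow> 'h::{real_normed_vector, second_countable_topology}"
  assumes Z: "cprocess Z" and t: "t \<le> T"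
  shows "sup_sq t Z \<in> borel_measurable M"
proof -
  obtain D where D: "countable D" "D \<subseteq> {0..t}" "{0..t} \<subseteq> closure D" by (rule separable)
  have "(\<lambda>w. SUP s\<in>D. nsq (Z s w)) \<in> borel_measurable M"
  proof (rule borel_measurable_SUP[OF D(1)])
    fix s assume "s \<in> D"
    then have [measurable]: "Z s \<in> borel_measurable M" using cprocessD[OF Z, of s] D t by auto
    show "(\<lambda>w. nsq (Z s w)) \<in> borel_measurable M" by measurable
  qed
  moreover have "sup_sq t Z w = (SUP s\<in>D. nsq (Z s w))" if "w \<in> space M" for w
    unfolding sup_sq_def using D t Z that
    by (intro SUP_norm_sq_dense) (auto simp: cprocess_def intro: continuous_on_subset)
  ultimately show ?thesis by (simp cong: measurable_cong)
qed

text \<open>On \<open>(u, v]\<close>, \<open>Z\<close> is the stochastic convolution of \<open>\<Psi>\<close>, started at \<open>Z u\<close>. In \<open>qstep\<close> the breakpoints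
  \<open>G\<close> are not tied to one partition, so that linear combinations only need a union of breakpoints.\<close>

definition qpiece :: "(real \<Rightarrow> 'h \<Rightarrow> 'h) \<Rightarrow> (real \<Rightarrow> 'w \<Rightarrow> 'h::{real_inner, banach, second_countable_topology}) \<Rightarrow>
    ('w \<Rightarrow> real \<Rightarrow> 'h) \<Rightarrow> real \<Rightarrow> real \<Rightarrow> ('w \<Rightarrow> 'h) \<Rightarrow> bool" where
  "qpiece S Z \<Psi> u v X \<longleftrightarrow> X \<in> borel_measurable (F u) \<and> (\<exists>K. \<forall>w\<in>space M. norm (X w) \<le> K) \<and>
     (\<forall>w\<in>space M. \<forall>s\<in>{u<..v}. Z s w = S (s - u) (Z u w + (B s w - B u w) *\<^sub>R X w) \<and> \<Psi> w s = S (s - u) (X w))"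

definition qstep :: "(real \<Rightarrow> 'h \<Rightarrow> 'h) \<Rightarrow> real set \<Rightarrow> (real \<Rightarrow> 'w \<Rightarrow> 'h::{real_inner, banach, second_countable_topology}) \<Rightarrow>
    ('w \<Rightarrow> real \<Rightarrow> 'h) \<Rightarrow> bool" where
  "qstep S G Z \<Psi> \<longleftrightarrow> finite G \<and> (\<forall>w\<in>space M. Z 0 w = 0) \<and>
     (\<forall>u v. 0 \<le> u \<and> u < v \<and> v \<le> T \<and> G \<inter> {u<..<v} = {} \<longrightarrow> (\<exists>X. qpiece S Z \<Psi> u v X))"

lemma qpieceD:
  assumes "qpiece S Z \<Psi> u v X"
  shows "X \<in> borel_measurable (F u)" "\<exists>K. \<forall>w\<in>space M. norm (X w) \<le> K"
    "w \<in> space M \<Longrightarrow> u < s \<Longrightarrow> s \<le> v \<Longrightarrow> Z s w = S (s - u) (Z u w + (B s w - B u w) *\<^sub>R X w)"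
    "w \<in> space M \<Longrightarrow> u < s \<Longrightarrow> s \<le> v \<Longrightarrow> \<Psi> w s = S (s - u) (X w)"
  using assms unfolding qpiece_def by auto

lemma qstepD:
  assumes "qstep S G Z \<Psi>" "0 \<le> u" "u < v" "v \<le> T" "G \<inter> {u<..<v} = {}"
  shows "\<exists>X. qpiece S Z \<Psi> u v X"
  using assms unfolding qstep_def by blast

lemma qstep_finite: "qstep S G Z \<Psi> \<Longrightarrow> finite G"
  and qstep_zero: "qstep S G Z \<Psi> \<Longrightarrow> w \<in> space M \<Longrightarrow> Z 0 w = 0"
  by (auto simp: qstep_def)

lemma qstep_lincomb:
  assumes S: "qc_semigroup S \<mu>" and 1: "qstep S G Z \<Psi>" and 2: "qstep S G' Z' \<Psi>'"
  shows "qstep S (G \<union> G') (\<lambda>t w. c *\<^sub>R Z t w + d *\<^sub>R Z' t w) (\<lambda>w s. c *\<^sub>R \<Psi> w s + d *\<^sub>R \<Psi>' w s)"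
  unfolding qstep_def
proof (intro conjI allI impI)
  show "finite (G \<union> G')" using 1 2 by (simp add: qstep_def)
  show "\<forall>w\<in>space M. c *\<^sub>R Z 0 w + d *\<^sub>R Z' 0 w = 0" using 1 2 by (simp add: qstep_def)
  fix u v assume uv: "0 \<le> u \<and> u < v \<and> v \<le> T \<and> (G \<union> G') \<inter> {u<..<v} = {}"
  interpret qc_semigroup S \<mu> by (rule S)
  from uv have "G \<inter> {u<..<v} = {}" "G' \<inter> {u<..<v} = {}" by auto
  then obtain X X' where X: "qpiece S Z \<Psi> u v X" and X': "qpiece S Z' \<Psi>' u v X'"
    using qstepD[OF 1, of u v] qstepD[OF 2, of u v] uv by auto
  obtain K K' where K: "\<And>w. w \<in> space M \<Longrightarrow> norm (X w) \<le> K" "\<And>w. w \<in> space M \<Longrightarrow> norm (X' w) \<le> K'"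
    using qpieceD(2)[OF X] qpieceD(2)[OF X'] by auto
  have "qpiece S (\<lambda>t w. c *\<^sub>R Z t w + d *\<^sub>R Z' t w) (\<lambda>w s. c *\<^sub>R \<Psi> w s + d *\<^sub>R \<Psi>' w s) u v (\<lambda>w. c *\<^sub>R X w + d *\<^sub>R X' w)"
    unfolding qpiece_def
  proof (intro conjI exI[of _ "\<bar>c\<bar> * K + \<bar>d\<bar> * K'"] ballI)
    show "(\<lambda>w. c *\<^sub>R X w + d *\<^sub>R X' w) \<in> borel_measurable (F u)"
      using qpieceD(1)[OF X] qpieceD(1)[OF X'] by measurable
    fix w assume w: "w \<in> space M"
    have "norm (c *\<^sub>R X w + d *\<^sub>R X' w) \<le> norm (c *\<^sub>R X w) + norm (d *\<^sub>R X' w)" by (rule norm_triangle_ineq)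
    also have "\<dots> \<le> \<bar>c\<bar> * K + \<bar>d\<bar> * K'" using K[OF w] by (auto intro!: add_mono mult_left_mono)
    finally show "norm (c *\<^sub>R X w + d *\<^sub>R X' w) \<le> \<bar>c\<bar> * K + \<bar>d\<bar> * K'" .
    fix s assume s: "s \<in> {u<..v}"
    show "c *\<^sub>R Z s w + d *\<^sub>R Z' s w = S (s - u) (c *\<^sub>R Z u w + d *\<^sub>R Z' u w + (B s w - B u w) *\<^sub>R (c *\<^sub>R X w + d *\<^sub>R X' w))"
      using qpieceD(3)[OF X w, of s] qpieceD(3)[OF X' w, of s] s
      by (simp add: S_plus S_scale scaleR_add_right mult.commute)
    show "c *\<^sub>R \<Psi> w s + d *\<^sub>R \<Psi>' w s = S (s - u) (c *\<^sub>R X w + d *\<^sub>R X' w)"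
      using qpieceD(4)[OF X w, of s] qpieceD(4)[OF X' w, of s] s by (simp add: S_plus S_scale)
  qed
  then show "\<exists>X. qpiece S (\<lambda>t w. c *\<^sub>R Z t w + d *\<^sub>R Z' t w) (\<lambda>w s. c *\<^sub>R \<Psi> w s + d *\<^sub>R \<Psi>' w s) u v X" by blast
qed

end

lemma is_grid_cover:
  assumes g: "is_grid G t m g" and s: "0 < s" "s \<le> t"
  shows "\<exists>k<m. s \<in> {g k<..g (Suc k)}"
proof -
  note g = is_gridD[OF g]
  define j where "j = (LEAST j. s \<le> g j)"
  have 1: "s \<le> g j" unfolding j_def by (rule LeastI[of _ m]) (use s g in simp)
  have jm: "j \<le> m" unfolding j_def by (rule Least_le) (use s g in simp)
  have "j \<noteq> 0" using 1 s g(1) by (metis not_le)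
  then obtain k where k: "j = Suc k" by (cases j) auto
  have "\<not> s \<le> g k" using not_less_Least[of k "\<lambda>j. s \<le> g j"] k by (simp add: j_def[symmetric])
  then show ?thesis using 1 k jm by (intro exI[of _ k]) auto
qed

lemma is_grid_disjoint:
  assumes g: "is_grid G t m g" and k: "k < m" "s \<in> {g k<..g (Suc k)}" and j: "j < m" "j \<noteq> k"
  shows "s \<notin> {g j<..g (Suc j)}"
proof (cases "j < k")
  case True
  then show ?thesis using is_gridD(4)[OF g, of "Suc j" k] k by auto
next
  case False
  then show ?thesis using is_gridD(4)[OF g, of "Suc k" j] k j by auto
qed

lemma is_grid_sum:
  fixes f :: "nat \<Rightarrow> 'a::comm_monoid_add"
  assumes g: "is_grid G t m g" and k: "k < m" "s \<in> {g k<..g (Suc k)}"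
  shows "(\<Sum>j<m. if s \<in> {g j<..g (Suc j)} then f j else 0) = f k"
proof -
  have "(\<Sum>j<m. if s \<in> {g j<..g (Suc j)} then f j else 0) = (\<Sum>j<m. if j = k then f k else 0)"
    by (rule sum.cong) (use is_grid_disjoint[OF g k] k in auto)
  then show ?thesis using k by simp
qed

lemma is_grid_nn_integral:
  assumes g: "is_grid G t m g"
    and f: "\<And>k s. k < m \<Longrightarrow> g k < s \<Longrightarrow> s \<le> g (Suc k) \<Longrightarrow> f s = ennreal (c k)" and c: "\<And>k. 0 \<le> c k"
  shows "(\<integral>\<^sup>+s\<in>{0..t}. f s \<partial>lborel) = ennreal (\<Sum>k<m. (g (Suc k) - g k) * c k)"
proof -
  note gd = is_gridD[OF g]
  have gp: "0 \<le> g (Suc k) - g k" if "k < m" for k using gd(3)[OF that] by simp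
  \<comment> \<open>The cells are open on the left, so together they miss exactly the point 0 of
    [0, t].\<close>
  have "AE s in lborel. f s * indicator {0..t} s = (\<Sum>k<m. ennreal (c k) * indicator {g k<..g (Suc k)} s)"
    using AE_lborel_singleton[of 0]
  proof eventually_elim
    fix s :: real assume "s \<noteq> 0"
    show "f s * indicator {0..t} s = (\<Sum>k<m. ennreal (c k) * indicator {g k<..g (Suc k)} s)"
    proof (cases "s \<in> {0..t}")
      case True
      then obtain k where k: "k < m" "s \<in> {g k<..g (Suc k)}"
        using is_grid_cover[OF g, of s] \<open>s \<noteq> 0\<close> by auto
      have "(\<Sum>j<m. ennreal (c j) * indicator {g j<..g (Suc j)} s) = (\<Sum>j<m. if s \<in> {g j<..g (Suc j)} then ennreal (c j) else 0)"
        by (rule sum.cong) auto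
      also have "\<dots> = ennreal (c k)" by (rule is_grid_sum[OF g k])
      finally show ?thesis using True f[OF k(1), of s] k by simp
    next
      case False
      have "s \<notin> {g k<..g (Suc k)}" if "k < m" for k
        using False gd(4)[of 0 k] gd(4)[of "Suc k" m] gd(1,2) that by auto
      then show ?thesis using False by (simp add: sum.neutral)
    qed
  qed
  then have "(\<integral>\<^sup>+s\<in>{0..t}. f s \<partial>lborel) = (\<integral>\<^sup>+s. (\<Sum>k<m. ennreal (c k) * indicator {g k<..g (Suc k)} s) \<partial>lborel)"
    by (rule nn_integral_cong_AE)
  also have "\<dots> = (\<Sum>k<m. \<integral>\<^sup>+s. ennreal (c k) * indicator {g k<..g (Suc k)} s \<partial>lborel)"
    by (rule nn_integral_sum) measurable
  also have "\<dots> = (\<Sum>k<m. ennreal ((g (Suc k) - g k) * c k))"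
  proof (rule sum.cong[OF refl])
    fix k assume "k \<in> {..<m}"
    then show "(\<integral>\<^sup>+s. ennreal (c k) * indicator {g k<..g (Suc k)} s \<partial>lborel) = ennreal ((g (Suc k) - g k) * c k)"
      using gp[of k] c by (subst nn_integral_cmult_indicator) (auto simp: ennreal_mult mult.commute)
  qed
  also have "\<dots> = ennreal (\<Sum>k<m. (g (Suc k) - g k) * c k)"
    using gp c by (intro sum_ennreal) auto
  finally show ?thesis .
qed

context brownian_setting
begin

lemma qstep_cprocess:
  assumes S: "qc_semigroup S \<mu>" and q: "qstep S G Z \<Psi>"
  shows "cprocess Z"
proof -
  interpret qc_semigroup S \<mu> by (rule S)
  have ad: "Z t \<in> borel_measurable (F t)" if t: "0 \<le> t" "t \<le> T" for t
  proof -
    obtain m g where "is_grid G t m g" using is_grid_exists[OF qstep_finite[OF q] t(1)] by blast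
    note g = is_gridD[OF this]
    have gb: "0 \<le> g k" "g k \<le> T" if "k \<le> m" for k using g(4)[of 0 k] g(4)[of k m] g(1,2) that t by auto
    have "k \<le> m \<Longrightarrow> Z (g k) \<in> borel_measurable (F (g k))" for k
    proof (induction k)
      case 0
      show ?case unfolding g(1)
        by (subst measurable_cong[where g = "\<lambda>_. 0"]) (use qstep_zero[OF q] space_F[of 0] T in auto)
    next
      case (Suc k)
      then have k: "k < m" by simp
      have b: "0 \<le> g k" "g k < g (Suc k)" "g (Suc k) \<le> T" "g k \<le> g (Suc k)" "0 \<le> g (Suc k)"
        using gb[of k] gb[of "Suc k"] g(3)[OF k] k by auto
      obtain X where X: "qpiece S Z \<Psi> (g k) (g (Suc k)) X" using qstepD[OF q b(1-3) g(5)[OF k]] by blast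
      have [measurable]: "X \<in> borel_measurable (F (g (Suc k)))" "B (g k) \<in> borel_measurable (F (g (Suc k)))"
        "B (g (Suc k)) \<in> borel_measurable (F (g (Suc k)))" "Z (g k) \<in> borel_measurable (F (g (Suc k)))"
        "S (g (Suc k) - g k) \<in> borel_measurable borel"
        using measurable_F_mono[OF qpieceD(1)[OF X]] measurable_F_mono[OF B_meas[of "g k"]] B_meas[of "g (Suc k)"]
          measurable_F_mono[OF Suc.IH] b k by auto
      have "(\<lambda>w. S (g (Suc k) - g k) (Z (g k) w + (B (g (Suc k)) w - B (g k) w) *\<^sub>R X w)) \<in> borel_measurable (F (g (Suc k)))"
        by measurable
      then show ?case
        by (subst measurable_cong[OF qpieceD(3)[OF X]]) (use b space_F[of "g (Suc k)"] in auto)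
    qed
    from this[of m] show ?thesis by (simp add: g)
  qed
  moreover have "continuous_on {0..T} (\<lambda>t. Z t w)" if w: "w \<in> space M" for w
  proof -
    obtain m g where "is_grid G T m g" using is_grid_exists[OF qstep_finite[OF q] less_imp_le[OF T]] by blast
    note g = is_gridD[OF this]
    have gb: "0 \<le> g k" "g k \<le> T" if "k \<le> m" for k using g(4)[of 0 k] g(4)[of k m] g(1,2) that by auto
    have "k \<le> m \<Longrightarrow> continuous_on {0..g k} (\<lambda>t. Z t w)" for k
    proof (induction k)
      case (Suc k)
      then have k: "k < m" by simp
      have b: "0 \<le> g k" "g k < g (Suc k)" "g (Suc k) \<le> T" using gb[of k] gb[of "Suc k"] g(3)[OF k] k by auto
      obtain X where X: "qpiece S Z \<Psi> (g k) (g (Suc k)) X" using qstepD[OF q b g(5)[OF k]] by blast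
      have "continuous_on {g k..g (Suc k)} (\<lambda>s. S (s - g k) (Z (g k) w + (B s w - B (g k) w) *\<^sub>R X w))"
        by (intro S_continuous_on continuous_intros continuous_on_subset[OF B_cont[OF w]]) (use b in auto)
      then have "continuous_on {g k..g (Suc k)} (\<lambda>t. Z t w)"
      proof (subst continuous_on_cong[OF refl])
        fix s assume "s \<in> {g k..g (Suc k)}"
        then show "Z s w = S (s - g k) (Z (g k) w + (B s w - B (g k) w) *\<^sub>R X w)"
          using qpieceD(3)[OF X w, of s] by (cases "s = g k") (auto simp: S_0)
      qed
      then have "continuous_on ({0..g k} \<union> {g k..g (Suc k)}) (\<lambda>t. Z t w)"
        using Suc by (intro continuous_on_closed_Un) auto
      moreover have "{0..g k} \<union> {g k..g (Suc k)} = {0..g (Suc k)}" using b by auto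
      ultimately show ?case by simp
    qed (simp add: g)
    from this[of m] show ?thesis by (simp add: g)
  qed
  ultimately show ?thesis by (simp add: cprocess_def)
qed

lemma qstep_pieces:
  assumes q: "qstep S G Z \<Psi>" and g: "is_grid G t m g" and t: "0 \<le> t" "t \<le> T"
  shows "\<exists>X K. \<forall>k<m. qpiece S Z \<Psi> (g k) (g (Suc k)) (X k) \<and> (\<forall>w\<in>space M. norm (X k w) \<le> K)"
proof -
  note gd = is_gridD[OF g]
  have gb: "0 \<le> g k" "g k \<le> t" "g k \<le> T" if "k \<le> m" for k using gd(4)[of 0 k] gd(4)[of k m] gd(1,2) that t by auto
  have "\<forall>k. \<exists>X. k < m \<longrightarrow> qpiece S Z \<Psi> (g k) (g (Suc k)) X"
    using qstepD[OF q, of "g k" "g (Suc k)" for k] gb gd(3,5) by auto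
  then have "\<exists>X. \<forall>k. k < m \<longrightarrow> qpiece S Z \<Psi> (g k) (g (Suc k)) (X k)" by (rule choice)
  then obtain X where X: "\<And>k. k < m \<Longrightarrow> qpiece S Z \<Psi> (g k) (g (Suc k)) (X k)" by blast
  have "\<forall>k. \<exists>K. k < m \<longrightarrow> (\<forall>w\<in>space M. norm (X k w) \<le> K)" using qpieceD(2)[OF X] by blast
  then have "\<exists>K. \<forall>k. k < m \<longrightarrow> (\<forall>w\<in>space M. norm (X k w) \<le> K k)" by (rule choice)
  then obtain K where K: "\<And>k w. k < m \<Longrightarrow> w \<in> space M \<Longrightarrow> norm (X k w) \<le> K k" by blast
  have "norm (X k w) \<le> (\<Sum>k<m. \<bar>K k\<bar>)" if k: "k < m" "w \<in> space M" for k w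
    using member_le_sum[of k "{..<m}" "\<lambda>k. \<bar>K k\<bar>"] K[OF k] k by simp
  with X show ?thesis by (intro exI[of _ X] exI[of _ "\<Sum>k<m. \<bar>K k\<bar>"]) blast
qed

text \<open>Multiplication by exp (- \<mu> \<open>g k\<close>) turns the transition from one grid
  point to the next into a contraction, so \<open>discrete_maximal\<close> applies to
  \<open>W\<close>. The observation times D are made grid points. Undoing the scaling costs exp (2
  \<mu> T).\<close>

lemma qstep_maximal_finite:
  assumes S: "qc_semigroup S \<mu>" and q: "qstep S G Z \<Psi>" and t: "0 \<le> t" "t \<le> T"
    and D: "finite D" "D \<subseteq> {0..t}"
  shows "(\<integral>\<^sup>+w. (SUP s\<in>D. nsq (Z s w)) \<partial>M)
    \<le> ennreal (18 * exp (2 * \<mu> * T)) * (\<integral>\<^sup>+w. path_sq t (\<Psi> w) \<partial>M)"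
proof -
  interpret qc_semigroup S \<mu> by (rule S)
  have Z: "cprocess Z" by (rule qstep_cprocess[OF S q])
  have "finite (G \<union> D)" using qstep_finite[OF q] D by simp
  then obtain m g where G: "is_grid (G \<union> D) t m g" using is_grid_exists[OF _ t(1)] by blast
  note g = is_gridD[OF G]
  note gD = g(6)
  have gb: "0 \<le> g k" "g k \<le> t" "g k \<le> T" if "k \<le> m" for k using g(4)[of 0 k] g(4)[of k m] g(1,2) that t by auto
  obtain X K where XK: "\<forall>k<m. qpiece S Z \<Psi> (g k) (g (Suc k)) (X k) \<and> (\<forall>w\<in>space M. norm (X k w) \<le> K)"
    using qstep_pieces[OF _ G t, of S Z \<Psi>] q D(1) by (auto simp: qstep_def Int_Un_distrib2)
  have X: "\<And>k. k < m \<Longrightarrow> qpiece S Z \<Psi> (g k) (g (Suc k)) (X k)"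
    and K: "\<And>k w. k < m \<Longrightarrow> w \<in> space M \<Longrightarrow> norm (X k w) \<le> K" using XK by blast+
  define W where "W k w = exp (- \<mu> * g k) *\<^sub>R Z (g k) w" for k w
  define C where "C k h = exp (- \<mu> * (g (Suc k) - g k)) *\<^sub>R S (g (Suc k) - g k) h" for k h
  define x where "x k w = exp (- \<mu> * g (Suc k)) *\<^sub>R S (g (Suc k) - g k) (X k w)" for k w
  have gp: "0 \<le> g (Suc k) - g k" if "k < m" for k using g(3)[OF that] by simp
  \<comment> \<open>The coefficient of the k-th increment is transported to the right end of the
    cell. It equals the value of \<Psi> at any s of the cell, carried on from s, and the scaling
    outweighs the growth on the way; so it is dominated on the whole cell.\<close>
  have xb: "norm (x k w) \<le> norm (\<Psi> w s)" if k: "k < m" and w: "w \<in> space M" and s: "s \<in> {g k<..g (Suc k)}" for k w s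
  proof -
    have "S (g (Suc k) - g k) (X k w) = S (g (Suc k) - s) (S (s - g k) (X k w))"
      using S_add[of "g (Suc k) - s" "s - g k"] s by simp
    also have "S (s - g k) (X k w) = \<Psi> w s" using qpieceD(4)[OF X[OF k] w] s by simp
    finally have "norm (x k w) = exp (- \<mu> * g (Suc k)) * norm (S (g (Suc k) - s) (\<Psi> w s))" by (simp add: x_def)
    also have "\<dots> \<le> exp (- \<mu> * g (Suc k)) * (exp (\<mu> * (g (Suc k) - s)) * norm (\<Psi> w s))"
      by (intro mult_left_mono S_norm) (use s in auto)
    also have "\<dots> = exp (- \<mu> * s) * norm (\<Psi> w s)"
      by (simp only: mult.assoc[symmetric] mult_exp_exp) (simp add: algebra_simps)
    also have "\<dots> \<le> 1 * norm (\<Psi> w s)"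
      by (intro mult_right_mono) (use s gb[of k] k \<mu> in auto)
    finally show ?thesis by simp
  qed
  have "(\<integral>\<^sup>+w. (SUP k\<in>{..m}. nsq (W k w)) \<partial>M)
    \<le> 18 * (\<integral>\<^sup>+w. (\<Sum>k<m. ennreal ((g (Suc k) - g k) * (norm (x k w))\<^sup>2)) \<partial>M)"
  proof (rule discrete_maximal[where C = C and K = "exp (\<mu> * T) * K"])
    show "0 \<le> g k \<and> g k \<le> T" if "k \<le> m" for k using gb[OF that] by simp
    show "g k \<le> g (Suc k)" if "k < m" for k using g(3)[OF that] by simp
    show "W 0 w = 0" if "w \<in> space M" for w using qstep_zero[OF q that] by (simp add: W_def g)
    show "W (Suc k) w = C k (W k w) + (B (g (Suc k)) w - B (g k) w) *\<^sub>R x k w" if k: "k < m" and w: "w \<in> space M" for k w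
    proof -
      have "C k (W k w) = exp (- \<mu> * g (Suc k)) *\<^sub>R S (g (Suc k) - g k) (Z (g k) w)"
        using gp[OF k] by (simp add: C_def W_def S_scale mult_exp_exp algebra_simps)
      moreover have "Z (g (Suc k)) w = S (g (Suc k) - g k) (Z (g k) w) + (B (g (Suc k)) w - B (g k) w) *\<^sub>R S (g (Suc k) - g k) (X k w)"
        using qpieceD(3)[OF X[OF k] w, of "g (Suc k)"] g(3)[OF k] by (simp add: S_plus S_scale)
      moreover have "W (Suc k) w = exp (- \<mu> * g (Suc k)) *\<^sub>R Z (g (Suc k)) w" by (simp add: W_def)
      ultimately show ?thesis by (simp add: x_def scaleR_add_right mult.commute)
    qed
    show "norm (C k h) \<le> norm h" if "k < m" for k h
    proof -
      have "norm (C k h) \<le> exp (- \<mu> * (g (Suc k) - g k)) * (exp (\<mu> * (g (Suc k) - g k)) * norm h)"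
        unfolding C_def norm_scaleR using gp[OF that] by (auto intro!: mult_left_mono S_norm)
      also have "\<dots> = norm h" by (simp add: mult.assoc[symmetric] mult_exp_exp)
      finally show ?thesis .
    qed
    show "C k \<in> borel_measurable borel" if "k < m" for k
      unfolding C_def[abs_def] using S_measurable[OF gp[OF that]] by measurable
    show "x k \<in> borel_measurable (F (g k))" if "k < m" for k
      unfolding x_def[abs_def] using S_measurable[OF gp[OF that]] qpieceD(1)[OF X[OF that]] by measurable
    show "norm (x k w) \<le> exp (\<mu> * T) * K" if k: "k < m" and w: "w \<in> space M" for k w
    proof -
      have "norm (x k w) \<le> 1 * norm (S (g (Suc k) - g k) (X k w))"
        unfolding x_def norm_scaleR by (intro mult_right_mono) (use \<mu> gb[of "Suc k"] k in auto)
      also have "\<dots> \<le> 1 * (exp (\<mu> * T) * K)"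
        by (intro mult_left_mono order_trans[OF S_norm_le[of _ T]])
          (use gp[OF k] gb[of k] gb[of "Suc k"] k K[OF k w] in auto)
      finally show ?thesis by simp
    qed
  qed
  also have "(\<integral>\<^sup>+w. (\<Sum>k<m. ennreal ((g (Suc k) - g k) * (norm (x k w))\<^sup>2)) \<partial>M)
    \<le> (\<integral>\<^sup>+w. path_sq t (\<Psi> w) \<partial>M)"
  proof (rule nn_integral_mono, goal_cases)
    case w: (1 w)
    let ?f = "\<lambda>s. \<Sum>j<m. if s \<in> {g j<..g (Suc j)} then nsq (x j w) else 0"
    have "(\<Sum>k<m. ennreal ((g (Suc k) - g k) * (norm (x k w))\<^sup>2)) = ennreal (\<Sum>k<m. (g (Suc k) - g k) * (norm (x k w))\<^sup>2)"
      using gp by (intro sum_ennreal) auto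
    also have "\<dots> = (\<integral>\<^sup>+s\<in>{0..t}. ?f s \<partial>lborel)"
      by (rule is_grid_nn_integral[OF G, symmetric]) (use is_grid_sum[OF G, of _ _ "\<lambda>j. nsq (x j w)"] in auto)
    also have "\<dots> \<le> path_sq t (\<Psi> w)"
    proof (rule nn_integral_mono_AE, use AE_lborel_singleton[of 0] in eventually_elim)
      case (elim s)
      show ?case
      proof (cases "s \<in> {0..t}")
        case True
        then obtain k where k: "k < m" "s \<in> {g k<..g (Suc k)}" using is_grid_cover[OF G, of s] elim by auto
        have "nsq (x k w) \<le> nsq (\<Psi> w s)" by (intro ennreal_leI power_mono xb[OF k(1) w k(2)]) auto
        then show ?thesis using is_grid_sum[OF G k, of "\<lambda>j. nsq (x j w)"] True by simp
      qed simp
    qed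
    finally show ?case .
  qed
  finally have main: "(\<integral>\<^sup>+w. (SUP k\<in>{..m}. nsq (W k w)) \<partial>M)
    \<le> 18 * (\<integral>\<^sup>+w. path_sq t (\<Psi> w) \<partial>M)"
    by (simp add: mult_left_mono)
  have "(\<integral>\<^sup>+w. (SUP s\<in>D. nsq (Z s w)) \<partial>M)
    \<le> (\<integral>\<^sup>+w. ennreal (exp (2 * \<mu> * T)) * (SUP k\<in>{..m}. nsq (W k w)) \<partial>M)"
  proof (intro nn_integral_mono SUP_least)
    fix w s assume "w \<in> space M" and s: "s \<in> D"
    then obtain k where k: "k \<le> m" "s = g k" using gD D(2) by blast
    have "(norm (Z s w))\<^sup>2 = exp (2 * \<mu> * s) * (norm (W k w))\<^sup>2"
      by (simp add: W_def k power_mult_distrib exp_double[symmetric] mult.assoc[symmetric] mult_exp_exp)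
    also have "\<dots> \<le> exp (2 * \<mu> * T) * (norm (W k w))\<^sup>2"
      by (intro mult_right_mono) (use gb[OF k(1)] k \<mu> in \<open>auto intro!: mult_left_mono\<close>)
    finally have "nsq (Z s w) \<le> ennreal (exp (2 * \<mu> * T)) * nsq (W k w)"
      by (simp add: ennreal_mult[symmetric] ennreal_leI)
    also have "\<dots> \<le> ennreal (exp (2 * \<mu> * T)) * (SUP k\<in>{..m}. nsq (W k w))"
      using k by (intro mult_left_mono SUP_upper) auto
    finally show "nsq (Z s w) \<le> ennreal (exp (2 * \<mu> * T)) * (SUP k\<in>{..m}. nsq (W k w))" .
  qed
  also have "\<dots> = ennreal (exp (2 * \<mu> * T)) * (\<integral>\<^sup>+w. (SUP k\<in>{..m}. nsq (W k w)) \<partial>M)"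
  proof (rule nn_integral_cmult, rule borel_measurable_SUP)
    fix k assume "k \<in> {..m}"
    then have [measurable]: "Z (g k) \<in> borel_measurable M" using cprocessD(2)[OF Z] gb by simp
    show "(\<lambda>w. nsq (W k w)) \<in> borel_measurable M" unfolding W_def by measurable
  qed auto
  also have "\<dots> \<le> ennreal (exp (2 * \<mu> * T)) * (18 * (\<integral>\<^sup>+w. path_sq t (\<Psi> w) \<partial>M))"
    by (intro mult_left_mono main) auto
  also have "\<dots> = ennreal (18 * exp (2 * \<mu> * T)) * (\<integral>\<^sup>+w. path_sq t (\<Psi> w) \<partial>M)"
    by (simp add: ennreal_mult mult_ac)
  finally show ?thesis .
qed

text \<open>The bound for finite sets of times does not depend on the set. Monotone convergence
  extends it to a countable dense set, continuity of paths to the interval.\<close>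

lemma qstep_maximal:
  assumes S: "qc_semigroup S \<mu>" and q: "qstep S G Z \<Psi>" and t: "0 \<le> t" "t \<le> T"
  shows "E_sup t Z
    \<le> ennreal (18 * exp (2 * \<mu> * T)) * (\<integral>\<^sup>+w. path_sq t (\<Psi> w) \<partial>M)" (is "_ \<le> ?R")
proof -
  have Z: "cprocess Z" by (rule qstep_cprocess[OF S q])
  obtain D where D: "countable D" "D \<subseteq> {0..t}" "{0..t} \<subseteq> closure D" by (rule separable)
  have ne: "D \<noteq> {}" using D(3) t by auto
  define d where "d = from_nat_into D"
  have d: "range d = D" unfolding d_def by (rule range_from_nat_into[OF ne D(1)])
  have e: "sup_sq t Z w = (SUP n. SUP s\<in>d ` {..n}. nsq (Z s w))" if "w \<in> space M" for w
  proof -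
    have "sup_sq t Z w = (SUP s\<in>D. nsq (Z s w))"
      unfolding sup_sq_def using D t Z that
      by (intro SUP_norm_sq_dense) (auto simp: cprocess_def intro: continuous_on_subset)
    also have "D = (\<Union>n. d ` {..n})" unfolding d[symmetric] by blast
    also have "(SUP s\<in>(\<Union>n. d ` {..n}). nsq (Z s w)) = (SUP n. SUP s\<in>d ` {..n}. nsq (Z s w))"
      by (rule SUP_UNION)
    finally show ?thesis .
  qed
  have "E_sup t Z = (\<integral>\<^sup>+w. (SUP n. SUP s\<in>d ` {..n}. nsq (Z s w)) \<partial>M)"
    by (rule nn_integral_cong) (rule e)
  also have "\<dots> = (SUP n. \<integral>\<^sup>+w. (SUP s\<in>d ` {..n}. nsq (Z s w)) \<partial>M)"
  proof (rule nn_integral_monotone_convergence_SUP)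
    show "incseq (\<lambda>n w. SUP s\<in>d ` {..n}. nsq (Z s w))"
      unfolding incseq_def le_fun_def by (intro allI impI SUP_subset_mono) auto
    fix n
    show "(\<lambda>w. SUP s\<in>d ` {..n}. nsq (Z s w)) \<in> borel_measurable M"
    proof (rule borel_measurable_SUP)
      fix s assume "s \<in> d ` {..n}"
      then have "s \<in> D" using d by auto
      then have [measurable]: "Z s \<in> borel_measurable M" using cprocessD(2)[OF Z, of s] D(2) t by auto
      show "(\<lambda>w. nsq (Z s w)) \<in> borel_measurable M" by measurable
    qed (simp add: countable_finite)
  qed
  also have "\<dots> \<le> ?R"
  proof (rule SUP_least, rule qstep_maximal_finite[OF S q t])
    fix n
    have "d ` {..n} \<subseteq> D" using d by auto
    then show "d ` {..n} \<subseteq> {0..t}" using D(2) by blast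
  qed simp
  finally show ?thesis .
qed

end

lemma id_semigroup: "qc_semigroup (\<lambda>t u. u) 0"
  by (rule qc_semigroup.intro) (auto simp: bounded_linear_ident)

context brownian_setting
begin

text \<open>For a fixed end time t, the semigroup law makes S (t - s) \<Psi>(s) constant in s on
  each cell. This is the reason for letting the semigroup act inside step processes: their
  convolution at time t is exactly an elementary integral, without approximation.\<close>

lemma qstep_elementary:
  assumes S: "qc_semigroup S \<mu>" and q: "qstep S G Z \<Psi>" and t: "0 \<le> t" "t \<le> T"
  shows "\<exists>m g X. elementary F t m g X \<and>
    (\<forall>w\<in>space M. (\<forall>s\<in>{0<..t}. elem_process m g X w s = S (t - s) (\<Psi> w s)) \<and> elem_integral B m g X w = Z t w)"
proof -
  interpret qc_semigroup S \<mu> by (rule S)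
  obtain m g where G: "is_grid G t m g" using is_grid_exists[OF qstep_finite[OF q] t(1)] by blast
  note g = is_gridD[OF G]
  have gb: "0 \<le> g k" "g k \<le> t" "g k \<le> T" if "k \<le> m" for k using g(4)[of 0 k] g(4)[of k m] g(1,2) that t by auto
  obtain X K where XK: "\<forall>k<m. qpiece S Z \<Psi> (g k) (g (Suc k)) (X k) \<and> (\<forall>w\<in>space M. norm (X k w) \<le> K)"
    using qstep_pieces[OF q G t] by blast
  have X: "\<And>k. k < m \<Longrightarrow> qpiece S Z \<Psi> (g k) (g (Suc k)) (X k)"
    and K: "\<And>k w. k < m \<Longrightarrow> w \<in> space M \<Longrightarrow> norm (X k w) \<le> K" using XK by blast+
  define Y where "Y k w = S (t - g k) (X k w)" for k w
  have el: "elementary F t m g Y"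
    unfolding elementary_def
  proof (intro allI impI conjI)
    fix k assume k: "k < m"
    show "0 \<le> g k" "g k \<le> g (Suc k)" "g (Suc k) \<le> t" using gb[of k] gb[of "Suc k"] g(3)[OF k] k by auto
    have [measurable]: "S (t - g k) \<in> borel_measurable borel" "X k \<in> borel_measurable (F (g k))"
      using S_measurable[of "t - g k"] gb[of k] k qpieceD(1)[OF X[OF k]] by auto
    show "Y k \<in> borel_measurable (F (g k))" unfolding Y_def[abs_def] by measurable
    show "bounded (Y k ` space (F (g k)))"
      unfolding bounded_iff
    proof (intro exI[of _ "exp (\<mu> * T) * K"] ballI)
      fix y assume "y \<in> Y k ` space (F (g k))"
      then obtain w where w: "w \<in> space M" "y = Y k w" using space_F[of "g k"] gb[of k] k by auto
      have "norm y \<le> exp (\<mu> * T) * norm (X k w)"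
        unfolding w Y_def by (rule S_norm_le) (use gb[of k] k t in auto)
      also have "\<dots> \<le> exp (\<mu> * T) * K" by (intro mult_left_mono K k w) auto
      finally show "norm y \<le> exp (\<mu> * T) * K" .
    qed
  qed
  have pr: "elem_process m g Y w s = S (t - s) (\<Psi> w s)" if w: "w \<in> space M" and s: "s \<in> {0<..t}" for w s
  proof -
    obtain k where k: "k < m" "s \<in> {g k<..g (Suc k)}" using is_grid_cover[OF G, of s] s by auto
    have "elem_process m g Y w s = (\<Sum>j<m. if s \<in> {g j<..g (Suc j)} then Y j w else 0)"
      unfolding elem_process_def by (rule sum.cong) auto
    also have "\<dots> = Y k w" by (rule is_grid_sum[OF G k])
    also have "\<dots> = S (t - s) (S (s - g k) (X k w))"
      using S_add[of "t - s" "s - g k"] s k by (simp add: Y_def)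
    also have "S (s - g k) (X k w) = \<Psi> w s" using qpieceD(4)[OF X[OF k(1)] w, of s] k by simp
    finally show ?thesis .
  qed
  have int: "k \<le> m \<Longrightarrow> (\<Sum>j<k. (B (g (Suc j)) w - B (g j) w) *\<^sub>R Y j w) = S (t - g k) (Z (g k) w)"
    if w: "w \<in> space M" for w k
  proof (induction k)
    case 0
    show ?case using qstep_zero[OF q w] t by (simp add: g(1) S_zero)
  next
    case (Suc k)
    then have k: "k < m" by simp
    have "S (t - g (Suc k)) (Z (g (Suc k)) w)
        = S (t - g (Suc k)) (S (g (Suc k) - g k) (Z (g k) w + (B (g (Suc k)) w - B (g k) w) *\<^sub>R X k w))"
      using qpieceD(3)[OF X[OF k] w, of "g (Suc k)"] g(3)[OF k] by simp
    also have "\<dots> = S (t - g k) (Z (g k) w + (B (g (Suc k)) w - B (g k) w) *\<^sub>R X k w)"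
      using S_add[of "t - g (Suc k)" "g (Suc k) - g k"] gb[of "Suc k"] g(3)[OF k] Suc.prems by simp
    also have "\<dots> = S (t - g k) (Z (g k) w) + (B (g (Suc k)) w - B (g k) w) *\<^sub>R Y k w"
      using gb[of k] k by (simp add: S_plus S_scale Y_def)
    finally show ?case using Suc.IH k by simp
  qed
  have "elem_integral B m g Y w = Z t w" if "w \<in> space M" for w
    using int[OF that, of m] by (simp add: elem_integral_def g(2) S_0)
  with el pr show ?thesis by blast
qed

lemma elementaryD:
  assumes "elementary F t n \<tau> X" "i < n"
  shows "0 \<le> \<tau> i" "\<tau> i \<le> \<tau> (Suc i)" "\<tau> (Suc i) \<le> t" "X i \<in> borel_measurable (F (\<tau> i))" "\<tau> i \<le> t" "0 \<le> \<tau> (Suc i)"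
    "bounded (X i ` space (F (\<tau> i)))"
  using assms unfolding elementary_def by force+

text \<open>Each coefficient X i is switched on at its grid time and transported by the semigroup
  from there on; Z is the corresponding convolution written out. Between two neighbouring
  breakpoints every summand either gains the new increment or is merely transported.\<close>

lemma elementary_qstep_semigroup:
  fixes X :: "nat \<Rightarrow> 'w \<Rightarrow> 'h::{real_inner, banach, second_countable_topology}"
  assumes S: "qc_semigroup S \<mu>" and e: "elementary F t n \<tau> X" and t: "t \<le> T"
  shows "qstep S (\<tau> ` {..n})
    (\<lambda>s w. \<Sum>i<n. S (max 0 (s - \<tau> i)) ((B (min s (\<tau> (Suc i))) w - B (min s (\<tau> i)) w) *\<^sub>R X i w))
    (\<lambda>w s. \<Sum>i<n. indicat_real {\<tau> i<..\<tau> (Suc i)} s *\<^sub>R S (max 0 (s - \<tau> i)) (X i w))" (is "qstep S _ ?Z ?\<Psi>")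
proof -
  interpret qc_semigroup S \<mu> by (rule S)
  note \<tau> = elementaryD[OF e]
  have S_sum: "S r (\<Sum>i\<in>J. f i) = (\<Sum>i\<in>J. S r (f i))" if "0 \<le> r" for r J and f :: "nat \<Rightarrow> 'h"
    by (rule linear_sum[OF bounded_linear.linear[OF S_linear[OF that]]])
  have "\<exists>K. \<forall>w\<in>space M. norm (X i w) \<le> K" if "i < n" for i
    using \<tau>(7)[OF that] space_F[of "\<tau> i"] \<tau>[OF that] t unfolding bounded_iff by auto
  then have "\<forall>i. \<exists>K. i < n \<longrightarrow> (\<forall>w\<in>space M. norm (X i w) \<le> K)" by blast
  then have "\<exists>K. \<forall>i. i < n \<longrightarrow> (\<forall>w\<in>space M. norm (X i w) \<le> K i)" by (rule choice)
  then obtain K where K: "\<And>i w. i < n \<Longrightarrow> w \<in> space M \<Longrightarrow> norm (X i w) \<le> K i" by blast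
  show ?thesis
    unfolding qstep_def
  proof (intro conjI allI impI)
    show "\<forall>w\<in>space M. ?Z 0 w = 0"
      using \<tau>(1,6) by (auto simp: min_absorb1 S_zero intro!: sum.neutral)
    fix u v assume uv: "0 \<le> u \<and> u < v \<and> v \<le> T \<and> \<tau> ` {..n} \<inter> {u<..<v} = {}"
    have no: "\<tau> i \<le> u \<or> v \<le> \<tau> i" if "i \<le> n" for i
    proof -
      have "\<tau> i \<notin> {u<..<v}" using uv that by blast
      then show ?thesis by auto
    qed
    \<comment> \<open>The summands that are active throughout \<open>(u, v]\<close>. Since no
      breakpoint lies inside, a summand active at one time of this interval is active on all of
      it.\<close>
    define I where "I = {i. i < n \<and> \<tau> i \<le> u \<and> v \<le> \<tau> (Suc i)}"
    have fI: "finite I" "I \<subseteq> {..<n}" by (auto simp: I_def)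
    define Y where "Y w = (\<Sum>i\<in>I. S (u - \<tau> i) (X i w))" for w
    have "qpiece S ?Z ?\<Psi> u v Y"
      unfolding qpiece_def
    proof (intro conjI exI[of _ "\<Sum>i\<in>I. exp (\<mu> * T) * K i"] ballI)
      show "Y \<in> borel_measurable (F u)"
        unfolding Y_def[abs_def]
      proof (rule borel_measurable_sum)
        fix i assume "i \<in> I"
        then have [measurable]: "X i \<in> borel_measurable (F u)" "S (u - \<tau> i) \<in> borel_measurable borel"
          using measurable_F_mono[OF \<tau>(4), of i u] \<tau>(1) uv S_measurable[of "u - \<tau> i"] by (auto simp: I_def)
        show "(\<lambda>w. S (u - \<tau> i) (X i w)) \<in> borel_measurable (F u)" by measurable
      qed
      fix w assume w: "w \<in> space M"
      show "norm (Y w) \<le> (\<Sum>i\<in>I. exp (\<mu> * T) * K i)"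
        unfolding Y_def
      proof (rule order_trans[OF norm_sum sum_mono])
        fix i assume i: "i \<in> I"
        have "norm (S (u - \<tau> i) (X i w)) \<le> exp (\<mu> * T) * norm (X i w)"
          by (rule S_norm_le) (use i uv \<tau>(1)[of i] in \<open>auto simp: I_def\<close>)
        also have "\<dots> \<le> exp (\<mu> * T) * K i" using K[OF _ w, of i] i by (intro mult_left_mono) (auto simp: I_def)
        finally show "norm (S (u - \<tau> i) (X i w)) \<le> exp (\<mu> * T) * K i" .
      qed
      fix s assume s: "s \<in> {u<..v}"
      have split: "S (max 0 (s - \<tau> i)) x = S (s - u) (S (max 0 (u - \<tau> i)) x)" if "\<tau> i \<le> u" for i x
        using S_add[of "s - u" "u - \<tau> i" x] that s by (simp add: max_def)
      have ind: "s \<in> {\<tau> i<..\<tau> (Suc i)} \<longleftrightarrow> i \<in> I" if "i < n" for i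
        using no[of i] no[of "Suc i"] s that by (auto simp: I_def)
      have "?\<Psi> w s = (\<Sum>i<n. if i \<in> I then S (s - u) (S (u - \<tau> i) (X i w)) else 0)"
      proof (rule sum.cong[OF refl])
        fix i assume "i \<in> {..<n}"
        then show "indicat_real {\<tau> i<..\<tau> (Suc i)} s *\<^sub>R S (max 0 (s - \<tau> i)) (X i w) = (if i \<in> I then S (s - u) (S (u - \<tau> i) (X i w)) else 0)"
          using ind[of i] split[of i] by (auto simp: indicator_def I_def)
      qed
      also have "\<dots> = (\<Sum>i\<in>I. S (s - u) (S (u - \<tau> i) (X i w)))"
        using fI by (simp add: sum.inter_restrict[symmetric] Int_absorb1)
      also have "\<dots> = S (s - u) (Y w)" using s by (simp add: Y_def S_sum)
      finally show "?\<Psi> w s = S (s - u) (Y w)" .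
      have d: "S (max 0 (s - \<tau> i)) ((B (min s (\<tau> (Suc i))) w - B (min s (\<tau> i)) w) *\<^sub>R X i w)
          = S (s - u) (S (max 0 (u - \<tau> i)) ((B (min u (\<tau> (Suc i))) w - B (min u (\<tau> i)) w) *\<^sub>R X i w))
          + (if i \<in> I then S (s - u) ((B s w - B u w) *\<^sub>R S (u - \<tau> i) (X i w)) else 0)"
        if i: "i < n" for i
      proof -
        \<comment> \<open>Active, already finished, or not yet started. The truncations by
          \<open>min\<close> freeze the increment in the second case and make it 0 in the
          third.\<close>
        consider "i \<in> I" | "\<tau> (Suc i) \<le> u" | "v \<le> \<tau> i" using no[of i] no[of "Suc i"] i by (auto simp: I_def)
        then show ?thesis
        proof cases
          case 1
          then have m: "min s (\<tau> (Suc i)) = s" "min s (\<tau> i) = \<tau> i" "min u (\<tau> (Suc i)) = u" "min u (\<tau> i) = \<tau> i"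
            "max 0 (u - \<tau> i) = u - \<tau> i" "\<tau> i \<le> u"
            using s by (auto simp: I_def)
          have "(B s w - B (\<tau> i) w) *\<^sub>R X i w = (B u w - B (\<tau> i) w) *\<^sub>R X i w + (B s w - B u w) *\<^sub>R X i w"
            by (simp add: algebra_simps)
          then show ?thesis using 1 m s unfolding split[OF m(6)] m by (simp add: S_plus S_scale)
        next
          case 2
          then have m: "min s (\<tau> (Suc i)) = \<tau> (Suc i)" "min s (\<tau> i) = \<tau> i" "min u (\<tau> (Suc i)) = \<tau> (Suc i)" "min u (\<tau> i) = \<tau> i" "i \<notin> I" "\<tau> i \<le> u"
            using s \<tau>(2)[OF i] uv by (auto simp: I_def)
          then show ?thesis unfolding split[OF m(6)] m by simp
        next
          case 3
          then have "min s (\<tau> (Suc i)) = s" "min s (\<tau> i) = s" "min u (\<tau> (Suc i)) = u" "min u (\<tau> i) = u" "i \<notin> I"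
            using s \<tau>(2)[OF i] uv by (auto simp: I_def)
          then show ?thesis using s by (simp add: S_zero)
        qed
      qed
      have "?Z s w = (\<Sum>i<n. S (s - u) (S (max 0 (u - \<tau> i)) ((B (min u (\<tau> (Suc i))) w - B (min u (\<tau> i)) w) *\<^sub>R X i w)))
          + (\<Sum>i<n. if i \<in> I then S (s - u) ((B s w - B u w) *\<^sub>R S (u - \<tau> i) (X i w)) else 0)"
        by (subst sum.distrib[symmetric], rule sum.cong) (use d in auto)
      also have "(\<Sum>i<n. if i \<in> I then S (s - u) ((B s w - B u w) *\<^sub>R S (u - \<tau> i) (X i w)) else 0)
          = (\<Sum>i\<in>I. S (s - u) ((B s w - B u w) *\<^sub>R S (u - \<tau> i) (X i w)))"
        using fI by (simp add: sum.inter_restrict[symmetric] Int_absorb1)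
      finally show "?Z s w = S (s - u) (?Z u w + (B s w - B u w) *\<^sub>R Y w)"
        using s by (simp add: Y_def S_plus S_sum scaleR_sum_right)
    qed
    then show "\<exists>X'. qpiece S ?Z ?\<Psi> u v X'" by blast
  qed simp
qed

lemma elementary_qstep:
  fixes X :: "nat \<Rightarrow> 'w \<Rightarrow> 'h::{real_inner, banach, second_countable_topology}"
  assumes e: "elementary F t n \<tau> X" and t: "t \<le> T"
  shows "\<exists>G Z. qstep (\<lambda>t u. u) G Z (elem_process n \<tau> X) \<and> (\<forall>w. Z t w = elem_integral B n \<tau> X w)"
proof -
  have eq: "(\<Sum>i<n. (B (min t (\<tau> (Suc i))) w - B (min t (\<tau> i)) w) *\<^sub>R X i w) = elem_integral B n \<tau> X w" for w
    unfolding elem_integral_def by (rule sum.cong) (use elementaryD(3,5)[OF e] in \<open>auto simp: min_absorb2\<close>)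
  have "qstep (\<lambda>t u. u) (\<tau> ` {..n}) (\<lambda>s w. \<Sum>i<n. (B (min s (\<tau> (Suc i))) w - B (min s (\<tau> i)) w) *\<^sub>R X i w) (elem_process n \<tau> X)"
    using elementary_qstep_semigroup[OF id_semigroup e t] by (simp add: elem_process_def[abs_def])
  then show ?thesis using eq by (intro exI conjI allI)
qed

text \<open>The integrand is switched off before its accumulated energy can exceed d. The switched
  integral has second moment at most 18 d, so Chebyshev's inequality applies, and it agrees with the
  original one where the energy is at most d. The event A is arbitrary and need not be known at any
  earlier time; this is the germ of locality.\<close>

lemma elementary_in_probability:
  assumes q: "qstep (\<lambda>t u. u) G Z \<Psi>" and t: "0 \<le> t" "t \<le> T"
    and [measurable]: "A \<in> sets M" "(\<lambda>w. path_sq t (\<Psi> w)) \<in> borel_measurable M" and e: "0 < e" and d: "0 < d"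
  shows "measure M {w \<in> space M. w \<in> A \<and> norm (Z t w) > e}
    \<le> measure M {w \<in> space M. w \<in> A \<and> path_sq t (\<Psi> w) > ennreal d} + 18 * d / e\<^sup>2"
proof -
  obtain m g where G: "is_grid G t m g" using is_grid_exists[OF qstep_finite[OF q] t(1)] by blast
  note g = is_gridD[OF G]
  have gb: "0 \<le> g k" "g k \<le> t" "g k \<le> T" if "k \<le> m" for k using g(4)[of 0 k] g(4)[of k m] g(1,2) that t by auto
  obtain X K where XK: "\<forall>k<m. qpiece (\<lambda>t u. u) Z \<Psi> (g k) (g (Suc k)) (X k) \<and> (\<forall>w\<in>space M. norm (X k w) \<le> K)"
    using qstep_pieces[OF q G t] by blast
  have X: "\<And>k. k < m \<Longrightarrow> qpiece (\<lambda>t u. u) Z \<Psi> (g k) (g (Suc k)) (X k)"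
    and K: "\<And>k w. k < m \<Longrightarrow> w \<in> space M \<Longrightarrow> norm (X k w) \<le> K" using XK by blast+
  define Q where "Q k w = (\<Sum>j<k. (g (Suc j) - g j) * (norm (X j w))\<^sup>2)" for k w
  have gp: "0 \<le> g (Suc k) - g k" if "k < m" for k using g(3)[OF that] by simp
  have Qe: "path_sq t (\<Psi> w) = ennreal (Q m w)" if "w \<in> space M" for w
    unfolding Q_def by (rule is_grid_nn_integral[OF G]) (use qpieceD(4)[OF X that] in auto)
  have Qmono: "Q j w \<le> Q k w" if "j \<le> k" "k \<le> m" for j k w
    unfolding Q_def by (rule sum_mono2) (use that gp in auto)
  \<comment> \<open>\<open>Q (Suc k)\<close> already contains the cell that begins at
    \<open>g k\<close>, yet it is known at that time because the integrand is constant on cells.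
    Thus the switch is adapted and the total energy never passes d.\<close>
  define x where "x k w = (if Q (Suc k) w \<le> d then X k w else 0)" for k w
  define W where "W k w = (\<Sum>j<k. (B (g (Suc j)) w - B (g j) w) *\<^sub>R x j w)" for k w
  have XF: "X j \<in> borel_measurable (F (g k))" if "j \<le> k" "k < m" for j k
    using measurable_F_mono[OF qpieceD(1)[OF X], of j "g k"] gb[of j] gb[of k] g(4)[of j k] that by auto
  have QF: "Q (Suc k) \<in> borel_measurable (F (g k))" if k: "k < m" for k
    unfolding Q_def[abs_def] using XF[OF _ k] by measurable
  have xF: "x k \<in> borel_measurable (F (g k))" if k: "k < m" for k
    unfolding x_def[abs_def] using QF[OF k] XF[OF order_refl k] by measurable
  have xM: "x k \<in> borel_measurable M" if k: "k < m" for k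
    using measurable_F_M[OF xF[OF k]] gb[of k] k by simp
  have WM: "W m \<in> borel_measurable M"
    unfolding W_def[abs_def] using xM gb by (intro borel_measurable_sum borel_measurable_scaleR borel_measurable_diff B_meas_M) auto
  have xsum: "(\<Sum>k<m. (g (Suc k) - g k) * (norm (x k w))\<^sup>2) \<le> d" for w
  proof -
    \<comment> \<open>The comparison with \<open>Q k w\<close> carries the induction while the
      switch is on; once \<open>Q\<close> has passed d, monotonicity keeps it off and nothing is
      added.\<close>
    have "k \<le> m \<Longrightarrow> (\<Sum>j<k. (g (Suc j) - g j) * (norm (x j w))\<^sup>2) \<le> d \<and> (\<Sum>j<k. (g (Suc j) - g j) * (norm (x j w))\<^sup>2) \<le> Q k w" for k
    proof (induction k)
      case 0 then show ?case using d by (simp add: Q_def)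
    next
      case (Suc k)
      then have k: "k < m" and IH: "(\<Sum>j<k. (g (Suc j) - g j) * (norm (x j w))\<^sup>2) \<le> d" "(\<Sum>j<k. (g (Suc j) - g j) * (norm (x j w))\<^sup>2) \<le> Q k w"
        by auto
      have QS: "Q (Suc k) w = Q k w + (g (Suc k) - g k) * (norm (X k w))\<^sup>2" by (simp add: Q_def)
      show ?case
      proof (cases "Q (Suc k) w \<le> d")
        case True
        then show ?thesis using IH QS by (simp add: x_def)
      next
        case False
        moreover have "Q k w \<le> Q (Suc k) w" by (rule Qmono) (use k in auto)
        ultimately show ?thesis using IH by (simp add: x_def)
      qed
    qed
    from this[of m] show ?thesis by simp
  qed
  have "(\<integral>\<^sup>+w. nsq (W m w) \<partial>M) \<le> (\<integral>\<^sup>+w. (SUP k\<in>{..m}. nsq (W k w)) \<partial>M)"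
    by (intro nn_integral_mono SUP_upper) auto
  also have "\<dots> \<le> 18 * (\<integral>\<^sup>+w. (\<Sum>k<m. ennreal ((g (Suc k) - g k) * (norm (x k w))\<^sup>2)) \<partial>M)"
  proof (rule discrete_maximal[where C = "\<lambda>k h. h" and K = "\<bar>K\<bar>"])
    show "0 \<le> g k \<and> g k \<le> T" if "k \<le> m" for k using gb[OF that] by simp
    show "g k \<le> g (Suc k)" if "k < m" for k using g(3)[OF that] by simp
    show "norm (x k w) \<le> \<bar>K\<bar>" if "k < m" "w \<in> space M" for k w
      using K[OF that] by (auto simp: x_def)
  qed (auto simp: W_def xF)
  also have "\<dots> \<le> 18 * (\<integral>\<^sup>+w. ennreal d \<partial>M)"
    using gp xsum by (intro mult_left_mono nn_integral_mono, subst sum_ennreal) (auto intro!: ennreal_leI)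
  also have "\<dots> = ennreal (18 * d)" using d by (simp add: emeasure_space_1 ennreal_mult)
  finally have E: "(\<integral>\<^sup>+w. nsq (W m w) \<partial>M) \<le> ennreal (18 * d)" .
  have Mk: "measure M {w \<in> space M. norm (W m w) > e} \<le> 18 * d / e\<^sup>2"
  proof -
    have "ennreal (e\<^sup>2) * emeasure M {w \<in> space M. norm (W m w) > e}
        = (\<integral>\<^sup>+w. ennreal (e\<^sup>2) * indicator {w \<in> space M. norm (W m w) > e} w \<partial>M)"
      using WM by (subst nn_integral_cmult_indicator) auto
    also have "\<dots> \<le> (\<integral>\<^sup>+w. nsq (W m w) \<partial>M)"
      using e by (intro nn_integral_mono) (auto simp: indicator_def intro!: ennreal_leI power_mono)
    also have "\<dots> \<le> ennreal (18 * d)" by (rule E)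
    finally have "e\<^sup>2 * measure M {w \<in> space M. norm (W m w) > e} \<le> 18 * d"
      using d by (simp add: emeasure_eq_measure ennreal_mult[symmetric])
    then show ?thesis using e by (simp add: field_simps)
  qed
  have Zt: "k \<le> m \<Longrightarrow> Z (g k) w = W k w" if w: "w \<in> space M" and Q: "Q m w \<le> d" for k w
  proof (induction k)
    case 0 then show ?case using qstep_zero[OF q w] by (simp add: W_def g(1))
  next
    case (Suc k)
    then have k: "k < m" by simp
    have "Q (Suc k) w \<le> d" using Qmono[of "Suc k" m w] Suc.prems Q by simp
    then show ?case using qpieceD(3)[OF X[OF k] w, of "g (Suc k)"] g(3)[OF k] Suc by (simp add: W_def x_def)
  qed
  have "measure M {w \<in> space M. w \<in> A \<and> norm (Z t w) > e}
    \<le> measure M ({w \<in> space M. w \<in> A \<and> path_sq t (\<Psi> w) > ennreal d} \<union> {w \<in> space M. norm (W m w) > e})"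
  proof (rule finite_measure_mono)
    show "{w \<in> space M. w \<in> A \<and> norm (Z t w) > e}
      \<subseteq> {w \<in> space M. w \<in> A \<and> path_sq t (\<Psi> w) > ennreal d} \<union> {w \<in> space M. norm (W m w) > e}"
    proof (intro subsetI)
      fix w assume w: "w \<in> {w \<in> space M. w \<in> A \<and> norm (Z t w) > e}"
      show "w \<in> {w \<in> space M. w \<in> A \<and> path_sq t (\<Psi> w) > ennreal d} \<union> {w \<in> space M. norm (W m w) > e}"
      proof (cases "Q m w \<le> d")
        case True
        then show ?thesis using w Zt[of w m] by (simp add: g(2))
      next
        case False
        then show ?thesis using w Qe[of w] d by (simp add: ennreal_less_iff)
      qed
    qed
    show "{w \<in> space M. w \<in> A \<and> path_sq t (\<Psi> w) > ennreal d} \<union> {w \<in> space M. norm (W m w) > e} \<in> events"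
      using WM by measurable
  qed
  also have "\<dots> \<le> measure M {w \<in> space M. w \<in> A \<and> path_sq t (\<Psi> w) > ennreal d} + measure M {w \<in> space M. norm (W m w) > e}"
    using WM by (intro measure_Un_le) measurable
  finally show ?thesis using Mk by simp
qed

end

subsection \<open>The Ito integral and its locality\<close>

lemma borel_measurable_nn_integral_on:
  fixes h :: "'a \<Rightarrow> real \<Rightarrow> ennreal"
  assumes h: "(\<lambda>(w, s). h w s) \<in> borel_measurable (N \<Otimes>\<^sub>M restrict_space borel A)" and A: "A \<in> sets borel"
  shows "(\<lambda>w. \<integral>\<^sup>+s\<in>A. h w s \<partial>lborel) \<in> borel_measurable N"
proof -
  interpret R: sigma_finite_measure "restrict_space lborel A"
    by (rule sigma_finite_measure_restrict_space) (use A in \<open>auto intro: sigma_finite_lborel\<close>)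
  have "sets (N \<Otimes>\<^sub>M restrict_space lborel A) = sets (N \<Otimes>\<^sub>M restrict_space borel A)"
    by (intro sets_pair_measure_cong sets_restrict_space_cong) auto
  then have "(\<lambda>(w, s). h w s) \<in> borel_measurable (N \<Otimes>\<^sub>M restrict_space lborel A)"
    using h by (simp cong: measurable_cong_sets)
  then have "(\<lambda>w. \<integral>\<^sup>+s. h w s \<partial>restrict_space lborel A) \<in> borel_measurable N"
    by (rule R.borel_measurable_nn_integral)
  then show ?thesis using A by (simp add: nn_integral_restrict_space)
qed

lemma measurable_snd_restrict:
  "snd \<in> measurable (N \<Otimes>\<^sub>M restrict_space borel A) (borel :: real measure)"
  by (rule measurable_compose[OF measurable_snd]) (rule measurable_restrict_space1, simp)

lemma nsq_add: "nsq (x + y) \<le> 2 * (nsq x + nsq y)"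
  for x y :: "'a::real_normed_vector"
proof -
  have "(norm (x + y))\<^sup>2 \<le> (norm x + norm y)\<^sup>2" by (rule power_mono[OF norm_triangle_ineq]) simp
  also have "\<dots> \<le> 2 * ((norm x)\<^sup>2 + (norm y)\<^sup>2)"
    using sum_squares_bound[of "norm x" "norm y"] by (simp add: power2_sum)
  finally show ?thesis by (simp flip: ennreal_plus ennreal_numeral ennreal_mult add: ennreal_leI)
qed

lemma nsq_add3: "nsq (x + y + z) \<le> 3 * (nsq x + nsq y + nsq z)"
  for x y z :: "'a::real_normed_vector"
  using norm_add3_sq[of x y z] by (simp flip: ennreal_plus ennreal_numeral ennreal_mult add: ennreal_leI)

abbreviation path_measurable :: "real \<Rightarrow> (real \<Rightarrow> 'a::real_normed_vector) \<Rightarrow> bool" where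
  "path_measurable t f \<equiv> (\<lambda>s. indicat_real {0..t} s *\<^sub>R f s) \<in> borel_measurable borel"

lemma path_measurable_nsq:
  fixes f :: "real \<Rightarrow> 'a::{real_normed_vector, second_countable_topology}"
  assumes [measurable]: "path_measurable t f"
  shows "(\<lambda>s. nsq (f s) * indicator {0..t} s) \<in> borel_measurable borel"
proof -
  have "(\<lambda>s. nsq (f s) * indicator {0..t} s) = (\<lambda>s. nsq (indicat_real {0..t} s *\<^sub>R f s))"
    by (auto simp: indicator_def fun_eq_iff)
  then show ?thesis by (simp only:) measurable
qed

lemma path_sq_add3:
  fixes f f1 f2 f3 :: "real \<Rightarrow> 'a::{real_normed_vector, second_countable_topology}"
  assumes "path_measurable t f1" "path_measurable t f2" "path_measurable t f3"
    and le: "AE s in lborel. s \<in> {0..t} \<longrightarrow> nsq (f s) \<le> c * (nsq (f1 s) + nsq (f2 s) + nsq (f3 s))"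
  shows "path_sq t f \<le> c * (path_sq t f1 + path_sq t f2 + path_sq t f3)"
proof -
  note [measurable] = assms(1-3)[THEN path_measurable_nsq]
  have "path_sq t f \<le> (\<integral>\<^sup>+s. c * (nsq (f1 s) * indicator {0..t} s + nsq (f2 s) * indicator {0..t} s + nsq (f3 s) * indicator {0..t} s) \<partial>lborel)"
    using le by (intro nn_integral_mono_AE) (auto elim!: eventually_mono simp: indicator_def)
  also have "\<dots> = c * (path_sq t f1 + path_sq t f2 + path_sq t f3)"
    by (simp add: nn_integral_cmult nn_integral_add)
  finally show ?thesis .
qed

lemma nsq_gt:
  assumes "0 < e"
  shows "ennreal e < nsq x \<longleftrightarrow> sqrt e < norm x"
proof -
  have "ennreal e < nsq x \<longleftrightarrow> e < (norm x)\<^sup>2" using assms by (simp add: ennreal_less_iff)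
  also have "\<dots> \<longleftrightarrow> sqrt e < norm x" using assms by (metis real_sqrt_less_iff real_sqrt_abs abs_norm_cancel)
  finally show ?thesis .
qed

lemma path_sq_le:
  fixes f :: "real \<Rightarrow> 'a::{real_normed_vector, second_countable_topology}" and g :: "real \<Rightarrow> 'b::{real_normed_vector, second_countable_topology}"
  assumes g: "path_measurable t' g" and t: "t \<le> t'" and c: "0 \<le> c"
    and le: "AE s in lborel. s \<in> {0..t} \<longrightarrow> norm (f s) \<le> c * norm (g s)"
  shows "path_sq t f \<le> ennreal (c\<^sup>2) * path_sq t' g"
proof -
  note [measurable] = path_measurable_nsq[OF g]
  have "path_sq t f \<le> (\<integral>\<^sup>+s. ennreal (c\<^sup>2) * (nsq (g s) * indicator {0..t'} s) \<partial>lborel)"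
  proof (rule nn_integral_mono_AE, use le in eventually_elim)
    case (elim s)
    show ?case
    proof (cases "s \<in> {0..t}")
      case True
      then have "(norm (f s))\<^sup>2 \<le> (c * norm (g s))\<^sup>2" using elim by (intro power_mono) auto
      then show ?thesis using True t by (simp add: power_mult_distrib ennreal_mult[symmetric] ennreal_leI)
    qed simp
  qed
  also have "\<dots> = ennreal (c\<^sup>2) * path_sq t' g" by (rule nn_integral_cmult) measurable
  finally show ?thesis .
qed

lemma (in prob_space) tendsto_prob_nn_integral:
  fixes f :: "nat \<Rightarrow> 'a \<Rightarrow> ennreal"
  assumes [measurable]: "\<And>k. f k \<in> borel_measurable M" and lim: "(\<lambda>k. \<integral>\<^sup>+w. f k w \<partial>M) \<longlonglongrightarrow> 0" and e: "0 < e"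
  shows "(\<lambda>k. measure M {w \<in> space M. f k w > ennreal e}) \<longlonglongrightarrow> 0"
proof -
  have b: "ennreal (measure M {w \<in> space M. f k w > ennreal e}) \<le> ennreal (1/e) * (\<integral>\<^sup>+w. f k w \<partial>M)" for k
  proof -
    have "ennreal e * emeasure M {w \<in> space M. f k w > ennreal e}
       = (\<integral>\<^sup>+w. ennreal e * indicator {w \<in> space M. f k w > ennreal e} w \<partial>M)"
      by (subst nn_integral_cmult_indicator) auto
    also have "\<dots> \<le> (\<integral>\<^sup>+w. f k w \<partial>M)"
      by (intro nn_integral_mono) (auto simp: indicator_def)
    finally have "ennreal (1/e) * (ennreal e * emeasure M {w \<in> space M. f k w > ennreal e}) \<le> ennreal (1/e) * (\<integral>\<^sup>+w. f k w \<partial>M)"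
      by (rule mult_left_mono) simp
    then show ?thesis using e
      by (simp add: mult.assoc[symmetric] ennreal_mult[symmetric] emeasure_eq_measure)
  qed
  have "(\<lambda>k. ennreal (1/e) * (\<integral>\<^sup>+w. f k w \<partial>M)) \<longlonglongrightarrow> ennreal (1/e) * 0"
    by (rule tendsto_mult_ennreal[OF tendsto_const lim]) auto
  then have L: "(\<lambda>k. ennreal (1/e) * (\<integral>\<^sup>+w. f k w \<partial>M)) \<longlonglongrightarrow> ennreal 0" by simp
  have "(\<lambda>k. ennreal (measure M {w \<in> space M. f k w > ennreal e})) \<longlonglongrightarrow> ennreal 0"
    by (rule tendsto_sandwich[OF always_eventually always_eventually tendsto_const L]) (use b in auto)
  then show ?thesis by (subst (asm) tendsto_ennreal_iff) auto
qed

text \<open>Convergence in probability seen only on A, so that integrands which agree merely on A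
  can be compared.\<close>

definition in_prob_zero :: "'w measure \<Rightarrow> 'w set \<Rightarrow> (nat \<Rightarrow> 'w \<Rightarrow> ennreal) \<Rightarrow> bool" where
  "in_prob_zero M A f \<longleftrightarrow> (\<forall>e>0. (\<lambda>k. measure M {w \<in> space M. w \<in> A \<and> f k w > ennreal e}) \<longlonglongrightarrow> 0)"

lemma (in prob_space) in_prob_zero_sum3:
  assumes [measurable]: "\<And>k. f1 k \<in> borel_measurable M" "\<And>k. f2 k \<in> borel_measurable M" "\<And>k. f3 k \<in> borel_measurable M"
    and A[measurable]: "A \<in> sets M"
    and 1: "in_prob_zero M A f1" and 2: "in_prob_zero M A f2" and 3: "in_prob_zero M A f3"
    and le: "\<And>k. AE w in M. w \<in> A \<longrightarrow> f k w \<le> 3 * (f1 k w + f2 k w + f3 k w)"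
    and [measurable]: "\<And>k. f k \<in> borel_measurable M"
  shows "in_prob_zero M A f"
  unfolding in_prob_zero_def
proof (intro allI impI)
  fix e :: real assume e: "0 < e"
  \<comment> \<open>The threshold satisfies 3 (e/9 + e/9 + e/9) = e, with the outer 3 from the
    squared triangle inequality for three terms.\<close>
  define E where "E g k = {w \<in> space M. w \<in> A \<and> (g k w :: ennreal) > ennreal (e/9)}" for g and k :: nat
  have [measurable]: "E f1 k \<in> sets M" "E f2 k \<in> sets M" "E f3 k \<in> sets M" for k unfolding E_def by measurable
  have b: "measure M {w \<in> space M. w \<in> A \<and> f k w > ennreal e} \<le> measure M (E f1 k) + measure M (E f2 k) + measure M (E f3 k)" for k
  proof -
    have "measure M {w \<in> space M. w \<in> A \<and> f k w > ennreal e} \<le> measure M (E f1 k \<union> E f2 k \<union> E f3 k)"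
    proof (rule finite_measure_mono_AE)
      show "AE w in M. w \<in> {w \<in> space M. w \<in> A \<and> f k w > ennreal e} \<longrightarrow> w \<in> E f1 k \<union> E f2 k \<union> E f3 k"
        using le[of k]
      proof eventually_elim
        case l: (elim w)
        show ?case
        proof (rule impI, rule ccontr)
          assume a: "w \<in> {w \<in> space M. w \<in> A \<and> f k w > ennreal e}" and n: "w \<notin> E f1 k \<union> E f2 k \<union> E f3 k"
          then have "f1 k w \<le> ennreal (e/9)" "f2 k w \<le> ennreal (e/9)" "f3 k w \<le> ennreal (e/9)"
            by (auto simp: E_def not_less)
          then have "3 * (f1 k w + f2 k w + f3 k w) \<le> 3 * (ennreal (e/9) + ennreal (e/9) + ennreal (e/9))"
            by (intro mult_left_mono add_mono) auto
          also have "\<dots> = ennreal e" using e by (simp flip: ennreal_plus ennreal_numeral ennreal_mult)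
          finally show False using a l by auto
        qed
      qed
    qed measurable
    also have "\<dots> \<le> measure M (E f1 k \<union> E f2 k) + measure M (E f3 k)" by (intro measure_Un_le) measurable
    also have "\<dots> \<le> measure M (E f1 k) + measure M (E f2 k) + measure M (E f3 k)"
      by (intro add_right_mono measure_Un_le) measurable
    finally show ?thesis .
  qed
  have "(\<lambda>k. measure M (E f1 k)) \<longlonglongrightarrow> 0" "(\<lambda>k. measure M (E f2 k)) \<longlonglongrightarrow> 0" "(\<lambda>k. measure M (E f3 k)) \<longlonglongrightarrow> 0"
    using 1 2 3 e unfolding in_prob_zero_def E_def by auto
  from tendsto_add[OF tendsto_add[OF this(1,2)] this(3)]
  have L: "(\<lambda>k. measure M (E f1 k) + measure M (E f2 k) + measure M (E f3 k)) \<longlonglongrightarrow> 0" by simp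
  show "(\<lambda>k. measure M {w \<in> space M. w \<in> A \<and> f k w > ennreal e}) \<longlonglongrightarrow> 0"
    by (rule tendsto_sandwich[OF always_eventually always_eventually tendsto_const L]) (use b in auto)
qed

text \<open>Extends a process from [0, t] to the whole line by its boundary values, so that Fubini's
  theorem can be used with Lebesgue measure on the line.\<close>

lemma measurable_clamp:
  assumes f: "(\<lambda>(w, s). f w s) \<in> measurable (N \<Otimes>\<^sub>M restrict_space borel {0..t}) L" and t: "0 \<le> t"
  shows "(\<lambda>(w, s). f w (max 0 (min t s))) \<in> measurable (N \<Otimes>\<^sub>M (borel :: real measure)) L"
proof -
  have "(\<lambda>s. max 0 (min t s)) \<in> measurable borel (restrict_space borel {0..t})"
    by (rule measurable_restrict_space2) (use t in auto)
  then have "(\<lambda>p. (fst p, max 0 (min t (snd p)))) \<in> measurable (N \<Otimes>\<^sub>M borel) (N \<Otimes>\<^sub>M restrict_space borel {0..t})"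
    by measurable
  from measurable_compose[OF this f] show ?thesis by (simp add: split_beta')
qed

context brownian_setting
begin

abbreviation jmeas :: "real \<Rightarrow> ('w \<Rightarrow> real \<Rightarrow> 'h::real_normed_vector) \<Rightarrow> bool" where
  "jmeas t \<Phi> \<equiv> (\<lambda>(w, s). \<Phi> w s) \<in> borel_measurable (MT t)"

definition energy :: "real \<Rightarrow> ('w \<Rightarrow> real \<Rightarrow> 'h::real_normed_vector) \<Rightarrow> ennreal" where
  "energy t \<Phi> = (\<integral>\<^sup>+w. path_sq t (\<Phi> w) \<partial>M)"

lemma jmeas_restrict:
  assumes f: "jmeas T \<Phi>" and t: "t \<le> T"
  shows "jmeas t \<Phi>"
proof -
  have "(\<lambda>s. s) \<in> measurable (restrict_space borel {0..t}) (restrict_space borel {0..T})"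
    using t by (intro measurable_restrict_space2 measurable_restrict_space1) (auto simp: space_restrict_space)
  then have "(\<lambda>p. (fst p, snd p)) \<in> measurable (MT t) (MT T)" by measurable
  from measurable_compose[OF this f] show ?thesis by (simp add: split_beta')
qed

lemma jmeas_path:
  fixes \<Phi> :: "'w \<Rightarrow> real \<Rightarrow> 'h::{real_normed_vector, second_countable_topology}"
  assumes "jmeas t \<Phi>" "w \<in> space M"
  shows "path_measurable t (\<Phi> w)"
  using measurable_Pair2[OF assms] by (simp add: borel_measurable_restrict_space_iff)

lemma jmeas_nsq:
  assumes "jmeas t \<Phi>"
  shows "(\<lambda>(w, s). nsq (\<Phi> w s)) \<in> borel_measurable (MT t)"
  using assms unfolding split_beta' by measurable

lemma path_sq_measurable:
  assumes "jmeas t \<Phi>"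
  shows "(\<lambda>w. path_sq t (\<Phi> w)) \<in> borel_measurable M"
  by (rule borel_measurable_nn_integral_on[OF jmeas_nsq[OF assms]]) simp

lemma jmeas_diff:
  fixes \<Phi> \<Psi> :: "'w \<Rightarrow> real \<Rightarrow> 'h::{real_normed_vector, second_countable_topology}"
  assumes "jmeas t \<Phi>" "jmeas t \<Psi>"
  shows "jmeas t (\<lambda>w s. \<Phi> w s - \<Psi> w s)"
  using assms unfolding split_beta' by measurable

lemma energy_le:
  fixes \<Phi> :: "'w \<Rightarrow> real \<Rightarrow> 'a::{real_normed_vector, second_countable_topology}"
    and \<Psi> :: "'w \<Rightarrow> real \<Rightarrow> 'b::{real_normed_vector, second_countable_topology}"
  assumes \<Psi>: "jmeas t' \<Psi>" and t: "t \<le> t'" and c: "0 \<le> c"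
    and le: "\<And>w. w \<in> space M \<Longrightarrow> AE s in lborel. s \<in> {0..t} \<longrightarrow> norm (\<Phi> w s) \<le> c * norm (\<Psi> w s)"
  shows "energy t \<Phi> \<le> ennreal (c\<^sup>2) * energy t' \<Psi>"
proof -
  have "energy t \<Phi> \<le> (\<integral>\<^sup>+w. ennreal (c\<^sup>2) * path_sq t' (\<Psi> w) \<partial>M)"
    unfolding energy_def by (intro nn_integral_mono path_sq_le[OF jmeas_path[OF \<Psi>] t c le])
  also have "\<dots> = ennreal (c\<^sup>2) * energy t' \<Psi>"
    unfolding energy_def by (rule nn_integral_cmult[OF path_sq_measurable[OF \<Psi>]])
  finally show ?thesis .
qed

lemma energy_bounded:
  assumes "0 \<le> t" and b: "\<And>w s. w \<in> space M \<Longrightarrow> s \<in> {0..t} \<Longrightarrow> nsq (\<Phi> w s) \<le> ennreal c" and c: "0 \<le> c"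
  shows "energy t \<Phi> \<le> ennreal (t * c)"
proof -
  have "energy t \<Phi> \<le> (\<integral>\<^sup>+w. (\<integral>\<^sup>+s. ennreal c * indicator {0..t} s \<partial>lborel) \<partial>M)"
    unfolding energy_def using b by (intro nn_integral_mono) (auto simp: indicator_def)
  also have "\<dots> = ennreal (t * c)"
    using assms by (subst nn_integral_cmult_indicator) (auto simp: emeasure_space_1 ennreal_mult mult.commute)
  finally show ?thesis .
qed

lemma energy_add:
  fixes \<Phi> \<Psi> :: "'w \<Rightarrow> real \<Rightarrow> 'h::{real_normed_vector, second_countable_topology}"
  assumes 1: "jmeas t \<Phi>" and 2: "jmeas t \<Psi>"
  shows "energy t (\<lambda>w s. \<Phi> w s + \<Psi> w s) \<le> 2 * (energy t \<Phi> + energy t \<Psi>)"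
proof -
  note [measurable] = path_sq_measurable[OF 1] path_sq_measurable[OF 2]
  have "path_sq t (\<lambda>s. \<Phi> w s + \<Psi> w s) \<le> 2 * (path_sq t (\<Phi> w) + path_sq t (\<Psi> w) + path_sq t (\<lambda>_. 0 :: 'h))" if "w \<in> space M" for w
    by (rule path_sq_add3[OF jmeas_path[OF 1 that] jmeas_path[OF 2 that]]) (use nsq_add[of "\<Phi> w s" "\<Psi> w s" for s] in \<open>simp_all add: distrib_left\<close>)
  then have "energy t (\<lambda>w s. \<Phi> w s + \<Psi> w s) \<le> (\<integral>\<^sup>+w. 2 * (path_sq t (\<Phi> w) + path_sq t (\<Psi> w)) \<partial>M)"
    unfolding energy_def by (intro nn_integral_mono) auto
  also have "\<dots> = 2 * (energy t \<Phi> + energy t \<Psi>)"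
    by (simp add: nn_integral_cmult nn_integral_add energy_def)
  finally show ?thesis .
qed

lemma energy_triangle:
  fixes \<Phi> \<Psi> \<Theta> :: "'w \<Rightarrow> real \<Rightarrow> 'h::{real_normed_vector, second_countable_topology}"
  assumes "jmeas t \<Phi>" "jmeas t \<Psi>" "jmeas t \<Theta>"
  shows "energy t (\<lambda>w s. \<Phi> w s - \<Theta> w s)
    \<le> 2 * (energy t (\<lambda>w s. \<Phi> w s - \<Psi> w s) + energy t (\<lambda>w s. \<Psi> w s - \<Theta> w s))"
  using energy_add[OF jmeas_diff[OF assms(1,2)] jmeas_diff[OF assms(2,3)]] by simp

lemma energy_minus_commute: "energy t (\<lambda>w s. \<Phi> w s - \<Psi> w s) = energy t (\<lambda>w s. \<Psi> w s - \<Phi> w s)"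
  by (simp add: energy_def norm_minus_commute)

text \<open>Dominated convergence is applied twice: in time along each path on which the dominating
  energy is finite, and over the probability space.\<close>

lemma energy_dominated_convergence:
  fixes \<Phi> :: "nat \<Rightarrow> 'w \<Rightarrow> real \<Rightarrow> 'a::{real_normed_vector, second_countable_topology}"
    and \<Psi> :: "'w \<Rightarrow> real \<Rightarrow> 'b::{real_normed_vector, second_countable_topology}"
  assumes \<Phi>: "\<And>k. jmeas t (\<Phi> k)" and \<Psi>: "jmeas t \<Psi>" and fin: "energy t \<Psi> < \<infinity>"
    and le: "\<And>k w s. w \<in> space M \<Longrightarrow> s \<in> {0..t} \<Longrightarrow> norm (\<Phi> k w s) \<le> norm (\<Psi> w s)"
    and lim: "\<And>w s. w \<in> space M \<Longrightarrow> s \<in> {0..t} \<Longrightarrow> (\<lambda>k. \<Phi> k w s) \<longlonglongrightarrow> 0"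
  shows "(\<lambda>k. energy t (\<Phi> k)) \<longlonglongrightarrow> 0"
proof -
  note [measurable] = path_sq_measurable[OF \<Phi>] path_sq_measurable[OF \<Psi>]
  have nle: "nsq (\<Phi> k w s) * indicator {0..t} s \<le> nsq (\<Psi> w s) * indicator {0..t} s" if "w \<in> space M" for k w s
    using le[OF that, of s k] by (auto simp: indicator_def intro!: ennreal_leI power_mono)
  have "(\<lambda>k. energy t (\<Phi> k)) \<longlonglongrightarrow> (\<integral>\<^sup>+w. 0 \<partial>M)"
    unfolding energy_def
  proof (rule nn_integral_dominated_convergence[where w = "\<lambda>w. path_sq t (\<Psi> w)"])
    show "AE w in M. path_sq t (\<Phi> k w) \<le> path_sq t (\<Psi> w)" for k
      by (intro AE_I2 nn_integral_mono nle)
    have "AE w in M. path_sq t (\<Psi> w) \<noteq> \<infinity>"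
      by (rule nn_integral_PInf_AE) (use fin in \<open>auto simp: energy_def\<close>)
    with AE_space show "AE w in M. (\<lambda>k. path_sq t (\<Phi> k w)) \<longlonglongrightarrow> 0"
    proof eventually_elim
      case (elim w)
      note [measurable] = jmeas_path[OF \<Phi> elim(1), THEN path_measurable_nsq] jmeas_path[OF \<Psi> elim(1), THEN path_measurable_nsq]
      have "(\<lambda>k. path_sq t (\<Phi> k w)) \<longlonglongrightarrow> (\<integral>\<^sup>+s. 0 \<partial>(lborel :: real measure))"
      proof (rule nn_integral_dominated_convergence[where w = "\<lambda>s. nsq (\<Psi> w s) * indicator {0..t} s"])
        show "AE s in lborel. nsq (\<Phi> k w s) * indicator {0..t} s \<le> nsq (\<Psi> w s) * indicator {0..t} s" for k
          by (intro AE_I2 nle elim)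
        show "path_sq t (\<Psi> w) < \<infinity>" using elim by (simp add: less_top)
        have "(\<lambda>k. nsq (\<Phi> k w s) * indicator {0..t} s) \<longlonglongrightarrow> 0" for s
        proof (cases "s \<in> {0..t}")
          case True
          have "(\<lambda>k. nsq (\<Phi> k w s)) \<longlonglongrightarrow> nsq (0 :: 'a)"
            by (intro tendsto_ennrealI tendsto_intros lim elim True)
          then show ?thesis using True by simp
        qed simp
        then show "AE s in lborel. (\<lambda>k. nsq (\<Phi> k w s) * indicator {0..t} s) \<longlonglongrightarrow> 0" by (intro AE_I2)
      qed auto
      then show ?case by simp
    qed
  qed (use fin in \<open>auto simp: energy_def\<close>)
  then show ?thesis by simp
qed

lemma elementary_measurable:
  fixes X :: "nat \<Rightarrow> 'w \<Rightarrow> 'h::{real_inner, banach, second_countable_topology}"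
  assumes e: "elementary F t n \<tau> X" and t: "t \<le> T"
  shows "jmeas r (elem_process n \<tau> X)"
    "elem_integral B n \<tau> X \<in> borel_measurable M"
proof -
  have \<tau>: "0 \<le> \<tau> i" "\<tau> i \<le> \<tau> (Suc i)" "\<tau> (Suc i) \<le> t" "X i \<in> borel_measurable (F (\<tau> i))" if "i < n" for i
    using e that unfolding elementary_def by force+
  have X: "X i \<in> borel_measurable M" if "i < n" for i
    using measurable_F_M[OF \<tau>(4)[OF that]] \<tau>[OF that] t by auto
  show "jmeas r (elem_process n \<tau> X)"
    unfolding elem_process_def split_beta'
  proof (intro borel_measurable_sum borel_measurable_scaleR)
    fix i assume "i \<in> {..<n}"
    then have [measurable]: "X i \<in> borel_measurable M" using X by simp
    show "(\<lambda>p. X i (fst p)) \<in> borel_measurable (MT r)" by measurable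
    note [measurable] = measurable_snd_restrict
    show "(\<lambda>p. indicat_real {\<tau> i<..\<tau> (Suc i)} (snd p)) \<in> borel_measurable (MT r)"
      by measurable
  qed
  show "elem_integral B n \<tau> X \<in> borel_measurable M"
    unfolding elem_integral_def[abs_def] using X \<tau> t order_trans[OF \<tau>(2,3)] order_trans[OF \<tau>(1,2)]
    by (intro borel_measurable_sum borel_measurable_scaleR borel_measurable_diff B_meas_M) (force intro: order_trans)+
qed

text \<open>The data of \<open>has_ito_integral\<close> in terms of \<open>qstep\<close> for the
  identity semigroup: unlike elementary processes with their own partitions, these can be subtracted
  from one another. \<open>I k\<close> is the value of the k-th integral at time t, and both limits
  are restricted to A.\<close>

definition ito_approx :: "'w set \<Rightarrow> real \<Rightarrow> ('w \<Rightarrow> real \<Rightarrow> 'h::{real_inner, banach, second_countable_topology}) \<Rightarrow> ('w \<Rightarrow> 'h) \<Rightarrow>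
    (nat \<Rightarrow> 'w \<Rightarrow> real \<Rightarrow> 'h) \<Rightarrow> (nat \<Rightarrow> 'w \<Rightarrow> 'h) \<Rightarrow> bool" where
  "ito_approx A t \<Phi> J P I \<longleftrightarrow>
     (\<forall>k. \<exists>G Z. qstep (\<lambda>t u. u) G Z (P k) \<and> (\<forall>w. Z t w = I k w)) \<and> (\<forall>k. I k \<in> borel_measurable M) \<and>
     in_prob_zero M A (\<lambda>k w. path_sq t (\<lambda>s. \<Phi> w s - P k w s)) \<and>
     in_prob_zero M A (\<lambda>k w. nsq (J w - I k w)) \<and> J \<in> borel_measurable M \<and> jmeas t \<Phi> \<and> (\<forall>k. jmeas t (P k))"

lemma ito_approxD:
  assumes "ito_approx A t \<Phi> J P I"
  shows "\<exists>G Z. qstep (\<lambda>t u. u) G Z (P k) \<and> (\<forall>w. Z t w = I k w)" "I k \<in> borel_measurable M"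
    "in_prob_zero M A (\<lambda>k w. path_sq t (\<lambda>s. \<Phi> w s - P k w s))"
    "in_prob_zero M A (\<lambda>k w. nsq (J w - I k w))" "J \<in> borel_measurable M" "jmeas t \<Phi>" "jmeas t (P k)"
  using assms unfolding ito_approx_def by simp_all

lemma ito_approx_exists:
  fixes \<Phi> :: "'w \<Rightarrow> real \<Rightarrow> 'h::{real_inner, banach, second_countable_topology}"
  assumes i: "has_ito_integral M F B t \<Phi> J" and t: "0 \<le> t" "t \<le> T" and A[measurable]: "A \<in> sets M"
  shows "\<exists>P I. ito_approx A t \<Phi> J P I"
proof -
  have m: "jmeas t \<Phi>" "J \<in> borel_measurable M" using i by (auto simp: has_ito_integral_def)
  obtain n \<tau> X where e: "\<forall>k. elementary F t (n k) (\<tau> k) (X k)"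
    and l1: "\<forall>\<epsilon>>0. (\<lambda>k. measure M {w \<in> space M.
          path_sq t (\<lambda>s. \<Phi> w s - elem_process (n k) (\<tau> k) (X k) w s) > ennreal \<epsilon>}) \<longlonglongrightarrow> 0"
    and l2: "\<forall>\<epsilon>>0. (\<lambda>k. measure M {w \<in> space M. norm (J w - elem_integral B (n k) (\<tau> k) (X k) w) > \<epsilon>}) \<longlonglongrightarrow> 0"
    using i unfolding has_ito_integral_def by blast
  define P where "P k = elem_process (n k) (\<tau> k) (X k)" for k
  define I where "I k = elem_integral B (n k) (\<tau> k) (X k)" for k
  have PM: "jmeas t (P k)" and IM: "I k \<in> borel_measurable M" for k
    using elementary_measurable[of t "n k" "\<tau> k" "X k"] e t unfolding P_def I_def by auto
  have sub: "in_prob_zero M A f" if f: "\<And>k. f k \<in> borel_measurable M"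
    and l: "\<And>e. 0 < e \<Longrightarrow> (\<lambda>k. measure M {w \<in> space M. f k w > ennreal e}) \<longlonglongrightarrow> 0" for f
    unfolding in_prob_zero_def
  proof (intro allI impI)
    fix e :: real assume "0 < e"
    note [measurable] = f
    show "(\<lambda>k. measure M {w \<in> space M. w \<in> A \<and> f k w > ennreal e}) \<longlonglongrightarrow> 0"
      by (rule tendsto_sandwich[OF _ _ tendsto_const l[OF \<open>0 < e\<close>]])
        (auto intro!: always_eventually finite_measure_mono)
  qed
  have z1: "in_prob_zero M A (\<lambda>k w. path_sq t (\<lambda>s. \<Phi> w s - P k w s))"
    by (rule sub[OF path_sq_measurable[OF jmeas_diff[OF m(1) PM]]]) (use l1 in \<open>auto simp: P_def\<close>)
  have z2: "in_prob_zero M A (\<lambda>k w. nsq (J w - I k w))"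
  proof (rule sub)
    show "(\<lambda>w. nsq (J w - I k w)) \<in> borel_measurable M" for k using m(2) IM[of k] by measurable
    show "(\<lambda>k. measure M {w \<in> space M. nsq (J w - I k w) > ennreal e}) \<longlonglongrightarrow> 0" if "0 < e" for e
      using l2 that by (simp add: I_def nsq_gt)
  qed
  have q: "\<exists>G Z. qstep (\<lambda>t u. u) G Z (P k) \<and> (\<forall>w. Z t w = I k w)" for k
    unfolding P_def I_def using elementary_qstep[OF _ t(2)] e by blast
  show ?thesis unfolding ito_approx_def using q IM z1 z2 m PM by blast
qed

text \<open>Subtracting the approximations of the second and third integrand from those of the first
  gives step processes whose energy tends to 0 in probability on A, because the integrands cancel
  there. By \<open>elementary_in_probability\<close> their integrals tend to 0 on A as well, while
  they converge to J1 - J2 - J3. Taking all of space M for A yields linearity.\<close>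

lemma ito_locality:
  fixes \<Phi>1 \<Phi>2 \<Phi>3 :: "'w \<Rightarrow> real \<Rightarrow> 'h::{real_inner, banach, second_countable_topology}"
  assumes i1: "has_ito_integral M F B t \<Phi>1 J1" and i2: "has_ito_integral M F B t \<Phi>2 J2"
    and i3: "has_ito_integral M F B t \<Phi>3 J3" and t: "0 \<le> t" "t \<le> T" and A[measurable]: "A \<in> sets M"
    and eq: "AE w in M. w \<in> A \<longrightarrow> (AE s in lborel. s \<in> {0..t} \<longrightarrow> \<Phi>3 w s = \<Phi>1 w s - \<Phi>2 w s)"
  shows "AE w in M. w \<in> A \<longrightarrow> J3 w = J1 w - J2 w"
proof -
  obtain P1 I1 where a1: "ito_approx A t \<Phi>1 J1 P1 I1" using ito_approx_exists[OF i1 t A] by blast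
  obtain P2 I2 where a2: "ito_approx A t \<Phi>2 J2 P2 I2" using ito_approx_exists[OF i2 t A] by blast
  obtain P3 I3 where a3: "ito_approx A t \<Phi>3 J3 P3 I3" using ito_approx_exists[OF i3 t A] by blast
  note q1 = ito_approxD(1)[OF a1] and q2 = ito_approxD(1)[OF a2] and q3 = ito_approxD(1)[OF a3]
  note m1 = ito_approxD(6,7)[OF a1] and m2 = ito_approxD(6,7)[OF a2] and m3 = ito_approxD(6,7)[OF a3]
  note [measurable] = ito_approxD(2,5)[OF a1] ito_approxD(2,5)[OF a2] ito_approxD(2,5)[OF a3]
    path_sq_measurable[OF jmeas_diff[OF m1]] path_sq_measurable[OF jmeas_diff[OF m2]] path_sq_measurable[OF jmeas_diff[OF m3]]
  note z1 = ito_approxD(3,4)[OF a1] and z2 = ito_approxD(3,4)[OF a2] and z3 = ito_approxD(3,4)[OF a3]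
  define P where "P k w s = P1 k w s - P2 k w s - P3 k w s" for k w s
  define I where "I k w = I1 k w - I2 k w - I3 k w" for k w
  have q: "\<exists>G Z. qstep (\<lambda>t u. u) G Z (P k) \<and> (\<forall>w. Z t w = I k w)" for k
  proof -
    obtain G1 Z1 G2 Z2 G3 Z3 where a: "qstep (\<lambda>t u. u) G1 Z1 (P1 k)" "\<forall>w. Z1 t w = I1 k w"
      "qstep (\<lambda>t u. u) G2 Z2 (P2 k)" "\<forall>w. Z2 t w = I2 k w" "qstep (\<lambda>t u. u) G3 Z3 (P3 k)" "\<forall>w. Z3 t w = I3 k w"
      using q1[of k] q2[of k] q3[of k] by blast
    have "qstep (\<lambda>t u. u) ((G1 \<union> G2) \<union> G3) (\<lambda>t w. 1 *\<^sub>R (1 *\<^sub>R Z1 t w + (-1) *\<^sub>R Z2 t w) + (-1) *\<^sub>R Z3 t w)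
       (\<lambda>w s. 1 *\<^sub>R (1 *\<^sub>R P1 k w s + (-1) *\<^sub>R P2 k w s) + (-1) *\<^sub>R P3 k w s)"
      by (rule qstep_lincomb[OF id_semigroup qstep_lincomb[OF id_semigroup a(1) a(3)] a(5)])
    moreover have "(\<lambda>w s. 1 *\<^sub>R (1 *\<^sub>R P1 k w s + (-1) *\<^sub>R P2 k w s) + (-1) *\<^sub>R P3 k w s) = P k"
      by (simp add: P_def fun_eq_iff)
    moreover have "\<forall>w. 1 *\<^sub>R (1 *\<^sub>R Z1 t w + (-1) *\<^sub>R Z2 t w) + (-1) *\<^sub>R Z3 t w = I k w"
      using a by (simp add: I_def)
    ultimately show ?thesis by (metis (no_types, lifting))
  qed
  have PM: "jmeas t (P k)" for k
    using m1(2)[of k] m2(2)[of k] m3(2)[of k] unfolding P_def split_beta' by measurable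
  note [measurable] = path_sq_measurable[OF PM]
  have [measurable]: "I k \<in> borel_measurable M" for k unfolding I_def by measurable
  have D0: "in_prob_zero M A (\<lambda>k w. path_sq t (P k w))"
  proof (rule in_prob_zero_sum3[OF _ _ _ A z1(1) z2(1) z3(1)])
    fix k
    show "AE w in M. w \<in> A \<longrightarrow> path_sq t (P k w) \<le> 3 * (path_sq t (\<lambda>s. \<Phi>1 w s - P1 k w s)
      + path_sq t (\<lambda>s. \<Phi>2 w s - P2 k w s) + path_sq t (\<lambda>s. \<Phi>3 w s - P3 k w s))"
      using eq AE_space
    proof eventually_elim
      case (elim w)
      show ?case
      proof (intro impI path_sq_add3 jmeas_path[OF jmeas_diff elim(2)] m1 m2 m3)
        assume "w \<in> A"
        with elim(1) have "AE s in lborel. s \<in> {0..t} \<longrightarrow> \<Phi>3 w s = \<Phi>1 w s - \<Phi>2 w s" by simp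
        then show "AE s in lborel. s \<in> {0..t} \<longrightarrow> nsq (P k w s)
          \<le> 3 * (nsq (\<Phi>1 w s - P1 k w s) + nsq (\<Phi>2 w s - P2 k w s) + nsq (\<Phi>3 w s - P3 k w s))"
        proof eventually_elim
          case (elim s)
          show ?case
            using nsq_add3[of "P1 k w s - \<Phi>1 w s" "\<Phi>2 w s - P2 k w s" "\<Phi>3 w s - P3 k w s"] elim
            by (auto simp: norm_minus_commute P_def)
        qed
      qed
    qed
  qed measurable
  have I0: "in_prob_zero M A (\<lambda>k w. nsq (I k w))"
    unfolding in_prob_zero_def
  proof (intro allI impI)
    fix e :: real assume e: "0 < e"
    have se: "0 < sqrt e" using e by simp
    have b: "measure M {w \<in> space M. w \<in> A \<and> nsq (I k w) > ennreal e}
      \<le> measure M {w \<in> space M. w \<in> A \<and> path_sq t (P k w) > ennreal d} + 18 * d / e" if d: "0 < d" for d k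
    proof -
      obtain G Z where Z: "qstep (\<lambda>t u. u) G Z (P k)" "\<forall>w. Z t w = I k w" using q by blast
      show ?thesis
        using elementary_in_probability[OF Z(1) t A _ se d] Z(2) e by (simp add: nsq_gt)
    qed
    show "(\<lambda>k. measure M {w \<in> space M. w \<in> A \<and> nsq (I k w) > ennreal e}) \<longlonglongrightarrow> 0"
    proof (rule LIMSEQ_I)
      fix r :: real assume r: "0 < r"
      \<comment> \<open>The Chebyshev term 18 d / e becomes r / 4; the other term is below r / 2 for
        large k.\<close>
      define d where "d = r * e / 72"
      have d: "0 < d" using r e by (simp add: d_def)
      have "(\<lambda>k. measure M {w \<in> space M. w \<in> A \<and> path_sq t (P k w) > ennreal d}) \<longlonglongrightarrow> 0"
        using D0 d by (simp add: in_prob_zero_def)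
      from LIMSEQ_D[OF this, of "r/2"] r
      obtain N where N: "\<And>k. N \<le> k \<Longrightarrow> measure M {w \<in> space M. w \<in> A \<and> path_sq t (P k w) > ennreal d} < r/2" by auto
      have "18 * d / e = r / 4" using e by (simp add: d_def)
      then have "norm (measure M {w \<in> space M. w \<in> A \<and> nsq (I k w) > ennreal e} - 0) < r" if "N \<le> k" for k
        using b[OF d, of k] N[OF that] r by simp
      then show "\<exists>no. \<forall>k\<ge>no. norm (measure M {w \<in> space M. w \<in> A \<and> nsq (I k w) > ennreal e} - 0) < r"
        by blast
    qed
  qed
  define R where "R w = J1 w - J2 w - J3 w" for w
  have [measurable]: "R \<in> borel_measurable M" unfolding R_def[abs_def] by measurable
  have J12: "in_prob_zero M A (\<lambda>k w. nsq (R w - I k w))"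
  proof (rule in_prob_zero_sum3[OF _ _ _ A z1(2) z2(2) z3(2)])
    fix k
    show "AE w in M. w \<in> A \<longrightarrow> nsq (R w - I k w) \<le> 3 * (nsq (J1 w - I1 k w)
      + nsq (J2 w - I2 k w) + nsq (J3 w - I3 k w))"
    proof (intro AE_I2 impI)
      fix w
      have "R w - I k w = (J1 w - I1 k w) + (I2 k w - J2 w) + (I3 k w - J3 w)" by (simp add: R_def I_def)
      then show "nsq (R w - I k w) \<le> 3 * (nsq (J1 w - I1 k w)
        + nsq (J2 w - I2 k w) + nsq (J3 w - I3 k w))"
        using nsq_add3[of "J1 w - I1 k w" "I2 k w - J2 w" "I3 k w - J3 w"] by (simp add: norm_minus_commute)
    qed
  qed measurable
  have zero: "in_prob_zero M A (\<lambda>k w. 0)" by (simp add: in_prob_zero_def)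
  have "in_prob_zero M A (\<lambda>k w. nsq (R w))"
  proof (rule in_prob_zero_sum3[OF _ _ _ A J12 I0 zero])
    fix k
    show "AE w in M. w \<in> A \<longrightarrow> nsq (R w) \<le> 3 * (nsq (R w - I k w) + nsq (I k w) + 0)"
      using nsq_add3[of "R w - I k w" "I k w" 0 for w] by (intro AE_I2) simp
  qed measurable
  then have n: "measure M {w \<in> space M. w \<in> A \<and> nsq (R w) > ennreal e} = 0" if "0 < e" for e
    using that by (simp add: in_prob_zero_def LIMSEQ_const_iff)
  have "AE w in M. \<forall>j. \<not> (w \<in> A \<and> nsq (R w) > ennreal (1 / real (Suc j)))"
  proof (subst AE_all_countable, rule allI)
    fix j
    have "{w \<in> space M. w \<in> A \<and> nsq (R w) > ennreal (1 / real (Suc j))} \<in> null_sets M"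
      using n[of "1 / real (Suc j)"] by (auto simp: null_sets_def emeasure_eq_measure)
    then show "AE w in M. \<not> (w \<in> A \<and> nsq (R w) > ennreal (1 / real (Suc j)))"
      by (rule AE_I') auto
  qed
  then show ?thesis
  proof eventually_elim
    case a: (elim w)
    show ?case
    proof
      assume "w \<in> A"
      then have "(norm (R w))\<^sup>2 \<le> inverse (real (Suc j))" for j
        using a by (simp add: not_less inverse_eq_divide)
      then have "(norm (R w))\<^sup>2 \<le> 0"
        by (intro LIMSEQ_le_const[OF LIMSEQ_inverse_real_of_nat]) auto
      then show "J3 w = J1 w - J2 w" by (simp add: R_def algebra_simps)
    qed
  qed
qed

end

subsection \<open>Approximation by step processes\<close>

lemma choice3:
  assumes "\<forall>k. \<exists>a b c. P k a b c"
  shows "\<exists>a b c. \<forall>k. P k (a k) (b k) (c k)"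
  using assms by metis

text \<open>Freezing an integrand that is merely measurable in time on a fixed grid need not approximate it.
  Averaging over all shifts of the grid turns the error into a modulus of continuity under
  translation, so some shift is good.\<close>

lemma exists_good_shift:
  fixes b :: "real \<Rightarrow> real \<Rightarrow> ennreal"
  assumes b: "(\<lambda>(r, u). b r u) \<in> borel_measurable (borel \<Otimes>\<^sub>M borel)" and d: "0 < d" and e: "0 < e"
    and c: "\<And>u. 0 < u \<Longrightarrow> u \<le> d \<Longrightarrow> (\<integral>\<^sup>+r. b r u \<partial>lborel) \<le> ennreal c" and c0: "0 \<le> c"
  shows "\<exists>h. 0 < h \<and> h < d \<and> (\<Sum>i<n. \<integral>\<^sup>+u\<in>{0<..d}. b (h + real i * d) u \<partial>lborel) \<le> ennreal (c + e)"
proof (rule ccontr)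
  assume *: "\<not> ?thesis"
  have bm[measurable]: "(\<lambda>(r, u). b r u) \<in> borel_measurable (lborel \<Otimes>\<^sub>M lborel)" using b by simp
  define A where "A r = (\<integral>\<^sup>+u\<in>{0<..d}. b r u \<partial>lborel)" for r
  have [measurable]: "A \<in> borel_measurable borel"
    unfolding A_def[abs_def] by measurable
  \<comment> \<open>If every shift h were bad, integrating over h in (0, d) would give at least d (c
    + e); the following lines bound the same integral by d c.\<close>
  have "ennreal (d * (c + e)) = (\<integral>\<^sup>+h. ennreal (c + e) * indicator {0<..<d} h \<partial>lborel)"
    using d c0 e by (subst nn_integral_cmult_indicator) (auto simp: ennreal_mult mult.commute)
  also have "\<dots> \<le> (\<integral>\<^sup>+h. (\<Sum>i<n. A (h + real i * d)) * indicator {0<..<d} h \<partial>lborel)"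
  proof (rule nn_integral_mono, goal_cases)
    case (1 h)
    show ?case
    proof (cases "h \<in> {0<..<d}")
      case True
      then have "\<not> (\<Sum>i<n. A (h + real i * d)) \<le> ennreal (c + e)" using * by (auto simp: A_def)
      then show ?thesis using True by simp
    qed simp
  qed
  also have "\<dots> = (\<Sum>i<n. \<integral>\<^sup>+h. A (h + real i * d) * indicator {0<..<d} h \<partial>lborel)"
    by (subst nn_integral_sum[symmetric]) (auto simp: sum_distrib_right)
  \<comment> \<open>The intervals swept by h + i d are disjoint for different i, so the sum over all
    cells is at most one integral of \<open>A\<close> over the line.\<close>
  also have "\<dots> = (\<Sum>i<n. \<integral>\<^sup>+r. A r * indicator {real i * d<..<real (Suc i) * d} r \<partial>lborel)"
  proof (rule sum.cong[OF refl])
    fix i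
    have "(\<integral>\<^sup>+h. A (h + real i * d) * indicator {0<..<d} h \<partial>lborel)
      = (\<integral>\<^sup>+h. A (h + real i * d) * indicator {real i * d<..<real (Suc i) * d} (h + real i * d) \<partial>lborel)"
      by (rule nn_integral_cong) (auto simp: indicator_def algebra_simps)
    also have "\<dots> = (\<integral>\<^sup>+r. A r * indicator {real i * d<..<real (Suc i) * d} r \<partial>lborel)"
      by (rule nn_integral_lborel_shift) measurable
    finally show "(\<integral>\<^sup>+h. A (h + real i * d) * indicator {0<..<d} h \<partial>lborel)
      = (\<integral>\<^sup>+r. A r * indicator {real i * d<..<real (Suc i) * d} r \<partial>lborel)" .
  qed
  also have "\<dots> = (\<integral>\<^sup>+r. (\<Sum>i<n. A r * indicator {real i * d<..<real (Suc i) * d} r) \<partial>lborel)"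
    by (rule nn_integral_sum[symmetric]) measurable
  also have "\<dots> \<le> (\<integral>\<^sup>+r. A r \<partial>lborel)"
  proof (rule nn_integral_mono, goal_cases)
    case (1 r)
    show ?case
    proof (cases "\<exists>i<n. r \<in> {real i * d<..<real (Suc i) * d}")
      case True
      then obtain i where i: "i < n" "real i * d < r" "r < real (Suc i) * d" by auto
      have "indicator {real j * d<..<real (Suc j) * d} r = (0::ennreal)" if "j \<noteq> i" for j
      proof (cases "j < i")
        case True
        then have "real (Suc j) * d \<le> real i * d" using d by (intro mult_right_mono) auto
        then show ?thesis using i by auto
      next
        case False
        then have "real (Suc i) * d \<le> real j * d" using d that by (intro mult_right_mono) auto
        then show ?thesis using i by auto
      qed
      then have "(\<Sum>j<n. A r * indicator {real j * d<..<real (Suc j) * d} r) = (\<Sum>j<n. if j = i then A r else 0)"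
        using i by (intro sum.cong) auto
      then show ?thesis using i by simp
    next
      case False
      then have "(\<Sum>i<n. A r * indicator {real i * d<..<real (Suc i) * d} r) = 0"
        by (intro sum.neutral) auto
      then show ?thesis by (simp only: zero_le)
    qed
  qed
  also have "\<dots> = (\<integral>\<^sup>+u. (\<integral>\<^sup>+r. b r u * indicator {0<..d} u \<partial>lborel) \<partial>lborel)"
    unfolding A_def by (rule lborel_pair.Fubini') measurable
  also have "\<dots> = (\<integral>\<^sup>+u. (\<integral>\<^sup>+r. b r u \<partial>lborel) * indicator {0<..d} u \<partial>lborel)"
    by (intro nn_integral_cong nn_integral_multc) measurable
  also have "\<dots> \<le> (\<integral>\<^sup>+u. ennreal c * indicator {0<..d} u \<partial>lborel)"
    using c by (intro nn_integral_mono) (auto simp: indicator_def)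
  also have "\<dots> = ennreal (d * c)"
    using d c0 by (subst nn_integral_cmult_indicator) (auto simp: ennreal_mult mult.commute)
  finally show False using d e c0 by (simp add: ennreal_le_iff)
qed

text \<open>Each path has a vanishing translation error by \<open>L2_translation_continuous\<close>,
  and boundedness on a finite time interval dominates it by 4 T N^2. Sequences of translations are
  used because dominated convergence is sequential.\<close>

lemma (in brownian_setting) translation_continuous_product:
  fixes f :: "'w \<Rightarrow> real \<Rightarrow> 'h::{banach, second_countable_topology}"
  assumes f: "(\<lambda>(w, s). f w s) \<in> borel_measurable (M \<Otimes>\<^sub>M borel)"
    and N: "\<And>w s. norm (f w s) \<le> N" and supp: "\<And>w s. s \<notin> {0..T} \<Longrightarrow> f w s = 0"
  shows "((\<lambda>u. \<integral>\<^sup>+w. \<integral>\<^sup>+r. nsq (f w (r + u) - f w r) \<partial>lborel \<partial>M) \<longlongrightarrow> 0) (at 0)"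
  unfolding tendsto_at_iff_sequentially
proof (intro allI impI)
  fix U :: "nat \<Rightarrow> real" assume U: "\<forall>i. U i \<in> UNIV - {0}" "U \<longlonglongrightarrow> 0"
  have N0: "0 \<le> N" using N[of undefined undefined] norm_ge_zero order_trans by blast
  have fm: "(\<lambda>p. f (fst p) (snd p)) \<in> borel_measurable (M \<Otimes>\<^sub>M borel)" using f by (simp add: split_beta')
  have f1: "f w \<in> borel_measurable borel" if "w \<in> space M" for w
    using measurable_Pair2[OF f that] by simp
  have E: "(\<integral>\<^sup>+r. nsq (f w r) \<partial>lborel) \<le> ennreal (T * N\<^sup>2)" for w
  proof -
    have "(\<integral>\<^sup>+r. nsq (f w r) \<partial>lborel) \<le> (\<integral>\<^sup>+r. ennreal (N\<^sup>2) * indicator {0..T} r \<partial>lborel)"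
      using N N0 supp by (intro nn_integral_mono) (auto simp: indicator_def intro!: ennreal_leI power_mono)
    also have "\<dots> = ennreal (T * N\<^sup>2)"
      using T by (subst nn_integral_cmult_indicator) (auto simp: ennreal_mult mult.commute)
    finally show ?thesis .
  qed
  define D where "D k w = (\<integral>\<^sup>+r. nsq (f w (r + U k) - f w r) \<partial>lborel)" for k w
  have Dm[measurable]: "D k \<in> borel_measurable M" for k
  proof -
    have "(\<lambda>p. (fst p, snd p + U k)) \<in> measurable (M \<Otimes>\<^sub>M lborel) (M \<Otimes>\<^sub>M borel)" by measurable
    from measurable_compose[OF this fm]
    have [measurable]: "(\<lambda>p. f (fst p) (snd p + U k)) \<in> borel_measurable (M \<Otimes>\<^sub>M lborel)" by simp
    have [measurable]: "(\<lambda>p. f (fst p) (snd p)) \<in> borel_measurable (M \<Otimes>\<^sub>M lborel)"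
      using fm by (simp cong: measurable_cong_sets add: sets_pair_measure_cong[OF refl sets_lborel])
    show ?thesis
      unfolding D_def[abs_def]
      by (rule lborel.borel_measurable_nn_integral) (simp add: split_beta', measurable)
  qed
  have Db: "D k w \<le> ennreal (4 * T * N\<^sup>2)" if w: "w \<in> space M" for k w
  proof -
    note [measurable] = f1[OF w]
    have "nsq (f w (r + U k) - f w r) \<le> 2 * (nsq (f w (r + U k)) + nsq (f w r))" for r
    proof -
      have "norm (f w (r + U k) - f w r) \<le> norm (f w (r + U k)) + norm (f w r)" by (rule norm_triangle_ineq4)
      then have "(norm (f w (r + U k) - f w r))\<^sup>2 \<le> (norm (f w (r + U k)) + norm (f w r))\<^sup>2" by (rule power_mono) simp
      also have "\<dots> \<le> 2 * ((norm (f w (r + U k)))\<^sup>2 + (norm (f w r))\<^sup>2)"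
        using sum_squares_bound[of "norm (f w (r + U k))" "norm (f w r)"] by (simp add: power2_sum)
      finally show ?thesis by (simp flip: ennreal_plus ennreal_numeral ennreal_mult add: ennreal_leI)
    qed
    then have "D k w \<le> (\<integral>\<^sup>+r. 2 * (nsq (f w (r + U k)) + nsq (f w r)) \<partial>lborel)"
      unfolding D_def by (intro nn_integral_mono)
    also have "\<dots> = 2 * ((\<integral>\<^sup>+r. nsq (f w (r + U k)) \<partial>lborel) + (\<integral>\<^sup>+r. nsq (f w r) \<partial>lborel))"
      by (simp add: nn_integral_cmult nn_integral_add)
    also have "(\<integral>\<^sup>+r. nsq (f w (r + U k)) \<partial>lborel) = (\<integral>\<^sup>+r. nsq (f w r) \<partial>lborel)"
      by (rule nn_integral_lborel_shift[where f = "\<lambda>r. nsq (f w r)"]) measurable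
    also have "2 * ((\<integral>\<^sup>+r. nsq (f w r) \<partial>lborel) + (\<integral>\<^sup>+r. nsq (f w r) \<partial>lborel))
      \<le> 2 * (ennreal (T * N\<^sup>2) + ennreal (T * N\<^sup>2))"
      by (intro mult_left_mono add_mono E) auto
    also have "\<dots> = ennreal (4 * T * N\<^sup>2)"
      using T by (simp flip: ennreal_plus ennreal_numeral ennreal_mult)
    finally show ?thesis .
  qed
  have "(\<lambda>k. \<integral>\<^sup>+w. D k w \<partial>M) \<longlonglongrightarrow> (\<integral>\<^sup>+w. 0 \<partial>M)"
  proof (rule nn_integral_dominated_convergence[where w = "\<lambda>_. ennreal (4 * T * N\<^sup>2)"])
    show "AE w in M. D k w \<le> ennreal (4 * T * N\<^sup>2)" for k using Db by (intro AE_I2) auto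
    show "(\<integral>\<^sup>+w. ennreal (4 * T * N\<^sup>2) \<partial>M) < \<infinity>" by (simp add: emeasure_space_1)
    show "AE w in M. (\<lambda>k. D k w) \<longlonglongrightarrow> 0"
    proof (rule AE_I2)
      fix w assume w: "w \<in> space M"
      have "((\<lambda>u. \<integral>\<^sup>+r. nsq (f w (r + u) - f w r) \<partial>lborel) \<longlongrightarrow> 0) (at 0)"
        by (rule L2_translation_continuous[OF f1[OF w]]) (use le_less_trans[OF E[of w]] in auto)
      then show "(\<lambda>k. D k w) \<longlonglongrightarrow> 0"
        using U unfolding tendsto_at_iff_sequentially D_def comp_def by blast
    qed
  qed auto
  then show "((\<lambda>u. \<integral>\<^sup>+w. \<integral>\<^sup>+r. nsq (f w (r + u) - f w r) \<partial>lborel \<partial>M) \<circ> U) \<longlonglongrightarrow> 0"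
    by (simp add: D_def comp_def)
qed

context brownian_setting
begin

lemma qstep_approx_bounded:
  fixes \<Phi> :: "'w \<Rightarrow> real \<Rightarrow> 'h::{real_inner, banach, second_countable_topology}"
  assumes S: "qc_semigroup S \<mu>"
    and \<Phi>: "(\<lambda>(w, s). \<Phi> w s) \<in> borel_measurable (MT T)"
    and ad: "\<And>t. t \<in> {0..T} \<Longrightarrow> (\<lambda>w. \<Phi> w t) \<in> borel_measurable (F t)"
    and N: "\<And>w s. w \<in> space M \<Longrightarrow> s \<in> {0..T} \<Longrightarrow> norm (\<Phi> w s) \<le> N"
  shows "\<exists>Z \<Psi>. (\<forall>k. (\<exists>G. qstep S G (Z k) (\<Psi> k)) \<and> jmeas T (\<Psi> k))
    \<and> (\<lambda>k. energy T (\<lambda>w s. \<Phi> w s - \<Psi> k w s)) \<longlonglongrightarrow> 0"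
proof -
  interpret qc_semigroup S \<mu> by (rule S)
  obtain w0 where w0: "w0 \<in> space M" using not_empty by blast
  have N0: "0 \<le> N" using order_trans[OF norm_ge_zero N[OF w0, of 0]] T by simp
  \<comment> \<open>Extension by 0 gives a meaning to translations in time; the jumps at 0 and T do
    no harm to continuity in the square mean.\<close>
  define f where "f w s = (if w \<in> space M \<and> s \<in> {0..T} then \<Phi> w s else 0)" for w s
  have fN: "norm (f w s) \<le> N" for w s using N N0 by (auto simp: f_def)
  have fM: "(\<lambda>(w, s). f w s) \<in> borel_measurable (M \<Otimes>\<^sub>M borel)"
  proof -
    have [measurable]: "(\<lambda>p. \<Phi> (fst p) (max 0 (min T (snd p)))) \<in> borel_measurable (M \<Otimes>\<^sub>M borel)"
      using measurable_clamp[OF \<Phi>] T by (simp add: split_beta')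
    have "(\<lambda>p. indicat_real {0..T} (snd p) *\<^sub>R \<Phi> (fst p) (max 0 (min T (snd p)))) \<in> borel_measurable (M \<Otimes>\<^sub>M borel)"
      by measurable
    moreover have "indicat_real {0..T} (snd p) *\<^sub>R \<Phi> (fst p) (max 0 (min T (snd p))) = f (fst p) (snd p)"
      if "p \<in> space (M \<Otimes>\<^sub>M borel)" for p
      using that by (auto simp: f_def indicator_def space_pair_measure max_def min_def)
    ultimately show ?thesis by (simp add: split_beta' cong: measurable_cong)
  qed
  define m where "m u = (\<integral>\<^sup>+w. \<integral>\<^sup>+r. nsq (f w (r + u) - f w r) \<partial>lborel \<partial>M)" for u
  have m0: "(m \<longlongrightarrow> 0) (at 0)"
    unfolding m_def by (rule translation_continuous_product[OF fM fN]) (auto simp: f_def)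
  \<comment> \<open>Expected squared error when the value at time r + u is replaced by the value at
    time r.\<close>
  define b where "b r u = (\<integral>\<^sup>+w. nsq (f w (r + u) - f w r) \<partial>M)" for r u
  have tri: "(\<lambda>q. nsq (f (snd q) (fst (fst q) + snd (fst q)) - f (snd q) (fst (fst q)))) \<in> borel_measurable (((borel :: real measure) \<Otimes>\<^sub>M (borel :: real measure)) \<Otimes>\<^sub>M M)"
  proof -
    have fM': "(\<lambda>p. f (fst p) (snd p)) \<in> borel_measurable (M \<Otimes>\<^sub>M borel)" using fM by (simp add: split_beta')
    have "(\<lambda>q. (snd q, fst (fst q) + snd (fst q))) \<in> measurable (((borel :: real measure) \<Otimes>\<^sub>M (borel :: real measure)) \<Otimes>\<^sub>M M) (M \<Otimes>\<^sub>M (borel :: real measure))" by measurable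
    from measurable_compose[OF this fM'] have [measurable]: "(\<lambda>q. f (snd q) (fst (fst q) + snd (fst q))) \<in> borel_measurable (((borel :: real measure) \<Otimes>\<^sub>M (borel :: real measure)) \<Otimes>\<^sub>M M)" by simp
    have "(\<lambda>q. (snd q, fst (fst q))) \<in> measurable (((borel :: real measure) \<Otimes>\<^sub>M (borel :: real measure)) \<Otimes>\<^sub>M M) (M \<Otimes>\<^sub>M (borel :: real measure))" by measurable
    from measurable_compose[OF this fM'] have [measurable]: "(\<lambda>q. f (snd q) (fst (fst q))) \<in> borel_measurable (((borel :: real measure) \<Otimes>\<^sub>M (borel :: real measure)) \<Otimes>\<^sub>M M)" by simp
    show ?thesis by measurable
  qed
  have bM: "(\<lambda>(r, u). b r u) \<in> borel_measurable (borel \<Otimes>\<^sub>M borel)"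
    unfolding b_def split_beta'
    by (rule borel_measurable_nn_integral) (use tri in \<open>simp add: split_beta'\<close>)
  have two: "(\<lambda>(w, s). nsq (f w (s + u) - f w s)) \<in> borel_measurable (M \<Otimes>\<^sub>M lborel)" for u
  proof -
    have "(\<lambda>p. ((snd p, u), fst p)) \<in> measurable (M \<Otimes>\<^sub>M lborel) ((borel \<Otimes>\<^sub>M borel) \<Otimes>\<^sub>M M)" by measurable
    from measurable_compose[OF this tri] show ?thesis by (simp add: split_beta')
  qed
  have two': "(\<lambda>(w, s). nsq (f w (r + s) - f w r)) \<in> borel_measurable (M \<Otimes>\<^sub>M lborel)" for r
  proof -
    have "(\<lambda>p. ((r, snd p), fst p)) \<in> measurable (M \<Otimes>\<^sub>M lborel) ((borel \<Otimes>\<^sub>M borel) \<Otimes>\<^sub>M M)" by measurable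
    from measurable_compose[OF this tri] show ?thesis by (simp add: split_beta')
  qed
  interpret pair_sigma_finite M lborel ..
  have mb: "m u = (\<integral>\<^sup>+r. b r u \<partial>lborel)" for u
    unfolding m_def b_def by (rule Fubini'[OF two, symmetric])
  \<comment> \<open>The integral over the lags u is the expected error of freezing f at time r
    throughout a cell of length d, so the sum bounded by \<open>exists_good_shift\<close> is the
    error over all cells.\<close>
  have Ab: "(\<integral>\<^sup>+u\<in>{0<..d}. b r u \<partial>lborel) = (\<integral>\<^sup>+w. (\<integral>\<^sup>+s\<in>{r<..r+d}. nsq (f w s - f w r) \<partial>lborel) \<partial>M)" for r d
  proof -
    have "(\<integral>\<^sup>+u\<in>{0<..d}. b r u \<partial>lborel) = (\<integral>\<^sup>+u. \<integral>\<^sup>+w. nsq (f w (r + u) - f w r) * indicator {0<..d} u \<partial>M \<partial>lborel)"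
      unfolding b_def
    proof (rule nn_integral_cong, rule nn_integral_multc[symmetric])
      fix u
      show "(\<lambda>w. nsq (f w (r + u) - f w r)) \<in> borel_measurable M"
        using measurable_Pair1[OF two'[of r], of u] by simp
    qed
    also have "\<dots> = (\<integral>\<^sup>+w. \<integral>\<^sup>+u. nsq (f w (r + u) - f w r) * indicator {0<..d} u \<partial>lborel \<partial>M)"
    proof (rule Fubini')
      show "(\<lambda>(w, u). nsq (f w (r + u) - f w r) * indicator {0<..d} u) \<in> borel_measurable (M \<Otimes>\<^sub>M lborel)"
        using two'[of r] unfolding split_beta' by measurable
    qed
    also have "\<dots> = (\<integral>\<^sup>+w. (\<integral>\<^sup>+s\<in>{r<..r+d}. nsq (f w s - f w r) \<partial>lborel) \<partial>M)"
    proof (rule nn_integral_cong, goal_cases)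
      case w: (1 w)
      have [measurable]: "f w \<in> borel_measurable borel" using measurable_Pair2[OF fM w] by simp
      have "(\<integral>\<^sup>+u. nsq (f w (u + r) - f w r) * indicator {r<..r+d} (u + r) \<partial>lborel)
          = (\<integral>\<^sup>+s\<in>{r<..r+d}. nsq (f w s - f w r) \<partial>lborel)"
        by (rule nn_integral_lborel_shift) measurable
      moreover have "indicator {r<..r+d} (u + r) = (indicator {0<..d} u :: ennreal)" for u by (auto simp: indicator_def)
      ultimately show ?case
        by (simp add: add.commute)
    qed
    finally show ?thesis .
  qed
  have "\<forall>k. \<exists>d n h. 0 < d \<and> d \<le> 1 / real (Suc k) \<and> T \<le> real n * d \<and> 0 < h \<and> h < d \<and>
    (\<Sum>i<n. \<integral>\<^sup>+u\<in>{0<..d}. b (h + real i * d) u \<partial>lborel) \<le> ennreal (2 / real (Suc k))"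
  proof
    fix k
    have "\<forall>\<^sub>F u in at 0. m u < ennreal (1 / real (Suc k))" by (rule order_tendstoD(2)[OF m0]) auto
    then obtain d0 where d0: "0 < d0" "\<And>u. u \<noteq> 0 \<Longrightarrow> \<bar>u\<bar> < d0 \<Longrightarrow> m u < ennreal (1 / real (Suc k))"
      unfolding eventually_at by (auto simp: dist_real_def)
    define d where "d = min (d0 / 2) (1 / real (Suc k))"
    have d: "0 < d" "d \<le> 1 / real (Suc k)" "d < d0" using d0(1) by (auto simp: d_def min_def)
    define n where "n = nat \<lceil>T / d\<rceil>"
    have "T / d \<le> real n" unfolding n_def by (meson real_nat_ceiling_ge)
    then have n: "T \<le> real n * d" using d(1) by (simp add: pos_divide_le_eq)
    have "\<exists>h. 0 < h \<and> h < d \<and> (\<Sum>i<n. \<integral>\<^sup>+u\<in>{0<..d}. b (h + real i * d) u \<partial>lborel) \<le> ennreal (1 / real (Suc k) + 1 / real (Suc k))"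
    proof (rule exists_good_shift[OF bM d(1)])
      show "(\<integral>\<^sup>+r. b r u \<partial>lborel) \<le> ennreal (1 / real (Suc k))" if "0 < u" "u \<le> d" for u
        using d0(2)[of u] d(3) that by (auto simp: mb[symmetric] intro: less_imp_le)
    qed auto
    then show "\<exists>d n h. 0 < d \<and> d \<le> 1 / real (Suc k) \<and> T \<le> real n * d \<and> 0 < h \<and> h < d \<and>
      (\<Sum>i<n. \<integral>\<^sup>+u\<in>{0<..d}. b (h + real i * d) u \<partial>lborel) \<le> ennreal (2 / real (Suc k))"
      using d n by auto
  qed
  from choice3[OF this] obtain d n h where d: "\<And>k. 0 < d k" "\<And>k. d k \<le> 1 / real (Suc k)"
    and n: "\<And>k. T \<le> real (n k) * d k" and h: "\<And>k. 0 < h k" "\<And>k. h k < d k"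
    and hs: "\<And>k. (\<Sum>i<n k. \<integral>\<^sup>+u\<in>{0<..d k}. b (h k + real i * d k) u \<partial>lborel) \<le> ennreal (2 / real (Suc k))"
    by blast
  \<comment> \<open>Grid points beyond T are moved to T, where they produce only empty
    cells.\<close>
  define \<tau> where "\<tau> k i = min T (h k + real i * d k)" for k i
  define X where "X k i w = f w (\<tau> k i)" for k i w
  define st where "st k w s = elem_process (n k) (\<tau> k) (X k) w s" for k w s
  \<comment> \<open>The time elapsed since the last grid point, and 0 before the first one.\<close>
  define rr where "rr k s = (\<Sum>i<n k. indicat_real {\<tau> k i<..\<tau> k (Suc i)} s * (s - \<tau> k i))" for k s
  define \<Psi> where "\<Psi> k w s = (\<Sum>i<n k. indicat_real {\<tau> k i<..\<tau> k (Suc i)} s *\<^sub>R S (max 0 (s - \<tau> k i)) (X k i w))" for k w s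
  define Z where "Z k s w = (\<Sum>i<n k. S (max 0 (s - \<tau> k i)) ((B (min s (\<tau> k (Suc i))) w - B (min s (\<tau> k i)) w) *\<^sub>R X k i w))" for k s w
  have \<tau>: "0 \<le> \<tau> k i" "\<tau> k i \<le> T" for k i using T h(1)[of k] d(1)[of k] by (auto simp: \<tau>_def)
  have \<tau>mono: "\<tau> k i \<le> \<tau> k j" if "i \<le> j" for k i j
  proof -
    have "real i * d k \<le> real j * d k" using that d(1)[of k] by (intro mult_right_mono) auto
    then show ?thesis by (auto simp: \<tau>_def min_def)
  qed
  have el: "elementary F T (n k) (\<tau> k) (X k)" for k
    unfolding elementary_def
  proof (intro allI impI conjI)
    fix i
    show "0 \<le> \<tau> k i" "\<tau> k (Suc i) \<le> T" by (rule \<tau>)+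
    show "\<tau> k i \<le> \<tau> k (Suc i)" by (rule \<tau>mono) simp
    have "X k i \<in> borel_measurable (F (\<tau> k i)) \<longleftrightarrow> (\<lambda>w. \<Phi> w (\<tau> k i)) \<in> borel_measurable (F (\<tau> k i))"
      by (rule measurable_cong) (use \<tau>[of k i] space_F[of "\<tau> k i"] in \<open>auto simp: X_def f_def\<close>)
    then show "X k i \<in> borel_measurable (F (\<tau> k i))" using ad[of "\<tau> k i"] \<tau> by simp
    show "bounded (X k i ` space (F (\<tau> k i)))"
      unfolding bounded_iff X_def using fN by blast
  qed
  have q: "qstep S (\<tau> k ` {..n k}) (Z k) (\<Psi> k)" for k
    unfolding Z_def[abs_def] \<Psi>_def[abs_def] by (rule elementary_qstep_semigroup[OF S el]) simp
  \<comment> \<open>Up to the shift h nothing has been observed and all approximating quantities are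
    0; after it, each time lies in exactly one cell. Every later property of \<open>st\<close>,
    \<open>rr\<close> and \<Psi> is read off from this alternative.\<close>
  have cases: "(s \<le> h k \<and> st k w s = 0 \<and> rr k s = 0 \<and> \<Psi> k w s = 0) \<or>
    (\<exists>i<n k. h k + real i * d k < s \<and> s \<le> h k + real i * d k + d k \<and>
       st k w s = f w (h k + real i * d k) \<and> rr k s = s - (h k + real i * d k) \<and>
       \<Psi> k w s = S (s - (h k + real i * d k)) (f w (h k + real i * d k)))"
    if s: "s \<in> {0..T}" for k w s
  proof (cases "s \<le> h k")
    case True
    have "s \<le> \<tau> k i" for i
    proof -
      have "0 \<le> real i * d k" using d(1)[of k] by simp
      then show ?thesis using True s by (auto simp: \<tau>_def)
    qed
    then have "s \<notin> {\<tau> k i<..\<tau> k (Suc i)}" for i by (simp add: not_less)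
    then have z: "indicat_real {\<tau> k i<..\<tau> k (Suc i)} s = 0" for i by simp
    show ?thesis unfolding st_def elem_process_def rr_def \<Psi>_def z using True by simp
  next
    case False
    have "s \<le> \<tau> k (n k)" using s n[of k] h(1)[of k] by (auto simp: \<tau>_def)
    define j where "j = (LEAST j. s \<le> \<tau> k j)"
    have j1: "s \<le> \<tau> k j" unfolding j_def by (rule LeastI) fact
    have jn: "j \<le> n k" unfolding j_def by (rule Least_le) fact
    have "j \<noteq> 0" using j1 False by (auto simp: \<tau>_def intro: ccontr)
    then obtain i where i: "j = Suc i" by (cases j) auto
    have "\<not> s \<le> \<tau> k i" using not_less_Least[of i "\<lambda>j. s \<le> \<tau> k j"] i by (simp add: j_def[symmetric])
    then have si: "\<tau> k i < s" "s \<le> \<tau> k (Suc i)" "i < n k" using j1 jn i by auto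
    have ti: "\<tau> k i = h k + real i * d k" using si(1) s by (auto simp: \<tau>_def min_def split: if_splits)
    have ind: "indicat_real {\<tau> k l<..\<tau> k (Suc l)} s = (if l = i then 1 else 0)" if "l < n k" for l
    proof (cases "l < i")
      case True
      then show ?thesis using \<tau>mono[of "Suc l" i k] si by auto
    next
      case False
      then show ?thesis using \<tau>mono[of "Suc i" l k] si by (cases "l = i") auto
    qed
    have "st k w s = (\<Sum>l<n k. if l = i then X k i w else 0)"
      unfolding st_def elem_process_def by (rule sum.cong) (use ind in auto)
    moreover have "rr k s = (\<Sum>l<n k. if l = i then s - \<tau> k i else 0)"
      unfolding rr_def by (rule sum.cong) (use ind in auto)
    moreover have "\<Psi> k w s = (\<Sum>l<n k. if l = i then S (max 0 (s - \<tau> k i)) (X k i w) else 0)"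
      unfolding \<Psi>_def by (rule sum.cong) (use ind in auto)
    moreover have "s \<le> h k + real i * d k + d k" using si(2) by (simp add: \<tau>_def algebra_simps)
    ultimately show ?thesis
      using si ti by (intro disjI2 exI[of _ i]) (auto simp: X_def max_def)
  qed
  have rr: "0 \<le> rr k s" "rr k s \<le> d k" "rr k s \<le> T" if s: "s \<in> {0..T}" for k s
  proof -
    have hp: "0 \<le> h k + real i * d k" for i using h(1)[of k] d(1)[of k] by simp
    have "0 \<le> rr k s \<and> rr k s \<le> d k \<and> rr k s \<le> T"
      using cases[OF s, of k undefined]
    proof (elim disjE exE conjE)
      assume "rr k s = 0"
      then show ?thesis using T d(1)[of k] by simp
    next
      fix i assume i: "h k + real i * d k < s" "s \<le> h k + real i * d k + d k" "rr k s = s - (h k + real i * d k)"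
      then show ?thesis using hp[of i] s by auto
    qed
    then show "0 \<le> rr k s" "rr k s \<le> d k" "rr k s \<le> T" by blast+
  qed
  have \<Psi>e: "\<Psi> k w s = S (max 0 (rr k s)) (st k w s)" if s: "s \<in> {0..T}" for k w s
    using cases[OF s, of k w] by (elim disjE exE conjE) (auto simp: S_zero max_def)
  have stM: "jmeas T (st k)" for k
    unfolding st_def by (rule elementary_measurable(1)[OF el order_refl])
  have rrM: "(\<lambda>p. rr k (snd p)) \<in> borel_measurable (MT T)" for k
  proof -
    note [measurable] = measurable_snd_restrict
    show ?thesis unfolding rr_def by measurable
  qed
  have SrM: "jmeas T (\<lambda>w s. S (max 0 (rr k s)) (h w s))" if "jmeas T h" for k and h :: "'w \<Rightarrow> real \<Rightarrow> 'h"
    using S_measurable2[OF rrM that] by (simp add: split_beta')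
  have \<Psi>M: "jmeas T (\<Psi> k)" for k
  proof -
    have "(\<lambda>(w, s). S (max 0 (rr k s)) (st k w s)) p = (\<lambda>(w, s). \<Psi> k w s) p" if "p \<in> space (MT T)" for p
      using that \<Psi>e[of "snd p" k "fst p"] by (auto simp: space_pair_measure space_restrict_space)
    then show ?thesis using SrM[OF stM, of k k] by (simp cong: measurable_cong)
  qed
  have fR: "jmeas T f"
  proof -
    have "(\<lambda>p. (fst p, snd p)) \<in> measurable (MT T) (M \<Otimes>\<^sub>M borel)"
      by (intro measurable_Pair measurable_fst measurable_snd_restrict)
    from measurable_compose[OF this fM] show ?thesis by (simp add: split_beta')
  qed
  define E1 where "E1 k = energy T (\<lambda>w s. f w s - S (max 0 (rr k s)) (f w s))" for k
  define E2 where "E2 k = energy T (\<lambda>w s. f w s - st k w s)" for k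
  have E1: "E1 \<longlonglongrightarrow> 0"
    unfolding E1_def
  proof (rule energy_dominated_convergence[OF jmeas_diff[OF fR SrM[OF fR]]])
    let ?b = "\<lambda>_ _. N + exp (\<mu> * T) * N"
    show "jmeas T ?b" by simp
    show "energy T ?b < \<infinity>"
      by (rule le_less_trans[OF energy_bounded[of T _ "(N + exp (\<mu> * T) * N)\<^sup>2"]]) (use T in auto)
    fix k w s assume s: "s \<in> {0..T}"
    have "norm (f w s - S (max 0 (rr k s)) (f w s)) \<le> norm (f w s) + norm (S (max 0 (rr k s)) (f w s))"
      by (rule norm_triangle_ineq4)
    also have "\<dots> \<le> N + exp (\<mu> * T) * N"
      using rr[OF s, of k] by (intro add_mono fN order_trans[OF S_norm_le[of _ T]] mult_left_mono) auto
    finally show "norm (f w s - S (max 0 (rr k s)) (f w s)) \<le> norm (N + exp (\<mu> * T) * N)" by simp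
  next
    fix w s assume s: "s \<in> {0..T}"
    have "(\<lambda>k. rr k s) \<longlonglongrightarrow> 0"
    proof (rule tendsto_sandwich[OF always_eventually always_eventually tendsto_const LIMSEQ_inverse_real_of_nat])
      show "\<forall>k. 0 \<le> rr k s" using rr[OF s] by blast
      show "\<forall>k. rr k s \<le> inverse (real (Suc k))"
        using order_trans[OF rr(2)[OF s] d(2)] by (simp add: inverse_eq_divide)
    qed
    then have "(\<lambda>k. max 0 (rr k s)) \<longlonglongrightarrow> max 0 0" by (intro tendsto_intros)
    then have "(\<lambda>k. S (max 0 (rr k s)) (f w s)) \<longlonglongrightarrow> S 0 (f w s)"
      by (intro S_tendsto) auto
    from tendsto_diff[OF tendsto_const this, of "f w s"]
    show "(\<lambda>k. f w s - S (max 0 (rr k s)) (f w s)) \<longlonglongrightarrow> 0" by (simp add: S_0)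
  qed
  \<comment> \<open>The initial gap has length at most d k and costs N^2 d k; the remaining cells
    cost at most 2 / (k + 1) by the choice of the shift.\<close>
  have E2b: "E2 k \<le> ennreal ((N\<^sup>2 + 2) * (1 / real (Suc k)))" for k
  proof -
    let ?r = "\<lambda>i. h k + real i * d k"
    let ?e = "\<lambda>i w. \<integral>\<^sup>+s\<in>{?r i<..?r i + d k}. nsq (f w s - f w (?r i)) \<partial>lborel"
    have "E2 k \<le> (\<integral>\<^sup>+w. (\<integral>\<^sup>+s\<in>{0..d k}. ennreal (N\<^sup>2) \<partial>lborel) + (\<Sum>i<n k. ?e i w) \<partial>M)"
      unfolding E2_def energy_def
    proof (rule nn_integral_mono, goal_cases)
      case (1 w)
      have [measurable]: "f w \<in> borel_measurable borel" using measurable_Pair2[OF fM 1] by simp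
      have "path_sq T (\<lambda>s. f w s - st k w s) \<le> (\<integral>\<^sup>+s. ennreal (N\<^sup>2) * indicator {0..d k} s
          + (\<Sum>i<n k. nsq (f w s - f w (?r i)) * indicator {?r i<..?r i + d k} s) \<partial>lborel)"
      proof (rule nn_integral_mono, goal_cases)
        case (1 s)
        show ?case
        proof (cases "s \<in> {0..T}")
          case True
          from cases[OF True, of k w] show ?thesis
          proof (elim disjE exE conjE)
            assume "s \<le> h k" "st k w s = 0"
            then have "nsq (f w s - st k w s) * indicator {0..T} s \<le> ennreal (N\<^sup>2) * indicator {0..d k} s"
              using True h(2)[of k] fN[of w s] by (auto intro!: ennreal_leI power_mono)
            then show ?thesis by (rule order_trans) simp
          next
            fix i assume i: "i < n k" "?r i < s" "s \<le> ?r i + d k" "st k w s = f w (?r i)"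
            have "nsq (f w s - st k w s) * indicator {0..T} s = nsq (f w s - f w (?r i)) * indicator {?r i<..?r i + d k} s"
              using True i by simp
            also have "\<dots> \<le> (\<Sum>i<n k. nsq (f w s - f w (?r i)) * indicator {?r i<..?r i + d k} s)"
              by (rule member_le_sum) (use i in auto)
            finally show ?thesis by (rule order_trans) simp
          qed
        qed simp
      qed
      also have "\<dots> = (\<integral>\<^sup>+s\<in>{0..d k}. ennreal (N\<^sup>2) \<partial>lborel) + (\<Sum>i<n k. ?e i w)"
        by (subst nn_integral_add, measurable, subst nn_integral_sum, measurable)
      finally show ?case .
    qed
    also have "\<dots> = (\<integral>\<^sup>+w. (\<integral>\<^sup>+s\<in>{0..d k}. ennreal (N\<^sup>2) \<partial>lborel) \<partial>M) + (\<Sum>i<n k. \<integral>\<^sup>+w. ?e i w \<partial>M)"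
    proof -
      have fM': "(\<lambda>p. f (fst p) (snd p)) \<in> borel_measurable (M \<Otimes>\<^sub>M lborel)"
        using fM by (simp add: split_beta' cong: measurable_cong_sets add: sets_pair_measure_cong[OF refl sets_lborel])
      have [measurable]: "?e i \<in> borel_measurable M" for i
      proof (rule lborel.borel_measurable_nn_integral)
        have "(\<lambda>p. (fst p, ?r i)) \<in> measurable (M \<Otimes>\<^sub>M lborel) (M \<Otimes>\<^sub>M lborel)" by measurable
        from measurable_compose[OF this fM'] have "(\<lambda>p. f (fst p) (?r i)) \<in> borel_measurable (M \<Otimes>\<^sub>M lborel)" by simp
        with fM' show "(\<lambda>(w, s). nsq (f w s - f w (?r i)) * indicator {?r i<..?r i + d k} s) \<in> borel_measurable (M \<Otimes>\<^sub>M lborel)"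
          unfolding split_beta' by measurable
      qed
      show ?thesis by (subst nn_integral_add) (auto simp: nn_integral_sum)
    qed
    also have "(\<Sum>i<n k. \<integral>\<^sup>+w. ?e i w \<partial>M) \<le> ennreal (2 / real (Suc k))"
      using hs[of k] by (simp add: Ab)
    also have "(\<integral>\<^sup>+w. (\<integral>\<^sup>+s\<in>{0..d k}. ennreal (N\<^sup>2) \<partial>lborel) \<partial>M) = ennreal (N\<^sup>2 * d k)"
      using d(1)[of k] by (simp add: nn_integral_cmult_indicator emeasure_space_1 ennreal_mult)
    also have "ennreal (N\<^sup>2 * d k) + ennreal (2 / real (Suc k)) = ennreal (N\<^sup>2 * d k + 2 / real (Suc k))"
      using d(1)[of k] by (subst ennreal_plus) auto
    also have "\<dots> \<le> ennreal ((N\<^sup>2 + 2) * (1 / real (Suc k)))"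
      using mult_left_mono[OF d(2)[of k], of "N\<^sup>2"] by (intro ennreal_leI) (simp add: distrib_right add_divide_distrib)
    finally show ?thesis by (simp add: add_mono)
  qed
  have E2: "E2 \<longlonglongrightarrow> 0"
  proof -
    have "(\<lambda>k. ennreal ((N\<^sup>2 + 2) * inverse (real (Suc k)))) \<longlonglongrightarrow> ennreal ((N\<^sup>2 + 2) * 0)"
      by (intro tendsto_ennrealI tendsto_intros LIMSEQ_inverse_real_of_nat)
    then have L: "(\<lambda>k. ennreal ((N\<^sup>2 + 2) * inverse (real (Suc k)))) \<longlonglongrightarrow> 0" by simp
    show ?thesis
      by (rule tendsto_sandwich[OF always_eventually always_eventually tendsto_const L])
        (use E2b in \<open>auto simp: inverse_eq_divide\<close>)
  qed
  have tot: "energy T (\<lambda>w s. \<Phi> w s - \<Psi> k w s) \<le> 2 * (E1 k + ennreal ((exp (\<mu> * T))\<^sup>2) * E2 k)" for k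
  proof -
    let ?u = "\<lambda>w s. S (max 0 (rr k s)) (f w s - st k w s)"
    have j: "jmeas T (\<lambda>w s. f w s - st k w s)" by (rule jmeas_diff[OF fR stM])
    have "energy T (\<lambda>w s. \<Phi> w s - \<Psi> k w s) = energy T (\<lambda>w s. (f w s - S (max 0 (rr k s)) (f w s)) + ?u w s)"
      unfolding energy_def
      by (intro nn_integral_cong) (auto simp: \<Psi>e f_def S_minus indicator_def)
    also have "\<dots> \<le> 2 * (E1 k + energy T ?u)"
      unfolding E1_def by (rule energy_add[OF jmeas_diff[OF fR SrM[OF fR]] SrM[OF j]])
    also have "energy T ?u \<le> ennreal ((exp (\<mu> * T))\<^sup>2) * E2 k"
      unfolding E2_def using rr T by (intro energy_le[OF j]) (auto intro!: AE_I2 S_norm_le)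
    finally show ?thesis by (auto simp: mult_left_mono add_mono)
  qed
  have "(\<lambda>k. 2 * (E1 k + ennreal ((exp (\<mu> * T))\<^sup>2) * E2 k)) \<longlonglongrightarrow> 2 * (0 + ennreal ((exp (\<mu> * T))\<^sup>2) * 0)"
    by (intro tendsto_mult_ennreal tendsto_add tendsto_const E1 E2) auto
  then have L: "(\<lambda>k. 2 * (E1 k + ennreal ((exp (\<mu> * T))\<^sup>2) * E2 k)) \<longlonglongrightarrow> 0" by simp
  have "(\<lambda>k. energy T (\<lambda>w s. \<Phi> w s - \<Psi> k w s)) \<longlonglongrightarrow> 0"
    by (rule tendsto_sandwich[OF always_eventually always_eventually tendsto_const L]) (use tot in auto)
  then show ?thesis using q \<Psi>M by (intro exI[of _ Z] exI[of _ \<Psi>]) blast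
qed

end

section \<open>Limits of continuous processes and stochastic convolutions\<close>

context brownian_setting
begin

lemma cprocess_diff:
  fixes Y Z :: "real \<Rightarrow> 'w \<Rightarrow> 'h::{real_normed_vector, second_countable_topology}"
  assumes "cprocess Y" "cprocess Z"
  shows "cprocess (\<lambda>t w. Y t w - Z t w)"
  using assms unfolding cprocess_def
  by (auto intro!: continuous_intros borel_measurable_diff)

lemma ennreal_2_power: "(2 :: ennreal) ^ n = ennreal (2 ^ n)"
  by (metis ennreal_numeral ennreal_power zero_le_numeral)

lemma E_sup_triangle:
  fixes X Y Z :: "real \<Rightarrow> 'w \<Rightarrow> 'h::{real_normed_vector, second_countable_topology}"
  assumes c: "cprocess X" "cprocess Y" "cprocess Z" and t: "t \<le> T"
  shows "E_sup t (\<lambda>s w. X s w - Z s w) \<le> 2 * (E_sup t (\<lambda>s w. X s w - Y s w) + E_sup t (\<lambda>s w. Y s w - Z s w))"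
proof -
  note [measurable] = sup_sq_measurable[OF cprocess_diff[OF c(1,2)] t] sup_sq_measurable[OF cprocess_diff[OF c(2,3)] t]
  let ?b = "\<lambda>w. 2 * (sup_sq t (\<lambda>s w. X s w - Y s w) w + sup_sq t (\<lambda>s w. Y s w - Z s w) w)"
  have "E_sup t (\<lambda>s w. X s w - Z s w) \<le> (\<integral>\<^sup>+w. ?b w \<partial>M)"
  proof (rule nn_integral_mono)
    fix w
    have "nsq (X s w - Z s w) \<le> ?b w" if s: "s \<in> {0..t}" for s
    proof -
      have "nsq (X s w - Z s w) \<le> 2 * (nsq (X s w - Y s w) + nsq (Y s w - Z s w))"
        using nsq_add[of "X s w - Y s w" "Y s w - Z s w"] by simp
      also have "\<dots> \<le> ?b w"
        using s by (intro mult_left_mono add_mono) (auto simp: sup_sq_def intro!: SUP_upper)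
      finally show ?thesis .
    qed
    then show "sup_sq t (\<lambda>s w. X s w - Z s w) w \<le> ?b w"
      unfolding sup_sq_def[of t "\<lambda>s w. X s w - Z s w"] by (rule SUP_least)
  qed
  then show ?thesis by (simp add: nn_integral_cmult nn_integral_add)
qed

text \<open>Values of norm above N are replaced by 0, which keeps adaptedness and changes the energy
  little for large N; the bounded remainder is covered by
  \<open>qstep_approx_bounded\<close>.\<close>

lemma qstep_approx:
  fixes \<Phi> :: "'w \<Rightarrow> real \<Rightarrow> 'h::{real_inner, banach, second_countable_topology}"
  assumes S: "qc_semigroup S \<mu>" and \<Phi>: "jmeas T \<Phi>"
    and ad: "\<And>t. t \<in> {0..T} \<Longrightarrow> (\<lambda>w. \<Phi> w t) \<in> borel_measurable (F t)"
    and fin: "energy T \<Phi> < \<infinity>" and e: "0 < e"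
  shows "\<exists>G Z \<Psi>. qstep S G Z \<Psi> \<and> jmeas T \<Psi> \<and> energy T (\<lambda>w s. \<Phi> w s - \<Psi> w s) \<le> ennreal e"
proof -
  define f where "f N w s = (if norm (\<Phi> w s) \<le> real N then \<Phi> w s else 0)" for N w s
  have fJ: "jmeas T (f N)" for N
    using \<Phi> unfolding f_def split_beta' by measurable
  have "(\<lambda>N. energy T (\<lambda>w s. \<Phi> w s - f N w s)) \<longlonglongrightarrow> 0"
  proof (rule energy_dominated_convergence[OF jmeas_diff[OF \<Phi> fJ] \<Phi> fin])
    show "norm (\<Phi> w s - f N w s) \<le> norm (\<Phi> w s)" for N w s
      by (auto simp: f_def)
    fix w s
    obtain N0 where N0: "norm (\<Phi> w s) \<le> real N0" using real_arch_simple by blast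
    show "(\<lambda>N. \<Phi> w s - f N w s) \<longlonglongrightarrow> 0"
      by (rule tendsto_eventually, rule eventually_sequentiallyI[of N0]) (use N0 in \<open>auto simp: f_def\<close>)
  qed
  then have "\<forall>\<^sub>F N in sequentially. energy T (\<lambda>w s. \<Phi> w s - f N w s) < ennreal (e / 4)"
    by (rule order_tendstoD(2)) (use e in auto)
  then obtain N where N: "energy T (\<lambda>w s. \<Phi> w s - f N w s) < ennreal (e / 4)"
    by (auto simp: eventually_sequentially)
  have fb: "norm (f N w s) \<le> real N" for w s by (simp add: f_def)
  have "(\<lambda>w. f N w t) \<in> borel_measurable (F t)" if "t \<in> {0..T}" for t
    using ad[OF that] unfolding f_def by measurable
  then obtain Z \<Psi> where Z: "\<forall>k. (\<exists>G. qstep S G (Z k) (\<Psi> k)) \<and> jmeas T (\<Psi> k)"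
    and L: "(\<lambda>k. energy T (\<lambda>w s. f N w s - \<Psi> k w s)) \<longlonglongrightarrow> 0"
    using qstep_approx_bounded[OF S fJ[of N], of "real N"] fb by blast
  have "\<forall>\<^sub>F k in sequentially. energy T (\<lambda>w s. f N w s - \<Psi> k w s) < ennreal (e / 4)"
    by (rule order_tendstoD(2)[OF L]) (use e in auto)
  then obtain k where k: "energy T (\<lambda>w s. f N w s - \<Psi> k w s) < ennreal (e / 4)"
    by (auto simp: eventually_sequentially)
  have \<Psi>: "jmeas T (\<Psi> k)" using Z by blast
  have "energy T (\<lambda>w s. \<Phi> w s - \<Psi> k w s)
    \<le> 2 * (energy T (\<lambda>w s. \<Phi> w s - f N w s) + energy T (\<lambda>w s. f N w s - \<Psi> k w s))"
    by (rule energy_triangle[OF \<Phi> fJ \<Psi>])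
  also have "\<dots> \<le> 2 * (ennreal (e / 4) + ennreal (e / 4))"
    using N k by (intro mult_left_mono add_mono) auto
  also have "\<dots> = ennreal e" using e by (simp flip: ennreal_plus ennreal_numeral ennreal_mult)
  finally show ?thesis using Z by blast
qed

text \<open>Where the weighted sum \<open>W 0\<close> is finite, 2^k W k \<le> W 0 makes the paths
  uniformly Cauchy, so the limit is continuous. The remaining points form a null set, which belongs
  to every F t, and the limit is set to 0 there.\<close>

lemma cprocess_limit:
  fixes Z :: "nat \<Rightarrow> real \<Rightarrow> 'w \<Rightarrow> 'h::{banach, second_countable_topology}"
  assumes Z: "\<And>k. cprocess (Z k)" and C: "0 \<le> C"
    and le: "\<And>k. E_sup T (\<lambda>s w. Z (Suc k) s w - Z k s w) \<le> ennreal (C * (1/16) ^ k)"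
  shows "\<exists>Y. cprocess Y \<and> (\<forall>k. E_sup T (\<lambda>s w. Y s w - Z k s w) \<le> ennreal (3 * C * (1/16) ^ k))"
proof -
  define D where "D k w = sup_sq T (\<lambda>s w. Z (Suc k) s w - Z k s w) w" for k w
  have Dm[measurable]: "D k \<in> borel_measurable M" for k
    unfolding D_def[abs_def] by (intro sup_sq_measurable cprocess_diff Z) simp
  \<comment> \<open>The weights solve W k = 2 D k + 2 W (k + 1), which is what the inequality |x +
    y|^2 \<le> 2 (|x|^2 + |y|^2) produces when a long increment is split off step by step. The rate
    1/16 leaves a geometric series of ratio 1/8.\<close>
  define W where "W k w = (\<Sum>j. 2 ^ Suc j * D (k + j) w)" for k w
  have Wm[measurable]: "W k \<in> borel_measurable M" for k unfolding W_def[abs_def] by measurable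
  have WI: "(\<integral>\<^sup>+w. W k w \<partial>M) \<le> ennreal (3 * C * (1/16) ^ k)" for k
  proof -
    have "(\<integral>\<^sup>+w. W k w \<partial>M) = (\<Sum>j. \<integral>\<^sup>+w. 2 ^ Suc j * D (k + j) w \<partial>M)"
      unfolding W_def by (rule nn_integral_suminf) measurable
    also have "\<dots> = (\<Sum>j. 2 ^ Suc j * (\<integral>\<^sup>+w. D (k + j) w \<partial>M))"
      by (intro suminf_cong nn_integral_cmult) measurable
    also have "\<dots> \<le> (\<Sum>j. ennreal (2 * C * (1/16) ^ k * (1/8) ^ j))"
    proof (rule suminf_le)
      fix j
      have "2 ^ Suc j * (\<integral>\<^sup>+w. D (k + j) w \<partial>M) \<le> 2 ^ Suc j * ennreal (C * (1/16) ^ (k + j))"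
        unfolding D_def by (intro mult_left_mono le) simp
      also have "\<dots> = ennreal (2 ^ Suc j * (C * (1/16) ^ (k + j)))"
        using C by (simp add: ennreal_2_power ennreal_mult[symmetric] del: power_Suc)
      also have "2 ^ Suc j * (C * (1/16) ^ (k + j)) = 2 * C * (1/16) ^ k * (1/8) ^ j"
      proof -
        have "(1/8 :: real) ^ j = 2 ^ j * (1/16) ^ j" by (simp flip: power_mult_distrib)
        then show ?thesis by (simp add: power_add)
      qed
      finally show "2 ^ Suc j * (\<integral>\<^sup>+w. D (k + j) w \<partial>M) \<le> ennreal (2 * C * (1/16) ^ k * (1/8) ^ j)" .
    qed auto
    also have "\<dots> = ennreal (2 * C * (1/16) ^ k * (1 / (1 - 1/8)))"
      using C by (intro suminf_ennreal_eq sums_mult geometric_sums) auto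
    \<comment> \<open>2 / (1 - 1/8) = 16/7, which is below 3.\<close>
    also have "\<dots> \<le> ennreal (3 * C * (1/16) ^ k)"
      using C by (intro ennreal_leI) (simp add: mult_right_mono)
    finally show ?thesis .
  qed
  have Wrec: "W k w = 2 * D k w + 2 * W (Suc k) w" for k w
  proof -
    have "W k w = (\<Sum>j. 2 ^ Suc (j + 1) * D (k + (j + 1)) w) + (\<Sum>j<1. 2 ^ Suc j * D (k + j) w)"
      unfolding W_def by (rule suminf_offset) simp
    also have "(\<Sum>j. 2 ^ Suc (j + 1) * D (k + (j + 1)) w) = (\<Sum>j. 2 * (2 ^ Suc j * D (Suc k + j) w))"
      by (intro suminf_cong) (simp add: mult.assoc)
    also have "\<dots> = 2 * W (Suc k) w" unfolding W_def by (rule ennreal_suminf_cmult)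
    finally show ?thesis by (simp add: add.commute)
  qed
  have Wk: "2 ^ k * W k w \<le> W 0 w" for k w
  proof (induction k)
    case (Suc k)
    have "2 ^ Suc k * W (Suc k) w = 2 ^ k * (2 * W (Suc k) w)" by (simp add: mult.assoc mult.commute mult.left_commute)
    also have "\<dots> \<le> 2 ^ k * W k w" unfolding Wrec[of k] by (intro mult_left_mono) auto
    finally show ?case using Suc by (rule order_trans)
  qed simp
  have dW: "nsq (Z (k + m) s w - Z k s w) \<le> W k w" if s: "s \<in> {0..T}" for k m s w
  proof (induction m arbitrary: k)
    case (Suc m)
    have "nsq (Z (k + Suc m) s w - Z k s w)
      = nsq ((Z (Suc k) s w - Z k s w) + (Z (Suc k + m) s w - Z (Suc k) s w))" by simp
    also have "\<dots> \<le> 2 * (nsq (Z (Suc k) s w - Z k s w) + nsq (Z (Suc k + m) s w - Z (Suc k) s w))"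
      by (rule nsq_add)
    also have "\<dots> \<le> 2 * (D k w + W (Suc k) w)"
    proof (intro mult_left_mono add_mono)
      show "nsq (Z (Suc k) s w - Z k s w) \<le> D k w"
        using s by (auto simp: D_def sup_sq_def intro!: SUP_upper)
      show "nsq (Z (Suc k + m) s w - Z (Suc k) s w) \<le> W (Suc k) w" by (rule Suc)
    qed simp
    also have "\<dots> = W k w" by (simp add: Wrec[of k] distrib_left)
    finally show ?case .
  qed simp
  define good where "good = {w \<in> space M. W 0 w < \<infinity>}"
  have goodM: "good \<in> sets M" unfolding good_def by measurable
  have "AE w in M. W 0 w \<noteq> \<infinity>"
  proof (rule nn_integral_PInf_AE)
    have "(\<integral>\<^sup>+w. W 0 w \<partial>M) < \<infinity>" by (rule le_less_trans[OF WI]) simp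
    then show "(\<integral>\<^sup>+w. W 0 w \<partial>M) \<noteq> \<infinity>" by simp
  qed measurable
  then have AEg: "AE w in M. w \<in> good"
    using AE_space by eventually_elim (auto simp: good_def less_top)
  have good_F: "good \<in> sets (F t)" if t: "0 \<le> t" "t \<le> T" for t
  proof -
    have "space M - good \<in> null_sets M"
      using AEg goodM by (subst AE_iff_null_sets) (auto elim!: eventually_mono)
    from null_F[OF this order_refl t] have "space (F t) - (space M - good) \<in> sets (F t)" by blast
    moreover have "space (F t) - (space M - good) = good" using space_F[OF t] by (auto simp: good_def)
    ultimately show ?thesis by simp
  qed
  have ucau: "uniformly_Cauchy_on {0..T} (\<lambda>k s. Z k s w)" if w: "w \<in> good" for w
  proof -
    obtain R where R: "0 \<le> R" "W 0 w = ennreal R" using w by (auto simp: good_def less_top elim: ennreal_cases)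
    have key: "(norm (Z (k + m) s w - Z k s w))\<^sup>2 \<le> R / 2 ^ k" if s: "s \<in> {0..T}" for k m s
    proof -
      have "2 ^ k * nsq (Z (k + m) s w - Z k s w) \<le> ennreal R"
        unfolding R(2)[symmetric] by (rule order_trans[OF mult_left_mono[OF dW[OF s]] Wk]) simp
      also have "2 ^ k * nsq (Z (k + m) s w - Z k s w) = ennreal (2 ^ k * (norm (Z (k + m) s w - Z k s w))\<^sup>2)"
        by (simp add: ennreal_2_power ennreal_mult[symmetric])
      finally have "2 ^ k * (norm (Z (k + m) s w - Z k s w))\<^sup>2 \<le> R" using R by (simp add: ennreal_le_iff)
      then show ?thesis by (simp add: pos_le_divide_eq mult.commute)
    qed
    show ?thesis
      unfolding uniformly_Cauchy_on_def
    proof (intro allI impI)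
      fix e :: real assume e: "0 < e"
      have L: "(\<lambda>k. R / 2 ^ k) \<longlonglongrightarrow> 0"
        using LIMSEQ_divide_realpow_zero[of 2 R] by simp
      have "\<forall>\<^sub>F k in sequentially. R / 2 ^ k < (e / 2)\<^sup>2"
        by (rule order_tendstoD(2)[OF L]) (use e in auto)
      then obtain k where k: "R / 2 ^ k < (e / 2)\<^sup>2" by (auto simp: eventually_sequentially)
      have h: "dist (Z m s w) (Z k s w) < e / 2" if s: "s \<in> {0..T}" and m: "k \<le> m" for s m
      proof -
        have "(norm (Z (k + (m - k)) s w - Z k s w))\<^sup>2 < (e / 2)\<^sup>2" by (rule le_less_trans[OF key[OF s] k])
        then have "(norm (Z m s w - Z k s w))\<^sup>2 < (e / 2)\<^sup>2" by (simp only: le_add_diff_inverse[OF m])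
        then have "norm (Z m s w - Z k s w) < e / 2" by (rule power2_less_imp_less) (use e in simp)
        then show ?thesis by (simp add: dist_norm)
      qed
      show "\<exists>k. \<forall>s\<in>{0..T}. \<forall>m\<ge>k. \<forall>n\<ge>k. dist (Z m s w) (Z n s w) < e"
      proof (intro exI[of _ k] ballI allI impI)
        fix s m n assume s: "s \<in> {0..T}" "k \<le> m" "k \<le> n"
        show "dist (Z m s w) (Z n s w) < e"
          using dist_triangle_half_l[of "Z m s w" "Z k s w" e "Z n s w"] h[OF s(1,2)] h[OF s(1,3)] by simp
      qed
    qed
  qed
  define Y where "Y s w = (if w \<in> good then lim (\<lambda>k. Z k s w) else 0)" for s w
  have ulim: "uniform_limit {0..T} (\<lambda>k s. Z k s w) (\<lambda>s. Y s w) sequentially" if w: "w \<in> good" for w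
    using Cauchy_uniformly_convergent[OF ucau[OF w]] w
    by (simp add: uniformly_convergent_uniform_limit_iff Y_def)
  have lim: "(\<lambda>k. Z k s w) \<longlonglongrightarrow> Y s w" if "w \<in> good" "s \<in> {0..T}" for s w
    by (rule tendsto_uniform_limitI[OF ulim[OF that(1)] that(2)])
  have cY: "cprocess Y"
    unfolding cprocess_def
  proof (intro conjI ballI)
    fix t assume t: "t \<in> {0..T}"
    have Zt[measurable]: "Z k t \<in> borel_measurable (F t)" for k using cprocessD(1)[OF Z] t by auto
    have [measurable]: "good \<in> sets (F t)" using good_F t by auto
    show "Y t \<in> borel_measurable (F t)"
    proof (rule borel_measurable_LIMSEQ_metric)
      show "(\<lambda>w. if w \<in> good then Z k t w else 0) \<in> borel_measurable (F t)" for k by measurable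
      show "(\<lambda>k. if w \<in> good then Z k t w else 0) \<longlonglongrightarrow> Y t w" for w
        using lim[OF _ t, of w] by (auto simp: Y_def)
    qed
  next
    fix w assume w: "w \<in> space M"
    show "continuous_on {0..T} (\<lambda>t. Y t w)"
    proof (cases "w \<in> good")
      case True
      show ?thesis
        by (rule uniform_limit_theorem[OF always_eventually ulim[OF True]])
          (use Z w in \<open>auto simp: cprocess_def\<close>)
    qed (simp add: Y_def)
  qed
  have "E_sup T (\<lambda>s w. Y s w - Z k s w) \<le> ennreal (3 * C * (1/16) ^ k)" for k
  proof -
    have "E_sup T (\<lambda>s w. Y s w - Z k s w) \<le> (\<integral>\<^sup>+w. W k w \<partial>M)"
    proof (rule nn_integral_mono_AE, goal_cases)
      case 1
      show ?case
        using AEg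
      proof eventually_elim
        case w: (elim w)
        show ?case
          unfolding sup_sq_def
        proof (rule SUP_least)
          fix s assume s: "s \<in> {0..T}"
          have "(\<lambda>m. Z (m + k) s w) \<longlonglongrightarrow> Y s w" by (rule LIMSEQ_ignore_initial_segment[OF lim[OF w s]])
          then have "(\<lambda>m. nsq (Z (m + k) s w - Z k s w)) \<longlonglongrightarrow> nsq (Y s w - Z k s w)"
            by (intro tendsto_ennrealI tendsto_intros)
          then show "nsq (Y s w - Z k s w) \<le> W k w"
            by (rule LIMSEQ_le_const2) (use dW[OF s, of k] in \<open>auto simp: add.commute\<close>)
        qed
      qed
    qed
    then show ?thesis using WI by (rule order_trans)
  qed
  with cY show ?thesis by blast
qed

text \<open>Step processes approximating \<Phi> at rate 16^-k have explicit convolutions, and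
  \<open>qstep_maximal\<close> for differences of consecutive ones provides the hypothesis of
  \<open>cprocess_limit\<close>. For each t the same sequence, seen through
  \<open>qstep_elementary\<close>, exhibits the limit as an Ito integral. The constant is 72 = 2 *
  18 * 2, with one factor 2 from splitting the process and one from splitting the energy.\<close>

lemma stochastic_convolution:
  fixes \<Phi> :: "'w \<Rightarrow> real \<Rightarrow> 'h::{real_inner, banach, second_countable_topology}"
  assumes S: "qc_semigroup S \<mu>" and \<Phi>: "jmeas T \<Phi>"
    and ad: "\<And>t. t \<in> {0..T} \<Longrightarrow> (\<lambda>w. \<Phi> w t) \<in> borel_measurable (F t)"
    and fin: "energy T \<Phi> < \<infinity>"
  shows "\<exists>Z. cprocess Z \<and> (\<forall>t\<in>{0..T}. has_ito_integral M F B t (\<lambda>w s. S (t - s) (\<Phi> w s)) (Z t)) \<and>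
    (\<forall>t\<in>{0..T}. E_sup t Z \<le> ennreal (72 * exp (2 * \<mu> * T)) * energy t \<Phi>)"
proof -
  interpret qc_semigroup S \<mu> by (rule S)
  define E where "E = exp (2 * \<mu> * T)"
  have "\<forall>k. \<exists>G Z \<Psi>. qstep S G Z \<Psi> \<and> jmeas T \<Psi> \<and> energy T (\<lambda>w s. \<Phi> w s - \<Psi> w s) \<le> ennreal ((1/16) ^ k)"
    using qstep_approx[OF S \<Phi> ad fin] by simp
  from choice3[OF this] obtain G Z \<Psi> where q: "\<And>k. qstep S (G k) (Z k) (\<Psi> k)" and \<Psi>: "\<And>k. jmeas T (\<Psi> k)"
    and err: "\<And>k. energy T (\<lambda>w s. \<Phi> w s - \<Psi> k w s) \<le> ennreal ((1/16) ^ k)" by blast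
  have cZ: "cprocess (Z k)" for k by (rule qstep_cprocess[OF S q])
  have "\<exists>Y. cprocess Y \<and> (\<forall>k. E_sup T (\<lambda>s w. Y s w - Z k s w) \<le> ennreal (3 * (72 * E) * (1/16) ^ k))"
  proof (rule cprocess_limit[OF cZ])
    show "0 \<le> 72 * E" by (simp add: E_def)
    fix k
    have "qstep S (G (Suc k) \<union> G k) (\<lambda>s w. Z (Suc k) s w - Z k s w) (\<lambda>w s. \<Psi> (Suc k) w s - \<Psi> k w s)"
      using qstep_lincomb[OF S q[of "Suc k"] q[of k], of 1 "-1"] by simp
    from qstep_maximal[OF S this, of T]
    have "E_sup T (\<lambda>s w. Z (Suc k) s w - Z k s w) \<le> ennreal (18 * E) * energy T (\<lambda>w s. \<Psi> (Suc k) w s - \<Psi> k w s)"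
      using T by (simp add: energy_def E_def)
    also have "\<dots> \<le> ennreal (18 * E) * (2 * (ennreal ((1/16) ^ k) + ennreal ((1/16) ^ k)))"
    proof (intro mult_left_mono order_trans[OF energy_triangle[OF \<Psi> \<Phi> \<Psi>]] add_mono)
      show "energy T (\<lambda>w s. \<Phi> w s - \<Psi> k w s) \<le> ennreal ((1/16) ^ k)" by (rule err)
      have "energy T (\<lambda>w s. \<Psi> (Suc k) w s - \<Phi> w s) \<le> ennreal ((1/16) ^ Suc k)"
        by (subst energy_minus_commute) (rule err)
      also have "\<dots> \<le> ennreal ((1/16) ^ k)" by (intro ennreal_leI) simp
      finally show "energy T (\<lambda>w s. \<Psi> (Suc k) w s - \<Phi> w s) \<le> ennreal ((1/16) ^ k)" .
    qed auto
    also have "\<dots> = ennreal (72 * E * (1/16) ^ k)"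
      by (simp add: E_def flip: ennreal_plus ennreal_numeral ennreal_mult)
    finally show "E_sup T (\<lambda>s w. Z (Suc k) s w - Z k s w) \<le> ennreal (72 * E * (1/16) ^ k)" .
  qed
  then obtain Y where Y: "cprocess Y"
    and YZ: "\<And>k. E_sup T (\<lambda>s w. Y s w - Z k s w) \<le> ennreal (3 * (72 * E) * (1/16) ^ k)" by blast
  have pow0: "(\<lambda>k. ennreal (c * (1/16) ^ k)) \<longlonglongrightarrow> 0" for c
  proof -
    have "(\<lambda>k. ennreal (c * (1/16) ^ k)) \<longlonglongrightarrow> ennreal (c * 0)"
      by (intro tendsto_ennrealI tendsto_intros LIMSEQ_realpow_zero) auto
    then show ?thesis by simp
  qed
  have supT: "sup_sq t X w \<le> sup_sq T X w" if "t \<le> T" for t X w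
    unfolding sup_sq_def using that by (intro SUP_subset_mono) auto
  have ito: "has_ito_integral M F B t (\<lambda>w s. S (t - s) (\<Phi> w s)) (Y t)" if t: "t \<in> {0..T}" for t
  proof -
    have t': "0 \<le> t" "t \<le> T" using t by auto
    have SM: "jmeas t (\<lambda>w s. S (t - s) (g w s))" if "jmeas T g" for g :: "'w \<Rightarrow> real \<Rightarrow> 'h"
    proof -
      note [measurable] = measurable_snd_restrict
      have "(\<lambda>p. S (max 0 (t - snd p)) ((\<lambda>(w, s). g w s) p)) \<in> borel_measurable (MT t)"
        by (intro S_measurable2[OF _ jmeas_restrict[OF that t'(2)]]) measurable
      moreover have "S (max 0 (t - snd p)) ((\<lambda>(w, s). g w s) p) = (\<lambda>(w, s). S (t - s) (g w s)) p" if "p \<in> space (MT t)" for p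
        using that by (auto simp: space_pair_measure space_restrict_space max_def)
      ultimately show ?thesis by (simp cong: measurable_cong)
    qed
    have "\<forall>k. \<exists>m g X. elementary F t m g X \<and> (\<forall>w\<in>space M.
      (\<forall>s\<in>{0<..t}. elem_process m g X w s = S (t - s) (\<Psi> k w s)) \<and> elem_integral B m g X w = Z k t w)"
      by (intro allI qstep_elementary[OF S q t'])
    from choice3[OF this] obtain m g X where e: "\<And>k. elementary F t (m k) (g k) (X k)"
      and eP: "\<And>k w s. w \<in> space M \<Longrightarrow> s \<in> {0<..t} \<Longrightarrow> elem_process (m k) (g k) (X k) w s = S (t - s) (\<Psi> k w s)"
      and eI: "\<And>k w. w \<in> space M \<Longrightarrow> elem_integral B (m k) (g k) (X k) w = Z k t w"
      by blast
    let ?D = "\<lambda>k w s. S (t - s) (\<Phi> w s) - elem_process (m k) (g k) (X k) w s"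
    have DM: "jmeas t (?D k)" for k
      by (rule jmeas_diff[OF SM[OF \<Phi>] elementary_measurable(1)[OF e t'(2)]])
    have le1: "energy t (?D k) \<le> ennreal (E * (1/16) ^ k)" for k
    proof -
      have "energy t (?D k) \<le> ennreal ((exp (\<mu> * T))\<^sup>2) * energy T (\<lambda>w s. \<Phi> w s - \<Psi> k w s)"
      proof (rule energy_le[OF jmeas_diff[OF \<Phi> \<Psi>] t'(2)])
        fix w assume w: "w \<in> space M"
        show "AE s in lborel. s \<in> {0..t} \<longrightarrow> norm (?D k w s) \<le> exp (\<mu> * T) * norm (\<Phi> w s - \<Psi> k w s)"
          using AE_lborel_singleton[of 0]
        proof eventually_elim
          case (elim s)
          then have "?D k w s = S (t - s) (\<Phi> w s - \<Psi> k w s)" if "s \<in> {0..t}"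
            using that eP[OF w, of s k] by (simp add: S_minus)
          then show ?case using S_norm_le[of "t - s" T "\<Phi> w s - \<Psi> k w s"] t' by auto
        qed
      qed simp
      also have "\<dots> \<le> ennreal E * ennreal ((1/16) ^ k)"
        unfolding E_def by (intro mult_mono err) (simp_all add: exp_double[symmetric] mult.assoc)
      finally show ?thesis by (simp add: ennreal_mult E_def)
    qed
    have L1: "(\<lambda>k. energy t (?D k)) \<longlonglongrightarrow> 0"
      by (rule tendsto_sandwich[OF always_eventually always_eventually tendsto_const pow0]) (use le1 in auto)
    have [measurable]: "Y t \<in> borel_measurable M" "\<And>k. Z k t \<in> borel_measurable M"
      using cprocessD(2)[OF Y t'] cprocessD(2)[OF cZ t'] by auto
    have le2: "(\<integral>\<^sup>+w. nsq (Y t w - Z k t w) \<partial>M) \<le> ennreal (3 * (72 * E) * (1/16) ^ k)" for k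
    proof (rule order_trans[OF _ YZ])
      show "(\<integral>\<^sup>+w. nsq (Y t w - Z k t w) \<partial>M) \<le> E_sup T (\<lambda>s w. Y s w - Z k s w)"
        using t by (intro nn_integral_mono) (auto simp: sup_sq_def intro!: SUP_upper)
    qed
    have L2: "(\<lambda>k. \<integral>\<^sup>+w. nsq (Y t w - Z k t w) \<partial>M) \<longlonglongrightarrow> 0"
      by (rule tendsto_sandwich[OF always_eventually always_eventually tendsto_const pow0]) (use le2 in auto)
    show ?thesis
      unfolding has_ito_integral_def
    proof (intro conjI exI[of _ m] exI[of _ g] exI[of _ X] allI impI)
      show "jmeas t (\<lambda>w s. S (t - s) (\<Phi> w s))" by (rule SM[OF \<Phi>])
      show "Y t \<in> borel_measurable M" by measurable
      show "elementary F t (m k) (g k) (X k)" for k by (rule e)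
      fix \<epsilon> :: real assume \<epsilon>: "0 < \<epsilon>"
      show "(\<lambda>k. measure M {w \<in> space M. (path_sq t (?D k w)) > ennreal \<epsilon>}) \<longlonglongrightarrow> 0"
        by (rule tendsto_prob_nn_integral[OF path_sq_measurable[OF DM] L1[unfolded energy_def] \<epsilon>])
      have "{w \<in> space M. norm (Y t w - elem_integral B (m k) (g k) (X k) w) > \<epsilon>}
        = {w \<in> space M. nsq (Y t w - Z k t w) > ennreal (\<epsilon>\<^sup>2)}" for k
        using \<epsilon> eI by (auto simp: ennreal_less_iff power_strict_mono dest: power2_less_imp_less)
      moreover have "(\<lambda>k. measure M {w \<in> space M. nsq (Y t w - Z k t w) > ennreal (\<epsilon>\<^sup>2)}) \<longlonglongrightarrow> 0"
        by (rule tendsto_prob_nn_integral[OF _ L2]) (use \<epsilon> in auto)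
      ultimately show "(\<lambda>k. measure M {w \<in> space M. norm (Y t w - elem_integral B (m k) (g k) (X k) w) > \<epsilon>}) \<longlonglongrightarrow> 0"
        by simp
    qed
  qed
  have bound: "E_sup t Y \<le> ennreal (72 * E) * energy t \<Phi>" if t: "t \<in> {0..T}" for t
  proof -
    have t': "0 \<le> t" "t \<le> T" using t by auto
    note \<Phi>t = jmeas_restrict[OF \<Phi> t'(2)] and \<Psi>t = jmeas_restrict[OF \<Psi> t'(2)]
    \<comment> \<open>The final bound on [0, t] contains the energy up to t only, as iterations in
      time require. Approximation errors on all of [0, T] are harmless because they disappear as k
      grows.\<close>
    have b: "E_sup t Y \<le> 2 * (ennreal (3 * (72 * E) * (1/16) ^ k)
        + ennreal (18 * E) * (2 * (ennreal (1 * (1/16) ^ k) + energy t \<Phi>)))" for k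
    proof -
      have "E_sup t Y \<le> 2 * (E_sup t (\<lambda>s w. Y s w - Z k s w) + E_sup t (Z k))"
        using E_sup_triangle[OF Y cZ, of "\<lambda>_ _. 0" t k] t by (simp add: cprocess_def)
      also have "\<dots> \<le> 2 * (ennreal (3 * (72 * E) * (1/16) ^ k)
        + ennreal (18 * E) * (2 * (ennreal (1 * (1/16) ^ k) + energy t \<Phi>)))"
      proof (intro mult_left_mono add_mono)
        show "E_sup t (\<lambda>s w. Y s w - Z k s w) \<le> ennreal (3 * (72 * E) * (1/16) ^ k)"
          by (rule order_trans[OF nn_integral_mono YZ]) (rule supT[OF t'(2)])
        have "E_sup t (Z k) \<le> ennreal (18 * E) * energy t (\<Psi> k)"
          using qstep_maximal[OF S q t'] by (simp add: energy_def E_def)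
        also have "energy t (\<Psi> k) \<le> 2 * (energy t (\<lambda>w s. \<Psi> k w s - \<Phi> w s) + energy t \<Phi>)"
          using energy_add[OF jmeas_diff[OF \<Psi>t \<Phi>t] \<Phi>t] by simp
        also have "energy t (\<lambda>w s. \<Psi> k w s - \<Phi> w s) \<le> ennreal (1 * (1/16) ^ k)"
          using energy_le[OF jmeas_diff[OF \<Phi> \<Psi>] t'(2), of 1 "\<lambda>w s. \<Psi> k w s - \<Phi> w s" k] err[of k]
          by (simp add: norm_minus_commute)
        finally show "E_sup t (Z k) \<le> ennreal (18 * E) * (2 * (ennreal (1 * (1/16) ^ k) + energy t \<Phi>))"
          by (auto simp: mult_left_mono add_mono)
      qed simp
      finally show ?thesis .
    qed
    have "(\<lambda>k. 2 * (ennreal (3 * (72 * E) * (1/16) ^ k) + ennreal (18 * E) * (2 * (ennreal (1 * (1/16) ^ k) + energy t \<Phi>))))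
      \<longlonglongrightarrow> 2 * (0 + ennreal (18 * E) * (2 * (0 + energy t \<Phi>)))"
      by (intro tendsto_mult_ennreal tendsto_add tendsto_const pow0) (auto simp: E_def)
    then have "E_sup t Y \<le> 2 * (0 + ennreal (18 * E) * (2 * (0 + energy t \<Phi>)))"
      by (rule LIMSEQ_le_const) (use b in auto)
    also have "\<dots> = ennreal (72 * E) * energy t \<Phi>"
    proof -
      have "ennreal (72 * E) = 2 * (ennreal (18 * E) * 2)"
        by (simp add: E_def flip: ennreal_numeral ennreal_mult)
      then show ?thesis by (simp add: mult.assoc)
    qed
    finally show ?thesis .
  qed
  show ?thesis using Y ito bound by (intro exI[of _ Y]) (auto simp: E_def)
qed

end

subsection \<open>Substitution operators\<close>

text \<open>In a second countable metric space an open set is a countable union of balls. For maps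
  into classes of functions, distances to fixed points are given by integrals and can be handled
  directly.\<close>

lemma borel_measurable_dist:
  fixes f :: "'a \<Rightarrow> 'h::{metric_space, second_countable_topology}"
  assumes f: "\<And>y. (\<lambda>x. dist y (f x)) \<in> borel_measurable N"
  shows "f \<in> borel_measurable N"
proof (rule borel_measurableI)
  fix U :: "'h set" assume U: "open U"
  define \<B> where "\<B> = {ball y r | y r. ball y r \<subseteq> U}"
  obtain \<C> where C: "\<C> \<subseteq> \<B>" "countable \<C>" "\<Union>\<C> = \<Union>\<B>"
    by (rule Lindelof[of \<B>]) (auto simp: \<B>_def)
  have "\<Union>\<B> = U"
  proof
    show "U \<subseteq> \<Union>\<B>"
    proof
      fix x assume "x \<in> U"
      then obtain r where "0 < r" "ball x r \<subseteq> U" using U by (auto simp: open_contains_ball)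
      then show "x \<in> \<Union>\<B>" by (auto simp: \<B>_def intro!: exI[of _ "ball x r"])
    qed
  qed (auto simp: \<B>_def)
  with C(3) have CU: "\<Union>\<C> = U" by simp
  have "f -` U \<inter> space N = (\<Union>A\<in>\<C>. f -` A \<inter> space N)" unfolding CU[symmetric] by auto
  also have "\<dots> \<in> sets N"
  proof (rule sets.countable_UN'[OF C(2)])
    show "(\<lambda>A. f -` A \<inter> space N) ` \<C> \<subseteq> sets N"
    proof clarify
      fix A assume "A \<in> \<C>"
      then obtain y r where A: "A = ball y r" using C(1) by (auto simp: \<B>_def)
      have "f -` A \<inter> space N = {x \<in> space N. dist y (f x) < r}" by (auto simp: A)
      also have "\<dots> \<in> sets N" using f[of y] by measurable
      finally show "f -` A \<inter> space N \<in> sets N" .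
    qed
  qed
  finally show "f -` U \<inter> space N \<in> sets N" .
qed

text \<open>For a simple Y the composition is pieced together from finitely many measurable
  functions; continuity in the second argument passes to limits of simple functions.\<close>

lemma borel_measurable_Caratheodory:
  fixes Y :: "'a \<Rightarrow> 'b::{metric_space, second_countable_topology}"
    and f :: "'a \<Rightarrow> 'b \<Rightarrow> 'c::{metric_space, second_countable_topology}"
  assumes f: "\<And>h. (\<lambda>x. f x h) \<in> borel_measurable N"
    and cont: "\<And>x. x \<in> space N \<Longrightarrow> continuous_on UNIV (f x)"
    and Y: "Y \<in> borel_measurable N"
  shows "(\<lambda>x. f x (Y x)) \<in> borel_measurable N"
proof -
  fix z :: 'b
  obtain s where s: "\<And>i. simple_function N (s i)" "\<And>x. x \<in> space N \<Longrightarrow> (\<lambda>i. s i x) \<longlonglongrightarrow> Y x"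
    using borel_measurable_implies_sequence_metric[OF Y, of z] by blast
  show ?thesis
  proof (rule borel_measurable_LIMSEQ_metric)
    fix i
    have fin: "finite (s i ` space N)" by (rule simple_functionD[OF s(1)])
    have "s i \<in> measurable N (count_space (s i ` space N))"
    proof (rule measurableI)
      fix A assume "A \<in> sets (count_space (s i ` space N))"
      show "s i -` A \<inter> space N \<in> sets N" by (rule simple_functionD[OF s(1)])
    qed auto
    then show "(\<lambda>x. f x (s i x)) \<in> borel_measurable N"
      by (rule measurable_compose_countable'[OF f _ countable_finite[OF fin]])
  next
    fix x assume x: "x \<in> space N"
    show "(\<lambda>i. f x (s i x)) \<longlonglongrightarrow> f x (Y x)"
      by (rule continuous_on_tendsto_compose[OF cont[OF x] s(2)[OF x]]) auto
  qed
qed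

locale weighted_L2 =
  fixes \<rho> :: "real \<Rightarrow> real" and lam Lam :: real
    and cls :: "(real \<Rightarrow> real) \<Rightarrow> 'h::{real_inner, banach, second_countable_topology}"
  assumes H: "is_L2_space \<rho> cls" and rho_meas[measurable]: "\<rho> \<in> borel_measurable borel"
    and lam: "0 < lam" and rho: "\<And>x. lam \<le> \<rho> x" "\<And>x. \<rho> x \<le> Lam"
begin

lemma rho_pos: "0 < \<rho> x" using less_le_trans[OF lam rho(1)] .

lemma sq_int_S2: "sq_int \<rho> = S2" using sq_int_eq_S2[OF rho_meas lam] rho by blast

lemma sq_int_measurable: "\<phi> \<in> sq_int \<rho> \<Longrightarrow> \<phi> \<in> borel_measurable borel"
  by (simp add: sq_int_def)

lemma sq_int_diff: "\<phi> \<in> sq_int \<rho> \<Longrightarrow> \<psi> \<in> sq_int \<rho> \<Longrightarrow> (\<lambda>x. \<phi> x - \<psi> x) \<in> sq_int \<rho>"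
  using S2_lin[of \<phi> \<psi> 1 "-1"] by (simp add: sq_int_S2)

lemma repr_mem: "repr \<rho> cls h \<in> sq_int \<rho>" and cls_repr: "cls (repr \<rho> cls h) = h"
proof -
  have "h \<in> cls ` sq_int \<rho>" using H by (simp add: is_L2_space_def)
  then have "\<exists>\<phi>. \<phi> \<in> sq_int \<rho> \<and> cls \<phi> = h" by auto
  from someI_ex[OF this] show "repr \<rho> cls h \<in> sq_int \<rho>" "cls (repr \<rho> cls h) = h"
    unfolding repr_def by blast+
qed

lemma cls_diff:
  assumes "\<phi> \<in> sq_int \<rho>" "\<psi> \<in> sq_int \<rho>"
  shows "cls (\<lambda>x. \<phi> x - \<psi> x) = cls \<phi> - cls \<psi>"
proof -
  have "cls (\<lambda>x. 1 * \<phi> x + (-1) * \<psi> x) = 1 *\<^sub>R cls \<phi> + (-1) *\<^sub>R cls \<psi>"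
    using H assms unfolding is_L2_space_def by blast
  then show ?thesis by simp
qed

lemma norm_cls:
  assumes p: "\<phi> \<in> sq_int \<rho>"
  shows "nsq (cls \<phi>) = (\<integral>\<^sup>+x. ennreal ((\<phi> x)\<^sup>2 / \<rho> x) \<partial>lborel)"
proof -
  have "(norm (cls \<phi>))\<^sup>2 = (LINT x|lborel. \<phi> x * \<phi> x / \<rho> x)"
    unfolding power2_norm_eq_inner using H p unfolding is_L2_space_def by blast
  also have "\<dots> = (LINT x|lborel. (\<phi> x)\<^sup>2 / \<rho> x)" by (simp add: power2_eq_square)
  finally show ?thesis
    using p rho_pos by (subst nn_integral_eq_integral) (auto simp: sq_int_def less_imp_le)
qed

lemma norm_cls_diff:
  assumes "\<phi> \<in> sq_int \<rho>" "\<psi> \<in> sq_int \<rho>"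
  shows "nsq (cls \<phi> - cls \<psi>) = (\<integral>\<^sup>+x. ennreal ((\<phi> x - \<psi> x)\<^sup>2 / \<rho> x) \<partial>lborel)"
  using norm_cls[OF sq_int_diff[OF assms]] by (simp add: cls_diff[OF assms])

text \<open>The Lipschitz bound compares with \<open>G x 0\<close>. A bound by a multiple of 1 + |y|
  would not do, as constants are not square integrable on the line.\<close>

lemma superposition_sq_int:
  assumes G0: "(\<lambda>x. G x 0) \<in> sq_int \<rho>" and Gm: "(\<lambda>x. G x (\<phi> x)) \<in> borel_measurable borel"
    and lip: "\<And>x y y'. \<bar>G x y - G x y'\<bar> \<le> L * \<bar>y - y'\<bar>" and \<phi>: "\<phi> \<in> sq_int \<rho>"
  shows "(\<lambda>x. G x (\<phi> x)) \<in> sq_int \<rho>"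
proof -
  have S: "(\<lambda>x. 1 * \<bar>G x 0\<bar> + L * \<bar>\<phi> x\<bar>) \<in> S2"
    using G0 \<phi> by (intro S2_lin) (auto simp: sq_int_S2 S2_def)
  have "integrable lborel (\<lambda>x. (G x (\<phi> x))\<^sup>2)"
  proof (rule Bochner_Integration.integrable_bound[OF S2_int[OF S]])
    show "AE x in lborel. norm ((G x (\<phi> x))\<^sup>2) \<le> norm ((1 * \<bar>G x 0\<bar> + L * \<bar>\<phi> x\<bar>)\<^sup>2)"
    proof (rule AE_I2)
      fix x
      have "\<bar>G x (\<phi> x)\<bar> \<le> 1 * \<bar>G x 0\<bar> + L * \<bar>\<phi> x\<bar>" using lip[of x "\<phi> x" 0] by simp
      from power_mono[OF this, of 2] show "norm ((G x (\<phi> x))\<^sup>2) \<le> norm ((1 * \<bar>G x 0\<bar> + L * \<bar>\<phi> x\<bar>)\<^sup>2)"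
        by simp
    qed
  qed (use Gm in simp)
  then show ?thesis using Gm by (simp add: sq_int_S2 S2_def)
qed

lemma superposition_Lipschitz:
  assumes G: "\<And>\<phi>. \<phi> \<in> sq_int \<rho> \<Longrightarrow> (\<lambda>x. G x (\<phi> x)) \<in> sq_int \<rho>"
    and lip: "\<And>x y y'. \<bar>G x y - G x y'\<bar> \<le> L * \<bar>y - y'\<bar>" and L: "0 \<le> L"
    and \<phi>: "\<phi> \<in> sq_int \<rho>" and \<psi>: "\<psi> \<in> sq_int \<rho>"
  shows "norm (cls (\<lambda>x. G x (\<phi> x)) - cls (\<lambda>x. G x (\<psi> x))) \<le> L * norm (cls \<phi> - cls \<psi>)"
proof -
  note [measurable] = sq_int_measurable[OF \<phi>] sq_int_measurable[OF \<psi>]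
  have "nsq (cls (\<lambda>x. G x (\<phi> x)) - cls (\<lambda>x. G x (\<psi> x)))
      = (\<integral>\<^sup>+x. ennreal ((G x (\<phi> x) - G x (\<psi> x))\<^sup>2 / \<rho> x) \<partial>lborel)"
    by (rule norm_cls_diff) (intro G \<phi> \<psi>)+
  also have "\<dots> \<le> (\<integral>\<^sup>+x. ennreal (L\<^sup>2) * ennreal ((\<phi> x - \<psi> x)\<^sup>2 / \<rho> x) \<partial>lborel)"
  proof (rule nn_integral_mono, goal_cases)
    case (1 x)
    have "(G x (\<phi> x) - G x (\<psi> x))\<^sup>2 \<le> (L * \<bar>\<phi> x - \<psi> x\<bar>)\<^sup>2"
      using power_mono[OF lip[of x "\<phi> x" "\<psi> x"], of 2] by simp
    then have "(G x (\<phi> x) - G x (\<psi> x))\<^sup>2 / \<rho> x \<le> L\<^sup>2 * ((\<phi> x - \<psi> x)\<^sup>2 / \<rho> x)"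
      using rho_pos[of x] by (simp add: power_mult_distrib divide_right_mono)
    then show ?case
      using rho_pos[of x] by (simp flip: ennreal_mult add: ennreal_leI)
  qed
  also have "\<dots> = ennreal (L\<^sup>2) * nsq (cls \<phi> - cls \<psi>)"
    by (simp add: nn_integral_cmult norm_cls_diff[OF \<phi> \<psi>])
  also have "\<dots> = ennreal ((L * norm (cls \<phi> - cls \<psi>))\<^sup>2)"
    by (simp add: power_mult_distrib ennreal_mult)
  finally have "(norm (cls (\<lambda>x. G x (\<phi> x)) - cls (\<lambda>x. G x (\<psi> x))))\<^sup>2 \<le> (L * norm (cls \<phi> - cls \<psi>))\<^sup>2"
    by (simp add: ennreal_le_iff)
  then show ?thesis by (rule power2_le_imp_le) (use L in simp)
qed

text \<open>The distance of \<open>cls (G a)\<close> to a fixed class is the square root of an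
  integral over x, measurable in a by Tonelli's theorem, so \<open>borel_measurable_dist\<close>
  applies.\<close>

lemma cls_measurable:
  assumes G: "(\<lambda>(a, x). G a x) \<in> borel_measurable (N \<Otimes>\<^sub>M borel)"
    and mem: "\<And>a. a \<in> space N \<Longrightarrow> G a \<in> sq_int \<rho>"
  shows "(\<lambda>a. cls (G a)) \<in> borel_measurable N"
proof (rule borel_measurable_dist)
  fix y
  let ?\<psi> = "repr \<rho> cls y"
  have [measurable]: "?\<psi> \<in> borel_measurable borel" by (rule sq_int_measurable[OF repr_mem])
  have [measurable]: "(\<lambda>p. G (fst p) (snd p)) \<in> borel_measurable (N \<Otimes>\<^sub>M lborel)"
    using G by (simp add: split_beta' cong: measurable_cong_sets add: sets_pair_measure_cong[OF refl sets_lborel])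
  have [measurable]: "(\<lambda>a. \<integral>\<^sup>+x. ennreal ((G a x - ?\<psi> x)\<^sup>2 / \<rho> x) \<partial>lborel) \<in> borel_measurable N"
    by (rule lborel.borel_measurable_nn_integral) (simp add: split_beta', measurable)
  have "(\<lambda>a. sqrt (enn2real (\<integral>\<^sup>+x. ennreal ((G a x - ?\<psi> x)\<^sup>2 / \<rho> x) \<partial>lborel))) \<in> borel_measurable N"
    by measurable
  moreover have "sqrt (enn2real (\<integral>\<^sup>+x. ennreal ((G a x - ?\<psi> x)\<^sup>2 / \<rho> x) \<partial>lborel)) = dist y (cls (G a))"
    if "a \<in> space N" for a
    unfolding norm_cls_diff[OF mem[OF that] repr_mem, symmetric] by (simp add: cls_repr dist_norm norm_minus_commute)
  ultimately show "(\<lambda>a. dist y (cls (G a))) \<in> borel_measurable N" by (simp cong: measurable_cong)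
qed

end

context brownian_setting
begin

text \<open>Measurability is asked for fixed h only; the joint measurability needed after inserting
  a process follows from continuity in h. All of the later theory sees the coefficients through this
  predicate and not through their pointwise form.\<close>

definition lip_coeff :: "real \<Rightarrow> ('w \<Rightarrow> real \<Rightarrow> 'h \<Rightarrow> 'h::{real_inner, banach, second_countable_topology}) \<Rightarrow> bool" where
  "lip_coeff L N \<longleftrightarrow> 0 \<le> L \<and>
     (\<forall>w\<in>space M. \<forall>t\<in>{0..T}. \<forall>h h'. norm (N w t h - N w t h') \<le> L * norm (h - h')) \<and>
     (\<forall>h. jmeas T (\<lambda>w t. N w t h)) \<and> (\<forall>t\<in>{0..T}. \<forall>h. (\<lambda>w. N w t h) \<in> borel_measurable (F t)) \<and>
     energy T (\<lambda>w t. N w t 0) < \<infinity>"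

lemma lip_coeffD:
  assumes "lip_coeff L N"
  shows "0 \<le> L" "w \<in> space M \<Longrightarrow> 0 \<le> t \<Longrightarrow> t \<le> T \<Longrightarrow> norm (N w t h - N w t h') \<le> L * norm (h - h')"
    "jmeas T (\<lambda>w t. N w t h)" "0 \<le> t \<Longrightarrow> t \<le> T \<Longrightarrow> (\<lambda>w. N w t h) \<in> borel_measurable (F t)"
    "energy T (\<lambda>w t. N w t 0) < \<infinity>"
  using assms unfolding lip_coeff_def by auto

lemma lip_coeff_continuous:
  assumes N: "lip_coeff L N" and "w \<in> space M" "0 \<le> t" "t \<le> T"
  shows "continuous_on UNIV (N w t)"
proof (rule lipschitz_on_continuous_on)
  show "L-lipschitz_on UNIV (N w t)"
    using lip_coeffD(1,2)[OF N] assms(2-4) by (intro lipschitz_onI) (auto simp: dist_norm)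
qed

lemma lip_coeff_jmeas:
  assumes N: "lip_coeff L N" and Y: "jmeas T Y"
  shows "jmeas T (\<lambda>w t. N w t (Y w t))"
  unfolding split_beta'
proof (rule borel_measurable_Caratheodory[where f = "\<lambda>p. N (fst p) (snd p)" and Y = "\<lambda>p. Y (fst p) (snd p)"])
  show "(\<lambda>p. N (fst p) (snd p) h) \<in> borel_measurable (MT T)" for h
    using lip_coeffD(3)[OF N, of h] by (simp add: split_beta')
  show "(\<lambda>p. Y (fst p) (snd p)) \<in> borel_measurable (MT T)"
    using Y by (simp add: split_beta')
  fix p assume "p \<in> space (MT T)"
  then show "continuous_on UNIV (N (fst p) (snd p))"
    by (intro lip_coeff_continuous[OF N]) (auto simp: space_pair_measure space_restrict_space)
qed

lemma lip_coeff_adapted: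
  assumes N: "lip_coeff L N" and t: "0 \<le> t" "t \<le> T" and Y: "Y \<in> borel_measurable (F t)"
  shows "(\<lambda>w. N w t (Y w)) \<in> borel_measurable (F t)"
  by (rule borel_measurable_Caratheodory[OF lip_coeffD(4)[OF N t] lip_coeff_continuous[OF N _ t] Y])
    (simp add: space_F[OF t])

end

locale nemytskii_setting = brownian_setting M F T B + weighted_L2 \<rho> lam Lam cls
  for M :: "'w measure" and F T B \<rho> lam Lam
    and cls :: "(real \<Rightarrow> real) \<Rightarrow> 'h::{real_inner, banach, second_countable_topology}"
begin

lemma nemytskii_lip_coeff:
  assumes gM: "measurable_field M T g" and gF: "adapted_field F T g" and L: "0 \<le> L"
    and lip: "\<And>w t x y y'. w \<in> space M \<Longrightarrow> t \<in> {0..T} \<Longrightarrow> \<bar>g w t x y - g w t x y'\<bar> \<le> L * \<bar>y - y'\<bar>"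
    and g0: "H_valued_at_zero M T \<rho> g"
  shows "lip_coeff L (nemytskii \<rho> cls g)"
proof -
  have sect: "(\<lambda>x. g w t x (\<phi> x)) \<in> borel_measurable borel"
    if w: "w \<in> space M" and t: "t \<in> {0..T}" and [measurable]: "\<phi> \<in> borel_measurable borel" for w t \<phi>
  proof -
    have "(\<lambda>x. (w, t, x, \<phi> x)) \<in> measurable borel (M \<Otimes>\<^sub>M restrict_space borel {0..T} \<Otimes>\<^sub>M borel \<Otimes>\<^sub>M borel)"
      using w t by (intro measurable_Pair) (auto simp: space_restrict_space)
    from measurable_compose[OF this gM[unfolded measurable_field_def]] show ?thesis by simp
  qed
  have g00: "(\<lambda>x. g w t x 0) \<in> sq_int \<rho>" if "w \<in> space M" "t \<in> {0..T}" for w t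
    using g0 that by (simp add: H_valued_at_zero_def)
  have mem: "(\<lambda>x. g w t x (\<phi> x)) \<in> sq_int \<rho>" if "w \<in> space M" "t \<in> {0..T}" "\<phi> \<in> sq_int \<rho>" for w t \<phi>
    by (rule superposition_sq_int[where L = L and G = "g w t" and \<phi> = \<phi>, OF g00 sect lip])
      (use that in \<open>auto intro: sq_int_measurable\<close>)
  have lipN: "norm (cls (\<lambda>x. g w t x (\<phi> x)) - cls (\<lambda>x. g w t x (\<psi> x))) \<le> L * norm (cls \<phi> - cls \<psi>)"
    if "w \<in> space M" "t \<in> {0..T}" "\<phi> \<in> sq_int \<rho>" "\<psi> \<in> sq_int \<rho>" for w t \<phi> \<psi>
    by (rule superposition_Lipschitz[where G = "g w t", OF mem lip L]) (use that in auto)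
  show ?thesis
    unfolding lip_coeff_def
  proof (intro conjI ballI allI)
    show "norm (nemytskii \<rho> cls g w t h - nemytskii \<rho> cls g w t h') \<le> L * norm (h - h')"
      if "w \<in> space M" "t \<in> {0..T}" for w t h h'
      using lipN[OF that repr_mem repr_mem, of h h'] by (simp add: nemytskii_def cls_repr)
    fix h
    let ?\<phi> = "repr \<rho> cls h"
    have [measurable]: "?\<phi> \<in> borel_measurable borel" by (rule sq_int_measurable[OF repr_mem])
    show "jmeas T (\<lambda>w t. nemytskii \<rho> cls g w t h)"
      unfolding nemytskii_def split_beta'
    proof (rule cls_measurable)
      have "(\<lambda>q. (fst (fst q), snd (fst q), snd q, ?\<phi> (snd q)))
        \<in> measurable ((MT T) \<Otimes>\<^sub>M borel) (M \<Otimes>\<^sub>M restrict_space borel {0..T} \<Otimes>\<^sub>M borel \<Otimes>\<^sub>M borel)"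
        by (intro measurable_Pair) measurable
      from measurable_compose[OF this gM[unfolded measurable_field_def]]
      show "(\<lambda>(p, x). g (fst p) (snd p) x (?\<phi> x)) \<in> borel_measurable ((MT T) \<Otimes>\<^sub>M borel)"
        by (simp add: split_beta')
      show "(\<lambda>x. g (fst p) (snd p) x (?\<phi> x)) \<in> sq_int \<rho>" if "p \<in> space (MT T)" for p
        using that by (intro mem repr_mem) (auto simp: space_pair_measure space_restrict_space)
    qed
    show "(\<lambda>w. nemytskii \<rho> cls g w t h) \<in> borel_measurable (F t)" if t: "t \<in> {0..T}" for t
      unfolding nemytskii_def
    proof (rule cls_measurable)
      have "(\<lambda>q. (fst q, snd q, ?\<phi> (snd q))) \<in> measurable (F t \<Otimes>\<^sub>M borel) (F t \<Otimes>\<^sub>M borel \<Otimes>\<^sub>M borel)"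
        by measurable
      moreover have "(\<lambda>(w, x, y). g w t x y) \<in> borel_measurable (F t \<Otimes>\<^sub>M borel \<Otimes>\<^sub>M borel)"
        using gF t by (simp add: adapted_field_def)
      ultimately have "(\<lambda>q. (\<lambda>(w, x, y). g w t x y) (fst q, snd q, ?\<phi> (snd q))) \<in> borel_measurable (F t \<Otimes>\<^sub>M borel)"
        by (rule measurable_compose)
      then show "(\<lambda>(w, x). g w t x (?\<phi> x)) \<in> borel_measurable (F t \<Otimes>\<^sub>M borel)"
        by (simp add: split_beta')
      show "(\<lambda>x. g w t x (?\<phi> x)) \<in> sq_int \<rho>" if "w \<in> space (F t)" for w
        using that t space_F[of t] by (intro mem repr_mem) auto
    qed
  next
    have z: "(\<lambda>x. 0) \<in> sq_int \<rho>" by (simp add: sq_int_def)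
    have cz: "cls (\<lambda>x. 0) = 0" using cls_diff[OF z z] by simp
    \<comment> \<open>\<open>repr\<close> may choose for the class 0 a function that vanishes only
      almost everywhere. The Lipschitz estimate with distance 0 shows that the resulting class is
      nevertheless that of g(\<cdot>, 0).\<close>
    have N0: "nemytskii \<rho> cls g w t 0 = cls (\<lambda>x. g w t x 0)" if "w \<in> space M" "t \<in> {0..T}" for w t
      using lipN[OF that repr_mem z, of 0] by (simp add: nemytskii_def cls_repr cz)
    have "energy T (\<lambda>w t. nemytskii \<rho> cls g w t 0)
      = (\<integral>\<^sup>+w. (\<integral>\<^sup>+t\<in>{0..T}. (\<integral>\<^sup>+x. ennreal ((g w t x 0)\<^sup>2 / \<rho> x) \<partial>lborel) \<partial>lborel) \<partial>M)"
      unfolding energy_def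
      by (intro nn_integral_cong) (auto simp: N0 norm_cls[OF g00] indicator_def)
    also have "\<dots> < \<infinity>" using g0 by (simp add: H_valued_at_zero_def)
    finally show "energy T (\<lambda>w t. nemytskii \<rho> cls g w t 0) < \<infinity>" .
  qed (rule L)
qed

end

section \<open>Convolutions in time\<close>

context qc_semigroup
begin

lemma convolution_measurable:
  assumes [measurable]: "path_measurable t f"
  shows "path_measurable t (\<lambda>s. S (t - s) (f s))"
proof -
  have "(\<lambda>s. S (max 0 (t - s)) (indicat_real {0..t} s *\<^sub>R f s)) \<in> borel_measurable borel"
    by (rule S_measurable2) measurable
  moreover have "S (max 0 (t - s)) (indicat_real {0..t} s *\<^sub>R f s) = indicat_real {0..t} s *\<^sub>R S (t - s) (f s)" for s
    by (cases "s \<in> {0..t}") (auto simp: S_zero max_def)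
  ultimately show ?thesis by simp
qed

text \<open>The norm goes inside the integral, the semigroup contributes at most exp (\<mu> c), and
  the Cauchy-Schwarz inequality on [0, t] gives the factor t \<le> c.\<close>

lemma convolution_bound:
  assumes f[measurable]: "path_measurable t f" and t: "0 \<le> t" "t \<le> c"
  shows "nsq (LINT s:{0..t}|lborel. S (t - s) (f s))
    \<le> ennreal (c * exp (2 * \<mu> * c)) * path_sq t f"
proof -
  note [measurable] = convolution_measurable[OF f]
  have nm[measurable]: "(\<lambda>s. ennreal (norm (indicat_real {0..t} s *\<^sub>R f s))) \<in> borel_measurable borel" by measurable
  have "ennreal (norm (LINT s:{0..t}|lborel. S (t - s) (f s))) \<le> (\<integral>\<^sup>+s. ennreal (norm (indicat_real {0..t} s *\<^sub>R S (t - s) (f s))) \<partial>lborel)"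
  proof (cases "integrable lborel (\<lambda>s. indicat_real {0..t} s *\<^sub>R S (t - s) (f s))")
    case True
    then show ?thesis unfolding set_lebesgue_integral_def by (rule integral_norm_bound_ennreal)
  next
    \<comment> \<open>The integral of a non-integrable function is 0 by convention, so the estimate
      persists without any assumption of integrability.\<close>
    case False
    then show ?thesis by (simp add: set_lebesgue_integral_def not_integrable_integral_eq)
  qed
  also have "\<dots> \<le> (\<integral>\<^sup>+s. (ennreal (exp (\<mu> * c)) * indicator {0..t} s) * ennreal (norm (indicat_real {0..t} s *\<^sub>R f s)) \<partial>lborel)"
  proof (rule nn_integral_mono, goal_cases)
    case (1 s)
    show ?case
      using S_norm_le[of "t - s" c "f s"] t
      by (cases "s \<in> {0..t}") (auto simp: ennreal_mult[symmetric] intro!: ennreal_leI)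
  qed
  finally have "(ennreal (norm (LINT s:{0..t}|lborel. S (t - s) (f s))))\<^sup>2
    \<le> (\<integral>\<^sup>+s. (ennreal (exp (\<mu> * c)) * indicator {0..t} s) * ennreal (norm (indicat_real {0..t} s *\<^sub>R f s)) \<partial>lborel)\<^sup>2"
    by (rule power_mono) simp
  also have "\<dots> \<le> (\<integral>\<^sup>+s. (ennreal (exp (\<mu> * c)) * indicator {0..t} s)\<^sup>2 \<partial>lborel) * (\<integral>\<^sup>+s. (ennreal (norm (indicat_real {0..t} s *\<^sub>R f s)))\<^sup>2 \<partial>lborel)"
    by (rule Cauchy_Schwarz_nn_integral) measurable
  also have "(\<integral>\<^sup>+s. (ennreal (norm (indicat_real {0..t} s *\<^sub>R f s)))\<^sup>2 \<partial>lborel) = path_sq t f"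
    by (intro nn_integral_cong) (auto simp: indicator_def ennreal_power)
  also have "(\<integral>\<^sup>+s. (ennreal (exp (\<mu> * c)) * indicator {0..t} s)\<^sup>2 \<partial>lborel) = (\<integral>\<^sup>+s. ennreal (exp (2 * \<mu> * c)) * indicator {0..t} s \<partial>lborel)"
    by (intro nn_integral_cong) (auto simp: indicator_def ennreal_power exp_double[symmetric] mult.assoc)
  also have "\<dots> = ennreal (t * exp (2 * \<mu> * c))"
    using t by (subst nn_integral_cmult_indicator) (auto simp: ennreal_mult mult.commute)
  also have "ennreal (t * exp (2 * \<mu> * c)) * (path_sq t f)
    \<le> ennreal (c * exp (2 * \<mu> * c)) * path_sq t f"
    using t by (intro mult_right_mono ennreal_leI) auto
  finally show ?thesis by (simp add: ennreal_power)
qed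

lemma convolution_integrable:
  assumes f: "set_integrable lborel {0..t} f"
  shows "set_integrable lborel {0..t} (\<lambda>s. S (t - s) (f s))"
  unfolding set_integrable_def
proof (rule Bochner_Integration.integrable_bound)
  show "integrable lborel (\<lambda>s. exp (\<mu> * t) * norm (indicat_real {0..t} s *\<^sub>R f s))"
    using f unfolding set_integrable_def by (intro integrable_mult_right integrable_norm)
  have "path_measurable t f"
    using borel_measurable_integrable[OF f[unfolded set_integrable_def]] by simp
  from convolution_measurable[OF this]
  show "(\<lambda>s. indicat_real {0..t} s *\<^sub>R S (t - s) (f s)) \<in> borel_measurable lborel" by simp
  show "AE s in lborel. norm (indicat_real {0..t} s *\<^sub>R S (t - s) (f s)) \<le> norm (exp (\<mu> * t) * norm (indicat_real {0..t} s *\<^sub>R f s))"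
    using S_norm_le[of "t - s" t "f s" for s] by (intro AE_I2) (auto simp: indicator_def)
qed

lemma convolution_continuous:
  assumes f: "set_integrable lborel {0..c} f"
  shows "continuous_on {0..c} (\<lambda>t. LINT s:{0..t}|lborel. S (t - s) (f s))"
  unfolding continuous_on_sequentially
proof (intro allI ballI impI)
  fix r t assume t: "t \<in> {0..c}" and r: "(\<forall>n. r n \<in> {0..c}) \<and> r \<longlonglongrightarrow> t"
  have fi: "integrable lborel (\<lambda>s. indicat_real {0..c} s *\<^sub>R f s)" using f by (simp add: set_integrable_def)
  have sub: "(\<lambda>s. indicat_real {0..u} s *\<^sub>R f s) \<in> borel_measurable borel" if "u \<in> {0..c}" for u
  proof -
    have "set_integrable lborel {0..u} f" by (rule set_integrable_subset[OF f]) (use that in auto)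
    from borel_measurable_integrable[OF this[unfolded set_integrable_def]] show ?thesis by simp
  qed
  have "(\<lambda>n. \<integral>s. indicat_real {0..r n} s *\<^sub>R S (r n - s) (f s) \<partial>lborel) \<longlonglongrightarrow> (\<integral>s. indicat_real {0..t} s *\<^sub>R S (t - s) (f s) \<partial>lborel)"
  proof (rule integral_dominated_convergence)
    show "integrable lborel (\<lambda>s. exp (\<mu> * c) * norm (indicat_real {0..c} s *\<^sub>R f s))"
      by (intro integrable_mult_right integrable_norm fi)
    show "(\<lambda>s. indicat_real {0..t} s *\<^sub>R S (t - s) (f s)) \<in> borel_measurable lborel"
      using convolution_measurable[OF sub[OF t]] by simp
    show "(\<lambda>s. indicat_real {0..r n} s *\<^sub>R S (r n - s) (f s)) \<in> borel_measurable lborel" for n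
      using convolution_measurable[OF sub[of "r n"]] r by simp
    show "AE s in lborel. norm (indicat_real {0..r n} s *\<^sub>R S (r n - s) (f s)) \<le> exp (\<mu> * c) * norm (indicat_real {0..c} s *\<^sub>R f s)" for n
    proof (rule AE_I2)
      fix s
      have "r n \<le> c" using r by auto
      then show "norm (indicat_real {0..r n} s *\<^sub>R S (r n - s) (f s)) \<le> exp (\<mu> * c) * norm (indicat_real {0..c} s *\<^sub>R f s)"
        using S_norm_le[of "r n - s" c "f s"] by (cases "s \<in> {0..r n}") auto
    qed
    show "AE s in lborel. (\<lambda>n. indicat_real {0..r n} s *\<^sub>R S (r n - s) (f s)) \<longlonglongrightarrow> indicat_real {0..t} s *\<^sub>R S (t - s) (f s)"
      \<comment> \<open>For s different from t the indicators of [0, r n] are eventually constant;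
        at s = t they need not converge.\<close>
      using AE_lborel_singleton[of t]
    proof eventually_elim
      case st: (elim s)
      show ?case
      proof (cases "0 \<le> s \<and> s < t")
        case True
        then have ev: "\<forall>\<^sub>F n in sequentially. s < r n" using r order_tendstoD(1) by blast
        have "(\<lambda>n. S (max 0 (r n - s)) (f s)) \<longlonglongrightarrow> S (max 0 (t - s)) (f s)"
          using r by (intro S_tendsto tendsto_intros) auto
        moreover have "\<forall>\<^sub>F n in sequentially. S (max 0 (r n - s)) (f s) = indicat_real {0..r n} s *\<^sub>R S (r n - s) (f s)"
          using ev by (rule eventually_mono) (use True in \<open>auto simp: max_def\<close>)
        ultimately have "(\<lambda>n. indicat_real {0..r n} s *\<^sub>R S (r n - s) (f s)) \<longlonglongrightarrow> S (max 0 (t - s)) (f s)"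
          by (rule Lim_transform_eventually)
        then show ?thesis using True by (simp add: max_def)
      next
        case False
        have "\<forall>\<^sub>F n in sequentially. indicat_real {0..r n} s = 0"
        proof (cases "s < 0")
          case False
          then have "t < s" using \<open>\<not> (0 \<le> s \<and> s < t)\<close> st by auto
          then have "\<forall>\<^sub>F n in sequentially. r n < s" using r order_tendstoD(2) by blast
          then show ?thesis by eventually_elim auto
        qed auto
        then have "\<forall>\<^sub>F n in sequentially. indicat_real {0..r n} s *\<^sub>R S (r n - s) (f s) = 0"
          by eventually_elim simp
        moreover have "indicat_real {0..t} s = 0" using False st by auto
        ultimately show ?thesis by (simp add: tendsto_eventually)
      qed
    qed
  qed
  then show "((\<lambda>t. LINT s:{0..t}|lborel. S (t - s) (f s)) \<circ> r) \<longlonglongrightarrow> (LINT s:{0..t}|lborel. S (t - s) (f s))"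
    by (simp add: comp_def set_lebesgue_integral_def)
qed

end

context brownian_setting
begin

lemma F_full_measure:
  assumes "A \<in> sets M" "AE w in M. w \<in> A" "0 \<le> t" "t \<le> T"
  shows "A \<in> sets (F t)"
proof -
  have "space M - A \<in> null_sets M"
    using assms(1,2) by (subst AE_iff_null_sets) (auto elim!: eventually_mono)
  from null_F[OF this order_refl assms(3,4)] have "space (F t) - (space M - A) \<in> sets (F t)" by blast
  moreover have "space (F t) - (space M - A) = A" using space_F[OF assms(3,4)] sets.sets_into_space[OF assms(1)] by auto
  ultimately show ?thesis by simp
qed

text \<open>The errors are summable, so U k converges to V almost everywhere along the whole
  sequence, and the completeness of F t transfers measurability to V.\<close>

lemma measurable_F_L2_limit:
  fixes V :: "'w \<Rightarrow> 'h::{banach, second_countable_topology}"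
  assumes U: "\<And>k. U k \<in> borel_measurable (F t)" and t: "0 \<le> t" "t \<le> T" and V[measurable]: "V \<in> borel_measurable M"
    and le: "\<And>k. (\<integral>\<^sup>+w. nsq (V w - U k w) \<partial>M) \<le> ennreal (C * (1/16) ^ k)" and C: "0 \<le> C"
  shows "V \<in> borel_measurable (F t)"
proof -
  have [measurable]: "U k \<in> borel_measurable M" for k by (rule measurable_F_M[OF U t])
  have "(\<integral>\<^sup>+w. (\<Sum>k. nsq (V w - U k w)) \<partial>M) = (\<Sum>k. \<integral>\<^sup>+w. nsq (V w - U k w) \<partial>M)"
    by (rule nn_integral_suminf) measurable
  also have "\<dots> \<le> (\<Sum>k. ennreal (C * (1/16) ^ k))" by (intro suminf_le le) auto
  also have "\<dots> = ennreal (C * (1 / (1 - 1/16)))"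
    using C by (intro suminf_ennreal_eq sums_mult geometric_sums) auto
  finally have "(\<integral>\<^sup>+w. (\<Sum>k. nsq (V w - U k w)) \<partial>M) < \<infinity>"
    by (rule le_less_trans) simp
  then have "AE w in M. (\<Sum>k. nsq (V w - U k w)) \<noteq> \<infinity>"
    by (intro nn_integral_PInf_AE) auto
  then have "AE w in M. lim (\<lambda>k. U k w) = V w"
  proof eventually_elim
    fix w assume "(\<Sum>k. nsq (V w - U k w)) \<noteq> \<infinity>"
    then have "summable (\<lambda>k. (norm (V w - U k w))\<^sup>2)" by (intro summable_suminf_not_top) auto
    then have "(\<lambda>k. (norm (V w - U k w))\<^sup>2) \<longlonglongrightarrow> 0" by (rule summable_LIMSEQ_zero)
    then have "(\<lambda>k. sqrt ((norm (V w - U k w))\<^sup>2)) \<longlonglongrightarrow> sqrt 0" by (intro tendsto_intros)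
    then have "(\<lambda>k. norm (U k w - V w)) \<longlonglongrightarrow> 0" by (simp add: norm_minus_commute)
    then have "(\<lambda>k. U k w) \<longlonglongrightarrow> V w" by (simp add: LIM_zero_cancel tendsto_norm_zero_iff)
    then show "lim (\<lambda>k. U k w) = V w" by (rule limI)
  qed
  then show ?thesis
    by (rule measurable_F_AE[OF borel_measurable_lim_metric[OF U] t]) auto
qed

lemma path_integrable:
  fixes \<Phi> :: "'w \<Rightarrow> real \<Rightarrow> 'h::{banach, second_countable_topology}"
  assumes \<Phi>: "jmeas T \<Phi>" and w: "w \<in> space M" and t: "0 \<le> t" "t \<le> T"
    and fin: "path_sq t (\<Phi> w) < \<infinity>"
  shows "set_integrable lborel {0..t} (\<Phi> w)"
  unfolding set_integrable_def integrable_iff_bounded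
proof
  note [measurable] = jmeas_path[OF jmeas_restrict[OF \<Phi> t(2)] w]
  note [measurable] = path_measurable_nsq[OF jmeas_path[OF jmeas_restrict[OF \<Phi> t(2)] w]]
  show "(\<lambda>s. indicat_real {0..t} s *\<^sub>R \<Phi> w s) \<in> borel_measurable lborel" by measurable
  have "(\<integral>\<^sup>+s. ennreal (norm (indicat_real {0..t} s *\<^sub>R \<Phi> w s)) \<partial>lborel)
    \<le> (\<integral>\<^sup>+s. indicator {0..t} s + nsq (\<Phi> w s) * indicator {0..t} s \<partial>lborel)"
  proof (rule nn_integral_mono, goal_cases)
    case (1 s)
    have "norm (\<Phi> w s) \<le> 1 + (norm (\<Phi> w s))\<^sup>2"
      using sum_squares_bound[of "norm (\<Phi> w s)" 1] zero_le_power2[of "norm (\<Phi> w s)"] norm_ge_zero[of "\<Phi> w s"] by (simp only: power2_eq_square)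
    then have "ennreal (norm (\<Phi> w s)) \<le> 1 + nsq (\<Phi> w s)"
      by (simp flip: ennreal_plus ennreal_1 add: ennreal_leI)
    then show ?case
      by (simp add: indicator_def)
  qed
  also have "\<dots> = ennreal t + path_sq t (\<Phi> w)"
    using t by (subst nn_integral_add) auto
  also have "\<dots> < \<infinity>" using fin by simp
  finally show "(\<integral>\<^sup>+s. ennreal (norm (indicat_real {0..t} s *\<^sub>R \<Phi> w s)) \<partial>lborel) < \<infinity>" .
qed

text \<open>Continuity and the bound hold path by path. The delicate point is adaptedness: an
  integrand that is jointly measurable and adapted need not be progressive, so Fubini's theorem
  gives measurability with respect to M only. Approximation by step processes, whose time integrals
  are finite sums of values known by time t, improves this to F t.\<close>

lemma deterministic_convolution:
  fixes \<Phi> :: "'w \<Rightarrow> real \<Rightarrow> 'h::{real_inner, banach, second_countable_topology}"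
  assumes S: "qc_semigroup S \<mu>" and \<Phi>: "jmeas T \<Phi>"
    and ad: "\<And>t. t \<in> {0..T} \<Longrightarrow> (\<lambda>w. \<Phi> w t) \<in> borel_measurable (F t)"
    and fin: "energy T \<Phi> < \<infinity>"
  shows "\<exists>V. cprocess V \<and>
    (AE w in M. \<forall>t\<in>{0..T}. set_integrable lborel {0..t} (\<lambda>s. S (t - s) (\<Phi> w s)) \<and>
        V t w = (LINT s:{0..t}|lborel. S (t - s) (\<Phi> w s))) \<and>
    (\<forall>t\<in>{0..T}. E_sup t V \<le> ennreal (T * exp (2 * \<mu> * T)) * energy t \<Phi>)"
proof -
  interpret qc_semigroup S \<mu> by (rule S)
  note pm[measurable] = path_sq_measurable[OF \<Phi>]
  define good where "good = {w \<in> space M. path_sq T (\<Phi> w) < \<infinity>}"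
  have gM[measurable]: "good \<in> sets M" unfolding good_def by measurable
  have "AE w in M. path_sq T (\<Phi> w) \<noteq> \<infinity>"
    by (rule nn_integral_PInf_AE) (use fin in \<open>auto simp: energy_def\<close>)
  then have AEg: "AE w in M. w \<in> good"
    using AE_space by eventually_elim (auto simp: good_def less_top)
  have gint: "set_integrable lborel {0..t} (\<Phi> w)" if w: "w \<in> good" and t: "t \<in> {0..T}" for w t
  proof (rule set_integrable_subset)
    show "set_integrable lborel {0..T} (\<Phi> w)"
      using w T by (intro path_integrable[OF \<Phi>]) (auto simp: good_def)
  qed (use t in auto)
  define V where "V t w = (if w \<in> good then LINT s:{0..t}|lborel. S (t - s) (\<Phi> w s) else 0)" for t w
  have Vb: "nsq (V r w) \<le> ennreal (T * exp (2 * \<mu> * T)) * path_sq r (\<Phi> w)"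
    if r: "r \<in> {0..T}" and w: "w \<in> space M" for r w
    using convolution_bound[OF jmeas_path[OF jmeas_restrict[OF \<Phi>] w], of r T] r by (auto simp: V_def)
  have cV: "cprocess V"
    unfolding cprocess_def
  proof (intro conjI ballI)
    fix w assume "w \<in> space M"
    show "continuous_on {0..T} (\<lambda>t. V t w)"
      using convolution_continuous[OF gint[of w T]] T by (cases "w \<in> good") (auto simp: V_def)
  next
    fix t assume t: "t \<in> {0..T}"
    then have t': "0 \<le> t" "t \<le> T" by auto
    have gF[measurable]: "good \<in> sets (F t)" by (rule F_full_measure[OF gM AEg t'])
    have VM: "V t \<in> borel_measurable M"
    proof -
      have [measurable]: "(\<lambda>p. \<Phi> (fst p) (max 0 (min T (snd p)))) \<in> borel_measurable (M \<Otimes>\<^sub>M borel)"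
        using measurable_clamp[OF \<Phi>] T by (simp add: split_beta')
      have "(\<lambda>p. S (max 0 (t - snd p)) (\<Phi> (fst p) (max 0 (min T (snd p))))) \<in> borel_measurable (M \<Otimes>\<^sub>M borel)"
        by (rule S_measurable2) measurable
      then have "(\<lambda>p. indicat_real {0..t} (snd p) *\<^sub>R S (max 0 (t - snd p)) (\<Phi> (fst p) (max 0 (min T (snd p))))) \<in> borel_measurable (M \<Otimes>\<^sub>M borel)"
        by measurable
      then have "(\<lambda>(w, s). indicat_real {0..t} s *\<^sub>R S (max 0 (t - s)) (\<Phi> w (max 0 (min T s)))) \<in> borel_measurable (M \<Otimes>\<^sub>M lborel)"
        by (simp add: split_beta' cong: measurable_cong_sets add: sets_pair_measure_cong[OF refl sets_lborel])
      from lborel.borel_measurable_lebesgue_integral[OF this]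
      have [measurable]: "(\<lambda>w. \<integral>s. indicat_real {0..t} s *\<^sub>R S (max 0 (t - s)) (\<Phi> w (max 0 (min T s))) \<partial>lborel) \<in> borel_measurable M" .
      have eq: "(\<lambda>s. indicat_real {0..t} s *\<^sub>R S (max 0 (t - s)) (\<Phi> w (max 0 (min T s)))) = (\<lambda>s. indicat_real {0..t} s *\<^sub>R S (t - s) (\<Phi> w s))" for w
      proof
        fix s
        show "indicat_real {0..t} s *\<^sub>R S (max 0 (t - s)) (\<Phi> w (max 0 (min T s))) = indicat_real {0..t} s *\<^sub>R S (t - s) (\<Phi> w s)"
        proof (cases "s \<in> {0..t}")
          case True
          then have "min T s = s" "max 0 s = s" "max 0 (t - s) = t - s" using t by auto
          then show ?thesis by (simp only:)
        qed simp
      qed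
      have "(\<lambda>w. \<integral>s. indicat_real {0..t} s *\<^sub>R S (t - s) (\<Phi> w s) \<partial>lborel) \<in> borel_measurable M"
        unfolding eq[symmetric] by measurable
      then have [measurable]: "(\<lambda>w. LINT s:{0..t}|lborel. S (t - s) (\<Phi> w s)) \<in> borel_measurable M"
        by (simp add: set_lebesgue_integral_def)
      show ?thesis unfolding V_def[abs_def] by measurable
    qed
    have "\<forall>k. \<exists>U. U \<in> borel_measurable (F t) \<and> (\<integral>\<^sup>+w. nsq (V t w - U w) \<partial>M) \<le> ennreal (T * exp (2 * \<mu> * T) * (1/16) ^ k)"
    proof
      fix k
      obtain G Z \<Psi> where q: "qstep S G Z \<Psi>" and \<Psi>: "jmeas T \<Psi>"
        and err: "energy T (\<lambda>w s. \<Phi> w s - \<Psi> w s) \<le> ennreal ((1/16) ^ k)"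
        using qstep_approx[OF S \<Phi> ad fin, of "(1/16) ^ k"] by auto
      obtain m g X where e: "elementary F t m g X"
        and eP: "\<forall>w\<in>space M. (\<forall>s\<in>{0<..t}. elem_process m g X w s = S (t - s) (\<Psi> w s)) \<and> elem_integral B m g X w = Z t w"
        using qstep_elementary[OF S q t'] by blast
      note ed = elementaryD[OF e]
      \<comment> \<open>The time integral of the elementary process that represents S (t - s)
        \<Psi>(s) on (0, t].\<close>
      define U where "U w = (\<Sum>i<m. (g (Suc i) - g i) *\<^sub>R X i w)" for w
      have UF: "U \<in> borel_measurable (F t)"
        unfolding U_def[abs_def]
      proof (rule borel_measurable_sum)
        fix i assume "i \<in> {..<m}"
        then have [measurable]: "X i \<in> borel_measurable (F t)" using measurable_F_mono[OF ed(4) ed(1,5)] t' by auto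
        show "(\<lambda>w. (g (Suc i) - g i) *\<^sub>R X i w) \<in> borel_measurable (F t)" by measurable
      qed
      have hb: "has_bochner_integral lborel (\<lambda>s. elem_process m g X w s) (U w)" for w
        unfolding elem_process_def U_def
      proof (rule has_bochner_integral_sum)
        fix i assume i: "i \<in> {..<m}"
        have "has_bochner_integral lborel (indicat_real {g i<..g (Suc i)}) (measure lborel {g i<..g (Suc i)})"
          using ed(2)[of i] i by (intro has_bochner_integral_real_indicator) auto
        from has_bochner_integral_scaleR_left[OF this, of "X i w"]
        show "has_bochner_integral lborel (\<lambda>s. indicat_real {g i<..g (Suc i)} s *\<^sub>R X i w) ((g (Suc i) - g i) *\<^sub>R X i w)"
          using ed(2) i by simp
      qed
      have dJ: "jmeas T (\<lambda>w s. \<Phi> w s - \<Psi> w s)" by (rule jmeas_diff[OF \<Phi> \<Psi>])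
      have diff: "V t w - U w = (LINT s:{0..t}|lborel. S (t - s) (\<Phi> w s - \<Psi> w s))" if w: "w \<in> good" for w
      proof -
        have wM: "w \<in> space M" using w by (simp add: good_def)
        have i1: "integrable lborel (\<lambda>s. indicat_real {0..t} s *\<^sub>R S (t - s) (\<Phi> w s))"
          using convolution_integrable[OF gint[OF w t]] by (simp add: set_integrable_def)
        have i2: "integrable lborel (\<lambda>s. elem_process m g X w s)" and i2': "(\<integral>s. elem_process m g X w s \<partial>lborel) = U w"
          using hb[of w] by (auto simp: has_bochner_integral_iff)
        have "V t w - U w = (\<integral>s. indicat_real {0..t} s *\<^sub>R S (t - s) (\<Phi> w s) - elem_process m g X w s \<partial>lborel)"
          using i1 i2 w by (simp add: V_def set_lebesgue_integral_def i2')
        also have "\<dots> = (\<integral>s. indicat_real {0..t} s *\<^sub>R S (t - s) (\<Phi> w s - \<Psi> w s) \<partial>lborel)"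
        proof (rule integral_cong_AE)
          show "(\<lambda>s. indicat_real {0..t} s *\<^sub>R S (t - s) (\<Phi> w s) - elem_process m g X w s) \<in> borel_measurable lborel"
            using i1 i2 by (intro borel_measurable_diff) auto
          show "(\<lambda>s. indicat_real {0..t} s *\<^sub>R S (t - s) (\<Phi> w s - \<Psi> w s)) \<in> borel_measurable lborel"
            using convolution_measurable[OF jmeas_path[OF jmeas_restrict[OF dJ t'(2)] wM]] by simp
          show "AE s in lborel. indicat_real {0..t} s *\<^sub>R S (t - s) (\<Phi> w s) - elem_process m g X w s
            = indicat_real {0..t} s *\<^sub>R S (t - s) (\<Phi> w s - \<Psi> w s)"
            using AE_lborel_singleton[of 0]
          proof eventually_elim
            case s0: (elim s)
            show ?case
            proof (cases "s \<in> {0..t}")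
              case True
              then show ?thesis using s0 eP wM by (simp add: S_minus)
            next
              case False
              have "indicat_real {g i<..g (Suc i)} s = 0" if "i < m" for i
                using False ed(1,3)[OF that] by (auto simp: indicator_def)
              then show ?thesis using False by (simp add: elem_process_def)
            qed
          qed
        qed
        finally show ?thesis by (simp add: set_lebesgue_integral_def)
      qed
      note [measurable] = path_sq_measurable[OF dJ]
      have "(\<integral>\<^sup>+w. nsq (V t w - U w) \<partial>M)
        \<le> (\<integral>\<^sup>+w. ennreal (T * exp (2 * \<mu> * T)) * path_sq T (\<lambda>s. \<Phi> w s - \<Psi> w s) \<partial>M)"
      proof (rule nn_integral_mono_AE, goal_cases)
        case 1
        show ?case
          using AEg
        proof eventually_elim
          case w: (elim w)
          then have wM: "w \<in> space M" by (simp add: good_def)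
          have "nsq (V t w - U w) \<le> ennreal (T * exp (2 * \<mu> * T)) * path_sq t (\<lambda>s. \<Phi> w s - \<Psi> w s)"
            unfolding diff[OF w] by (rule convolution_bound[OF jmeas_path[OF jmeas_restrict[OF dJ t'(2)] wM] t'])
          also have "\<dots> \<le> ennreal (T * exp (2 * \<mu> * T)) * path_sq T (\<lambda>s. \<Phi> w s - \<Psi> w s)"
            using t' by (intro mult_left_mono nn_integral_mono) (auto simp: indicator_def)
          finally show ?case .
        qed
      qed
      also have "\<dots> = ennreal (T * exp (2 * \<mu> * T)) * energy T (\<lambda>w s. \<Phi> w s - \<Psi> w s)"
        unfolding energy_def by (rule nn_integral_cmult) measurable
      also have "\<dots> \<le> ennreal (T * exp (2 * \<mu> * T)) * ennreal ((1/16) ^ k)" by (intro mult_left_mono err) simp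
      also have "\<dots> = ennreal (T * exp (2 * \<mu> * T) * (1/16) ^ k)" using T by (subst ennreal_mult) auto
      finally show "\<exists>U. U \<in> borel_measurable (F t) \<and> (\<integral>\<^sup>+w. nsq (V t w - U w) \<partial>M) \<le> ennreal (T * exp (2 * \<mu> * T) * (1/16) ^ k)"
        using UF by blast
    qed
    from choice[OF this] obtain U where U: "\<And>k. U k \<in> borel_measurable (F t)"
      "\<And>k. (\<integral>\<^sup>+w. nsq (V t w - U k w) \<partial>M) \<le> ennreal (T * exp (2 * \<mu> * T) * (1/16) ^ k)" by blast
    show "V t \<in> borel_measurable (F t)"
      by (rule measurable_F_L2_limit[OF U(1) t' VM U(2)]) (use T in simp)
  qed
  have "E_sup t V \<le> ennreal (T * exp (2 * \<mu> * T)) * energy t \<Phi>" if t: "t \<in> {0..T}" for t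
  proof -
    note [measurable] = path_sq_measurable[OF jmeas_restrict[OF \<Phi>, of t]]
    have "E_sup t V \<le> (\<integral>\<^sup>+w. ennreal (T * exp (2 * \<mu> * T)) * path_sq t (\<Phi> w) \<partial>M)"
    proof (rule nn_integral_mono, goal_cases)
      case w: (1 w)
      show ?case
        unfolding sup_sq_def
      proof (rule SUP_least)
        fix r assume r: "r \<in> {0..t}"
        then have "r \<in> {0..T}" using t by auto
        from Vb[OF this w] have "nsq (V r w) \<le> ennreal (T * exp (2 * \<mu> * T)) * path_sq r (\<Phi> w)" .
        also have "\<dots> \<le> ennreal (T * exp (2 * \<mu> * T)) * path_sq t (\<Phi> w)"
          using r by (intro mult_left_mono nn_integral_mono) (auto simp: indicator_def)
        finally show "nsq (V r w) \<le> \<dots>" .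
      qed
    qed
    also have "\<dots> = ennreal (T * exp (2 * \<mu> * T)) * energy t \<Phi>"
      unfolding energy_def using t by (intro nn_integral_cmult) auto
    finally show ?thesis .
  qed
  moreover have "AE w in M. \<forall>t\<in>{0..T}. set_integrable lborel {0..t} (\<lambda>s. S (t - s) (\<Phi> w s)) \<and>
        V t w = (LINT s:{0..t}|lborel. S (t - s) (\<Phi> w s))"
    using AEg by eventually_elim (auto simp: V_def intro!: convolution_integrable gint)
  ultimately show ?thesis using cV by blast
qed

end

section \<open>Predictable processes\<close>

context brownian_setting
begin

lemma space_predictable: "space (predictable_algebra M F T) = space M \<times> {0..T}"
proof -
  have "A \<subseteq> space M" if "A \<in> sets (F s)" "0 \<le> s" "s \<le> T" for A s
    using sets.sets_into_space[OF that(1)] space_F[OF that(2,3)] by simp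
  then show ?thesis
    using T unfolding predictable_algebra_def by (intro space_measure_of) fastforce
qed

lemma predictable_rectangle:
  assumes "0 \<le> s" "s \<le> t" "t \<le> T" "A \<in> sets (F s)"
  shows "A \<times> {s<..t} \<in> sets (predictable_algebra M F T)"
proof -
  have "A \<subseteq> space M" if "A \<in> sets (F s)" "0 \<le> s" "s \<le> T" for A s
    using sets.sets_into_space[OF that(1)] space_F[OF that(2,3)] by simp
  then have "{A \<times> {0} | A. A \<in> sets (F 0)} \<union> {A \<times> {s<..t} | A s t. 0 \<le> s \<and> s \<le> t \<and> t \<le> T \<and> A \<in> sets (F s)}
    \<subseteq> Pow (space M \<times> {0..T})" using T by fastforce
  then show ?thesis
    using assms unfolding predictable_algebra_def by (subst sets_measure_of) (auto intro!: sigma_sets.Basic)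
qed

lemma predictable_initial:
  assumes "A \<in> sets (F 0)"
  shows "A \<times> {0} \<in> sets (predictable_algebra M F T)"
proof -
  have "A \<subseteq> space M" if "A \<in> sets (F s)" "0 \<le> s" "s \<le> T" for A s
    using sets.sets_into_space[OF that(1)] space_F[OF that(2,3)] by simp
  then have "{A \<times> {0} | A. A \<in> sets (F 0)} \<union> {A \<times> {s<..t} | A s t. 0 \<le> s \<and> s \<le> t \<and> t \<le> T \<and> A \<in> sets (F s)}
    \<subseteq> Pow (space M \<times> {0..T})" using T by fastforce
  then show ?thesis
    using assms unfolding predictable_algebra_def by (subst sets_measure_of) (auto intro!: sigma_sets.Basic)
qed

text \<open>Only the generating rectangles have to be intersected with [0, t]; those that begin
  after t become empty. At t = T this yields joint measurability, at a general t
  adaptedness.\<close>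

lemma predictable_progressive:
  assumes f: "f \<in> measurable (predictable_algebra M F T) N" and t: "0 \<le> t" "t \<le> T"
  shows "f \<in> measurable (F t \<Otimes>\<^sub>M restrict_space borel {0..t}) N"
proof -
  have sb: "A \<subseteq> space M" if "A \<in> sets (F s)" "0 \<le> s" "s \<le> T" for A s
    using sets.sets_into_space[OF that(1)] space_F[OF that(2,3)] by simp
  have "(\<lambda>p. p) \<in> measurable (F t \<Otimes>\<^sub>M restrict_space borel {0..t}) (predictable_algebra M F T)"
    unfolding predictable_algebra_def
  proof (rule measurable_measure_of)
    show "{A \<times> {0} | A. A \<in> sets (F 0)} \<union> {A \<times> {s<..t} | A s t. 0 \<le> s \<and> s \<le> t \<and> t \<le> T \<and> A \<in> sets (F s)}
      \<subseteq> Pow (space M \<times> {0..T})" using T sb by fastforce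
    show "(\<lambda>p. p) \<in> space (F t \<Otimes>\<^sub>M restrict_space borel {0..t}) \<rightarrow> space M \<times> {0..T}"
      using t space_F[OF t] by (auto simp: space_pair_measure space_restrict_space)
    fix C assume "C \<in> {A \<times> {0} | A. A \<in> sets (F 0)} \<union> {A \<times> {s<..t} | A s t. 0 \<le> s \<and> s \<le> t \<and> t \<le> T \<and> A \<in> sets (F s)}"
    then show "(\<lambda>p. p) -` C \<inter> space (F t \<Otimes>\<^sub>M restrict_space borel {0..t}) \<in> sets (F t \<Otimes>\<^sub>M restrict_space borel {0..t})"
    proof (elim UnE CollectE exE conjE)
      fix A assume A: "C = A \<times> {0}" "A \<in> sets (F 0)"
      have "A \<in> sets (F t)" using A(2) sets_F_mono[of 0 t] t by auto
      moreover have "{0} \<in> sets (restrict_space borel {0..t})" using t by (auto simp: sets_restrict_space_iff)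
      ultimately have "A \<times> {0} \<in> sets (F t \<Otimes>\<^sub>M restrict_space borel {0..t})" by (rule pair_measureI)
      then show ?thesis using A by (auto intro: sets.Int)
    next
      fix A s u assume A: "C = A \<times> {s<..u}" "0 \<le> s" "s \<le> u" "u \<le> T" "A \<in> sets (F s)"
      show ?thesis
      proof (cases "s \<le> t")
        case True
        have "A \<in> sets (F t)" using A True sets_F_mono[of s t] t by auto
        moreover have "{s<..u} \<inter> {0..t} \<in> sets (restrict_space borel {0..t})" using t by (auto simp: sets_restrict_space_iff)
        ultimately have "A \<times> ({s<..u} \<inter> {0..t}) \<in> sets (F t \<Otimes>\<^sub>M restrict_space borel {0..t})" by (rule pair_measureI)
        moreover have "(\<lambda>p. p) -` C \<inter> space (F t \<Otimes>\<^sub>M restrict_space borel {0..t}) = A \<times> ({s<..u} \<inter> {0..t})"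
          using sets.sets_into_space[OF \<open>A \<in> sets (F t)\<close>] A by (auto simp: space_pair_measure space_restrict_space)
        ultimately show ?thesis by simp
      next
        case False
        then have "(\<lambda>p. p) -` C \<inter> space (F t \<Otimes>\<^sub>M restrict_space borel {0..t}) = {}"
          using A by (auto simp: space_pair_measure space_restrict_space)
        then show ?thesis by (simp only: sets.empty_sets)
      qed
    qed
  qed
  from measurable_compose[OF this f] show ?thesis by simp
qed

lemma predictable_jmeas:
  assumes "(\<lambda>(w, t). Y t w) \<in> borel_measurable (predictable_algebra M F T)"
  shows "jmeas T (\<lambda>w t. Y t w)"
proof -
  have f: "(\<lambda>(w, t). Y t w) \<in> borel_measurable (F T \<Otimes>\<^sub>M restrict_space borel {0..T})"
    by (rule predictable_progressive[OF assms]) (use T in auto)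
  have "(\<lambda>w. w) \<in> measurable M (F T)"
    by (rule measurable_F_M[of _ T]) (use T in auto)
  then have "(\<lambda>p. (fst p, snd p)) \<in> measurable (MT T) (F T \<Otimes>\<^sub>M restrict_space borel {0..T})"
    by (intro measurable_Pair measurable_compose[OF measurable_fst] measurable_snd)
  from measurable_compose[OF this f] show ?thesis by (simp add: split_beta')
qed

lemma predictable_adapted:
  assumes "(\<lambda>(w, t). Y t w) \<in> borel_measurable (predictable_algebra M F T)" "t \<in> {0..T}"
  shows "Y t \<in> borel_measurable (F t)"
  using measurable_Pair1[OF predictable_progressive[OF assms(1), of t], of t] assms(2)
  by (simp add: space_restrict_space)

lemma predictable_step:
  fixes X :: "'w \<Rightarrow> 'h::real_normed_vector"
  assumes X: "X \<in> borel_measurable (F s)" and s: "0 \<le> s" "s \<le> u" "u \<le> T"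
  shows "(\<lambda>p. if snd p \<in> {s<..u} then X (fst p) else 0) \<in> borel_measurable (predictable_algebra M F T)"
proof (rule borel_measurableI)
  fix U :: "'h set" assume U: "open U"
  have sp: "space (F s) = space M" using s by (intro space_F) auto
  have 1: "(X -` U \<inter> space M) \<times> {s<..u} \<in> sets (predictable_algebra M F T)"
    using measurable_sets[OF X borel_open[OF U]] sp s by (intro predictable_rectangle) auto
  have "space M \<in> sets (F s)" using sets.top[of "F s"] sp by simp
  then have 2: "space M \<times> {s<..u} \<in> sets (predictable_algebra M F T)"
    using s by (intro predictable_rectangle) auto
  have "(\<lambda>p. if snd p \<in> {s<..u} then X (fst p) else 0) -` U \<inter> space (predictable_algebra M F T)
    = (X -` U \<inter> space M) \<times> {s<..u} \<union> (if 0 \<in> U then space (predictable_algebra M F T) - space M \<times> {s<..u} else {})"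
    using s by (auto simp: space_predictable split: if_splits)
  also have "\<dots> \<in> sets (predictable_algebra M F T)" using 1 2 by auto
  finally show "(\<lambda>p. if snd p \<in> {s<..u} then X (fst p) else 0) -` U \<inter> space (predictable_algebra M F T) \<in> sets (predictable_algebra M F T)" .
qed

lemma predictable_start:
  fixes X :: "'w \<Rightarrow> 'h::real_normed_vector"
  assumes X: "X \<in> borel_measurable (F 0)"
  shows "(\<lambda>p. if snd p = 0 then X (fst p) else 0) \<in> borel_measurable (predictable_algebra M F T)"
proof (rule borel_measurableI)
  fix U :: "'h set" assume U: "open U"
  have sp: "space (F 0) = space M" using T by (intro space_F) auto
  have 1: "(X -` U \<inter> space M) \<times> {0} \<in> sets (predictable_algebra M F T)"
    using measurable_sets[OF X borel_open[OF U]] sp by (intro predictable_initial) auto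
  have "space M \<in> sets (F 0)" using sets.top[of "F 0"] sp by simp
  then have 2: "space M \<times> {0} \<in> sets (predictable_algebra M F T)"
    by (intro predictable_initial) auto
  have "(\<lambda>p. if snd p = 0 then X (fst p) else 0) -` U \<inter> space (predictable_algebra M F T)
    = (X -` U \<inter> space M) \<times> {0} \<union> (if 0 \<in> U then space (predictable_algebra M F T) - space M \<times> {0} else {})"
    using T by (auto simp: space_predictable split: if_splits)
  also have "\<dots> \<in> sets (predictable_algebra M F T)" using 1 2 by auto
  finally show "(\<lambda>p. if snd p = 0 then X (fst p) else 0) -` U \<inter> space (predictable_algebra M F T) \<in> sets (predictable_algebra M F T)" .
qed

text \<open>Along uniform grids, the process frozen at the left end of each cell is predictable, and
  it converges because the left ends approach t and paths are continuous.\<close>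

lemma cprocess_predictable:
  fixes Y :: "real \<Rightarrow> 'w \<Rightarrow> 'h::{real_normed_vector, second_countable_topology}"
  assumes Y: "cprocess Y"
  shows "(\<lambda>(w, t). Y t w) \<in> borel_measurable (predictable_algebra M F T)"
proof (rule borel_measurable_LIMSEQ_metric)
  define g where "g n k = real k * T / real (Suc n)" for n k
  have g0: "0 \<le> g n k" for n k using T by (simp add: g_def)
  have gs: "g n (Suc k) = g n k + T / real (Suc n)" for n k
    by (simp add: g_def add_divide_distrib distrib_right)
  have gT: "g n (Suc n) = T" for n by (simp add: g_def)
  have gm: "g n j \<le> g n k" if "j \<le> k" for n j k
    using that T unfolding g_def by (intro divide_right_mono mult_right_mono) auto
  have gg: "is_grid {} T (Suc n) (g n)" for n
    unfolding is_grid_def using gs gm gT T by (auto simp: g_def)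
  let ?f = "\<lambda>n p. (if snd p = 0 then Y 0 (fst p) else 0) + (\<Sum>k<Suc n. if snd p \<in> {g n k<..g n (Suc k)} then Y (g n k) (fst p) else 0)"
  show "?f n \<in> borel_measurable (predictable_algebra M F T)" for n
  proof (intro borel_measurable_add borel_measurable_sum predictable_start predictable_step)
    show "Y 0 \<in> borel_measurable (F 0)" using cprocessD(1)[OF Y, of 0] T by simp
    fix k assume k: "k \<in> {..<Suc n}"
    have b: "g n (Suc k) \<le> T" using gm[of "Suc k" "Suc n" n] k gT[of n] by simp
    then show "g n (Suc k) \<le> T" .
    show "0 \<le> g n k" "g n k \<le> g n (Suc k)" by (rule g0, rule gm) simp
    then show "Y (g n k) \<in> borel_measurable (F (g n k))" using b by (intro cprocessD(1)[OF Y]) auto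
  qed
  fix p assume p: "p \<in> space (predictable_algebra M F T)"
  obtain w t where p': "p = (w, t)" "w \<in> space M" "t \<in> {0..T}" using p by (auto simp: space_predictable)
  have "(\<lambda>n. ?f n (w, t)) \<longlonglongrightarrow> Y t w"
  proof (cases "t = 0")
    case True
    have "?f n (w, t) = Y t w" for n
      using True g0 by (simp add: not_less[symmetric] sum.neutral del: sum.lessThan_Suc)
    then show ?thesis by simp
  next
    case False
    have "\<exists>r. 0 \<le> r \<and> r < t \<and> t \<le> r + T / real (Suc n) \<and> ?f n (w, t) = Y r w" for n
    proof -
      obtain k where k: "k < Suc n" "t \<in> {g n k<..g n (Suc k)}"
        using is_grid_cover[OF gg, of t n] p'(3) False by auto
      have "?f n (w, t) = Y (g n k) w"
        unfolding fst_conv snd_conv is_grid_sum[OF gg k, of "\<lambda>k. Y (g n k) w"] using False by simp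
      then show ?thesis using k g0[of n k] by (intro exI[of _ "g n k"]) (auto simp: gs)
    qed
    then have "\<forall>n. \<exists>r. 0 \<le> r \<and> r < t \<and> t \<le> r + T / real (Suc n) \<and> ?f n (w, t) = Y r w" by blast
    from choice[OF this] obtain r where r: "\<And>n. 0 \<le> r n" "\<And>n. r n < t" "\<And>n. t \<le> r n + T / real (Suc n)"
      "\<And>n. ?f n (w, t) = Y (r n) w" by blast
    have "r \<longlonglongrightarrow> t"
    proof (rule tendsto_sandwich[OF always_eventually always_eventually _ tendsto_const])
      show "\<forall>n. t - T * inverse (real (Suc n)) \<le> r n" using r(3) by (auto simp: field_simps)
      show "\<forall>n. r n \<le> t" using r(2) by (auto intro: less_imp_le)
      have "(\<lambda>n. t - T * inverse (real (Suc n))) \<longlonglongrightarrow> t - T * 0"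
        by (intro tendsto_intros LIMSEQ_inverse_real_of_nat)
      then show "(\<lambda>n. t - T * inverse (real (Suc n))) \<longlonglongrightarrow> t" by simp
    qed
    moreover have "continuous_on {0..T} (\<lambda>t. Y t w)" using Y p' by (simp add: cprocess_def)
    moreover have "r n \<in> {0..T}" for n using r(1)[of n] r(2)[of n] p'(3) by auto
    ultimately have "(\<lambda>n. Y (r n) w) \<longlonglongrightarrow> Y t w"
      using continuous_on_tendsto_compose[of "{0..T}" "\<lambda>t. Y t w" r t sequentially] p' by auto
    then show ?thesis by (simp only: r(4))
  qed
  then show "(\<lambda>n. ?f n p) \<longlonglongrightarrow> (\<lambda>(w, t). Y t w) p" by (simp only: p'(1) prod.case)
qed

lemma cprocess_jmeas:
  fixes Y :: "real \<Rightarrow> 'w \<Rightarrow> 'h::{real_normed_vector, second_countable_topology}"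
  assumes "cprocess Y"
  shows "jmeas T (\<lambda>w t. Y t w)"
  by (rule predictable_jmeas[OF cprocess_predictable[OF assms]])

lemma cprocess_const: "cprocess (\<lambda>t w. c)"
  by (simp add: cprocess_def)

lemma cprocess_add:
  fixes Y Z :: "real \<Rightarrow> 'w \<Rightarrow> 'h::{real_normed_vector, second_countable_topology}"
  assumes "cprocess Y" "cprocess Z"
  shows "cprocess (\<lambda>t w. Y t w + Z t w)"
  using assms unfolding cprocess_def
  by (auto intro!: continuous_intros borel_measurable_add)

lemma cprocess_indistinguishable:
  fixes Y Z :: "real \<Rightarrow> 'w \<Rightarrow> 'h::real_normed_vector"
  assumes Y: "AE w in M. continuous_on {0..T} (\<lambda>t. Y t w)" and Z: "AE w in M. continuous_on {0..T} (\<lambda>t. Z t w)"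
    and eq: "\<And>t. t \<in> {0..T} \<Longrightarrow> AE w in M. Y t w = Z t w"
  shows "AE w in M. \<forall>t\<in>{0..T}. Y t w = Z t w"
proof -
  obtain D where D: "countable D" "D \<subseteq> {0..T}" "{0..T} \<subseteq> closure D" by (rule separable)
  have "AE w in M. \<forall>t\<in>D. Y t w = Z t w"
    using D(2) eq by (intro AE_ball_countable' D(1)) auto
  with Y Z show ?thesis
  proof eventually_elim
    fix w assume c: "continuous_on {0..T} (\<lambda>t. Y t w)" "continuous_on {0..T} (\<lambda>t. Z t w)" and e: "\<forall>t\<in>D. Y t w = Z t w"
    show "\<forall>t\<in>{0..T}. Y t w = Z t w"
    proof
      fix t assume t: "t \<in> {0..T}"
      then have "t \<in> closure D" using D(3) by blast
      then obtain d where d: "\<And>n. d n \<in> D" "d \<longlonglongrightarrow> t" unfolding closure_sequential by blast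
      have dT: "\<forall>\<^sub>F n in sequentially. d n \<in> {0..T}" using d(1) D(2) by (intro always_eventually) blast
      have "(\<lambda>n. Y (d n) w) \<longlonglongrightarrow> Y t w" by (rule continuous_on_tendsto_compose[OF c(1) d(2) t dT])
      moreover have "(\<lambda>n. Z (d n) w) \<longlonglongrightarrow> Z t w" by (rule continuous_on_tendsto_compose[OF c(2) d(2) t dT])
      moreover have "(\<lambda>n. Y (d n) w) = (\<lambda>n. Z (d n) w)" using e d(1) by auto
      ultimately show "Y t w = Z t w" using LIMSEQ_unique by fastforce
    qed
  qed
qed

text \<open>Writes the energy as a time integral of second moments, the shape in which estimates can
  be iterated in time.\<close>

lemma energy_Fubini:
  fixes Y :: "real \<Rightarrow> 'w \<Rightarrow> 'h::{real_normed_vector, second_countable_topology}"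
  assumes Y: "jmeas T (\<lambda>w t. Y t w)" and t: "0 \<le> t" "t \<le> T"
  shows "energy t (\<lambda>w s. Y s w) = (\<integral>\<^sup>+s\<in>{0..t}. (\<integral>\<^sup>+w. nsq (Y s w) \<partial>M) \<partial>lborel)"
proof -
  interpret pair_sigma_finite M lborel ..
  have "(\<lambda>(w, s). nsq (Y (max 0 (min T s)) w)) \<in> borel_measurable (M \<Otimes>\<^sub>M borel)"
    using measurable_clamp[OF jmeas_nsq[OF Y]] T by simp
  then have [measurable]: "(\<lambda>p. nsq (Y (max 0 (min T (snd p))) (fst p))) \<in> borel_measurable (M \<Otimes>\<^sub>M lborel)"
    by (simp add: split_beta' cong: measurable_cong_sets add: sets_pair_measure_cong[OF refl sets_lborel])
  have m: "(\<lambda>(w, s). nsq (Y (max 0 (min T s)) w) * indicator {0..t} s) \<in> borel_measurable (M \<Otimes>\<^sub>M lborel)"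
    unfolding split_beta' by measurable
  have e: "nsq (Y (max 0 (min T s)) w) * indicator {0..t} s = nsq (Y s w) * indicator {0..t} s" for s w
  proof (cases "s \<in> {0..t}")
    case True
    then have "max 0 (min T s) = s" using t by auto
    then show ?thesis by (simp only:)
  qed simp
  have "energy t (\<lambda>w s. Y s w) = (\<integral>\<^sup>+s. \<integral>\<^sup>+w. nsq (Y s w) * indicator {0..t} s \<partial>M \<partial>lborel)"
    unfolding energy_def using Fubini'[OF m] by (simp only: e)
  also have "\<dots> = (\<integral>\<^sup>+s\<in>{0..t}. (\<integral>\<^sup>+w. nsq (Y s w) \<partial>M) \<partial>lborel)"
    by (intro nn_integral_cong) (auto simp: indicator_def)
  finally show ?thesis .
qed

end

subsection \<open>Existence\<close>

text \<open>Integrating exp (b s) gains a factor 1 / b. With b = 16 c + 1 one iteration therefore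
  gains 1/16 relative to the weight, the rate used in \<open>cprocess_limit\<close>; the summand 1
  keeps b positive for c = 0.\<close>

lemma exp_weight_step:
  assumes u: "\<And>s. s \<in> {0..t} \<Longrightarrow> u s \<le> ennreal (K * exp (b * s))" and v: "v \<le> ennreal c * (\<integral>\<^sup>+s\<in>{0..t}. u s \<partial>lborel)"
    and b: "b = 16 * c + 1" and c: "0 \<le> c" and K: "0 \<le> K" and t: "0 \<le> t"
  shows "v \<le> ennreal (K / 16 * exp (b * t))"
proof -
  have b0: "0 < b" "c / b \<le> 1/16" using b c by (auto simp: field_simps)
  have "(\<integral>\<^sup>+s. ennreal (exp (b * s)) * indicator {0..t} s \<partial>lborel) = ennreal (exp (b * t) / b - exp (b * 0) / b)"
    using b0 t by (intro nn_integral_FTC_Icc) (auto intro!: derivative_eq_intros)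
  also have "\<dots> \<le> ennreal (exp (b * t) / b)" using b0 by (intro ennreal_leI) simp
  finally have e: "(\<integral>\<^sup>+s\<in>{0..t}. ennreal (exp (b * s)) \<partial>lborel) \<le> ennreal (exp (b * t) / b)" .
  note v
  also have "(\<integral>\<^sup>+s\<in>{0..t}. u s \<partial>lborel) \<le> (\<integral>\<^sup>+s. ennreal K * (ennreal (exp (b * s)) * indicator {0..t} s) \<partial>lborel)"
    using u K by (intro nn_integral_mono) (auto simp: indicator_def ennreal_mult)
  also have "\<dots> = ennreal K * (\<integral>\<^sup>+s\<in>{0..t}. ennreal (exp (b * s)) \<partial>lborel)"
    by (rule nn_integral_cmult) measurable
  also have "ennreal c * (ennreal K * (\<integral>\<^sup>+s\<in>{0..t}. ennreal (exp (b * s)) \<partial>lborel)) \<le> ennreal c * (ennreal K * ennreal (exp (b * t) / b))"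
    by (intro mult_left_mono e) auto
  also have "\<dots> = ennreal (c / b * (K * exp (b * t)))"
    using c K b0 by (simp flip: ennreal_mult)
  also have "\<dots> \<le> ennreal (1 / 16 * (K * exp (b * t)))"
    using K by (intro ennreal_leI mult_right_mono b0) simp
  finally show ?thesis by (simp add: mult_left_mono)
qed

context brownian_setting
begin

definition admissible :: "('w \<Rightarrow> real \<Rightarrow> 'h::{real_normed_vector, second_countable_topology}) \<Rightarrow> bool" where
  "admissible \<Phi> \<longleftrightarrow> jmeas T \<Phi> \<and> (\<forall>t\<in>{0..T}. (\<lambda>w. \<Phi> w t) \<in> borel_measurable (F t)) \<and> energy T \<Phi> < \<infinity>"

text \<open>The mild equation with integrands decoupled from the solution. It thus covers a Picard
  step, the equation itself, and differences with cut-off integrands.\<close>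

definition mild_conv :: "(real \<Rightarrow> 'h \<Rightarrow> 'h::{real_inner, banach, second_countable_topology}) \<Rightarrow> 'h \<Rightarrow>
    ('w \<Rightarrow> real \<Rightarrow> 'h) \<Rightarrow> ('w \<Rightarrow> real \<Rightarrow> 'h) \<Rightarrow> (real \<Rightarrow> 'w \<Rightarrow> 'h) \<Rightarrow> bool" where
  "mild_conv S x \<Phi> \<Psi> Y \<longleftrightarrow> (\<forall>t\<in>{0..T}.
     (AE w in M. set_integrable lborel {0..t} (\<lambda>s. S (t - s) (\<Phi> w s))) \<and>
     (\<exists>J. has_ito_integral M F B t (\<lambda>w s. S (t - s) (\<Psi> w s)) J \<and>
       (AE w in M. Y t w = S t x + (LINT s:{0..t}|lborel. S (t - s) (\<Phi> w s)) + J w)))"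

lemma admissible_diff:
  assumes 1: "admissible \<Phi>" and 2: "admissible \<Psi>"
  shows "admissible (\<lambda>w s. \<Phi> w s - \<Psi> w s)"
proof -
  have j1: "jmeas T \<Phi>" and j2: "jmeas T \<Psi>" and f: "energy T \<Phi> < \<infinity>" "energy T \<Psi> < \<infinity>"
    using 1 2 by (auto simp: admissible_def)
  have j3: "jmeas T (\<lambda>w s. - \<Psi> w s)" using j2 unfolding split_beta' by measurable
  have "energy T (\<lambda>w s. \<Phi> w s + - \<Psi> w s) \<le> 2 * (energy T \<Phi> + energy T (\<lambda>w s. - \<Psi> w s))"
    by (rule energy_add[OF j1 j3])
  also have "\<dots> = 2 * (energy T \<Phi> + energy T \<Psi>)" by (simp add: energy_def)
  also have "\<dots> < \<infinity>" using f by (simp add: ennreal_mult_less_top)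
  finally have "energy T (\<lambda>w s. \<Phi> w s - \<Psi> w s) < \<infinity>" by simp
  with 1 2 jmeas_diff[OF j1 j2] show ?thesis
    by (auto simp: admissible_def intro!: borel_measurable_diff)
qed

text \<open>The three summands are the orbit of x and the two convolutions. The factor 3 comes from
  the square of a sum of three terms; T is the constant of the deterministic convolution, 72 that of
  the stochastic one, and their sum also majorizes the 1 needed for the initial value.\<close>

lemma mild_conv_exists:
  fixes \<Phi> \<Psi> :: "'w \<Rightarrow> real \<Rightarrow> 'h::{real_inner, banach, second_countable_topology}"
  assumes S: "qc_semigroup S \<mu>" and \<Phi>: "admissible \<Phi>" and \<Psi>: "admissible \<Psi>"
  shows "\<exists>Y. cprocess Y \<and> mild_conv S x \<Phi> \<Psi> Y \<and>
    (\<forall>t\<in>{0..T}. E_sup t Y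
      \<le> ennreal (3 * (T + 72) * exp (2 * \<mu> * T)) * (nsq x + energy t \<Phi> + energy t \<Psi>))"
proof -
  interpret qc_semigroup S \<mu> by (rule S)
  obtain V where V: "cprocess V"
    and Vc: "AE w in M. \<forall>t\<in>{0..T}. set_integrable lborel {0..t} (\<lambda>s. S (t - s) (\<Phi> w s)) \<and>
        V t w = (LINT s:{0..t}|lborel. S (t - s) (\<Phi> w s))"
    and Vb: "\<forall>t\<in>{0..T}. E_sup t V \<le> ennreal (T * exp (2 * \<mu> * T)) * energy t \<Phi>"
    using deterministic_convolution[OF S, of \<Phi>] \<Phi> unfolding admissible_def by blast
  obtain Z where Z: "cprocess Z" and Zi: "\<forall>t\<in>{0..T}. has_ito_integral M F B t (\<lambda>w s. S (t - s) (\<Psi> w s)) (Z t)"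
    and Zb: "\<forall>t\<in>{0..T}. E_sup t Z \<le> ennreal (72 * exp (2 * \<mu> * T)) * energy t \<Psi>"
    using stochastic_convolution[OF S, of \<Psi>] \<Psi> unfolding admissible_def by blast
  define Y where "Y t w = S (max 0 t) x + V t w + Z t w" for t w
  have X: "cprocess (\<lambda>t w. S (max 0 t) x)"
    unfolding cprocess_def by (auto intro!: S_continuous_on continuous_intros)
  have Y: "cprocess Y" unfolding Y_def[abs_def] by (intro cprocess_add X V Z)
  have "mild_conv S x \<Phi> \<Psi> Y"
    unfolding mild_conv_def
  proof (intro ballI conjI exI)
    fix t assume t: "t \<in> {0..T}"
    show "AE w in M. set_integrable lborel {0..t} (\<lambda>s. S (t - s) (\<Phi> w s))"
      using Vc by eventually_elim (use t in blast)
    show "has_ito_integral M F B t (\<lambda>w s. S (t - s) (\<Psi> w s)) (Z t)" using Zi t by blast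
    show "AE w in M. Y t w = S t x + (LINT s:{0..t}|lborel. S (t - s) (\<Phi> w s)) + Z t w"
      using Vc
    proof eventually_elim
      fix w assume "\<forall>t\<in>{0..T}. set_integrable lborel {0..t} (\<lambda>s. S (t - s) (\<Phi> w s)) \<and>
        V t w = (LINT s:{0..t}|lborel. S (t - s) (\<Phi> w s))"
      then have "V t w = (LINT s:{0..t}|lborel. S (t - s) (\<Phi> w s))" using t by blast
      then show "Y t w = S t x + (LINT s:{0..t}|lborel. S (t - s) (\<Phi> w s)) + Z t w"
        using t by (simp add: Y_def max_def)
    qed
  qed
  moreover have "E_sup t Y
      \<le> ennreal (3 * (T + 72) * exp (2 * \<mu> * T)) * (nsq x + energy t \<Phi> + energy t \<Psi>)" if t: "t \<in> {0..T}" for t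
  proof -
    note [measurable] = sup_sq_measurable[OF V, of t] sup_sq_measurable[OF Z, of t]
    define E where "E = exp (2 * \<mu> * T)"
    have E0: "0 \<le> E" by (simp add: E_def)
    have "E_sup t Y \<le> (\<integral>\<^sup>+w. 3 * (ennreal (E * (norm x)\<^sup>2) + sup_sq t V w + sup_sq t Z w) \<partial>M)"
    proof (rule nn_integral_mono, goal_cases)
      case (1 w)
      show ?case
        unfolding sup_sq_def[of t Y]
      proof (rule SUP_least)
        fix s assume s: "s \<in> {0..t}"
        have "nsq (Y s w) \<le> 3 * (nsq (S (max 0 s) x) + nsq (V s w) + nsq (Z s w))"
          unfolding Y_def by (rule nsq_add3)
        also have "\<dots> \<le> 3 * (ennreal (E * (norm x)\<^sup>2) + sup_sq t V w + sup_sq t Z w)"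
        proof (intro mult_left_mono add_mono)
          show "nsq (S (max 0 s) x) \<le> ennreal (E * (norm x)\<^sup>2)"
            using S_norm_sq_le[of "max 0 s" T x] s t by (intro ennreal_leI) (auto simp: E_def)
        qed (use s in \<open>auto simp: sup_sq_def intro!: SUP_upper\<close>)
        finally show "nsq (Y s w) \<le> \<dots>" .
      qed
    qed
    also have "\<dots> = 3 * (ennreal (E * (norm x)\<^sup>2) + E_sup t V + E_sup t Z)"
      using t by (simp add: nn_integral_cmult nn_integral_add emeasure_space_1)
    also have "\<dots> \<le> 3 * (ennreal ((T + 72) * E) * nsq x + ennreal ((T + 72) * E) * energy t \<Phi> + ennreal ((T + 72) * E) * energy t \<Psi>)"
    proof (intro mult_left_mono add_mono)
      have "E * (norm x)\<^sup>2 \<le> (T + 72) * E * (norm x)\<^sup>2"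
        using T E0 by (intro mult_right_mono) (auto simp: mult_le_cancel_right1)
      then show "ennreal (E * (norm x)\<^sup>2) \<le> ennreal ((T + 72) * E) * nsq x"
        using T E0 by (simp add: ennreal_mult[symmetric] ennreal_leI)
      have "E_sup t V \<le> ennreal (T * E) * energy t \<Phi>" using Vb t by (simp add: E_def)
      also have "\<dots> \<le> ennreal ((T + 72) * E) * energy t \<Phi>"
        using E0 by (intro mult_right_mono ennreal_leI) auto
      finally show "E_sup t V \<le> ennreal ((T + 72) * E) * energy t \<Phi>" .
      have "E_sup t Z \<le> ennreal (72 * E) * energy t \<Psi>" using Zb t by (simp add: E_def)
      also have "\<dots> \<le> ennreal ((T + 72) * E) * energy t \<Psi>"
        using E0 T by (intro mult_right_mono ennreal_leI) auto
      finally show "E_sup t Z \<le> ennreal ((T + 72) * E) * energy t \<Psi>" .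
    qed simp
    also have "\<dots> = ennreal (3 * (T + 72) * E) * (nsq x + energy t \<Phi> + energy t \<Psi>)"
    proof -
      have "ennreal (3 * (T + 72) * E) = 3 * ennreal ((T + 72) * E)"
        unfolding mult.assoc using T E0 by (subst ennreal_mult) auto
      then show ?thesis by (simp only: distrib_left mult.assoc)
    qed
    finally show ?thesis by (simp add: E_def)
  qed
  ultimately show ?thesis using Y by blast
qed

text \<open>The initial terms cancel, the time integral is linear along each path, and
  \<open>ito_locality\<close> treats the stochastic integral. The event A need not be
  adapted.\<close>

lemma mild_conv_locality:
  fixes \<Phi>1 \<Phi>2 \<Phi>3 :: "'w \<Rightarrow> real \<Rightarrow> 'h::{real_inner, banach, second_countable_topology}"
  assumes S: "qc_semigroup S \<mu>"
    and 1: "mild_conv S x \<Phi>1 \<Psi>1 Y1" and 2: "mild_conv S x \<Phi>2 \<Psi>2 Y2" and 3: "mild_conv S 0 \<Phi>3 \<Psi>3 Y3"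
    and t: "t \<in> {0..T}" and A: "A \<in> sets M"
    and eq: "\<And>w s. w \<in> A \<Longrightarrow> s \<in> {0..t} \<Longrightarrow> \<Phi>3 w s = \<Phi>1 w s - \<Phi>2 w s \<and> \<Psi>3 w s = \<Psi>1 w s - \<Psi>2 w s"
  shows "AE w in M. w \<in> A \<longrightarrow> Y3 t w = Y1 t w - Y2 t w"
proof -
  interpret qc_semigroup S \<mu> by (rule S)
  obtain J1 where J1: "has_ito_integral M F B t (\<lambda>w s. S (t - s) (\<Psi>1 w s)) J1"
    and e1: "AE w in M. Y1 t w = S t x + (LINT s:{0..t}|lborel. S (t - s) (\<Phi>1 w s)) + J1 w"
    using 1 t unfolding mild_conv_def by blast
  obtain J2 where J2: "has_ito_integral M F B t (\<lambda>w s. S (t - s) (\<Psi>2 w s)) J2"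
    and e2: "AE w in M. Y2 t w = S t x + (LINT s:{0..t}|lborel. S (t - s) (\<Phi>2 w s)) + J2 w"
    using 2 t unfolding mild_conv_def by blast
  obtain J3 where J3: "has_ito_integral M F B t (\<lambda>w s. S (t - s) (\<Psi>3 w s)) J3"
    and e3: "AE w in M. Y3 t w = S t 0 + (LINT s:{0..t}|lborel. S (t - s) (\<Phi>3 w s)) + J3 w"
    using 3 t unfolding mild_conv_def by blast
  have i: "AE w in M. set_integrable lborel {0..t} (\<lambda>s. S (t - s) (\<Phi>1 w s))"
    "AE w in M. set_integrable lborel {0..t} (\<lambda>s. S (t - s) (\<Phi>2 w s))"
    using 1 2 t unfolding mild_conv_def by blast+
  have "AE w in M. w \<in> A \<longrightarrow> J3 w = J1 w - J2 w"
  proof (rule ito_locality[OF J1 J2 J3 _ _ A])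
    show "AE w in M. w \<in> A \<longrightarrow> (AE s in lborel. s \<in> {0..t} \<longrightarrow> S (t - s) (\<Psi>3 w s) = S (t - s) (\<Psi>1 w s) - S (t - s) (\<Psi>2 w s))"
      using eq by (intro AE_I2 impI) (auto simp: S_minus)
  qed (use t in auto)
  with e1 e2 e3 i show ?thesis
  proof eventually_elim
    fix w assume h: "Y1 t w = S t x + (LINT s:{0..t}|lborel. S (t - s) (\<Phi>1 w s)) + J1 w"
      "Y2 t w = S t x + (LINT s:{0..t}|lborel. S (t - s) (\<Phi>2 w s)) + J2 w"
      "Y3 t w = S t 0 + (LINT s:{0..t}|lborel. S (t - s) (\<Phi>3 w s)) + J3 w"
      "set_integrable lborel {0..t} (\<lambda>s. S (t - s) (\<Phi>1 w s))" "set_integrable lborel {0..t} (\<lambda>s. S (t - s) (\<Phi>2 w s))"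
      "w \<in> A \<longrightarrow> J3 w = J1 w - J2 w"
    show "w \<in> A \<longrightarrow> Y3 t w = Y1 t w - Y2 t w"
    proof
      assume w: "w \<in> A"
      have "(LINT s:{0..t}|lborel. S (t - s) (\<Phi>3 w s)) = (LINT s:{0..t}|lborel. S (t - s) (\<Phi>1 w s) - S (t - s) (\<Phi>2 w s))"
        using eq[OF w] by (intro set_lebesgue_integral_cong) (auto simp: S_minus)
      also have "\<dots> = (LINT s:{0..t}|lborel. S (t - s) (\<Phi>1 w s)) - (LINT s:{0..t}|lborel. S (t - s) (\<Phi>2 w s))"
        by (rule set_integral_diff(2)[OF h(4,5)])
      finally show "Y3 t w = Y1 t w - Y2 t w"
        using h(1,2,3,6) w t S_zero[of t] by simp
    qed
  qed
qed

text \<open>The maximal bound belongs to the process that \<open>mild_conv_exists\<close> constructs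
  from the differences of the integrands. Locality with A = space M identifies this process with Y1
  - Y2 at each time, and continuity at all times simultaneously.\<close>

lemma mild_conv_contraction:
  fixes \<Phi>1 \<Phi>2 \<Psi>1 \<Psi>2 :: "'w \<Rightarrow> real \<Rightarrow> 'h::{real_inner, banach, second_countable_topology}"
  assumes S: "qc_semigroup S \<mu>"
    and a: "admissible \<Phi>1" "admissible \<Psi>1" "admissible \<Phi>2" "admissible \<Psi>2"
    and c: "cprocess Y1" "cprocess Y2"
    and 1: "mild_conv S x \<Phi>1 \<Psi>1 Y1" and 2: "mild_conv S x \<Phi>2 \<Psi>2 Y2" and t: "t \<in> {0..T}"
  shows "E_sup t (\<lambda>s w. Y1 s w - Y2 s w)
    \<le> ennreal (3 * (T + 72) * exp (2 * \<mu> * T)) * (energy t (\<lambda>w s. \<Phi>1 w s - \<Phi>2 w s) + energy t (\<lambda>w s. \<Psi>1 w s - \<Psi>2 w s))"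
proof -
  obtain Y3 where Y3: "cprocess Y3" "mild_conv S 0 (\<lambda>w s. \<Phi>1 w s - \<Phi>2 w s) (\<lambda>w s. \<Psi>1 w s - \<Psi>2 w s) Y3"
    and b: "\<forall>t\<in>{0..T}. E_sup t Y3
      \<le> ennreal (3 * (T + 72) * exp (2 * \<mu> * T)) * (nsq (0::'h) + energy t (\<lambda>w s. \<Phi>1 w s - \<Phi>2 w s) + energy t (\<lambda>w s. \<Psi>1 w s - \<Psi>2 w s))"
    using mild_conv_exists[OF S admissible_diff[OF a(1,3)] admissible_diff[OF a(2,4)], of 0] by blast
  have "AE w in M. \<forall>t\<in>{0..T}. Y3 t w = Y1 t w - Y2 t w"
  proof (rule cprocess_indistinguishable)
    show "AE w in M. continuous_on {0..T} (\<lambda>t. Y3 t w)" using Y3(1) by (auto simp: cprocess_def)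
    show "AE w in M. continuous_on {0..T} (\<lambda>t. Y1 t w - Y2 t w)"
      using cprocess_diff[OF c] by (auto simp: cprocess_def)
    fix t assume t: "t \<in> {0..T}"
    have "AE w in M. w \<in> space M \<longrightarrow> Y3 t w = Y1 t w - Y2 t w"
      by (rule mild_conv_locality[OF S 1 2 Y3(2) t]) auto
    with AE_space show "AE w in M. Y3 t w = Y1 t w - Y2 t w" by eventually_elim simp
  qed
  then have "AE w in M. sup_sq t (\<lambda>s w. Y1 s w - Y2 s w) w = sup_sq t Y3 w"
    by eventually_elim (use t in \<open>auto simp: sup_sq_def intro!: SUP_cong\<close>)
  then have "E_sup t (\<lambda>s w. Y1 s w - Y2 s w) = E_sup t Y3"
    by (rule nn_integral_cong_AE)
  with b t show ?thesis by simp
qed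

lemma lip_coeff_energy:
  fixes N :: "'w \<Rightarrow> real \<Rightarrow> 'h \<Rightarrow> 'h::{real_inner, banach, second_countable_topology}"
  assumes N: "lip_coeff L N" and D: "jmeas T (\<lambda>w s. Y1 w s - Y2 w s)" and t: "0 \<le> t" "t \<le> T"
  shows "energy t (\<lambda>w s. N w s (Y1 w s) - N w s (Y2 w s)) \<le> ennreal (L\<^sup>2) * energy t (\<lambda>w s. Y1 w s - Y2 w s)"
  using lip_coeffD(1,2)[OF N] t
  by (intro energy_le[OF jmeas_restrict[OF D t(2)]]) (auto intro!: AE_I2)

text \<open>The Lipschitz estimate compares with the value at 0, whose energy is finite by
  \<open>lip_coeff\<close>.\<close>

lemma lip_coeff_admissible:
  fixes N :: "'w \<Rightarrow> real \<Rightarrow> 'h \<Rightarrow> 'h::{real_inner, banach, second_countable_topology}"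
  assumes N: "lip_coeff L N" and Y: "admissible Y"
  shows "admissible (\<lambda>w s. N w s (Y w s))"
proof -
  have jY: "jmeas T Y" and fY: "energy T Y < \<infinity>" using Y by (auto simp: admissible_def)
  have jN: "jmeas T (\<lambda>w s. N w s (Y w s))" by (rule lip_coeff_jmeas[OF N jY])
  have "energy T (\<lambda>w s. (N w s (Y w s) - N w s 0) + N w s 0) \<le> 2 * (energy T (\<lambda>w s. N w s (Y w s) - N w s 0) + energy T (\<lambda>w s. N w s 0))"
    by (intro energy_add jmeas_diff jN lip_coeffD(3)[OF N])
  also have "\<dots> \<le> 2 * (ennreal (L\<^sup>2) * energy T Y + energy T (\<lambda>w s. N w s 0))"
    using lip_coeff_energy[OF N, of Y "\<lambda>_ _. 0" T] jY T by (intro mult_left_mono add_mono) auto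
  also have "\<dots> < \<infinity>" using fY lip_coeffD(5)[OF N] by (simp add: ennreal_mult_less_top)
  finally have "energy T (\<lambda>w s. N w s (Y w s)) < \<infinity>" by simp
  then show ?thesis
    using jN lip_coeff_adapted[OF N] Y by (auto simp: admissible_def)
qed

lemma cprocess_admissible:
  fixes Y :: "real \<Rightarrow> 'w \<Rightarrow> 'h::{real_normed_vector, second_countable_topology}"
  assumes Y: "cprocess Y" and fin: "E_sup T Y < \<infinity>"
  shows "admissible (\<lambda>w s. Y s w)" "energy T (\<lambda>w s. Y s w) \<le> ennreal T * E_sup T Y"
proof -
  show e: "energy T (\<lambda>w s. Y s w) \<le> ennreal T * E_sup T Y"
  proof -
    have "energy T (\<lambda>w s. Y s w) = (\<integral>\<^sup>+s\<in>{0..T}. (\<integral>\<^sup>+w. nsq (Y s w) \<partial>M) \<partial>lborel)"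
      by (rule energy_Fubini[OF cprocess_jmeas[OF Y]]) (use T in auto)
    also have "\<dots> \<le> (\<integral>\<^sup>+s. E_sup T Y * indicator {0..T} s \<partial>lborel)"
    proof (rule nn_integral_mono, goal_cases)
      case (1 s)
      show ?case
      proof (cases "s \<in> {0..T}")
        case True
        then have "(\<integral>\<^sup>+w. nsq (Y s w) \<partial>M) \<le> E_sup T Y"
          by (intro nn_integral_mono) (auto simp: sup_sq_def intro!: SUP_upper)
        then show ?thesis by (rule mult_right_mono) simp
      qed simp
    qed
    also have "\<dots> = ennreal T * E_sup T Y"
      using T by (subst nn_integral_cmult_indicator) (auto simp: mult.commute)
    finally show ?thesis .
  qed
  have "energy T (\<lambda>w s. Y s w) < \<infinity>" by (rule le_less_trans[OF e]) (use fin in \<open>simp add: ennreal_mult_less_top\<close>)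
  then show "admissible (\<lambda>w s. Y s w)"
    using cprocess_jmeas[OF Y] Y by (auto simp: admissible_def cprocess_def)
qed

text \<open>The contraction estimate involves the energy up to t only, so a weight exp (b t) makes
  successive differences shrink by 1/16 on the whole interval, with no need to divide [0, T] into
  short pieces.\<close>

lemma picard_exists:
  fixes \<kappa> \<sigma> :: "'w \<Rightarrow> real \<Rightarrow> 'h \<Rightarrow> 'h::{real_inner, banach, second_countable_topology}"
  assumes S: "qc_semigroup S \<mu>" and \<kappa>: "lip_coeff L \<kappa>" and \<sigma>: "lip_coeff L \<sigma>"
  shows "\<exists>Y. cprocess Y \<and> E_sup T Y < \<infinity> \<and>
    mild_conv S x (\<lambda>w s. \<kappa> w s (Y s w)) (\<lambda>w s. \<sigma> w s (Y s w)) Y"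
proof -
  interpret qc_semigroup S \<mu> by (rule S)
  define C where "C = 3 * (T + 72) * exp (2 * \<mu> * T)"
  have C0: "0 < C" using T by (simp add: C_def)
  define good where "good Y \<longleftrightarrow> cprocess Y \<and> E_sup T Y < \<infinity>" for Y :: "real \<Rightarrow> 'w \<Rightarrow> 'h"
  \<comment> \<open>A relation rather than a map, since the equation determines the next iterate
    only up to null sets; a choice function is extracted below.\<close>
  define step where "step Y Y' \<longleftrightarrow> mild_conv S x (\<lambda>w s. \<kappa> w s (Y s w)) (\<lambda>w s. \<sigma> w s (Y s w)) Y'" for Y Y' :: "real \<Rightarrow> 'w \<Rightarrow> 'h"
  have gadm: "admissible (\<lambda>w s. Y s w)" if "good Y" for Y
    using that cprocess_admissible(1)[of Y] by (simp add: good_def)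
  have gk: "admissible (\<lambda>w s. \<kappa> w s (Y s w))" "admissible (\<lambda>w s. \<sigma> w s (Y s w))" if "good Y" for Y
    using lip_coeff_admissible[OF \<kappa> gadm[OF that]] lip_coeff_admissible[OF \<sigma> gadm[OF that]] by auto
  have ex: "\<exists>Y'. good Y' \<and> step Y Y'" if g: "good Y" for Y
  proof -
    obtain Y' where Y': "cprocess Y'" "step Y Y'"
      and b: "\<forall>t\<in>{0..T}. E_sup t Y' \<le> ennreal C * (nsq x
        + energy t (\<lambda>w s. \<kappa> w s (Y s w)) + energy t (\<lambda>w s. \<sigma> w s (Y s w)))"
      using mild_conv_exists[OF S gk[OF g], of x] unfolding step_def C_def by blast
    have "E_sup T Y' \<le> ennreal C * (nsq x
        + energy T (\<lambda>w s. \<kappa> w s (Y s w)) + energy T (\<lambda>w s. \<sigma> w s (Y s w)))" using b T by auto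
    also have "\<dots> < \<infinity>" using gk[OF g] by (simp add: admissible_def ennreal_mult_less_top)
    finally show ?thesis using Y' by (auto simp: good_def)
  qed
  have contr: "E_sup t (\<lambda>s w. Y1' s w - Y2' s w) \<le> ennreal (2 * L\<^sup>2 * C) * energy t (\<lambda>w s. Y1 s w - Y2 s w)"
    if g: "good Y1" "good Y2" "good Y1'" "good Y2'" and s: "step Y1 Y1'" "step Y2 Y2'" and t: "t \<in> {0..T}" for Y1 Y2 Y1' Y2' t
  proof -
    have d: "jmeas T (\<lambda>w s. Y1 s w - Y2 s w)"
      using gadm[OF g(1)] gadm[OF g(2)] by (intro jmeas_diff) (auto simp: admissible_def)
    have t': "0 \<le> t" "t \<le> T" using t by auto
    have "E_sup t (\<lambda>s w. Y1' s w - Y2' s w)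
      \<le> ennreal C * (energy t (\<lambda>w s. \<kappa> w s (Y1 s w) - \<kappa> w s (Y2 s w)) + energy t (\<lambda>w s. \<sigma> w s (Y1 s w) - \<sigma> w s (Y2 s w)))"
      unfolding C_def
      by (rule mild_conv_contraction[OF S gk[OF g(1)] gk[OF g(2)] _ _ s[unfolded step_def] t])
        (use g in \<open>auto simp: good_def\<close>)
    also have "\<dots> \<le> ennreal C * (ennreal (L\<^sup>2) * energy t (\<lambda>w s. Y1 s w - Y2 s w) + ennreal (L\<^sup>2) * energy t (\<lambda>w s. Y1 s w - Y2 s w))"
      by (intro mult_left_mono add_mono lip_coeff_energy[OF \<kappa> d t'] lip_coeff_energy[OF \<sigma> d t']) simp
    also have "\<dots> = ennreal (2 * L\<^sup>2 * C) * energy t (\<lambda>w s. Y1 s w - Y2 s w)"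
    proof -
      have "ennreal (2 * L\<^sup>2 * C) = ennreal C * (ennreal (L\<^sup>2) + ennreal (L\<^sup>2))"
        using C0 by (simp flip: ennreal_plus ennreal_mult)
      then show ?thesis by (simp only: distrib_right mult.assoc)
    qed
    finally show ?thesis .
  qed
  have "\<exists>Y. Y 0 = (\<lambda>_ _. 0) \<and> (\<forall>n. good (Y n) \<and> step (Y n) (Y (Suc n)))"
  proof -
    have g0: "good (\<lambda>_ _. 0)" 
    proof -
      have "sup_sq T (\<lambda>_ (_ :: 'w). 0 :: 'h) = (\<lambda>w. 0)" using T by (simp add: sup_sq_def fun_eq_iff)
      then show ?thesis by (simp add: good_def cprocess_const)
    qed
    have "\<forall>Y. \<exists>Y'. good Y \<longrightarrow> good Y' \<and> step Y Y'" using ex by blast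
    from choice[OF this] obtain nx where nx: "\<And>Y. good Y \<Longrightarrow> good (nx Y) \<and> step Y (nx Y)" by blast
    have "good ((nx ^^ n) (\<lambda>_ _. 0))" for n by (induction n) (use g0 nx in auto)
    then show ?thesis using nx by (intro exI[of _ "\<lambda>n. (nx ^^ n) (\<lambda>_ _. 0)"]) auto
  qed
  then obtain Y where Yg: "\<And>n. good (Y n)" and Ys: "\<And>n. step (Y n) (Y (Suc n))" and Y0: "Y 0 = (\<lambda>_ _. 0)" by blast
  have Yc: "cprocess (Y n)" for n using Yg[of n] by (simp add: good_def)
  define D where "D = 2 * L\<^sup>2 * C"
  have D0: "0 \<le> D" using C0 by (simp add: D_def)
  \<comment> \<open>The value for which \<open>exp_weight_step\<close> turns the Lipschitz constant
    \<open>D\<close> of a Picard step into the ratio 1/16.\<close>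
  define b where "b = 16 * D + 1"
  have b: "0 < b" using D0 by (simp add: b_def)
  define K where "K = enn2real (E_sup T (Y 1))"
  have K: "E_sup T (Y 1) = ennreal K" "0 \<le> K"
    using Yg[of 1] by (auto simp: good_def K_def)
  have est: "E_sup t (\<lambda>s w. Y (Suc n) s w - Y n s w) \<le> ennreal (K * (1/16) ^ n * exp (b * t))"
    if "t \<in> {0..T}" for n t
    using that
  proof (induction n arbitrary: t)
    case 0
    have "E_sup t (\<lambda>s w. Y (Suc 0) s w - Y 0 s w) \<le> E_sup T (Y 1)"
      using 0 by (intro nn_integral_mono) (auto simp: Y0 sup_sq_def intro!: SUP_subset_mono)
    also have "\<dots> \<le> ennreal (K * (1/16) ^ 0 * exp (b * t))"
      unfolding K(1) using 0 b K(2) by (intro ennreal_leI) (simp add: mult_le_cancel_left1)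
    finally show ?case .
  next
    case (Suc n)
    let ?D = "\<lambda>s w. Y (Suc n) s w - Y n s w"
    have t: "0 \<le> t" "t \<le> T" using Suc.prems by auto
    have "E_sup t (\<lambda>s w. Y (Suc (Suc n)) s w - Y (Suc n) s w) \<le> ennreal D * energy t (\<lambda>w s. ?D s w)"
      unfolding D_def by (rule contr[OF Yg Yg Yg Yg Ys Ys Suc.prems])
    also have "energy t (\<lambda>w s. ?D s w) = (\<integral>\<^sup>+s\<in>{0..t}. (\<integral>\<^sup>+w. nsq (?D s w) \<partial>M) \<partial>lborel)"
      by (rule energy_Fubini[OF cprocess_jmeas[OF cprocess_diff[OF Yc Yc]] t])
    finally have le: "E_sup t (\<lambda>s w. Y (Suc (Suc n)) s w - Y (Suc n) s w) \<le> ennreal D * (\<integral>\<^sup>+s\<in>{0..t}. (\<integral>\<^sup>+w. nsq (?D s w) \<partial>M) \<partial>lborel)" .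
    have "E_sup t (\<lambda>s w. Y (Suc (Suc n)) s w - Y (Suc n) s w) \<le> ennreal (K * (1/16) ^ n / 16 * exp (b * t))"
    proof (rule exp_weight_step[OF _ le b_def D0 _ t(1)])
      fix s assume s: "s \<in> {0..t}"
      have "(\<integral>\<^sup>+w. nsq (?D s w) \<partial>M) \<le> E_sup s ?D"
        using s by (intro nn_integral_mono) (auto simp: sup_sq_def intro!: SUP_upper)
      also have "\<dots> \<le> ennreal (K * (1/16) ^ n * exp (b * s))" using s t by (intro Suc.IH) auto
      finally show "(\<integral>\<^sup>+w. nsq (?D s w) \<partial>M) \<le> ennreal (K * (1/16) ^ n * exp (b * s))" .
    qed (use K in simp)
    then show ?case by simp
  qed
  have "\<exists>X. cprocess X \<and> (\<forall>k. E_sup T (\<lambda>s w. X s w - Y k s w) \<le> ennreal (3 * (K * exp (b * T)) * (1/16) ^ k))"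
  proof (rule cprocess_limit[OF Yc])
    show "0 \<le> K * exp (b * T)" using K by simp
    show "E_sup T (\<lambda>s w. Y (Suc k) s w - Y k s w) \<le> ennreal (K * exp (b * T) * (1/16) ^ k)" for k
      using est[of T k] T by (simp add: mult_ac)
  qed
  then obtain X where X: "cprocess X"
    and XY: "\<And>k. E_sup T (\<lambda>s w. X s w - Y k s w) \<le> ennreal (3 * (K * exp (b * T)) * (1/16) ^ k)" by blast
  have Xg: "good X" using X XY[of 0] by (simp add: good_def Y0 le_less_trans)
  \<comment> \<open>One more Picard step from the limit X. Both X' and X are close to Y (k + 1) for
    large k, so they are indistinguishable, and the equation solved by X' becomes the one for
    X.\<close>
  obtain X' where X': "good X'" "step X X'" using ex[OF Xg] by blast
  have X'c: "cprocess X'" using X' by (simp add: good_def)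
  define R where "R = 3 * (K * exp (b * T))"
  have R0: "0 \<le> R" using K by (simp add: R_def)
  have diff: "E_sup T (\<lambda>s w. X' s w - X s w) \<le> ennreal (2 * (D * T + 1) * R * (1/16) ^ k)" for k
  proof -
    have cs: "cprocess (\<lambda>s w. X s w - Y k s w)" for k by (rule cprocess_diff[OF X Yc])
    have mc: "E_sup T (\<lambda>s w. Y (Suc k) s w - X s w) = E_sup T (\<lambda>s w. X s w - Y (Suc k) s w)"
      by (simp add: sup_sq_def norm_minus_commute)
    have "E_sup T (\<lambda>s w. X' s w - X s w)
      \<le> 2 * (E_sup T (\<lambda>s w. X' s w - Y (Suc k) s w) + E_sup T (\<lambda>s w. X s w - Y (Suc k) s w))"
      using E_sup_triangle[OF X'c Yc X order_refl, of "Suc k"] unfolding mc .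
    also have "\<dots> \<le> 2 * (ennreal (D * (T * (R * (1/16) ^ k))) + ennreal (R * (1/16) ^ k))"
    proof (intro mult_left_mono add_mono)
      have "E_sup T (\<lambda>s w. X' s w - Y (Suc k) s w) \<le> ennreal D * energy T (\<lambda>w s. X s w - Y k s w)"
        unfolding D_def by (rule contr[OF Xg Yg X'(1) Yg X'(2) Ys]) (use T in simp)
      also have "energy T (\<lambda>w s. X s w - Y k s w) \<le> ennreal T * E_sup T (\<lambda>s w. X s w - Y k s w)"
        by (rule cprocess_admissible(2)[OF cs]) (rule le_less_trans[OF XY], simp)
      also have "\<dots> \<le> ennreal T * ennreal (R * (1/16) ^ k)" using XY by (intro mult_left_mono) (auto simp: R_def)
      also have "ennreal D * (ennreal T * ennreal (R * (1/16) ^ k)) = ennreal (D * (T * (R * (1/16) ^ k)))"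
        using D0 T R0 by (simp add: ennreal_mult)
      finally show "E_sup T (\<lambda>s w. X' s w - Y (Suc k) s w) \<le> ennreal (D * (T * (R * (1/16) ^ k)))"
        by (auto simp: mult_left_mono)
      have "E_sup T (\<lambda>s w. X s w - Y (Suc k) s w) \<le> ennreal (R * (1/16) ^ Suc k)"
        using XY[of "Suc k"] unfolding R_def .
      also have "\<dots> \<le> ennreal (R * (1/16) ^ k)" using R0 by (intro ennreal_leI mult_left_mono) auto
      finally show "E_sup T (\<lambda>s w. X s w - Y (Suc k) s w) \<le> ennreal (R * (1/16) ^ k)" .
    qed simp
    also have "\<dots> = ennreal (2 * (D * (T * (R * (1/16) ^ k)) + R * (1/16) ^ k))"
      using D0 T R0 by (simp flip: ennreal_plus ennreal_numeral ennreal_mult)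
    also have "2 * (D * (T * (R * (1/16) ^ k)) + R * (1/16) ^ k) = 2 * (D * T + 1) * R * (1/16) ^ k"
      by (simp add: algebra_simps)
    finally show ?thesis .
  qed
  have "(\<lambda>k. ennreal (2 * (D * T + 1) * R * (1/16) ^ k)) \<longlonglongrightarrow> ennreal (2 * (D * T + 1) * R * 0)"
    by (intro tendsto_ennrealI tendsto_intros LIMSEQ_realpow_zero) auto
  then have "E_sup T (\<lambda>s w. X' s w - X s w) \<le> ennreal (2 * (D * T + 1) * R * 0)"
    by (rule LIMSEQ_le_const) (use diff in auto)
  then have z: "E_sup T (\<lambda>s w. X' s w - X s w) = 0" by simp
  have "AE w in M. sup_sq T (\<lambda>s w. X' s w - X s w) w = 0"
    using z by (subst (asm) nn_integral_0_iff_AE) (auto intro!: sup_sq_measurable cprocess_diff X'c X)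
  then have XX: "AE w in M. \<forall>t\<in>{0..T}. X' t w = X t w"
  proof eventually_elim
    case s0: (elim w)
    show ?case
    proof
      fix t assume "t \<in> {0..T}"
      then have "nsq (X' t w - X t w) \<le> sup_sq T (\<lambda>s w. X' s w - X s w) w"
        unfolding sup_sq_def by (rule SUP_upper)
      then show "X' t w = X t w" unfolding s0 by simp
    qed
  qed
  have "mild_conv S x (\<lambda>w s. \<kappa> w s (X s w)) (\<lambda>w s. \<sigma> w s (X s w)) X"
    unfolding mild_conv_def
  proof (intro ballI conjI)
    fix t assume t: "t \<in> {0..T}"
    show "AE w in M. set_integrable lborel {0..t} (\<lambda>s. S (t - s) (\<kappa> w s (X s w)))"
      using X'(2) t unfolding step_def mild_conv_def by blast
    obtain J where J: "has_ito_integral M F B t (\<lambda>w s. S (t - s) (\<sigma> w s (X s w))) J"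
      and e: "AE w in M. X' t w = S t x + (LINT s:{0..t}|lborel. S (t - s) (\<kappa> w s (X s w))) + J w"
      using X'(2) t unfolding step_def mild_conv_def by blast
    have "AE w in M. X t w = S t x + (LINT s:{0..t}|lborel. S (t - s) (\<kappa> w s (X s w))) + J w"
      using XX e by eventually_elim (use t in auto)
    with J show "\<exists>J. has_ito_integral M F B t (\<lambda>w s. S (t - s) (\<sigma> w s (X s w))) J \<and>
      (AE w in M. X t w = S t x + (LINT s:{0..t}|lborel. S (t - s) (\<kappa> w s (X s w))) + J w)" by blast
  qed
  then show ?thesis using Xg by (auto simp: good_def)
qed

end

subsection \<open>Pathwise uniqueness\<close>

text \<open>Starting from the crude bound n, each application of the inequality gains 1/16 relative
  to the weight exp (b t). Only upper bounds of the integrand are integrated, so u need not be known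
  to be measurable.\<close>

lemma gronwall_zero:
  fixes u :: "real \<Rightarrow> ennreal"
  assumes u: "\<And>t. t \<in> {0..T} \<Longrightarrow> u t \<le> ennreal c * (\<integral>\<^sup>+s\<in>{0..t}. u s \<partial>lborel)"
    and n: "\<And>t. t \<in> {0..T} \<Longrightarrow> u t \<le> ennreal n" and c: "0 \<le> c" and n0: "0 \<le> n" and t: "t \<in> {0..T}"
  shows "u t = 0"
proof -
  define b where "b = 16 * c + 1"
  have b: "0 < b" using c by (simp add: b_def)
  have est: "u t \<le> ennreal (n * (1/16) ^ k * exp (b * t))" if "t \<in> {0..T}" for k t
    using that
  proof (induction k arbitrary: t)
    case 0
    have "n \<le> n * (1/16) ^ 0 * exp (b * t)" using 0 b n0 by (simp add: mult_le_cancel_left1)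
    then show ?case using n[OF 0] by (meson ennreal_leI order_trans)
  next
    case (Suc k)
    have "u t \<le> ennreal (n * (1/16) ^ k / 16 * exp (b * t))"
      by (rule exp_weight_step[OF _ u[OF Suc.prems] b_def c])
        (use Suc n0 in auto)
    then show ?case by simp
  qed
  have "(\<lambda>k. ennreal (n * (1/16) ^ k * exp (b * t))) \<longlonglongrightarrow> ennreal (n * 0 * exp (b * t))"
    by (intro tendsto_ennrealI tendsto_intros LIMSEQ_realpow_zero) auto
  then have "u t \<le> ennreal (n * 0 * exp (b * t))"
    by (rule LIMSEQ_le_const) (use est[OF t] in auto)
  then show ?thesis by simp
qed

context brownian_setting
begin

text \<open>Rescaling [0, s] to [0, 1] provides a countable set of parameters that does not depend
  on s, which makes the running supremum jointly measurable in (w, s).\<close>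

lemma sup_sq_scaled:
  fixes D :: "real \<Rightarrow> 'w \<Rightarrow> 'h::real_normed_vector"
  assumes D: "continuous_on {0..T} (\<lambda>t. D t w)" and s: "0 \<le> s" "s \<le> T"
    and Q: "Q \<subseteq> {0..1}" "{0..1} \<subseteq> closure Q"
  shows "sup_sq s D w = (SUP r\<in>Q. nsq (D (r * s) w))"
proof -
  have "(\<lambda>r. r * s) ` {0..1} = {0..s}"
  proof
    show "(\<lambda>r. r * s) ` {0..1} \<subseteq> {0..s}" using s by (auto simp: mult_left_le_one_le)
    show "{0..s} \<subseteq> (\<lambda>r. r * s) ` {0..1}"
    proof
      fix x assume x: "x \<in> {0..s}"
      show "x \<in> (\<lambda>r. r * s) ` {0..1}"
        using x by (cases "s = 0") (auto intro!: image_eqI[of _ _ "x / s"])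
    qed
  qed
  then have "sup_sq s D w = (SUP r\<in>{0..1}. nsq (D (r * s) w))"
    unfolding sup_sq_def by (simp add: image_image flip: \<open>(\<lambda>r. r * s) ` {0..1} = {0..s}\<close>)
  also have "\<dots> = (SUP r\<in>Q. nsq (D (r * s) w))"
  proof (rule SUP_norm_sq_dense[OF _ Q])
    have "r * s \<le> T" if "0 \<le> r" "r \<le> 1" for r using mult_left_le_one_le[of s r] s that by simp
    then show "continuous_on {0..1} (\<lambda>r. D (r * s) w)"
      using s by (intro continuous_on_compose2[OF D]) (auto intro!: continuous_intros)
  qed
  finally show ?thesis .
qed

lemma stopped_set_measurable:
  fixes D :: "real \<Rightarrow> 'w \<Rightarrow> 'h::{real_normed_vector, second_countable_topology}"
  assumes D: "cprocess D"
  shows "(\<lambda>(w, s). sup_sq s D w) \<in> borel_measurable (MT T)"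
    "s \<in> {0..T} \<Longrightarrow> sup_sq s D \<in> borel_measurable (F s)"
proof -
  obtain Q where Q: "countable Q" "Q \<subseteq> {0..1::real}" "{0..1} \<subseteq> closure Q" by (rule separable)
  have c: "continuous_on {0..T} (\<lambda>t. D t w)" if "w \<in> space M" for w using D that by (simp add: cprocess_def)
  have qT: "r * s \<in> {0..s}" if "r \<in> Q" "0 \<le> s" for r s :: real
  proof -
    have "0 \<le> r" "r \<le> 1" using that Q(2) by auto
    then show ?thesis using mult_left_le_one_le[of s r] that by simp
  qed
  have "(\<lambda>p. SUP r\<in>Q. nsq (D (r * snd p) (fst p))) \<in> borel_measurable (MT T)"
  proof (rule borel_measurable_SUP[OF Q(1)])
    fix r assume r: "r \<in> Q"
    note [measurable] = measurable_snd_restrict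
    have "(\<lambda>p. r * snd p) \<in> measurable (MT T) (restrict_space borel {0..T})"
    proof (rule measurable_restrict_space2)
      have "r * s \<in> {0..T}" if "s \<in> {0..T}" for s using qT[OF r, of s] that by auto
      then show "(\<lambda>p. r * snd p) \<in> space (MT T) \<rightarrow> {0..T}"
        by (auto simp: space_pair_measure space_restrict_space)
    qed measurable
    then have "(\<lambda>p. (fst p, r * snd p)) \<in> measurable (MT T) (MT T)"
      by measurable
    from measurable_compose[OF this jmeas_nsq[OF cprocess_jmeas[OF D]]]
    show "(\<lambda>p. nsq (D (r * snd p) (fst p))) \<in> borel_measurable (MT T)"
      by simp
  qed
  moreover have "(SUP r\<in>Q. nsq (D (r * snd p) (fst p))) = (\<lambda>(w, s). sup_sq s D w) p"
    if "p \<in> space (MT T)" for p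
    using sup_sq_scaled[where D = D and w = "fst p" and s = "snd p" and Q = Q] c Q(2,3) that
    by (auto simp: space_pair_measure space_restrict_space)
  ultimately show "(\<lambda>(w, s). sup_sq s D w) \<in> borel_measurable (MT T)"
    by (simp cong: measurable_cong)
  assume s: "s \<in> {0..T}"
  have "(\<lambda>w. SUP r\<in>Q. nsq (D (r * s) w)) \<in> borel_measurable (F s)"
  proof (rule borel_measurable_SUP[OF Q(1)])
    fix r assume r: "r \<in> Q"
    have rs: "0 \<le> r * s" "r * s \<le> s" "s \<le> T" using qT[OF r, of s] s by auto
    have [measurable]: "D (r * s) \<in> borel_measurable (F s)"
      by (rule measurable_F_mono[OF cprocessD(1)[OF D] rs]) (use rs in auto)
    show "(\<lambda>w. nsq (D (r * s) w)) \<in> borel_measurable (F s)" by measurable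
  qed
  moreover have "(SUP r\<in>Q. nsq (D (r * s) w)) = sup_sq s D w" if "w \<in> space (F s)" for w
    using sup_sq_scaled[where D = D and w = w and s = s and Q = Q] c Q(2,3) that s space_F[of s] by auto
  ultimately show "sup_sq s D \<in> borel_measurable (F s)" by (simp cong: measurable_cong)
qed

lemma mild_unique:
  fixes \<kappa> \<sigma> :: "'w \<Rightarrow> real \<Rightarrow> 'h \<Rightarrow> 'h::{real_inner, banach, second_countable_topology}"
  assumes S: "qc_semigroup S \<mu>" and \<kappa>: "lip_coeff L \<kappa>" and \<sigma>: "lip_coeff L \<sigma>"
    and Yp: "(\<lambda>(w, t). Y t w) \<in> borel_measurable (predictable_algebra M F T)"
    and Zp: "(\<lambda>(w, t). Z t w) \<in> borel_measurable (predictable_algebra M F T)"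
    and Yc: "AE w in M. continuous_on {0..T} (\<lambda>t. Y t w)" and Zc: "AE w in M. continuous_on {0..T} (\<lambda>t. Z t w)"
    and Y: "mild_conv S x (\<lambda>w s. \<kappa> w s (Y s w)) (\<lambda>w s. \<sigma> w s (Y s w)) Y"
    and Z: "mild_conv S x (\<lambda>w s. \<kappa> w s (Z s w)) (\<lambda>w s. \<sigma> w s (Z s w)) Z"
  shows "AE w in M. \<forall>t\<in>{0..T}. Y t w = Z t w"
proof -
  note jY = predictable_jmeas[OF Yp] and jZ = predictable_jmeas[OF Zp]
  have "AE w in M. continuous_on {0..T} (\<lambda>t. Y t w) \<and> continuous_on {0..T} (\<lambda>t. Z t w)"
    using Yc Zc by eventually_elim simp
  then have "\<exists>N\<in>null_sets M. {w \<in> space M. \<not> (continuous_on {0..T} (\<lambda>t. Y t w) \<and> continuous_on {0..T} (\<lambda>t. Z t w))} \<subseteq> N"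
    by (simp only: eventually_ae_filter)
  then obtain N where N: "N \<in> null_sets M"
    "{w \<in> space M. \<not> (continuous_on {0..T} (\<lambda>t. Y t w) \<and> continuous_on {0..T} (\<lambda>t. Z t w))} \<subseteq> N"
    by blast
  define good where "good = space M - N"
  have gM[measurable]: "good \<in> sets M" using N(1) by (auto simp: good_def)
  have AEg: "AE w in M. w \<in> good"
    using AE_not_in[OF N(1)] AE_space by eventually_elim (simp add: good_def)
  have gF: "good \<in> sets (F t)" if "t \<in> {0..T}" for t
    by (rule F_full_measure[OF gM AEg]) (use that in auto)
  have gc: "continuous_on {0..T} (\<lambda>t. Y t w)" "continuous_on {0..T} (\<lambda>t. Z t w)" "w \<in> space M" if "w \<in> good" for w
    using that N(2) by (auto simp: good_def)
  \<comment> \<open>Setting the difference to 0 off \<open>good\<close> makes all its paths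
    continuous; it stays adapted since \<open>good\<close> has full measure and so belongs to every
    F t.\<close>
  define D where "D s w = (if w \<in> good then Y s w - Z s w else 0)" for s w
  have Dc: "cprocess D"
    unfolding cprocess_def
  proof (intro conjI ballI)
    fix t assume t: "t \<in> {0..T}"
    note [measurable] = gF[OF t] predictable_adapted[OF Yp t] predictable_adapted[OF Zp t]
    show "D t \<in> borel_measurable (F t)" unfolding D_def[abs_def] by measurable
  next
    fix w assume "w \<in> space M"
    show "continuous_on {0..T} (\<lambda>t. D t w)"
      by (cases "w \<in> good") (auto simp: D_def intro!: continuous_intros gc)
  qed
  define C where "C = 3 * (T + 72) * exp (2 * \<mu> * T)"
  have C0: "0 \<le> C" using T by (simp add: C_def)
  have L0: "0 \<le> L" by (rule lip_coeffD(1)[OF \<kappa>])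
  have main: "AE w in M. w \<in> good \<and> sup_sq t D w \<le> ennreal (real n) \<longrightarrow> D t w = 0" if t: "t \<in> {0..T}" for n t
  proof -
    \<comment> \<open>The events of the cut-off: \<open>G s\<close> is known at time s and decreases
      in s. On \<open>G s\<close> the difference is bounded at time s, which gives the cut-off
      integrands finite energy although Y and Z may have no moments.\<close>
    define G where "G s = {w \<in> good. sup_sq s D w \<le> ennreal (real n)}" for s
    have Gmono: "w \<in> G s" if "w \<in> G t" "s \<le> t" for w s t
    proof -
      have "sup_sq s D w \<le> sup_sq t D w"
        unfolding sup_sq_def using that(2) by (intro SUP_subset_mono) auto
      then show ?thesis using that(1) by (auto simp: G_def)
    qed
    define E where "E w s = indicat_real (G s) w *\<^sub>R D s w" for w s
    have Gj: "(\<lambda>p. indicat_real (G (snd p)) (fst p)) \<in> borel_measurable (MT T)"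
    proof -
      have [measurable]: "(\<lambda>p. sup_sq (snd p) D (fst p)) \<in> borel_measurable (MT T)"
        using stopped_set_measurable(1)[OF Dc] by (simp add: split_beta')
      have "(\<lambda>p. indicat_real good (fst p) * (if sup_sq (snd p) D (fst p) \<le> ennreal (real n) then 1 else 0)) \<in> borel_measurable (MT T)"
        by measurable
      moreover have "(\<lambda>p. indicat_real good (fst p) * (if sup_sq (snd p) D (fst p) \<le> ennreal (real n) then 1 else 0)) = (\<lambda>p. indicat_real (G (snd p)) (fst p))"
        by (auto simp: G_def indicator_def fun_eq_iff)
      ultimately show ?thesis by simp
    qed
    have GF: "G s \<in> sets (F s)" if s: "s \<in> {0..T}" for s
    proof -
      note [measurable] = stopped_set_measurable(2)[OF Dc s] gF[OF s]
      have "G s = {w \<in> space (F s). w \<in> good \<and> sup_sq s D w \<le> ennreal (real n)}"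
        using space_F[of s] s gc(3) by (auto simp: G_def)
      also have "\<dots> \<in> sets (F s)" by measurable
      finally show ?thesis .
    qed
    have Db: "nsq (E w s) \<le> ennreal (real n)" if "s \<in> {0..T}" for w s
    proof (cases "w \<in> G s")
      case True
      have "nsq (D s w) \<le> sup_sq s D w" unfolding sup_sq_def using that by (intro SUP_upper) auto
      also have "\<dots> \<le> ennreal (real n)" using True by (simp add: G_def)
      finally show ?thesis using True by (simp add: E_def)
    qed (simp add: E_def)
    have jE: "jmeas T E"
      using Gj cprocess_jmeas[OF Dc] unfolding E_def split_beta' by measurable
    have eE: "energy T E \<le> ennreal (T * real n)" using T Db by (intro energy_bounded) auto
    have adm: "admissible (\<lambda>w s. indicat_real (G s) w *\<^sub>R (f w s (Y s w) - f w s (Z s w)))"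
      and en: "\<And>r. 0 \<le> r \<Longrightarrow> r \<le> T \<Longrightarrow> energy r (\<lambda>w s. indicat_real (G s) w *\<^sub>R (f w s (Y s w) - f w s (Z s w))) \<le> ennreal (L\<^sup>2) * energy r E"
      if f: "lip_coeff L f" for f :: "'w \<Rightarrow> real \<Rightarrow> 'h \<Rightarrow> 'h"
    proof -
      let ?\<Phi> = "\<lambda>w s. indicat_real (G s) w *\<^sub>R (f w s (Y s w) - f w s (Z s w))"
      have j: "jmeas T ?\<Phi>"
        using Gj lip_coeff_jmeas[OF f jY] lip_coeff_jmeas[OF f jZ] unfolding split_beta' by measurable
      show e: "energy r ?\<Phi> \<le> ennreal (L\<^sup>2) * energy r E" if r: "0 \<le> r" "r \<le> T" for r
      proof (rule energy_le[OF jmeas_restrict[OF jE r(2)] order_refl L0], intro AE_I2 impI)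
        fix w s assume w: "w \<in> space M" and s: "s \<in> {0..r}"
        show "norm (?\<Phi> w s) \<le> L * norm (E w s)"
        proof (cases "w \<in> G s")
          case True
          then have "w \<in> good" by (simp add: G_def)
          then show ?thesis
            using lip_coeffD(2)[OF f w, of s "Y s w" "Z s w"] s r True by (simp add: E_def D_def)
        qed (simp add: E_def)
      qed
      have "energy T ?\<Phi> \<le> ennreal (L\<^sup>2) * energy T E" using T by (intro e) auto
      also have "\<dots> < \<infinity>" using le_less_trans[OF eE] by (simp add: ennreal_mult_less_top)
      finally have fin: "energy T ?\<Phi> < \<infinity>" .
      have "(\<lambda>w. ?\<Phi> w s) \<in> borel_measurable (F s)" if s: "s \<in> {0..T}" for s
      proof -
        have [measurable]: "(\<lambda>w. f w s (Y s w)) \<in> borel_measurable (F s)" "(\<lambda>w. f w s (Z s w)) \<in> borel_measurable (F s)"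
          using lip_coeff_adapted[OF f _ _ predictable_adapted[OF Yp s]] lip_coeff_adapted[OF f _ _ predictable_adapted[OF Zp s]] s by auto
        note [measurable] = GF[OF s]
        show ?thesis by measurable
      qed
      with j fin show "admissible ?\<Phi>" by (simp add: admissible_def)
    qed
    define \<Phi> where "\<Phi> w s = indicat_real (G s) w *\<^sub>R (\<kappa> w s (Y s w) - \<kappa> w s (Z s w))" for w s
    define \<Psi> where "\<Psi> w s = indicat_real (G s) w *\<^sub>R (\<sigma> w s (Y s w) - \<sigma> w s (Z s w))" for w s
    \<comment> \<open>X is driven by the cut-off differences of the coefficients, so
      \<open>mild_conv_exists\<close> bounds its supremum; Y - Z itself has no such bound a
      priori.\<close>
    obtain X where X: "cprocess X" "mild_conv S 0 \<Phi> \<Psi> X"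
      and Xb: "\<forall>t\<in>{0..T}. E_sup t X \<le> ennreal C * (nsq (0::'h) + energy t \<Phi> + energy t \<Psi>)"
      using mild_conv_exists[OF S adm[OF \<kappa>] adm[OF \<sigma>], of 0] unfolding \<Phi>_def \<Psi>_def C_def by blast
    \<comment> \<open>On \<open>G r\<close> all earlier indicators equal 1, so the cut-off
      integrands coincide there with the original differences on the whole of [0, r].\<close>
    have XD: "AE w in M. w \<in> G r \<longrightarrow> X r w = Y r w - Z r w" if r: "r \<in> {0..T}" for r
    proof (rule mild_conv_locality[OF S Y Z X(2) r])
      show "G r \<in> sets M" using GF[OF r] sets_F_M[of r] r by auto
      show "\<Phi> w s = \<kappa> w s (Y s w) - \<kappa> w s (Z s w) \<and> \<Psi> w s = \<sigma> w s (Y s w) - \<sigma> w s (Z s w)"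
        if "w \<in> G r" "s \<in> {0..r}" for w s
        using Gmono[OF that(1), of s] that(2) by (simp add: \<Phi>_def \<Psi>_def)
    qed
    define u where "u r = (\<integral>\<^sup>+w. nsq (E w r) \<partial>M)" for r
    \<comment> \<open>On \<open>G r\<close> the cut-off difference \<open>E\<close> equals X, and
      elsewhere it is 0; its second moment is thus bounded by the energy of the coefficients and
      hence by the time integral of its own second moments.\<close>
    have u0: "u t = 0"
    proof (rule gronwall_zero[OF _ _ _ _ t])
      show "0 \<le> 2 * C * L\<^sup>2" using C0 by simp
      show "0 \<le> real n" by simp
      fix r assume r: "r \<in> {0..T}"
      have "u r \<le> (\<integral>\<^sup>+w. ennreal (real n) \<partial>M)" unfolding u_def using Db[OF r] by (intro nn_integral_mono)
      then show "u r \<le> ennreal (real n)" by (simp add: emeasure_space_1)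
      have "u r \<le> E_sup r X"
        unfolding u_def
      proof (rule nn_integral_mono_AE, goal_cases)
        case 1
        show ?case
          using XD[OF r]
        proof eventually_elim
          case e: (elim w)
          show ?case
          proof (cases "w \<in> G r")
            case True
            then have "E w r = X r w" using e by (auto simp: E_def D_def G_def)
            then show ?thesis unfolding sup_sq_def using r by (auto intro!: SUP_upper)
          qed (simp add: E_def)
        qed
      qed
      also have "\<dots> \<le> ennreal C * (nsq (0::'h) + energy r \<Phi> + energy r \<Psi>)" using Xb r by blast
      also have "\<dots> \<le> ennreal C * (0 + ennreal (L\<^sup>2) * energy r E + ennreal (L\<^sup>2) * energy r E)"
        unfolding \<Phi>_def \<Psi>_def using r by (intro mult_left_mono add_mono en \<kappa> \<sigma>) auto
      also have "\<dots> = ennreal (2 * C * L\<^sup>2) * energy r E"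
      proof -
        have "ennreal (2 * C * L\<^sup>2) = ennreal C * (ennreal (L\<^sup>2) + ennreal (L\<^sup>2))"
          using C0 by (simp flip: ennreal_plus ennreal_mult)
        then show ?thesis by (simp only: distrib_right mult.assoc add_0)
      qed
      also have "energy r E = (\<integral>\<^sup>+s\<in>{0..r}. u s \<partial>lborel)"
        unfolding u_def using energy_Fubini[of "\<lambda>s w. E w s" r] jE r by auto
      finally show "u r \<le> ennreal (2 * C * L\<^sup>2) * (\<integral>\<^sup>+s\<in>{0..r}. u s \<partial>lborel)" .
    qed
    have [measurable]: "D t \<in> borel_measurable M" "G t \<in> sets M"
      using cprocessD(2)[OF Dc] GF[OF t] sets_F_M[of t] t by auto
    have "(\<lambda>w. nsq (E w t)) \<in> borel_measurable M" unfolding E_def by measurable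
    then have "AE w in M. nsq (E w t) = 0"
      using u0 unfolding u_def by (subst (asm) nn_integral_0_iff_AE) auto
    then show ?thesis by eventually_elim (auto simp: E_def G_def indicator_def split: if_splits)
  qed
  show ?thesis
  proof (rule cprocess_indistinguishable[OF Yc Zc])
    fix t assume t: "t \<in> {0..T}"
    \<comment> \<open>A continuous path is bounded on [0, t], so every good point satisfies the
      bound for some n, and countably many null sets suffice.\<close>
    have "AE w in M. \<forall>n. w \<in> good \<and> sup_sq t D w \<le> ennreal (real n) \<longrightarrow> D t w = 0"
      using main[OF t] by (subst AE_all_countable) blast
    with AEg show "AE w in M. Y t w = Z t w"
    proof eventually_elim
      fix w assume g: "w \<in> good" and h: "\<forall>n. w \<in> good \<and> sup_sq t D w \<le> ennreal (real n) \<longrightarrow> D t w = 0"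
      have "compact ((\<lambda>s. (norm (D s w))\<^sup>2) ` {0..t})"
        using Dc gc(3)[OF g] t
        by (intro compact_continuous_image continuous_intros) (auto simp: cprocess_def intro: continuous_on_subset)
      then have "bounded ((\<lambda>s. (norm (D s w))\<^sup>2) ` {0..t})" by (rule compact_imp_bounded)
      then have "\<exists>b. \<forall>s\<in>{0..t}. (norm (D s w))\<^sup>2 \<le> b" by (simp add: bounded_iff)
      then obtain b where b: "\<And>s. s \<in> {0..t} \<Longrightarrow> (norm (D s w))\<^sup>2 \<le> b" by blast
      obtain n where n: "b \<le> real n" using real_arch_simple by blast
      have "sup_sq t D w \<le> ennreal (real n)"
        unfolding sup_sq_def using b n by (intro SUP_least ennreal_leI) (meson order_trans)
      then have "D t w = 0" using h g by blast
      then show "Y t w = Z t w" using g by (simp add: D_def)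
    qed
  qed
qed

end

section \<open>Passage to a Brownian motion with continuous paths, and conclusion\<close>

lemma has_ito_integral_cong_AE:
  fixes \<Phi> :: "'w \<Rightarrow> real \<Rightarrow> 'h::{real_normed_vector, second_countable_topology}"
  assumes M: "prob_space M" and filt: "usual_filtration M F T" and t: "t \<le> T"
    and B: "\<And>s. s \<in> {0..T} \<Longrightarrow> B s \<in> borel_measurable M" "\<And>s. s \<in> {0..T} \<Longrightarrow> B' s \<in> borel_measurable M"
    and eq: "AE w in M. \<forall>s\<in>{0..T}. B s w = B' s w"
    and i: "has_ito_integral M F B t \<Phi> J"
  shows "has_ito_integral M F B' t \<Phi> J"
proof -
  interpret prob_space M by (rule M)
  have J[measurable]: "J \<in> borel_measurable M" using i by (simp add: has_ito_integral_def)
  \<comment> \<open>The approximating processes do not involve the Brownian motion; only their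
    integrals do, and these agree almost surely. Hence the same approximations serve for B'.\<close>
  have k: "measure M {w \<in> space M. norm (J w - elem_integral B n \<tau> X w) > \<epsilon>}
      = measure M {w \<in> space M. norm (J w - elem_integral B' n \<tau> X w) > \<epsilon>}"
    if e: "elementary F t n \<tau> X" for n \<tau> X \<epsilon>
  proof -
    have \<tau>: "\<tau> i \<in> {0..T}" "\<tau> (Suc i) \<in> {0..T}" "X i \<in> borel_measurable (F (\<tau> i))" if "i < n" for i
      using e that t unfolding elementary_def by force+
    have X: "X i \<in> borel_measurable M" if "i < n" for i
    proof (rule measurable_from_subalg[OF _ \<tau>(3)[OF that]])
      show "subalgebra M (F (\<tau> i))" using filt \<tau>(1)[OF that] by (simp add: usual_filtration_def)
    qed
    have m: "elem_integral C n \<tau> X \<in> borel_measurable M" if C: "\<And>s. s \<in> {0..T} \<Longrightarrow> C s \<in> borel_measurable M" for C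
      unfolding elem_integral_def[abs_def]
      by (intro borel_measurable_sum borel_measurable_scaleR borel_measurable_diff) (use \<tau> X C in auto)
    note [measurable] = m[of B, OF B(1)] m[of B', OF B(2)]
    show ?thesis
    proof (rule measure_eq_AE)
      show "AE w in M. (w \<in> {w \<in> space M. norm (J w - elem_integral B n \<tau> X w) > \<epsilon>})
        = (w \<in> {w \<in> space M. norm (J w - elem_integral B' n \<tau> X w) > \<epsilon>})"
        using eq
      proof eventually_elim
        case h: (elim w)
        have "elem_integral B n \<tau> X w = elem_integral B' n \<tau> X w"
          unfolding elem_integral_def using h \<tau> by (intro sum.cong) auto
        then show ?case by simp
      qed
    qed measurable
  qed
  obtain n \<tau> X where e: "\<forall>k. elementary F t (n k) (\<tau> k) (X k)"
    and c: "\<forall>\<epsilon>>0. (\<lambda>k. measure M {w \<in> space M.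
            (path_sq t (\<lambda>s. \<Phi> w s - elem_process (n k) (\<tau> k) (X k) w s))
              > ennreal \<epsilon>}) \<longlonglongrightarrow> 0"
    and l: "\<forall>\<epsilon>>0. (\<lambda>k. measure M {w \<in> space M. norm (J w - elem_integral B (n k) (\<tau> k) (X k) w) > \<epsilon>}) \<longlonglongrightarrow> 0"
    using i unfolding has_ito_integral_def by blast
  have l': "\<forall>\<epsilon>>0. (\<lambda>k. measure M {w \<in> space M. norm (J w - elem_integral B' (n k) (\<tau> k) (X k) w) > \<epsilon>}) \<longlonglongrightarrow> 0"
    using l by (simp only: k[OF e[rule_format]])
  have "(\<lambda>(w, s). \<Phi> w s) \<in> borel_measurable (M \<Otimes>\<^sub>M restrict_space borel {0..t})"
    using i by (simp add: has_ito_integral_def)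
  then show ?thesis using J e c l' unfolding has_ito_integral_def by blast
qed

text \<open>The exceptional null set belongs to \<open>F 0\<close>, so the version is still adapted.\<close>

lemma brownian_motion_continuous_version:
  assumes M: "prob_space M" and T: "0 < T" and filt: "usual_filtration M F T" and BM: "brownian_motion M F T B"
  shows "\<exists>B'. brownian_setting M F T B' \<and> (AE w in M. \<forall>s\<in>{0..T}. B s w = B' s w)"
proof -
  interpret prob_space M by (rule M)
  have "AE w in M. continuous_on {0..T} (\<lambda>t. B t w)" using BM by (simp add: brownian_motion_def)
  then have "\<exists>N\<in>null_sets M. {w \<in> space M. \<not> continuous_on {0..T} (\<lambda>t. B t w)} \<subseteq> N"
    by (simp only: eventually_ae_filter)
  then obtain N where N: "N \<in> null_sets M" "{w \<in> space M. \<not> continuous_on {0..T} (\<lambda>t. B t w)} \<subseteq> N" by blast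
  define B' where "B' t w = (if w \<in> N then 0 else B t w)" for t w
  have eq: "AE w in M. \<forall>s. B s w = B' s w"
    using AE_not_in[OF N(1)] by eventually_elim (simp add: B'_def)
  have sub: "subalgebra M (F t)" if "t \<in> {0..T}" for t using filt that by (simp add: usual_filtration_def)
  have NF: "N \<in> sets (F t)" if "t \<in> {0..T}" for t
  proof -
    have "N \<in> sets (F 0)" using filt N(1) unfolding usual_filtration_def by blast
    moreover have "sets (F 0) \<subseteq> sets (F t)" using filt that unfolding usual_filtration_def by auto
    ultimately show ?thesis by blast
  qed
  have BF: "B t \<in> borel_measurable (F t)" if "t \<in> {0..T}" for t using BM that by (simp add: brownian_motion_def)
  have B'F: "B' t \<in> borel_measurable (F t)" if t: "t \<in> {0..T}" for t
  proof -
    note [measurable] = NF[OF t] BF[OF t]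
    show ?thesis unfolding B'_def[abs_def] by measurable
  qed
  have mM: "f \<in> borel_measurable M" if "f \<in> borel_measurable (F t)" "t \<in> {0..T}" for f :: "'a \<Rightarrow> real" and t
    by (rule measurable_from_subalg[OF sub[OF that(2)] that(1)])
  have inc: "distributed M lborel (\<lambda>w. B' t w - B' s w) (normal_density 0 (sqrt (t - s))) \<and>
        indep_set (sets (F s)) (sets (vimage_algebra (space M) (\<lambda>w. B' t w - B' s w) borel))"
    if st: "0 \<le> s" "s < t" "t \<le> T" for s t
  proof
    have d: "distributed M lborel (\<lambda>w. B t w - B s w) (normal_density 0 (sqrt (t - s)))"
      and ind: "indep_set (sets (F s)) (sets (vimage_algebra (space M) (\<lambda>w. B t w - B s w) borel))"
      using BM st unfolding brownian_motion_def by blast+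
    have m[measurable]: "B t \<in> borel_measurable M" "B s \<in> borel_measurable M" "B' t \<in> borel_measurable M" "B' s \<in> borel_measurable M"
      using mM[OF BF] mM[OF B'F] st by auto
    have e: "AE w in M. B t w - B s w = B' t w - B' s w" using eq by eventually_elim simp
    \<comment> \<open>Law and independence depend on probabilities only and do not notice a change
      on a null set; the generated \<sigma>-algebra does change, so independence is checked set by
      set.\<close>
    have "distr M lborel (\<lambda>w. B' t w - B' s w) = distr M lborel (\<lambda>w. B t w - B s w)"
      by (rule distr_cong_AE) (use e in \<open>auto elim: eventually_mono\<close>)
    then show "distributed M lborel (\<lambda>w. B' t w - B' s w) (normal_density 0 (sqrt (t - s)))"
      using d by (simp add: distributed_def)
    have va: "sets (vimage_algebra (space M) f borel) = {f -` A \<inter> space M | A. A \<in> sets borel}" for f :: "'a \<Rightarrow> real"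
      by (rule sets_vimage_algebra2) simp
    show "indep_set (sets (F s)) (sets (vimage_algebra (space M) (\<lambda>w. B' t w - B' s w) borel))"
      unfolding indep_sets2_eq
    proof (intro conjI ballI)
      show Fs: "sets (F s) \<subseteq> events" using ind by (simp add: indep_sets2_eq)
      show "sets (vimage_algebra (space M) (\<lambda>w. B' t w - B' s w) borel) \<subseteq> events"
        unfolding va by (auto intro!: measurable_sets)
      fix a b assume a: "a \<in> sets (F s)" and "b \<in> sets (vimage_algebra (space M) (\<lambda>w. B' t w - B' s w) borel)"
      then obtain A where A: "A \<in> sets borel" "b = (\<lambda>w. B' t w - B' s w) -` A \<inter> space M" unfolding va by blast
      let ?b = "(\<lambda>w. B t w - B s w) -` A \<inter> space M"
      have [measurable]: "a \<in> events" using a Fs by blast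
      have bM[measurable]: "b \<in> events" "?b \<in> events" using A by (auto intro!: measurable_sets)
      \<comment> \<open>The two preimages of the same Borel set differ by a null set, hence have the
        same probability, also after intersection with a.\<close>
      have ab: "AE w in M. (w \<in> b) = (w \<in> ?b)" using e by eventually_elim (simp add: A(2))
      have "prob (a \<inter> b) = prob (a \<inter> ?b)"
        by (rule measure_eq_AE) (use ab in \<open>auto elim: eventually_mono\<close>)
      moreover have "prob b = prob ?b" by (rule measure_eq_AE) (use ab in auto)
      moreover have "prob (a \<inter> ?b) = prob a * prob ?b"
        using ind a A(1) unfolding indep_sets2_eq va by blast
      ultimately show "prob (a \<inter> b) = prob a * prob b" by simp
    qed
  qed
  have B'_cont: "continuous_on {0..T} (\<lambda>t. B' t w)" if "w \<in> space M" for w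
    using N(2) that by (cases "w \<in> N") (auto simp: B'_def)
  have "brownian_motion M F T B'"
    unfolding brownian_motion_def
  proof (intro conjI ballI allI impI)
    show "B' t \<in> borel_measurable (F t)" if "t \<in> {0..T}" for t by (rule B'F[OF that])
    show "AE w in M. B' 0 w = 0" using BM eq unfolding brownian_motion_def by auto
    show "AE w in M. continuous_on {0..T} (\<lambda>t. B' t w)" using B'_cont by (rule AE_I2)
  qed (use inc in blast)+
  then have "brownian_setting M F T B'"
    using T filt B'_cont by (intro brownian_setting.intro brownian_setting_axioms.intro M) auto
  moreover have "AE w in M. \<forall>s\<in>{0..T}. B s w = B' s w" using eq by eventually_elim simp
  ultimately show ?thesis by blast
qed

text \<open>As 1 / \<rho> has infinite mass on the line, linear growth of the coefficients and
  boundedness of \<xi> do not place them in the weighted space; \<open>A2_H\<close> and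
  \<open>A3_H\<close> do. Adaptedness of the coefficients gives the stochastic integral its meaning.
  The first part of the conclusion is existence with uniqueness among solutions with finite second
  moment of the supremum; the second compares arbitrary mild solutions with continuous
  paths.\<close>

theorem theorem11:
  fixes M :: "'w measure" and F :: "real \<Rightarrow> 'w measure" and B :: "real \<Rightarrow> 'w \<Rightarrow> real"
    and T lam Lam L K :: real
    and \<rho> a b \<xi> :: "real \<Rightarrow> real"
    and \<kappa> \<sigma> :: "'w \<Rightarrow> real \<Rightarrow> real \<Rightarrow> real \<Rightarrow> real"
    and cls :: "(real \<Rightarrow> real) \<Rightarrow> 'h::{real_inner, banach, second_countable_topology}"
    and P :: "real \<Rightarrow> 'h \<Rightarrow> 'h"
  assumes T: "T > 0"
    and prob: "prob_space M"
    and filt: "usual_filtration M F T"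
    and BM: "brownian_motion M F T B"
    and H: "is_L2_space \<rho> cls"
    and A1_meas: "\<rho> \<in> borel_measurable borel" "a \<in> borel_measurable borel" "b \<in> borel_measurable borel"
    and A1_const: "0 < lam" "lam \<le> Lam"
    and A1_bounds: "\<And>x. lam \<le> \<rho> x \<and> \<rho> x \<le> Lam" "\<And>x. lam \<le> a x \<and> a x \<le> Lam" "\<And>x. \<bar>b x\<bar> \<le> Lam"
    and A2_meas: "measurable_field M T \<kappa>" "measurable_field M T \<sigma>"
    and A2_adapted: "adapted_field F T \<kappa>" "adapted_field F T \<sigma>"
    and A2_const: "L > 0"
    and A2_Lipschitz: "\<And>\<omega> t x y y'. \<omega> \<in> space M \<Longrightarrow> t \<in> {0..T} \<Longrightarrow>
          max \<bar>\<kappa> \<omega> t x y - \<kappa> \<omega> t x y'\<bar> \<bar>\<sigma> \<omega> t x y - \<sigma> \<omega> t x y'\<bar> \<le> L * \<bar>y - y'\<bar>"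
    and A2_growth: "\<And>\<omega> t x y. \<omega> \<in> space M \<Longrightarrow> t \<in> {0..T} \<Longrightarrow>
          max \<bar>\<kappa> \<omega> t x y\<bar> \<bar>\<sigma> \<omega> t x y\<bar> \<le> L * (1 + \<bar>y\<bar>)"
    and A2_H: "H_valued_at_zero M T \<rho> \<kappa>" "H_valued_at_zero M T \<rho> \<sigma>"
    and A3_meas: "\<xi> \<in> borel_measurable borel"
    and A3_bound: "K > 0" "\<And>x. \<bar>\<xi> x\<bar> \<le> K"
    and A3_H: "\<xi> \<in> sq_int \<rho>"
    and semigroup: "C0_semigroup P" "generator_graph P = div_form_graph \<rho> a b cls"
  shows "(\<exists>Y. mild_solution M F T B \<rho> cls P \<xi> \<kappa> \<sigma> Y \<and> L2_continuous M T Y \<and>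
            (\<forall>Z. mild_solution M F T B \<rho> cls P \<xi> \<kappa> \<sigma> Z \<and> L2_continuous M T Z \<longrightarrow>
                 indistinguishable M T Y Z)) \<and>
         (\<forall>Y Z. mild_solution M F T B \<rho> cls P \<xi> \<kappa> \<sigma> Y \<and> continuous_paths M T Y \<and>
                mild_solution M F T B \<rho> cls P \<xi> \<kappa> \<sigma> Z \<and> continuous_paths M T Z \<longrightarrow>
                indistinguishable M T Y Z)"
proof -
  note B_adapted = BM[unfolded brownian_motion_def, THEN conjunct1, rule_format]
  interpret prob_space M by (rule prob)
  obtain B' where B': "brownian_setting M F T B'" and BB: "AE w in M. \<forall>s\<in>{0..T}. B s w = B' s w"
    using brownian_motion_continuous_version[OF prob T filt BM] by blast
  interpret brownian_setting M F T B' by (rule B')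
  interpret nemytskii_setting M F T B' \<rho> lam Lam cls
    by unfold_locales (use H A1_meas A1_const A1_bounds in auto)
  define \<mu> where "\<mu> = Lam ^ 3 / (2 * lam ^ 3)"
  have "inner v h \<le> \<mu> * (norm h)\<^sup>2" if "(h, v) \<in> generator_graph P" for h v
    unfolding \<mu>_def
    by (rule div_form_quasi_dissipative[OF H A1_meas A1_const(1) A1_bounds]) (use that semigroup(2) in simp)
  then have P_norm: "norm (P t u) \<le> exp (\<mu> * t) * norm u" if "0 \<le> t" for t u
    by (rule quasi_contraction[OF semigroup(1) _ that])
  have S: "qc_semigroup P \<mu>"
  proof (rule qc_semigroup.intro)
    show "0 \<le> \<mu>" using A1_const by (simp add: \<mu>_def)
    show "bounded_linear (P t)" "norm (P t u) \<le> exp (\<mu> * t) * norm u" if "0 \<le> t" for t u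
      using semigroup(1) that P_norm by (auto simp: C0_semigroup_def)
    show "P 0 u = u" for u using semigroup(1) by (simp add: C0_semigroup_def)
    show "P (s + t) u = P s (P t u)" if "0 \<le> s" "0 \<le> t" for s t u
      using semigroup(1) that by (simp add: C0_semigroup_def)
    show "continuous_on {0..} (\<lambda>t. P t u)" for u by (rule C0_continuous_on[OF semigroup(1)])
  qed
  have \<kappa>: "lip_coeff L (nemytskii \<rho> cls \<kappa>)" and \<sigma>: "lip_coeff L (nemytskii \<rho> cls \<sigma>)"
    using A2_meas A2_adapted A2_H A2_const A2_Lipschitz by (auto intro!: nemytskii_lip_coeff)
  have BM_M: "B s \<in> borel_measurable M" "B' s \<in> borel_measurable M" if "s \<in> {0..T}" for s
  proof -
    have "B s \<in> borel_measurable (F s)" by (rule B_adapted[OF that])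
    then show "B s \<in> borel_measurable M" using measurable_F_M that by auto
    show "B' s \<in> borel_measurable M" using B_meas_M that by auto
  qed
  \<comment> \<open>Both Brownian motions define the same stochastic integrals, so a mild solution
    with respect to \<open>B\<close> is one with respect to \<open>B'\<close> and
    conversely.\<close>
  have ito: "has_ito_integral M F B t \<Phi> J \<longleftrightarrow> has_ito_integral M F B' t \<Phi> J" if "t \<in> {0..T}"
    for t J and \<Phi> :: "'w \<Rightarrow> real \<Rightarrow> 'h"
  proof
    have BB': "AE w in M. \<forall>s\<in>{0..T}. B' s w = B s w" using BB by eventually_elim simp
    show "has_ito_integral M F B' t \<Phi> J" if "has_ito_integral M F B t \<Phi> J"
      using has_ito_integral_cong_AE[OF prob filt _ BM_M BB that] \<open>t \<in> {0..T}\<close> by auto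
    show "has_ito_integral M F B t \<Phi> J" if "has_ito_integral M F B' t \<Phi> J"
      using has_ito_integral_cong_AE[OF prob filt _ BM_M(2,1) BB' that] \<open>t \<in> {0..T}\<close> by auto
  qed
  have mild: "mild_solution M F T B \<rho> cls P \<xi> \<kappa> \<sigma> Y \<longleftrightarrow>
    (\<lambda>(w, t). Y t w) \<in> borel_measurable (predictable_algebra M F T) \<and>
    mild_conv P (cls \<xi>) (\<lambda>w s. nemytskii \<rho> cls \<kappa> w s (Y s w)) (\<lambda>w s. nemytskii \<rho> cls \<sigma> w s (Y s w)) Y" for Y
    unfolding mild_solution_def mild_conv_def using ito by auto
  have unique: "indistinguishable M T Y Z"
    if "mild_solution M F T B \<rho> cls P \<xi> \<kappa> \<sigma> Y" "continuous_paths M T Y"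
      "mild_solution M F T B \<rho> cls P \<xi> \<kappa> \<sigma> Z" "continuous_paths M T Z" for Y Z
    unfolding indistinguishable_def
    by (rule mild_unique[OF S \<kappa> \<sigma>]) (use that mild in \<open>auto simp: continuous_paths_def\<close>)
  obtain Y where Y: "cprocess Y" "E_sup T Y < \<infinity>"
    "mild_conv P (cls \<xi>) (\<lambda>w s. nemytskii \<rho> cls \<kappa> w s (Y s w)) (\<lambda>w s. nemytskii \<rho> cls \<sigma> w s (Y s w)) Y"
    using picard_exists[OF S \<kappa> \<sigma>] by blast
  have "mild_solution M F T B \<rho> cls P \<xi> \<kappa> \<sigma> Y"
    using Y(3) cprocess_predictable[OF Y(1)] by (simp add: mild)
  moreover have "L2_continuous M T Y"
    using Y(1,2) cprocessD(2)[OF Y(1)]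
    by (auto simp: L2_continuous_def continuous_paths_def cprocess_def sup_sq_def[abs_def])
  ultimately show ?thesis using unique unfolding L2_continuous_def by blast
qed

end
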